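(* Let $k$ be a field of characteristic zero, $T$ a finite-dimensional vector superspace over $k$, and $F$ a vector superspace over $k$. There is a natural bijection between the set of representations of the algebra $H_*T$ in $F$ (parity-preserving homomorphisms of $k$-algebras without identity $K: H_*T\to \mathrm{End}\,F$) and the set of pencils of flat connections on the trivial bundle with fiber $F$ on the formal completion of $T$ at the origin, i.e. of pencils $\nabla_\lambda=d+\lambda\mathcal A$ with $\nabla_\lambda^2=0$, where $d$ is the trivial connection. Explicitly, choose a parity-homogeneous basis $(\Delta_a\,|\,a\in I)$ of $T$ with dual formal coordinates $(x^a)$. To a representation $K$ one associates the pencil $d+\lambda\, d\mathcal B_K$, where $$\mathcal B_K=\sum_{n=1}^{\infty}\ \sum_{(a_1,\dots,a_n)\in I^n}\frac{x^{a_n}\cdots x^{a_1}}{n!}\,K\big(\mu(\varepsilon^{(n)})\otimes\Delta_{a_1}\otimes\cdots\otimes\Delta_{a_n}\big)\in \mathrm{End}(F)[[x]],$$ and $\varepsilon^{(n)}$ is the trivial partition of $\{1,\dots,n\}$ with one part. One has $d\mathcal B_K\wedge d\mathcal B_K=0$, and $K\mapsto d+\lambda\, d\mathcal B_K$ is the asserted bijection.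
   Context: **Partitions.** A partition $\tau=(\tau_1,\dots,\tau_N)$ of a finite set $B$ is a totally ordered family of non-empty, pairwise disjoint subsets with union $B$; if there are $N$ parts it is an $N$-partition. For a part $\tau_a$ and a 2-partition $\alpha=(\tau_{a1},\tau_{a2})$ of the set $\tau_a$, put $\tau(\alpha)=(\tau_1,\dots,\tau_{a-1},\tau_{a1},\tau_{a2},\tau_{a+1},\dots,\tau_N)$. For $i,j\in\tau_a$ write $i\alpha j$ if $i\in\tau_{a1}$ and $j\in\tau_{a2}$. **The spaces $H_{*n}$.** $H_{*n}$ is the (purely even) $k$-vector space generated by symbols $\mu(\tau)$, for all partitions $\tau$ of $\{1,\dots,n\}$, subject to the following linear relations: for every partition $\tau$, every part $\tau_a$ with $|\tau_a|\ge2$ and every $i\neq j$ in $\tau_a$, $$\sum_{\alpha:\,i\alpha j}\mu(\tau(\alpha))-\sum_{\alpha:\,j\alpha i}\mu(\tau(\alpha))=0,$$ where $\alpha$ runs over 2-partitions of $\tau_a$. The symmetric group $\mathbf S_n$ acts by $s\,\mu(\tau)=\mu(s(\tau))$, $s(\tau)_r=s(\tau_r)$. The sum $\bigoplus_{n\ge1}H_{*n}$ is a graded associative algebra with product $\mu(\tau^{(1)})\mu(\tau^{(2)})=\mu(\tau^{(1)}\cup\tau^{(2)})$, where for $\tau^{(1)}$ a partition of $\{1,\dots,m\}$ and $\tau^{(2)}$ a partition of $\{1,\dots,n\}$, the partition $\tau^{(1)}\cup\tau^{(2)}$ of $\{1,\dots,m+n\}$ is the list of parts of $\tau^{(1)}$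 followed by the parts of $\tau^{(2)}$ shifted by $m$. **The algebra $H_*T$.** $\mathbf S_n$ acts on $T^{\otimes n}$ by permuting the factors with the usual sign rule for superspaces. $\bigoplus_{n\ge1}H_{*n}\otimes T^{\otimes n}$ is an algebra with componentwise multiplication (the product above on the first factors, concatenation of tensors on the second), with the diagonal action of $\mathbf S_n$ on its $n$-th component. The span of all $(1-s)v$, with $s\in\mathbf S_n$, $v\in H_{*n}\otimes T^{\otimes n}$, $n\ge1$, is a two-sided ideal. $H_*T:=\big(\bigoplus_{n\ge1}H_{*n}\otimes T^{\otimes n}\big)_{\mathbf S}$ is the quotient algebra (the direct sum of the spaces of coinvariants). $K(\mu(\tau)\otimes\Delta_{a_1}\otimes\dots\otimes\Delta_{a_n})$ denotes the value of $K$ on the class of this element. **Connections.** $x^a$ has the same parity as $\Delta_a$. The functions on the formal completion of $T$ at the origin are the formal power series in the supercommuting variables $x^a$. Differentials in the de Rham complex and connections are odd ($dx^a$ has parity opposite to $x^a$) and $\lambda$ is an even parameter. In a pencil $\nabla_\lambda=d+\lambda\mathcal A$, $\mathcal A$ is an odd function-linear operator from sections of the trivial bundle to 1-forms with values in it. The pencil is a pencil of flat connections if $\nabla_\lambda^2=0$ identically in $\lambda$. *)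

theory Defs
  imports Complex_Main "HOL-Library.Poly_Mapping" "HOL-Library.Multiset"
    "HOL-Library.FuncSet" "HOL-Library.Function_Algebras"
    "HOL-Combinatorics.Permutations"
begin

section \<open>Free vector spaces\<close>

text \<open>The free vector space over \<open>'k\<close> on the type \<open>'a\<close> is \<open>'a \<Rightarrow>\<^sub>0 'k\<close>,
  with basis \<open>Poly_Mapping.single a 1\<close>.\<close>

definition pm_scale :: "'k::field \<Rightarrow> ('a \<Rightarrow>\<^sub>0 'k) \<Rightarrow> ('a \<Rightarrow>\<^sub>0 'k)" where
  "pm_scale c x = Poly_Mapping.map ((*) c) x"

definition pm_push :: "('a \<Rightarrow> 'b) \<Rightarrow> ('a \<Rightarrow>\<^sub>0 'k::field) \<Rightarrow> ('b \<Rightarrow>\<^sub>0 'k)" where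
  "pm_push g x = (\<Sum>a\<in>Poly_Mapping.keys x. Poly_Mapping.single (g a) (Poly_Mapping.lookup x a))"

definition pm_bilin :: "('a \<Rightarrow> 'b \<Rightarrow> 'c) \<Rightarrow> ('a \<Rightarrow>\<^sub>0 'k::field) \<Rightarrow> ('b \<Rightarrow>\<^sub>0 'k) \<Rightarrow> ('c \<Rightarrow>\<^sub>0 'k)" where
  "pm_bilin g x y = (\<Sum>a\<in>Poly_Mapping.keys x. \<Sum>b\<in>Poly_Mapping.keys y.
     Poly_Mapping.single (g a b) (Poly_Mapping.lookup x a * Poly_Mapping.lookup y b))"

lemma lookup_pm_scale [simp]: "Poly_Mapping.lookup (pm_scale c x) a = c * Poly_Mapping.lookup x a"
  by (simp add: pm_scale_def Poly_Mapping.map.rep_eq when_def)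

global_interpretation pm: vector_space "pm_scale :: 'k::field \<Rightarrow> ('a \<Rightarrow>\<^sub>0 'k) \<Rightarrow> _"
  by unfold_locales (auto intro!: poly_mapping_eqI simp: lookup_add algebra_simps)

lemma pm_scale_single: "pm_scale c (Poly_Mapping.single a d) = Poly_Mapping.single a (c * d)"
  by (intro poly_mapping_eqI) (auto simp: lookup_single when_def)

lemma pm_push_superset:
  assumes "finite A" "Poly_Mapping.keys x \<subseteq> A"
  shows "pm_push g x = (\<Sum>a\<in>A. Poly_Mapping.single (g a) (Poly_Mapping.lookup x a))"
  unfolding pm_push_def using assms
  by (intro sum.mono_neutral_left) (auto simp: in_keys_iff)

lemma pm_push_add: "pm_push g (x + y) = pm_push g x + pm_push g y"
proof -
  let ?A = "Poly_Mapping.keys x \<union> Poly_Mapping.keys y"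
  have "finite ?A" "Poly_Mapping.keys (x + y) \<subseteq> ?A" by (auto simp: Poly_Mapping.keys_add)
  then show ?thesis
    by (simp add: pm_push_superset[of ?A] lookup_add single_add sum.distrib)
qed

lemma pm_push_scale: "pm_push g (pm_scale c x) = pm_scale c (pm_push g x)"
proof -
  have "Poly_Mapping.keys (pm_scale c x) \<subseteq> Poly_Mapping.keys x" by (auto simp: in_keys_iff)
  then have "pm_push g (pm_scale c x)
      = (\<Sum>a\<in>Poly_Mapping.keys x. Poly_Mapping.single (g a) (c * Poly_Mapping.lookup x a))"
    by (simp add: pm_push_superset[of "Poly_Mapping.keys x"])
  also have "\<dots> = pm_scale c (pm_push g x)"
    unfolding pm_push_def pm.scale_sum_right
    by (intro sum.cong refl poly_mapping_eqI) (auto simp: lookup_single when_def)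
  finally show ?thesis .
qed

lemma linear_pm_push: "Vector_Spaces.linear pm_scale pm_scale (pm_push g)"
  by unfold_locales (simp_all add: pm_push_add pm_push_scale)

lemma pm_push_single [simp]: "pm_push g (Poly_Mapping.single a c) = Poly_Mapping.single (g a) c"
  by (auto simp: pm_push_def)

lemma pm_bilin_left: "pm_bilin g x y = (\<Sum>b\<in>Poly_Mapping.keys y. pm_scale (Poly_Mapping.lookup y b) (pm_push (\<lambda>a. g a b) x))"
  unfolding pm_bilin_def pm_push_def
  by (subst sum.swap) (simp add: pm.scale_sum_right pm_scale_single mult.commute)

lemma pm_bilin_right: "pm_bilin g x y = (\<Sum>a\<in>Poly_Mapping.keys x. pm_scale (Poly_Mapping.lookup x a) (pm_push (g a) y))"
  unfolding pm_bilin_def pm_push_def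
  by (simp add: pm.scale_sum_right pm_scale_single)

lemma linear_pm_bilin_left: "Vector_Spaces.linear pm_scale pm_scale (\<lambda>x. pm_bilin g x y)"
  by unfold_locales
     (simp_all add: pm_bilin_left pm_push_add pm_push_scale pm.scale_right_distrib sum.distrib
       pm.scale_sum_right mult.commute)

lemma linear_pm_bilin_right: "Vector_Spaces.linear pm_scale pm_scale (pm_bilin g x)"
  by unfold_locales
     (simp_all add: pm_bilin_right pm_push_add pm_push_scale pm.scale_right_distrib sum.distrib
       pm.scale_sum_right mult.commute)

lemma pm_bilin_single_left [simp]:
  "pm_bilin g (Poly_Mapping.single a 1) y = pm_push (g a) y"
  by (simp add: pm_bilin_right)

lemma pm_bilin_single_right [simp]:
  "pm_bilin g x (Poly_Mapping.single b 1) = pm_push (\<lambda>a. g a b) x"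
  by (simp add: pm_bilin_left)


section \<open>Partitions and the spaces \<open>H\<^sub>*\<^sub>n\<close>\<close>

definition ordered_partition :: "nat set \<Rightarrow> nat set list \<Rightarrow> bool" where
  "ordered_partition B \<tau> \<longleftrightarrow> \<Union> (set \<tau>) = B \<and> {} \<notin> set \<tau> \<and> sorted_wrt disjnt \<tau>"

typedef opart = "{\<tau>. \<exists>n\<ge>1. ordered_partition {1..n} \<tau>}"
  by (rule exI[of _ "[{1}]"]) (auto simp: ordered_partition_def intro!: exI[of _ 1])

setup_lifting type_definition_opart

definition npoints :: "nat set list \<Rightarrow> nat" where
  "npoints \<tau> = card (\<Union> (set \<tau>))"

text \<open>The 2-partitions \<open>\<alpha> = (B\<^sub>1, B\<^sub>2)\<close> of \<open>B\<close> with \<open>i \<alpha> j\<close>.\<close>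

definition splits :: "nat set \<Rightarrow> nat \<Rightarrow> nat \<Rightarrow> (nat set \<times> nat set) set" where
  "splits B i j = {(B1, B2). ordered_partition B [B1, B2] \<and> i \<in> B1 \<and> j \<in> B2}"

text \<open>\<open>\<tau>(\<alpha>)\<close>, where \<open>\<alpha>\<close> is a 2-partition of the part \<open>\<tau> ! a\<close>.\<close>

definition refine :: "nat set list \<Rightarrow> nat \<Rightarrow> nat set \<times> nat set \<Rightarrow> nat set list" where
  "refine \<tau> a \<alpha> = take a \<tau> @ [fst \<alpha>, snd \<alpha>] @ drop (Suc a) \<tau>"

definition relator :: "nat set list \<Rightarrow> nat \<Rightarrow> nat \<Rightarrow> nat \<Rightarrow> (opart \<Rightarrow>\<^sub>0 'k::field)" where
  "relator \<tau> a i j =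
     (\<Sum>\<alpha>\<in>splits (\<tau> ! a) i j. Poly_Mapping.single (Abs_opart (refine \<tau> a \<alpha>)) 1)
   - (\<Sum>\<alpha>\<in>splits (\<tau> ! a) j i. Poly_Mapping.single (Abs_opart (refine \<tau> a \<alpha>)) 1)"

definition relators :: "(opart \<Rightarrow>\<^sub>0 'k::field) set" where
  "relators = {relator \<tau> a i j | \<tau> a i j. (\<exists>n\<ge>1. ordered_partition {1..n} \<tau>) \<and> a < length \<tau>
     \<and> 2 \<le> card (\<tau> ! a) \<and> i \<in> \<tau> ! a \<and> j \<in> \<tau> ! a \<and> i \<noteq> j}"

text \<open>The type \<open>'k hstar\<close> is the whole direct sum of the \<open>H\<^sub>*\<^sub>n\<close>, \<open>n \<ge> 1\<close>; the
  individual summands are the subspaces \<open>hgraded n\<close> below.\<close>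

quotient_type (overloaded) 'k hstar = "opart \<Rightarrow>\<^sub>0 'k::field" / "\<lambda>x y. x - y \<in> pm.span relators"
proof (rule equivpI)
  show "reflp (\<lambda>x y :: opart \<Rightarrow>\<^sub>0 'k. x - y \<in> pm.span relators)"
    by (simp add: reflp_def pm.span_zero)
  show "symp (\<lambda>x y :: opart \<Rightarrow>\<^sub>0 'k. x - y \<in> pm.span relators)"
  proof (rule sympI)
    fix x y :: "opart \<Rightarrow>\<^sub>0 'k"
    assume "x - y \<in> pm.span relators"
    from pm.span_neg[OF this] show "y - x \<in> pm.span relators" by simp
  qed
  show "transp (\<lambda>x y :: opart \<Rightarrow>\<^sub>0 'k. x - y \<in> pm.span relators)"
  proof (rule transpI)
    fix x y z :: "opart \<Rightarrow>\<^sub>0 'k"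
    assume "x - y \<in> pm.span relators" "y - z \<in> pm.span relators"
    from pm.span_add[OF this] show "x - z \<in> pm.span relators" by simp
  qed
qed

instantiation hstar :: (field) ab_group_add
begin

lift_definition zero_hstar :: "'a hstar" is 0 .

lift_definition plus_hstar :: "'a hstar \<Rightarrow> 'a hstar \<Rightarrow> 'a hstar" is "(+)"
  subgoal for x x' y y'
    using pm.span_add[of "x - x'" relators "y - y'"] by (simp add: algebra_simps)
  done

lift_definition uminus_hstar :: "'a hstar \<Rightarrow> 'a hstar" is uminus
  subgoal for x x'
    using pm.span_neg[of "x - x'" relators] by simp
  done

lift_definition minus_hstar :: "'a hstar \<Rightarrow> 'a hstar \<Rightarrow> 'a hstar" is "(-)"
  subgoal for x x' y y'
    using pm.span_diff[of "x - x'" relators "y - y'"] by (simp add: algebra_simps)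
  done

instance
  by standard (transfer, simp add: pm.span_zero algebra_simps)+

end

lift_definition hscale :: "'k::field \<Rightarrow> 'k hstar \<Rightarrow> 'k hstar" is pm_scale
  subgoal for c x y
    using pm.span_scale[of "x - y" relators c] by (simp add: pm.scale_right_diff_distrib)
  done

definition mu :: "nat set list \<Rightarrow> 'k::field hstar" where
  "mu \<tau> = abs_hstar (Poly_Mapping.single (Abs_opart \<tau>) 1)"

definition hgraded :: "nat \<Rightarrow> 'k::field hstar set" where
  "hgraded n = module.span hscale (mu ` {\<tau>. ordered_partition {1..n} \<tau>})"


text \<open>\<open>\<tau>\<^sup>(\<^sup>1\<^sup>) \<union> \<tau>\<^sup>(\<^sup>2\<^sup>)\<close> and \<open>s(\<tau>)\<close>. The action is that of permutations of
  \<open>{1..n}\<close> on the partitions of \<open>{1..n}\<close>; on other partitions \<open>s\<close> is made to act trivially.\<close>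

definition raw_cup :: "nat set list \<Rightarrow> nat set list \<Rightarrow> nat set list" where
  "raw_cup \<tau> \<sigma> = \<tau> @ map ((`) ((+) (npoints \<tau>))) \<sigma>"

definition raw_perm :: "(nat \<Rightarrow> nat) \<Rightarrow> nat set list \<Rightarrow> nat set list" where
  "raw_perm s \<tau> = (if s permutes \<Union> (set \<tau>) then map ((`) s) \<tau> else \<tau>)"

lemma sorted_wrt_disjnt_image:
  "inj f \<Longrightarrow> sorted_wrt disjnt (map ((`) f) \<tau>) = sorted_wrt disjnt \<tau>"
  by (simp add: sorted_wrt_map disjnt_def[abs_def] image_Int[symmetric])

lemma ordered_partition_image:
  assumes "inj f" "ordered_partition B \<tau>"
  shows "ordered_partition (f ` B) (map ((`) f) \<tau>)"
  using assms unfolding ordered_partition_def by (auto simp: sorted_wrt_disjnt_image)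

lemma ordered_partition_image_iff:
  assumes "inj f"
  shows "ordered_partition (f ` B) (map ((`) f) \<tau>) = ordered_partition B \<tau>"
  using assms unfolding ordered_partition_def
  by (auto simp: sorted_wrt_disjnt_image image_Union[symmetric] inj_image_eq_iff)

lemma ordered_partition_append:
  assumes "ordered_partition B \<tau>" "ordered_partition C \<sigma>" "disjnt B C"
  shows "ordered_partition (B \<union> C) (\<tau> @ \<sigma>)"
  using assms unfolding ordered_partition_def
  by (auto simp: sorted_wrt_append disjnt_def)

lemma npoints_eq: "ordered_partition {1..n} \<tau> \<Longrightarrow> npoints \<tau> = n"
  by (simp add: ordered_partition_def npoints_def)

lemma shift_interval: "(+) m ` {1..n} = {m + 1..m + (n::nat)}"
  by simp

lemma ordered_partition_raw_cup:
  assumes "ordered_partition {1..m} \<tau>" "ordered_partition {1..n} \<sigma>"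
  shows "ordered_partition {1..m + n} (raw_cup \<tau> \<sigma>)"
proof -
  have "ordered_partition ({1..m} \<union> (+) m ` {1..n}) (raw_cup \<tau> \<sigma>)"
    unfolding raw_cup_def npoints_eq[OF assms(1)]
    by (intro ordered_partition_append ordered_partition_image assms) (auto simp: disjnt_def)
  moreover have "{1..m} \<union> (+) m ` {1..n} = {1..m + n}"
    unfolding shift_interval by auto
  ultimately show ?thesis by simp
qed

lemma ordered_partition_raw_perm:
  assumes "ordered_partition {1..n} \<tau>"
  shows "ordered_partition {1..n} (raw_perm s \<tau>)"
proof (cases "s permutes {1..n}")
  case True
  then show ?thesis
    using ordered_partition_image[OF permutes_inj[OF True] assms] assms
    by (simp add: raw_perm_def permutes_image[OF True] ordered_partition_def del: One_nat_def)
next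
  case False
  then show ?thesis using assms by (simp add: raw_perm_def ordered_partition_def)
qed

lift_definition cup :: "opart \<Rightarrow> opart \<Rightarrow> opart" is raw_cup
  by (meson ordered_partition_raw_cup trans_le_add1)

lift_definition perm :: "(nat \<Rightarrow> nat) \<Rightarrow> opart \<Rightarrow> opart" is raw_perm
  by (meson ordered_partition_raw_perm)

lemma ordered_partition_refine:
  assumes "ordered_partition B \<tau>" "a < length \<tau>" "ordered_partition (\<tau> ! a) [B1, B2]"
  shows "ordered_partition B (refine \<tau> a (B1, B2))"
proof -
  have \<tau>: "\<tau> = take a \<tau> @ [\<tau> ! a] @ drop (Suc a) \<tau>"
    using assms(2) by (simp add: id_take_nth_drop[symmetric])
  have "ordered_partition B (take a \<tau> @ [\<tau> ! a] @ drop (Suc a) \<tau>)"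
    using assms(1) \<tau> by simp
  moreover have "\<tau> ! a = B1 \<union> B2" "B1 \<noteq> {}" "B2 \<noteq> {}" "disjnt B1 B2"
    using assms(3) by (auto simp: ordered_partition_def)
  ultimately show ?thesis
    unfolding refine_def ordered_partition_def
    by (auto simp: sorted_wrt_append disjnt_Un1 disjnt_Un2)
qed

lemma splits_iff: "(B1, B2) \<in> splits B i j \<longleftrightarrow> ordered_partition B [B1, B2] \<and> i \<in> B1 \<and> j \<in> B2"
  by (simp add: splits_def)

lemma splits_image:
  assumes "inj f"
  shows "bij_betw (map_prod ((`) f) ((`) f)) (splits B i j) (splits (f ` B) (f i) (f j))"
proof (rule bij_betw_imageI)
  have "inj ((`) f)" using assms by (simp add: inj_def inj_image_eq_iff[OF assms])
  then show "inj_on (map_prod ((`) f) ((`) f)) (splits B i j)"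
    by (meson inj_on_subset prod.inj_map subset_UNIV)
  have iff: "(f ` B1, f ` B2) \<in> splits (f ` B) (f i) (f j) \<longleftrightarrow> (B1, B2) \<in> splits B i j" for B1 B2
    using ordered_partition_image_iff[OF assms, of B "[B1, B2]"]
    by (simp add: splits_iff inj_image_mem_iff[OF assms])
  show "map_prod ((`) f) ((`) f) ` splits B i j = splits (f ` B) (f i) (f j)"
  proof (intro set_eqI iffI)
    fix C assume C: "C \<in> splits (f ` B) (f i) (f j)"
    obtain C1 C2 where CC: "C = (C1, C2)" by (rule prod.exhaust)
    have "ordered_partition (f ` B) [C1, C2]" using C unfolding CC splits_iff by blast
    then have "C1 \<subseteq> f ` B" "C2 \<subseteq> f ` B" by (simp_all add: ordered_partition_def) blast+
    then obtain B1 B2 where B: "C1 = f ` B1" "C2 = f ` B2" by (meson subset_imageE)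
    then have "(B1, B2) \<in> splits B i j" using C iff CC by simp
    then show "C \<in> map_prod ((`) f) ((`) f) ` splits B i j"
      unfolding CC B by (metis image_eqI map_prod_simp)
  next
    fix C assume "C \<in> map_prod ((`) f) ((`) f) ` splits B i j"
    then obtain \<alpha> where \<alpha>: "\<alpha> \<in> splits B i j" "C = map_prod ((`) f) ((`) f) \<alpha>" by (rule imageE)
    obtain B1 B2 where "\<alpha> = (B1, B2)" by (rule prod.exhaust)
    then show "C \<in> splits (f ` B) (f i) (f j)" using \<alpha> iff by simp
  qed
qed

lemma refine_image:
  "a < length \<tau> \<Longrightarrow> map ((`) f) (refine \<tau> a \<alpha>) = refine (map ((`) f) \<tau>) a (map_prod ((`) f) ((`) f) \<alpha>)"
  by (simp add: refine_def take_map drop_map)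

lemma Union_refine:
  assumes "ordered_partition {1..n} \<tau>" "a < length \<tau>" "\<alpha> \<in> splits (\<tau> ! a) i j"
  shows "ordered_partition {1..n} (refine \<tau> a \<alpha>)"
  using ordered_partition_refine[OF assms(1,2)] assms(3) by (auto simp: splits_def)

lemma relator_image_aux:
  fixes g :: "opart \<Rightarrow> opart"
  assumes \<tau>: "ordered_partition {1..n} \<tau>" "a < length \<tau>" "1 \<le> n" and f: "inj f"
    and g: "\<And>\<rho>. ordered_partition {1..n} \<rho> \<Longrightarrow> g (Abs_opart \<rho>) = Abs_opart (G \<rho>)"
    and G: "\<And>\<alpha>. G (refine \<tau> a \<alpha>) = refine \<tau>' a' (map_prod ((`) f) ((`) f) \<alpha>)"
    and \<tau>': "\<tau>' ! a' = f ` (\<tau> ! a)"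
  shows "pm_push g (relator \<tau> a i j :: opart \<Rightarrow>\<^sub>0 'k::field) = relator \<tau>' a' (f i) (f j)"
proof -
  interpret l: Vector_Spaces.linear pm_scale pm_scale "pm_push g" by (rule linear_pm_push)
  have "pm_push g (\<Sum>\<alpha>\<in>splits (\<tau> ! a) i j. Poly_Mapping.single (Abs_opart (refine \<tau> a \<alpha>)) 1)
      = (\<Sum>\<alpha>\<in>splits (\<tau>' ! a') (f i) (f j). Poly_Mapping.single (Abs_opart (refine \<tau>' a' \<alpha>)) (1::'k))" for i j
    unfolding l.sum \<tau>'
    by (subst sum.reindex_bij_betw[OF splits_image[OF f], symmetric])
       (intro sum.cong refl, simp add: g[OF Union_refine[OF \<tau>(1,2)]] G)
  then show ?thesis by (simp add: relator_def l.diff)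
qed

lemma Abs_cup:
  assumes "ordered_partition {1..m} \<tau>" "1 \<le> m" "ordered_partition {1..n} \<sigma>" "1 \<le> n"
  shows "cup (Abs_opart \<tau>) (Abs_opart \<sigma>) = Abs_opart (raw_cup \<tau> \<sigma>)"
  using assms by (intro cup.abs_eq) (auto simp: eq_onp_def)

lemma Abs_perm:
  assumes "ordered_partition {1..n} \<tau>" "1 \<le> n"
  shows "perm s (Abs_opart \<tau>) = Abs_opart (raw_perm s \<tau>)"
  using assms by (intro perm.abs_eq) (auto simp: eq_onp_def)

lemma relators_mem:
  assumes "ordered_partition {1..n} \<tau>" "1 \<le> n" "a < length \<tau>" "i \<in> \<tau> ! a" "j \<in> \<tau> ! a" "i \<noteq> j"
  shows "relator \<tau> a i j \<in> relators"
proof -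
  have "\<tau> ! a \<subseteq> {1..n}"
    using assms(1,3) nth_mem[OF assms(3)] by (auto simp: ordered_partition_def)
  then have "card {i, j} \<le> card (\<tau> ! a)"
    using assms(4,5) by (intro card_mono) (auto intro: finite_subset)
  then have "2 \<le> card (\<tau> ! a)" using assms(6) by simp
  then show ?thesis using assms unfolding relators_def by blast
qed

lemma relatorsE:
  assumes "r \<in> relators"
  obtains \<tau> a i j n where "r = relator \<tau> a i j" "1 \<le> n" "ordered_partition {1..n} \<tau>"
    "a < length \<tau>" "i \<in> \<tau> ! a" "j \<in> \<tau> ! a" "i \<noteq> j"
  using assms unfolding relators_def by blast

lemma opartE:
  obtains \<tau> n where "\<sigma> = Abs_opart \<tau>" "1 \<le> n" "ordered_partition {1..n} \<tau>"
  by (cases \<sigma>) blast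

lemma perm_relators:
  assumes "r \<in> relators"
  shows "pm_push (perm s) r \<in> relators"
proof -
  obtain \<tau> a i j n where r: "r = relator \<tau> a i j" and n: "1 \<le> n" "ordered_partition {1..n} \<tau>"
    and a: "a < length \<tau>" and ij: "i \<in> \<tau> ! a" "j \<in> \<tau> ! a" "i \<noteq> j"
    using assms by (rule relatorsE)
  define f where "f = (if s permutes {1..n} then s else id)"
  have f: "f permutes {1..n}" by (simp add: f_def permutes_id)
  have eq: "raw_perm s \<rho> = map ((`) f) \<rho>" if "ordered_partition {1..n} \<rho>" for \<rho>
    using that by (auto simp: raw_perm_def f_def ordered_partition_def)
  have "pm_push (perm s) r = relator (map ((`) f) \<tau>) a (f i) (f j)"
    unfolding r
    by (rule relator_image_aux[OF n(2) a n(1) permutes_inj[OF f], where G = "map ((`) f)"])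
       (use a n(1) in \<open>simp_all add: Abs_perm eq refine_image\<close>)
  also have "\<dots> \<in> relators"
    using ordered_partition_image[OF permutes_inj[OF f] n(2)] n(1) a ij
    by (intro relators_mem[of n])
       (auto simp: permutes_image[OF f] inj_eq[OF permutes_inj[OF f]] simp del: One_nat_def)
  finally show ?thesis .
qed

lemma cup_left_relators:
  assumes "r \<in> relators"
  shows "pm_push (cup \<sigma>) r \<in> relators"
proof -
  obtain \<tau> a i j n where r: "r = relator \<tau> a i j" and n: "1 \<le> n" "ordered_partition {1..n} \<tau>"
    and a: "a < length \<tau>" and ij: "i \<in> \<tau> ! a" "j \<in> \<tau> ! a" "i \<noteq> j"
    using assms by (rule relatorsE)
  obtain \<sigma>' m where \<sigma>: "\<sigma> = Abs_opart \<sigma>'" and m: "1 \<le> m" "ordered_partition {1..m} \<sigma>'"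
    by (rule opartE)
  note m' = npoints_eq[OF m(2)]
  have "pm_push (cup \<sigma>) r = relator (raw_cup \<sigma>' \<tau>) (length \<sigma>' + a) (m + i) (m + j)"
    unfolding r \<sigma>
  proof (rule relator_image_aux[OF n(2) a n(1), where G = "raw_cup \<sigma>'" and f = "(+) m"])
    show "raw_cup \<sigma>' (refine \<tau> a \<alpha>)
        = refine (raw_cup \<sigma>' \<tau>) (length \<sigma>' + a) (map_prod ((`) ((+) m)) ((`) ((+) m)) \<alpha>)" for \<alpha>
      by (simp add: raw_cup_def m' refine_def take_map drop_map)
    show "raw_cup \<sigma>' \<tau> ! (length \<sigma>' + a) = (+) m ` (\<tau> ! a)"
      using a by (simp add: raw_cup_def m' nth_append)
  qed (use Abs_cup[OF m(2,1) _ n(1)] in \<open>simp_all\<close>)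
  also have "\<dots> \<in> relators"
    using ordered_partition_raw_cup[OF m(2) n(2)] n m a ij
    by (intro relators_mem[of "m + n"]) (simp_all add: raw_cup_def m' nth_append)
  finally show ?thesis .
qed

lemma cup_right_relators:
  assumes "r \<in> relators"
  shows "pm_push (\<lambda>\<rho>. cup \<rho> \<sigma>) r \<in> relators"
proof -
  obtain \<tau> a i j n where r: "r = relator \<tau> a i j" and n: "1 \<le> n" "ordered_partition {1..n} \<tau>"
    and a: "a < length \<tau>" and ij: "i \<in> \<tau> ! a" "j \<in> \<tau> ! a" "i \<noteq> j"
    using assms by (rule relatorsE)
  obtain \<sigma>' m where \<sigma>: "\<sigma> = Abs_opart \<sigma>'" and m: "1 \<le> m" "ordered_partition {1..m} \<sigma>'"
    by (rule opartE)
  have "pm_push (\<lambda>\<rho>. cup \<rho> \<sigma>) r = relator (raw_cup \<tau> \<sigma>') a (id i) (id j)"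
    unfolding r \<sigma>
  proof (rule relator_image_aux[OF n(2) a n(1), where G = "\<lambda>\<rho>. \<rho> @ map ((`) ((+) n)) \<sigma>'"])
    show "cup (Abs_opart \<rho>) (Abs_opart \<sigma>') = Abs_opart (\<rho> @ map ((`) ((+) n)) \<sigma>')"
      if "ordered_partition {1..n} \<rho>" for \<rho>
      using Abs_cup[OF that n(1) m(2,1)] npoints_eq[OF that] by (simp add: raw_cup_def)
    show "refine \<tau> a \<alpha> @ map ((`) ((+) n)) \<sigma>'
        = refine (raw_cup \<tau> \<sigma>') a (map_prod ((`) id) ((`) id) \<alpha>)" for \<alpha>
      using a by (simp add: raw_cup_def npoints_eq[OF n(2)] refine_def)
    show "raw_cup \<tau> \<sigma>' ! a = id ` (\<tau> ! a)"
      using a by (simp add: raw_cup_def nth_append)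
  qed simp
  also have "\<dots> \<in> relators"
    using ordered_partition_raw_cup[OF n(2) m(2)] n m a ij
    by (intro relators_mem[of "n + m"]) (simp_all add: raw_cup_def nth_append)
  finally show ?thesis .
qed

lemma linear_span_relators:
  assumes "Vector_Spaces.linear pm_scale pm_scale h" "\<And>r. r \<in> relators \<Longrightarrow> h r \<in> pm.span relators"
    "x \<in> pm.span relators"
  shows "h x \<in> pm.span relators"
proof -
  interpret l: Vector_Spaces.linear pm_scale pm_scale h by fact
  have "h ` pm.span relators = pm.span (h ` relators)" by (rule l.span_image[symmetric])
  also have "\<dots> \<subseteq> pm.span relators" by (rule pm.span_minimal) (use assms(2) in auto)
  finally show ?thesis using assms(3) by blast
qed

lift_definition hperm :: "(nat \<Rightarrow> nat) \<Rightarrow> 'k::field hstar \<Rightarrow> 'k hstar" is "\<lambda>s. pm_push (perm s)"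
proof -
  fix s and x y :: "opart \<Rightarrow>\<^sub>0 'k"
  assume *: "x - y \<in> pm.span relators"
  have **: "pm_push (perm s) (x - y) \<in> pm.span relators"
    by (rule linear_span_relators[OF linear_pm_push _ *]) (intro pm.span_base perm_relators)
  interpret l: Vector_Spaces.linear pm_scale pm_scale "pm_push (perm s) :: (opart \<Rightarrow>\<^sub>0 'k) \<Rightarrow> _"
    by (rule linear_pm_push)
  show "pm_push (perm s) x - pm_push (perm s) y \<in> pm.span relators"
    using ** by (simp only: l.diff)
qed

lemma pm_bilin_cup_right:
  assumes "x \<in> pm.span relators"
  shows "pm_bilin cup x y \<in> pm.span relators"
  using linear_pm_bilin_left _ assms
proof (rule linear_span_relators)
  fix r :: "opart \<Rightarrow>\<^sub>0 'a"
  assume "r \<in> relators"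
  then show "pm_bilin cup r y \<in> pm.span relators"
    unfolding pm_bilin_left
    by (intro pm.span_sum pm.span_scale pm.span_base cup_right_relators)
qed

lemma pm_bilin_cup_left:
  assumes "y \<in> pm.span relators"
  shows "pm_bilin cup x y \<in> pm.span relators"
  using linear_pm_bilin_right _ assms
proof (rule linear_span_relators)
  fix r :: "opart \<Rightarrow>\<^sub>0 'a"
  assume "r \<in> relators"
  then show "pm_bilin cup x r \<in> pm.span relators"
    unfolding pm_bilin_right
    by (intro pm.span_sum pm.span_scale pm.span_base cup_left_relators)
qed

lift_definition hmult :: "'k::field hstar \<Rightarrow> 'k hstar \<Rightarrow> 'k hstar" is "pm_bilin cup"
proof -
  fix x x' y y' :: "opart \<Rightarrow>\<^sub>0 'k"
  assume *: "x - x' \<in> pm.span relators" "y - y' \<in> pm.span relators"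
  interpret l: Vector_Spaces.linear pm_scale pm_scale "\<lambda>z. pm_bilin cup z u" for u :: "opart \<Rightarrow>\<^sub>0 'k"
    by (rule linear_pm_bilin_left)
  interpret r: Vector_Spaces.linear pm_scale pm_scale "pm_bilin cup u" for u :: "opart \<Rightarrow>\<^sub>0 'k"
    by (rule linear_pm_bilin_right)
  have "pm_bilin cup x y - pm_bilin cup x' y' = pm_bilin cup (x - x') y + pm_bilin cup x' (y - y')"
    by (simp add: l.diff r.diff)
  also have "\<dots> \<in> pm.span relators"
    using pm_bilin_cup_right[OF *(1), of y] pm_bilin_cup_left[OF *(2), of x']
    by (rule pm.span_add)
  finally show "pm_bilin cup x y - pm_bilin cup x' y' \<in> pm.span relators" .
qed

lemma hmult_mu:
  assumes "ordered_partition {1..m} \<tau>" "1 \<le> m" "ordered_partition {1..n} \<sigma>" "1 \<le> n"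
  shows "hmult (mu \<tau>) (mu \<sigma>) = mu (raw_cup \<tau> \<sigma>)"
  by (simp add: mu_def hmult.abs_eq Abs_cup[OF assms])

lemma hperm_mu:
  assumes "ordered_partition {1..n} \<tau>" "1 \<le> n" "s permutes {1..n}"
  shows "hperm s (mu \<tau>) = mu (map ((`) s) \<tau>)"
proof -
  have "s permutes \<Union> (set \<tau>)" using assms by (simp add: ordered_partition_def)
  then show ?thesis
    by (simp add: mu_def hperm.abs_eq Abs_perm[OF assms(1,2)] raw_perm_def)
qed


section \<open>Superspaces\<close>

text \<open>\<open>part False\<close> is the even part and \<open>part True\<close> the odd part.\<close>

locale superspace = vector_space scale
  for scale :: "'k::field \<Rightarrow> 'v::ab_group_add \<Rightarrow> 'v" +
  fixes part :: "bool \<Rightarrow> 'v set"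
  assumes subspace_part: "subspace (part q)"
    and part_Int: "part False \<inter> part True = {0}"
    and part_sum: "\<exists>u\<in>part False. \<exists>w\<in>part True. v = u + w"

definition homogeneous_basis ::
  "('k::field \<Rightarrow> 't::ab_group_add \<Rightarrow> 't) \<Rightarrow> (bool \<Rightarrow> 't set) \<Rightarrow> 'i set \<Rightarrow> ('i \<Rightarrow> bool) \<Rightarrow> ('i \<Rightarrow> 't) \<Rightarrow> bool" where
  "homogeneous_basis sT T I p \<Delta> \<longleftrightarrow> finite I \<and> inj_on \<Delta> I \<and> \<not> module.dependent sT (\<Delta> ` I)
     \<and> module.span sT (\<Delta> ` I) = UNIV \<and> (\<forall>a\<in>I. \<Delta> a \<in> T (p a))"

definition endo :: "('k::field \<Rightarrow> 'f::ab_group_add \<Rightarrow> 'f) \<Rightarrow> ('f \<Rightarrow> 'f) set" where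
  "endo sF = {\<phi>. Vector_Spaces.linear sF sF \<phi>}"

definition endo_part ::
  "('k::field \<Rightarrow> 'f::ab_group_add \<Rightarrow> 'f) \<Rightarrow> (bool \<Rightarrow> 'f set) \<Rightarrow> bool \<Rightarrow> ('f \<Rightarrow> 'f) set" where
  "endo_part sF F q = {\<phi> \<in> endo sF. \<forall>e. \<phi> ` F e \<subseteq> F (e \<noteq> q)}"

definition grading_involution :: "(bool \<Rightarrow> 'f::ab_group_add set) \<Rightarrow> 'f \<Rightarrow> 'f" where
  "grading_involution F v = (THE w. \<exists>u\<in>F False. \<exists>t\<in>F True. v = u + t \<and> w = u - t)"

text \<open>\<open>twist F q \<phi> = (-1)\<^bsup>q |\<phi>|\<^esup> \<phi>\<close> for homogeneous \<open>\<phi>\<close>, extended linearly to all of \<open>End F\<close>: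
  the sign for moving \<open>\<phi>\<close> past something of parity \<open>q\<close>.\<close>

definition twist :: "(bool \<Rightarrow> 'f::ab_group_add set) \<Rightarrow> bool \<Rightarrow> ('f \<Rightarrow> 'f) \<Rightarrow> ('f \<Rightarrow> 'f)" where
  "twist F q \<phi> = (if q then grading_involution F \<circ> \<phi> \<circ> grading_involution F else \<phi>)"


section \<open>The algebra \<open>H\<^sub>*T\<close>\<close>

text \<open>\<open>H\<^sub>*\<^sub>n \<otimes> T\<^bsup>\<otimes>n\<^esup>\<close> is the span of the symbols \<open>h \<otimes> v\<^sub>1 \<otimes> \<dots> \<otimes> v\<^sub>n\<close>, written \<open>tgen h [v\<^sub>1, \<dots>, v\<^sub>n]\<close>,
  modulo multilinearity.  The tensor product and the passage to coinvariants are done in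
  a single quotient, by the sum of the two subspaces of relations.\<close>

definition tgen :: "'k::field hstar \<Rightarrow> 't list \<Rightarrow> (('k hstar \<times> 't list) \<Rightarrow>\<^sub>0 'k)" where
  "tgen h vs = Poly_Mapping.single (h, vs) 1"

definition tensor_gens :: "(('k::field hstar \<times> 't list) \<Rightarrow>\<^sub>0 'k) set" where
  "tensor_gens = {tgen h vs | h vs. vs \<noteq> [] \<and> h \<in> hgraded (length vs)}"

definition multilinear_relators ::
  "('k::field \<Rightarrow> 't::ab_group_add \<Rightarrow> 't) \<Rightarrow> (('k hstar \<times> 't list) \<Rightarrow>\<^sub>0 'k) set" where
  "multilinear_relators sT =
     {tgen (h + h') vs - tgen h vs - tgen h' vs | h h' vs.
        vs \<noteq> [] \<and> h \<in> hgraded (length vs) \<and> h' \<in> hgraded (length vs)}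
   \<union> {tgen (hscale c h) vs - pm_scale c (tgen h vs) | c h vs.
        vs \<noteq> [] \<and> h \<in> hgraded (length vs)}
   \<union> {tgen h (us @ (v + w) # ws) - tgen h (us @ v # ws) - tgen h (us @ w # ws) | h us v w ws.
        h \<in> hgraded (Suc (length us + length ws))}
   \<union> {tgen h (us @ sT c v # ws) - pm_scale c (tgen h (us @ v # ws)) | h us c v ws.
        h \<in> hgraded (Suc (length us + length ws))}"

text \<open>For a permutation \<open>s\<close> of \<open>{1..n}\<close>: \<open>s (v\<^sub>1 \<otimes> \<dots> \<otimes> v\<^sub>n)\<close> has \<open>v\<^sub>i\<close> in position \<open>s i\<close>, with the sign
  \<open>perm_sign s ps\<close> counting the inversions among odd factors, where \<open>ps\<close> lists the parities of
  the \<open>v\<^sub>i\<close>.\<close>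

definition perm_list :: "(nat \<Rightarrow> nat) \<Rightarrow> 't list \<Rightarrow> 't list" where
  "perm_list s vs = map (\<lambda>j. vs ! (inv s j - 1)) [1..<Suc (length vs)]"

definition perm_sign :: "(nat \<Rightarrow> nat) \<Rightarrow> bool list \<Rightarrow> 'k::field" where
  "perm_sign s ps = (-1) ^ card {(i, j). 1 \<le> i \<and> i < j \<and> j \<le> length ps \<and> s j < s i
     \<and> ps ! (i - 1) \<and> ps ! (j - 1)}"

definition coinvariant_relators ::
  "(bool \<Rightarrow> 't set) \<Rightarrow> (('k::field hstar \<times> 't list) \<Rightarrow>\<^sub>0 'k) set" where
  "coinvariant_relators T =
     {tgen h vs - pm_scale (perm_sign s ps) (tgen (hperm s h) (perm_list s vs)) | h vs ps s.
        vs \<noteq> [] \<and> h \<in> hgraded (length vs) \<and> list_all2 (\<lambda>v q. v \<in> T q) vs ps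
        \<and> s permutes {1..length vs}}"

definition HT_rel ::
  "('k::field \<Rightarrow> 't::ab_group_add \<Rightarrow> 't) \<Rightarrow> (bool \<Rightarrow> 't set) \<Rightarrow>
   ((('k hstar \<times> 't list) \<Rightarrow>\<^sub>0 'k) \<times> (('k hstar \<times> 't list) \<Rightarrow>\<^sub>0 'k)) set" where
  "HT_rel sT T = {(x, y). x \<in> pm.span tensor_gens \<and> y \<in> pm.span tensor_gens
     \<and> x - y \<in> pm.span (multilinear_relators sT \<union> coinvariant_relators T)}"

type_synonym ('k, 't) HT_elem = "(('k hstar \<times> 't list) \<Rightarrow>\<^sub>0 'k) set"

definition HT ::
  "('k::field \<Rightarrow> 't::ab_group_add \<Rightarrow> 't) \<Rightarrow> (bool \<Rightarrow> 't set) \<Rightarrow> ('k, 't) HT_elem set" where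
  "HT sT T = pm.span tensor_gens // HT_rel sT T"

definition HT_class ::
  "('k::field \<Rightarrow> 't::ab_group_add \<Rightarrow> 't) \<Rightarrow> (bool \<Rightarrow> 't set) \<Rightarrow> (('k hstar \<times> 't list) \<Rightarrow>\<^sub>0 'k) \<Rightarrow>
   ('k, 't) HT_elem" where
  "HT_class sT T x = HT_rel sT T `` {x}"

definition HT_add ::
  "('k::field \<Rightarrow> 't::ab_group_add \<Rightarrow> 't) \<Rightarrow> (bool \<Rightarrow> 't set) \<Rightarrow>
   ('k, 't) HT_elem \<Rightarrow> ('k, 't) HT_elem \<Rightarrow> ('k, 't) HT_elem" where
  "HT_add sT T A B = (\<Union>x\<in>A. \<Union>y\<in>B. HT_class sT T (x + y))"

definition HT_scale ::
  "('k::field \<Rightarrow> 't::ab_group_add \<Rightarrow> 't) \<Rightarrow> (bool \<Rightarrow> 't set) \<Rightarrow>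
   'k \<Rightarrow> ('k, 't) HT_elem \<Rightarrow> ('k, 't) HT_elem" where
  "HT_scale sT T c A = (\<Union>x\<in>A. HT_class sT T (pm_scale c x))"

definition HT_mult ::
  "('k::field \<Rightarrow> 't::ab_group_add \<Rightarrow> 't) \<Rightarrow> (bool \<Rightarrow> 't set) \<Rightarrow>
   ('k, 't) HT_elem \<Rightarrow> ('k, 't) HT_elem \<Rightarrow> ('k, 't) HT_elem" where
  "HT_mult sT T A B = (\<Union>x\<in>A. \<Union>y\<in>B.
     HT_class sT T (pm_bilin (\<lambda>(h, vs) (h', vs'). (hmult h h', vs @ vs')) x y))"

definition HT_part ::
  "('k::field \<Rightarrow> 't::ab_group_add \<Rightarrow> 't) \<Rightarrow> (bool \<Rightarrow> 't set) \<Rightarrow> bool \<Rightarrow> ('k, 't) HT_elem set" where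
  "HT_part sT T q = HT_class sT T ` pm.span {tgen h vs | h vs ps. vs \<noteq> [] \<and> h \<in> hgraded (length vs)
     \<and> list_all2 (\<lambda>v e. v \<in> T e) vs ps \<and> odd (length (filter id ps)) = q}"

text \<open>Functions on \<open>H\<^sub>*T\<close> are taken to be \<open>undefined\<close> off the carrier, so that equality of
  representations is equality on \<open>H\<^sub>*T\<close>.\<close>

definition HT_representations ::
  "('k::field \<Rightarrow> 't::ab_group_add \<Rightarrow> 't) \<Rightarrow> (bool \<Rightarrow> 't set) \<Rightarrow>
   ('k \<Rightarrow> 'f::ab_group_add \<Rightarrow> 'f) \<Rightarrow> (bool \<Rightarrow> 'f set) \<Rightarrow> (('k, 't) HT_elem \<Rightarrow> 'f \<Rightarrow> 'f) set" where
  "HT_representations sT T sF F = {K \<in> HT sT T \<rightarrow>\<^sub>E endo sF.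
     (\<forall>A\<in>HT sT T. \<forall>B\<in>HT sT T. \<forall>v. K (HT_add sT T A B) v = K A v + K B v)
   \<and> (\<forall>c. \<forall>A\<in>HT sT T. \<forall>v. K (HT_scale sT T c A) v = sF c (K A v))
   \<and> (\<forall>A\<in>HT sT T. \<forall>B\<in>HT sT T. K (HT_mult sT T A B) = K A \<circ> K B)
   \<and> (\<forall>q. \<forall>A\<in>HT_part sT T q. K A \<in> endo_part sF F q)}"


section \<open>Formal differential forms\<close>

text \<open>The de Rham complex of the formal completion of \<open>T\<close> is the supercommutative algebra on
  \<open>X a = x\<^sup>a\<close> and \<open>D a = dx\<^sup>a\<close>, where \<open>D a\<close> has parity opposite to \<open>X a\<close>; it consists of power
  series in the \<open>X a\<close> and polynomials in the \<open>D a\<close>.  A form (with values in some vector space) is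
  given by its coefficients, always written to the right of the monomials.  A monomial is a
  multiset of variables without repeated odd ones, standing for the product of its elements
  in the increasing order \<open>dvar_less\<close>; the linear order on indices serves only to fix this normal
  form.\<close>

datatype 'i dvar = X 'i | D 'i

fun dvar_less :: "'i::linorder dvar \<Rightarrow> 'i dvar \<Rightarrow> bool" where
  "dvar_less (X a) (X b) = (a < b)"
| "dvar_less (X a) (D b) = True"
| "dvar_less (D a) (X b) = False"
| "dvar_less (D a) (D b) = (a < b)"

fun dvar_index :: "'i dvar \<Rightarrow> 'i" where
  "dvar_index (X a) = a"
| "dvar_index (D a) = a"

fun is_D :: "'i dvar \<Rightarrow> bool" where
  "is_D (X a) = False"
| "is_D (D a) = True"

fun dvar_parity :: "('i \<Rightarrow> bool) \<Rightarrow> 'i dvar \<Rightarrow> bool" where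
  "dvar_parity p (X a) = p a"
| "dvar_parity p (D a) = (\<not> p a)"

type_synonym ('i, 'v) form = "'i dvar multiset \<Rightarrow> 'v"

definition mon_parity :: "('i \<Rightarrow> bool) \<Rightarrow> 'i dvar multiset \<Rightarrow> bool" where
  "mon_parity p M = odd (size (filter_mset (dvar_parity p) M))"

definition monomials :: "'i set \<Rightarrow> ('i \<Rightarrow> bool) \<Rightarrow> nat \<Rightarrow> 'i dvar multiset set" where
  "monomials I p r = {M. dvar_index ` set_mset M \<subseteq> I \<and> (\<forall>v. dvar_parity p v \<longrightarrow> count M v \<le> 1)
     \<and> size (filter_mset is_D M) = r}"

definition forms :: "'i set \<Rightarrow> ('i \<Rightarrow> bool) \<Rightarrow> nat \<Rightarrow> 'v set \<Rightarrow> ('i, 'v::zero) form set" where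
  "forms I p r V = {\<omega>. (\<forall>M. \<omega> M \<in> V) \<and> (\<forall>M. \<omega> M \<noteq> 0 \<longrightarrow> M \<in> monomials I p r)}"

definition forms_part ::
  "'i set \<Rightarrow> ('i \<Rightarrow> bool) \<Rightarrow> nat \<Rightarrow> (bool \<Rightarrow> 'v set) \<Rightarrow> bool \<Rightarrow> ('i, 'v::zero) form set" where
  "forms_part I p r V q = {\<omega> \<in> forms I p r UNIV. \<forall>M. \<omega> M \<in> V (q \<noteq> mon_parity p M)}"

definition scalar_part :: "bool \<Rightarrow> 'k::field set" where
  "scalar_part q = (if q then {0} else UNIV)"

text \<open>The product of the monomials \<open>M\<close> and \<open>N\<close>, in this order, is \<open>mon_sign p M N\<close> times \<open>M + N\<close>.\<close>

definition mon_sign :: "('i::linorder \<Rightarrow> bool) \<Rightarrow> 'i dvar multiset \<Rightarrow> 'i dvar multiset \<Rightarrow> 'k::field" where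
  "mon_sign p M N =
     (if \<exists>v. dvar_parity p v \<and> v \<in># M \<and> v \<in># N then 0
      else (-1) ^ card {(u, v). u \<in># M \<and> v \<in># N \<and> dvar_parity p u \<and> dvar_parity p v \<and> dvar_less v u})"

definition mon_form :: "'i dvar multiset \<Rightarrow> ('i, 'k::field) form" where
  "mon_form M = (\<lambda>N. if N = M then 1 else 0)"

definition form_mult ::
  "('i::linorder \<Rightarrow> bool) \<Rightarrow> ('k::field \<Rightarrow> 'v::ab_group_add \<Rightarrow> 'v) \<Rightarrow>
   ('i, 'k) form \<Rightarrow> ('i, 'v) form \<Rightarrow> ('i, 'v) form" where
  "form_mult p sc f \<omega> = (\<lambda>M. \<Sum>N | N \<subseteq># M. sc (mon_sign p N (M - N) * f N) (\<omega> (M - N)))"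

text \<open>The products \<open>\<Omega>(End F) \<times> \<Omega>(F) \<rightarrow> \<Omega>(F)\<close> and \<open>\<Omega>(End F) \<times> \<Omega>(End F) \<rightarrow> \<Omega>(End F)\<close>; a coefficient
  in \<open>End F\<close> is moved past the second monomial.\<close>

definition endo_form_apply ::
  "('i::linorder \<Rightarrow> bool) \<Rightarrow> ('k::field \<Rightarrow> 'f::ab_group_add \<Rightarrow> 'f) \<Rightarrow> (bool \<Rightarrow> 'f set) \<Rightarrow>
   ('i, 'f \<Rightarrow> 'f) form \<Rightarrow> ('i, 'f) form \<Rightarrow> ('i, 'f) form" where
  "endo_form_apply p sF F \<Phi> \<omega> = (\<lambda>M. \<Sum>N | N \<subseteq># M.
     sF (mon_sign p N (M - N)) (twist F (mon_parity p (M - N)) (\<Phi> N) (\<omega> (M - N))))"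

definition endo_form_wedge ::
  "('i::linorder \<Rightarrow> bool) \<Rightarrow> ('k::field \<Rightarrow> 'f::ab_group_add \<Rightarrow> 'f) \<Rightarrow> (bool \<Rightarrow> 'f set) \<Rightarrow>
   ('i, 'f \<Rightarrow> 'f) form \<Rightarrow> ('i, 'f \<Rightarrow> 'f) form \<Rightarrow> ('i, 'f \<Rightarrow> 'f) form" where
  "endo_form_wedge p sF F \<Phi> \<Psi> = (\<lambda>M v. \<Sum>N | N \<subseteq># M.
     sF (mon_sign p N (M - N)) (twist F (mon_parity p (M - N)) (\<Phi> N) (\<Psi> (M - N) v)))"

text \<open>The left partial derivative by \<open>x\<^sup>a\<close>, and \<open>d = \<Sum>\<^sub>a dx\<^sup>a \<partial>\<^sub>a\<close>.\<close>

definition form_partial ::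
  "('i::linorder \<Rightarrow> bool) \<Rightarrow> ('k::field \<Rightarrow> 'v::ab_group_add \<Rightarrow> 'v) \<Rightarrow> 'i \<Rightarrow> ('i, 'v) form \<Rightarrow> ('i, 'v) form" where
  "form_partial p sc a \<omega> = (\<lambda>N.
     sc (of_nat (Suc (count N (X a))) * mon_sign p {#X a#} N) (\<omega> (add_mset (X a) N)))"

definition form_d ::
  "'i set \<Rightarrow> ('i::linorder \<Rightarrow> bool) \<Rightarrow> ('k::field \<Rightarrow> 'v::ab_group_add \<Rightarrow> 'v) \<Rightarrow> ('i, 'v) form \<Rightarrow> ('i, 'v) form" where
  "form_d I p sc \<omega> = (\<lambda>M. \<Sum>a\<in>I. form_mult p sc (mon_form {#D a#}) (form_partial p sc a \<omega>) M)"


section \<open>Connections\<close>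

text \<open>Sections of the trivial bundle are \<open>forms I p 0 UNIV\<close>, i.e. \<open>F[[x]]\<close>.\<close>

definition odd_function_linear ::
  "'i set \<Rightarrow> ('i::linorder \<Rightarrow> bool) \<Rightarrow> ('k::field \<Rightarrow> 'f::ab_group_add \<Rightarrow> 'f) \<Rightarrow> (bool \<Rightarrow> 'f set) \<Rightarrow>
   (('i, 'f) form \<Rightarrow> ('i, 'f) form) \<Rightarrow> bool" where
  "odd_function_linear I p sF F A \<longleftrightarrow>
     A \<in> forms I p 0 UNIV \<rightarrow> forms I p 1 UNIV
   \<and> (\<forall>q. \<forall>s\<in>forms_part I p 0 F q. A s \<in> forms_part I p 1 F (\<not> q))
   \<and> (\<forall>s\<in>forms I p 0 UNIV. \<forall>t\<in>forms I p 0 UNIV. A (s + t) = A s + A t)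
   \<and> (\<forall>q. \<forall>f\<in>forms_part I p 0 scalar_part q. \<forall>s\<in>forms I p 0 UNIV. \<forall>M.
        A (form_mult p sF f s) M = sF (if q then -1 else 1) (form_mult p sF f (A s) M))"

text \<open>The pencil \<open>\<lambda> \<mapsto> d + \<lambda>A\<close>, as a family of operators on sections.\<close>

definition pencil ::
  "'i set \<Rightarrow> ('i::linorder \<Rightarrow> bool) \<Rightarrow> ('k::field \<Rightarrow> 'f::ab_group_add \<Rightarrow> 'f) \<Rightarrow>
   (('i, 'f) form \<Rightarrow> ('i, 'f) form) \<Rightarrow> 'k \<Rightarrow> ('i, 'f) form \<Rightarrow> ('i, 'f) form" where
  "pencil I p sF A l = (\<lambda>s\<in>forms I p 0 UNIV. \<lambda>M. form_d I p sF s M + sF l (A s M))"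

text \<open>\<open>D_coeff a \<omega>\<close> are the sections \<open>\<omega>\<^sub>a\<close> in \<open>\<omega> = \<Sum>\<^sub>a dx\<^sup>a \<omega>\<^sub>a\<close> for a 1-form \<open>\<omega>\<close> with values in \<open>F\<close>.
  A connection extends to 1-forms by the Leibniz rule
  \<open>\<nabla>(dx\<^sup>a \<omega>\<^sub>a) = (-1)\<^bsup>|dx\<^sup>a|\<^esup> dx\<^sup>a \<nabla>\<omega>\<^sub>a\<close>; this gives a meaning to \<open>\<nabla>\<^sup>2\<close>.\<close>

definition D_coeff ::
  "('i::linorder \<Rightarrow> bool) \<Rightarrow> ('k::field \<Rightarrow> 'f::ab_group_add \<Rightarrow> 'f) \<Rightarrow> 'i \<Rightarrow> ('i, 'f) form \<Rightarrow> ('i, 'f) form" where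
  "D_coeff p sF a \<omega> = (\<lambda>M. if \<exists>v. v \<in># M \<and> is_D v then 0
     else sF (mon_sign p {#D a#} M) (\<omega> (add_mset (D a) M)))"

definition extend_connection ::
  "'i set \<Rightarrow> ('i::linorder \<Rightarrow> bool) \<Rightarrow> ('k::field \<Rightarrow> 'f::ab_group_add \<Rightarrow> 'f) \<Rightarrow>
   (('i, 'f) form \<Rightarrow> ('i, 'f) form) \<Rightarrow> ('i, 'f) form \<Rightarrow> ('i, 'f) form" where
  "extend_connection I p sF G \<omega> = (\<lambda>M. \<Sum>a\<in>I.
     sF (if dvar_parity p (D a) then -1 else 1)
        (form_mult p sF (mon_form {#D a#}) (G (D_coeff p sF a \<omega>)) M))"

definition flat ::
  "'i set \<Rightarrow> ('i::linorder \<Rightarrow> bool) \<Rightarrow> ('k::field \<Rightarrow> 'f::ab_group_add \<Rightarrow> 'f) \<Rightarrow>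
   (('i, 'f) form \<Rightarrow> ('i, 'f) form) \<Rightarrow> bool" where
  "flat I p sF G \<longleftrightarrow> (\<forall>s\<in>forms I p 0 UNIV. \<forall>M. extend_connection I p sF G (G s) M = 0)"

definition flat_pencils ::
  "'i set \<Rightarrow> ('i::linorder \<Rightarrow> bool) \<Rightarrow> ('k::field \<Rightarrow> 'f::ab_group_add \<Rightarrow> 'f) \<Rightarrow> (bool \<Rightarrow> 'f set) \<Rightarrow>
   ('k \<Rightarrow> ('i, 'f) form \<Rightarrow> ('i, 'f) form) set" where
  "flat_pencils I p sF F = {pencil I p sF A | A.
     odd_function_linear I p sF F A \<and> (\<forall>l. flat I p sF (pencil I p sF A l))}"


section \<open>The series \<open>\<B>\<^sub>K\<close>\<close>

definition word :: "('i::linorder \<Rightarrow> bool) \<Rightarrow> 'i dvar list \<Rightarrow> ('i, 'k::field) form" where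
  "word p w = foldr (\<lambda>v f. form_mult p (*) (mon_form {#v#}) f) w (mon_form {#})"

text \<open>In the coefficient of \<open>M\<close> the sum over \<open>n\<close> stops at the degree of \<open>M\<close>, since words of length \<open>n\<close>
  only involve monomials of degree \<open>n\<close>.\<close>

definition potential ::
  "('k::field_char_0 \<Rightarrow> 't::ab_group_add \<Rightarrow> 't) \<Rightarrow> (bool \<Rightarrow> 't set) \<Rightarrow>
   'i set \<Rightarrow> ('i::linorder \<Rightarrow> bool) \<Rightarrow> ('i \<Rightarrow> 't) \<Rightarrow> ('k \<Rightarrow> 'f::ab_group_add \<Rightarrow> 'f) \<Rightarrow>
   (('k, 't) HT_elem \<Rightarrow> 'f \<Rightarrow> 'f) \<Rightarrow> ('i, 'f \<Rightarrow> 'f) form" where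
  "potential sT T I p \<Delta> sF K = (\<lambda>M v. \<Sum>n\<in>{1..size M}. \<Sum>as | set as \<subseteq> I \<and> length as = n.
     sF (word p (map X (rev as)) M / fact n)
        (K (HT_class sT T (tgen (mu [{1..n}]) (map \<Delta> as))) v))"

definition d_potential ::
  "('k::field_char_0 \<Rightarrow> 't::ab_group_add \<Rightarrow> 't) \<Rightarrow> (bool \<Rightarrow> 't set) \<Rightarrow>
   'i set \<Rightarrow> ('i::linorder \<Rightarrow> bool) \<Rightarrow> ('i \<Rightarrow> 't) \<Rightarrow> ('k \<Rightarrow> 'f::ab_group_add \<Rightarrow> 'f) \<Rightarrow>
   (('k, 't) HT_elem \<Rightarrow> 'f \<Rightarrow> 'f) \<Rightarrow> ('i, 'f \<Rightarrow> 'f) form" where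
  "d_potential sT T I p \<Delta> sF K = form_d I p (\<lambda>c \<phi> v. sF c (\<phi> v)) (potential sT T I p \<Delta> sF K)"

end

theory Submission
  imports Defs "HOL-Combinatorics.Multiset_Permutations"
begin

text \<open>The derivations \<open>\<partial>\<^sub>a\<close> and the multiplications by \<open>x\<^sup>a\<close> make the formal sections \<open>F[[x]]\<close> a module over
  a super Weyl algebra.  A pencil \<open>d + \<lambda>A\<close> has components \<open>\<partial>\<^sub>a + \<lambda>A\<^sub>a\<close> with \<open>A\<^sub>a\<close> function-linear, and it is flat
  for all \<open>\<lambda>\<close> iff the \<open>A\<^sub>a\<close> supercommute and \<open>[\<partial>\<^sub>c, A\<^sub>a] = \<plusminus>[\<partial>\<^sub>a, A\<^sub>c]\<close>.  A function-linear operator that vanishes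
  on constants is zero, so all this can be read off the Taylor coefficients
  \<open>C(a\<^sub>1, \<dots>, a\<^sub>n) = \<partial>\<^bsub>a\<^sub>1\<^esub> \<dots> \<partial>\<^bsub>a\<^sub>n\<^sub>-\<^sub>1\<^esub> A\<^bsub>a\<^sub>n\<^esub>\<close> at 0, which are endomorphisms of \<open>F\<close>.  The second condition says that
  \<open>C\<close> is supersymmetric.  By the iterated Leibniz rule the first one says that, for every word with two
  distinguished letters \<open>i\<close> and \<open>j\<close>, the signed sum of the products \<open>C(S) C(S')\<close> over the
  2-partitions \<open>(S, S')\<close> with \<open>i \<in> S\<close> and \<open>j \<in> S'\<close> equals the one with \<open>i\<close> and \<open>j\<close> exchanged: these are the
  defining relations of \<open>H\<^sub>*\<close>.

  On the other side, coinvariance moves the parts of any partition to consecutive intervals, where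
  \<open>\<mu>(\<tau>)\<close> is a product of the classes of one-part partitions; so a representation of \<open>H\<^sub>*T\<close> is
  determined by such a system \<open>C\<close>, and every such system occurs.\<close>

section \<open>Signs\<close>

text \<open>What shapes the proof is the signs. They arise in three ways: from sorting monomials,
  from moving derivatives past operators, and from counting inversions of permutations. All are
  compared through \<open>lsgn\<close>, the sign of sorting a word with marked odd letters: it
  changes by \<open>sg\<close> under an exchange of neighbours, and \<open>swap_invariant\<close>
  turns such a local rule into independence of the order. As an index may occur several times in a
  word, partitions are taken of distinct positions, and a labelling \<open>A\<close> assigns an
  index to each position. On distinct positions \<open>lsgn\<close> is its own inverse; on indices
  it vanishes exactly when an odd index is repeated. The defining relations of the spaces
  \<open>H\<close> split one part of an arbitrary partition, whereas flatness speaks of a single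
  split set. Multiplicativity bridges this: the other parts contribute the same outer factors to
  both sums, and the sign of the split part can be separated from its surroundings.\<close>

definition sg :: "bool \<Rightarrow> bool \<Rightarrow> 'k::field" where
  "sg a b = (if a \<and> b then -1 else 1)"

lemma sg_simps [simp]: "sg False b = 1" "sg a False = 1" "sg True True = -1" "sg a b * sg a b = 1"
    "sg a b * (sg a b * x) = x"
  by (auto simp: sg_def)

lemma sg_commute: "sg a b = sg b a"
  by (auto simp: sg_def)

lemma sg_xor: "sg (a = (\<not> b)) c = sg a c * sg b c" "sg c (a = (\<not> b)) = sg c a * sg c b"
  by (auto simp: sg_def)

text \<open>The contribution of a letter \<open>x\<close> standing before \<open>y\<close>: -1 for
  an odd inversion, and 0 for an odd letter met twice, because the square of an odd variable is
  0.\<close>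

definition pair_sg :: "('a::linorder \<Rightarrow> bool) \<Rightarrow> 'a \<Rightarrow> 'a \<Rightarrow> 'k::field" where
  "pair_sg e x y = (if e x \<and> e y then (if y = x then 0 else if y < x then -1 else 1) else 1)"

primrec lsgn :: "('a::linorder \<Rightarrow> bool) \<Rightarrow> 'a list \<Rightarrow> 'k::field" where
  "lsgn e [] = 1"
| "lsgn e (x # xs) = prod_list (map (pair_sg e x) xs) * lsgn e xs"

definition lpar :: "('a \<Rightarrow> bool) \<Rightarrow> 'a list \<Rightarrow> bool" where
  "lpar e xs = odd (length (filter e xs))"

lemma lpar_simps [simp]: "lpar e [] = False" "lpar e (x # xs) = (e x \<noteq> lpar e xs)"
    "lpar e (xs @ ys) = (lpar e xs \<noteq> lpar e ys)" "lpar e (rev xs) = lpar e xs"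
  by (auto simp: lpar_def rev_filter[symmetric])

lemma pair_sg_swap: "pair_sg e x y = sg (e x) (e y) * pair_sg e y x"
  by (auto simp: pair_sg_def sg_def)

lemma lsgn_append:
  "lsgn e (u @ v) = lsgn e u * prod_list (map (\<lambda>x. prod_list (map (pair_sg e x) v)) u) * lsgn e v"
  by (induction u) (simp_all add: algebra_simps)

lemma prod_list_mult: "prod_list (map (\<lambda>x. f x * g x) xs) = prod_list (map f xs) * (prod_list (map g xs) :: 'k::comm_monoid_mult)"
  by (induction xs) (simp_all add: ac_simps)

lemma prod_list_one: "(\<And>x. x \<in> set xs \<Longrightarrow> f x = 1) \<Longrightarrow> prod_list (map f xs) = (1::'k::comm_monoid_mult)"
  by (induction xs) simp_all

lemma prod_list_sg: "prod_list (map (\<lambda>y. sg b (e y)) u) = sg b (lpar e u)"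
  by (induction u) (simp_all add: sg_xor)

lemma lsgn_swap: "lsgn e (u @ a # b # v) = sg (e a) (e b) * lsgn e (u @ b # a # v)"
  by (simp add: lsgn_append prod_list_mult pair_sg_swap[of e a b])

lemma lsgn_move: "lsgn e (u @ x # v) = sg (e x) (lpar e u) * (lsgn e (x # u @ v) :: 'k::field)"
proof -
  have "prod_list (map (\<lambda>y. pair_sg e y x) u) = sg (e x) (lpar e u) * (prod_list (map (pair_sg e x) u) :: 'k)"
    by (simp add: prod_list_sg[symmetric] prod_list_mult[symmetric] pair_sg_swap[of e x] mult.assoc[symmetric])
  then show ?thesis by (simp add: lsgn_append prod_list_mult)
qed

text \<open>Exchanges of neighbours generate all rearrangements of a word. Restricting the
  hypothesis to words with content \<open>M\<close> lets it use facts about the letters, such as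
  membership in \<open>I\<close>.\<close>

lemma swap_invariant:
  assumes "\<And>u a b v. mset (u @ a # b # v) = M \<Longrightarrow> f (u @ a # b # v) = f (u @ b # a # v)"
    and "mset x = M" "mset y = M"
  shows "f x = f y"
proof -
  \<comment> \<open>A letter is carried to the front by exchanges; the fixed prefix \<open>w\<close>
    is what the induction on words below needs.\<close>
  have front: "f (w @ u @ a # v) = f (w @ a # u @ v)" if "mset (w @ u @ a # v) = M" for w u a v
    using that
  proof (induction u arbitrary: v rule: rev_induct)
    case (snoc b u)
    have "f (w @ u @ b # a # v) = f (w @ u @ a # b # v)"
      using assms(1)[of "w @ u" b a v] snoc.prems by (simp add: ac_simps add_mset_commute[of a b])
    also have "f (w @ u @ a # b # v) = f (w @ a # u @ b # v)"
      by (rule snoc.IH) (use snoc.prems in \<open>simp add: ac_simps add_mset_commute[of a b]\<close>)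
    finally show ?case by simp
  qed simp
  have "f (w @ x) = f (w @ y)" if "mset x = mset y" "mset (w @ x) = M" for w
    using that
  proof (induction x arbitrary: y w)
    case (Cons a x)
    then obtain u v where y: "y = u @ a # v" by (metis list.set_intros(1) mset_eq_setD split_list)
    have "f (w @ a # x) = f ((w @ [a]) @ x)" by simp
    also have "\<dots> = f ((w @ [a]) @ u @ v)"
      using Cons.prems y by (intro Cons.IH) simp_all
    also have "\<dots> = f (w @ u @ a # v)"
      using front[of w u a v] Cons.prems y by simp
    finally show ?case by (simp add: y)
  qed simp
  from this[of "[]"] show ?thesis using assms(2,3) by simp
qed

text \<open>On distinct letters no factor is 0, so the sign is 1 or -1 and multiplying by it again
  serves as division.\<close>

lemma lsgn_sq: "distinct w \<Longrightarrow> lsgn e w * lsgn e w = (1::'k::field)"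
proof (induction w)
  case (Cons x w)
  have "prod_list (map (pair_sg e x) w) * prod_list (map (pair_sg e x) w) = (1::'k)"
    unfolding prod_list_mult[symmetric] using Cons.prems
    by (intro prod_list_one) (auto simp: pair_sg_def)
  moreover have "lsgn e w * lsgn e w = (1::'k)" using Cons by simp
  ultimately show ?case
    using mult.assoc[of "lsgn e w" "lsgn e w :: 'k" "prod_list (map (pair_sg e x) w) * prod_list (map (pair_sg e x) w)"]
    by (simp add: ac_simps)
qed simp

text \<open>Only the pair of an odd letter with itself has sign 0. The right side speaks of the
  content alone, so the vanishing can be tested on a word where the two copies are
  neighbours.\<close>

lemma lsgn_zero_iff: "lsgn e w = (0::'k::field) \<longleftrightarrow> (\<exists>a u v. e a \<and> mset w = mset (a # a # u @ v))" (is "?L \<longleftrightarrow> ?R")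
proof
  show "?L \<Longrightarrow> ?R"
  proof (induction w)
    case (Cons x w)
    show ?case
    proof (cases "lsgn e w = (0::'k)")
      case True
      then obtain a u v where "e a" "mset w = mset (a # a # u @ v)" using Cons.IH by blast
      then show ?thesis by (intro exI[of _ a] exI[of _ "x # u"] exI[of _ v]) simp
    next
      case False
      then obtain y where y: "y \<in> set w" "pair_sg e x y = (0::'k)"
        using Cons.prems by (auto simp: prod_list_zero_iff)
      then have xy: "y = x" "e x" by (auto simp: pair_sg_def split: if_splits)
      with y obtain u v where "w = u @ x # v" by (meson split_list)
      then show ?thesis using xy by (intro exI[of _ x] exI[of _ u] exI[of _ v]) simp
    qed
  qed simp
next
  assume ?R
  then obtain a u v where a: "e a" and m: "mset w = mset (a # a # u @ v)" by blast
  have "(lsgn e w = (0::'k)) = (lsgn e (a # a # u @ v) = (0::'k))"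
  proof (rule swap_invariant[where M = "mset w" and f = "\<lambda>w. lsgn e w = (0::'k)"])
    show "(lsgn e (u @ a # b # v) = (0::'k)) = (lsgn e (u @ b # a # v) = (0::'k))" for u a b v
      by (subst lsgn_swap) (simp add: sg_def)
  qed (use m in simp_all)
  also have "lsgn e (a # a # u @ v) = (0::'k)" using a by (simp add: pair_sg_def)
  finally show ?L by simp
qed

text \<open>Rearranging a block changes the sign of the whole word by the same factor as the sign of
  the block alone, whatever surrounds it. The ratio is cross-multiplied, since the whole word may
  have sign 0.\<close>

lemma lsgn_cong_context:
  assumes "distinct w" "mset w = mset w'"
  shows "lsgn e (x @ w @ y) * lsgn e w' = (lsgn e (x @ w' @ y) * lsgn e w :: 'k::field)"
proof -
  have "lsgn e (x @ w @ y) * lsgn e w = (lsgn e (x @ w' @ y) * lsgn e w' :: 'k)"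
  proof (rule swap_invariant[where M = "mset w" and f = "\<lambda>w. lsgn e (x @ w @ y) * lsgn e w"])
    show "lsgn e (x @ (u @ a # b # v) @ y) * lsgn e (u @ a # b # v)
        = (lsgn e (x @ (u @ b # a # v) @ y) * lsgn e (u @ b # a # v) :: 'k)" for u a b v
      by (simp add: lsgn_swap[of e u a b v] lsgn_swap[of e "x @ u" a b "v @ y", simplified])
  qed (use assms in auto)
  then have "(lsgn e (x @ w @ y) * lsgn e w') * (lsgn e w * lsgn e w)
    = (lsgn e (x @ w' @ y) * lsgn e w :: 'k) * (lsgn e w' * lsgn e w')"
    by (simp add: algebra_simps)
  moreover have "distinct w'" using assms by (metis distinct_count_atmost_1 mset_eq_setD)
  ultimately show ?thesis using assms by (simp add: lsgn_sq)
qed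

lemma lsgn_less_append:
  assumes *: "\<And>x y. x \<in> set u \<Longrightarrow> y \<in> set v \<Longrightarrow> x < y"
  shows "lsgn e (u @ v) = lsgn e u * (lsgn e v :: 'k::field)"
proof -
  have "prod_list (map (pair_sg e x) v) = (1::'k)" if "x \<in> set u" for x
    by (rule prod_list_one) (use *[OF that] in \<open>force simp: pair_sg_def\<close>)
  then have "prod_list (map (\<lambda>x. prod_list (map (pair_sg e x) v)) u) = (1::'k)"
    by (rule prod_list_one)
  then show ?thesis by (simp add: lsgn_append)
qed

lemma lsgn_sorted: "sorted_wrt (<) w \<Longrightarrow> lsgn e w = (1::'k::field)"
proof (induction w)
  case (Cons x w)
  have "prod_list (map (pair_sg e x) w) = (1::'k)"
    by (rule prod_list_one) (use Cons.prems in \<open>force simp: pair_sg_def\<close>)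
  then show ?case using Cons by simp
qed simp

lemma lsgn_map:
  assumes "\<And>x y. x \<in> set w \<Longrightarrow> y \<in> set w \<Longrightarrow> f x < f y \<longleftrightarrow> x < y" "\<And>x y. x \<in> set w \<Longrightarrow> y \<in> set w \<Longrightarrow> f x = f y \<longleftrightarrow> x = y"
    "\<And>x. x \<in> set w \<Longrightarrow> e' (f x) = e x"
  shows "lsgn e' (map f w) = (lsgn e w :: 'k::field)"
  using assms
proof (induction w)
  case (Cons x w)
  have "map (pair_sg e' (f x)) (map f w) = map (pair_sg e x :: _ \<Rightarrow> 'k) w"
    using Cons.prems by (simp add: pair_sg_def)
  moreover have "lsgn e' (map f w) = (lsgn e w :: 'k)" by (rule Cons.IH) (use Cons.prems in auto)
  ultimately show ?case by (simp only: list.map lsgn.simps)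
qed simp

text \<open>Connects the recursive sign with the counting of inversions, the form in which
  \<open>perm_sign\<close> is given.\<close>

lemma lsgn_card:
  "distinct w \<Longrightarrow> lsgn e w = (-1 :: 'k::field) ^ card {(i, j). i < j \<and> j < length w \<and> w ! j < w ! i \<and> e (w ! i) \<and> e (w ! j)}"
proof (induction w)
  case (Cons x w)
  let ?A = "{j. j < length w \<and> w ! j < x \<and> e x \<and> e (w ! j)}"
  let ?B = "{(i, j). i < j \<and> j < length w \<and> w ! j < w ! i \<and> e (w ! i) \<and> e (w ! j)}"
  have "?B \<subseteq> {..<length w} \<times> {..<length w}" by auto
  then have fB: "finite ?B" by (rule finite_subset) simp
  have eq: "{(i, j). i < j \<and> j < length (x # w) \<and> (x # w) ! j < (x # w) ! i \<and> e ((x # w) ! i) \<and> e ((x # w) ! j)}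
     = (\<lambda>j. (0, Suc j)) ` ?A \<union> map_prod Suc Suc ` ?B" (is "?L = ?R")
  proof (rule set_eqI, clarify)
    fix i j show "(i, j) \<in> ?L \<longleftrightarrow> (i, j) \<in> ?R"
      by (cases i; cases j) (auto simp: image_iff)
  qed
  have "card ?L = card ((\<lambda>j. (0::nat, Suc j)) ` ?A) + card (map_prod Suc Suc ` ?B)"
    unfolding eq by (rule card_Un_disjoint) (use fB in auto)
  also have "\<dots> = card ?A + card ?B"
    by (subst (1 2) card_image) (auto simp: inj_on_def)
  finally have c: "card ?L = card ?A + card ?B" .
  have "x \<notin> set w \<Longrightarrow> prod_list (map (pair_sg e x) w) = (-1 :: 'k) ^ card {j. j < length w \<and> w ! j < x \<and> e x \<and> e (w ! j)}"
  proof (induction w rule: rev_induct)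
    case (snoc y w)
    have "{j. j < length (w @ [y]) \<and> (w @ [y]) ! j < x \<and> e x \<and> e ((w @ [y]) ! j)}
      = {j. j < length w \<and> w ! j < x \<and> e x \<and> e (w ! j)} \<union> (if y < x \<and> e x \<and> e y then {length w} else {})"
      by (auto simp: nth_append less_Suc_eq split: if_splits)
    then show ?case using snoc by (auto simp: pair_sg_def card_insert_if)
  qed simp
  then show ?case using Cons by (simp only: c power_add) simp
qed simp

text \<open>Exchanging two neighbours of \<open>w\<close> multiplies the signs before and after
  applying \<open>s\<close> by the same factor, so their product does not depend on
  \<open>w\<close>; on the increasing word it counts the inversions of \<open>s\<close> among odd
  entries.\<close>

lemma lsgn_perm:
  fixes s :: "nat \<Rightarrow> nat"
  assumes "s permutes {1..n}" "\<And>i. i \<in> {1..n} \<Longrightarrow> e' (s i) = e i" "\<And>i. i \<in> {1..n} \<Longrightarrow> e i = ps ! (i - 1)"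
    "length ps = n" "mset w = mset [1..<Suc n]"
  shows "lsgn e' (map s w) = perm_sign s ps * (lsgn e w :: 'k::field)"
proof -
  have dw: "distinct w" and sw: "set w = {1..n}"
    using assms(5) mset_eq_imp_distinct_iff[of w] by (auto dest!: mset_eq_setD)
  have "lsgn e' (map s w) * (lsgn e w :: 'k) = lsgn e' (map s [1..<Suc n]) * lsgn e [1..<Suc n]"
  proof (rule swap_invariant[where f = "\<lambda>w. lsgn e' (map s w) * lsgn e w"])
    fix u a b v
    assume "mset (u @ a # b # v) = mset w"
    then have "set (u @ a # b # v) = {1..n}" using sw by (metis set_mset_mset)
    then have "a \<in> {1..n}" "b \<in> {1..n}" by auto
    then have "e' (s a) = e a" "e' (s b) = e b" using assms(2) by blast+
    then show "lsgn e' (map s (u @ a # b # v)) * lsgn e (u @ a # b # v)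
      = (lsgn e' (map s (u @ b # a # v)) * lsgn e (u @ b # a # v) :: 'k)"
      by (simp add: lsgn_swap[of _ _ a b] lsgn_swap[of _ _ "s a" "s b"])
  qed (use assms in simp_all)
  also have "lsgn e [1..<Suc n] = (1::'k)" by (rule lsgn_sorted) (rule sorted_wrt_upt)
  also have "lsgn e' (map s [1..<Suc n]) = (perm_sign s ps :: 'k)"
  proof -
    have d: "distinct (map s [1..<Suc n])"
      using permutes_inj[OF assms(1)] inj_on_subset[of s UNIV] by (simp add: distinct_map del: upt_Suc)
    let ?w = "map s [1..<Suc n]"
    \<comment> \<open>Positions in a list start at 0, the points moved by \<open>s\<close> at 1;
      hence the shift of both coordinates.\<close>
    have "bij_betw (map_prod Suc Suc) {(i, j). i < j \<and> j < length ?w \<and> ?w ! j < ?w ! i \<and> e' (?w ! i) \<and> e' (?w ! j)}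
      {(i, j). 1 \<le> i \<and> i < j \<and> j \<le> length ps \<and> s j < s i \<and> ps ! (i - 1) \<and> ps ! (j - 1)}" (is "bij_betw _ ?A ?B")
    proof (rule bij_betw_imageI)
      show "inj_on (map_prod Suc Suc) ?A" by (auto simp: inj_on_def)
      have *: "e' (?w ! i) = ps ! i" "?w ! i = s (Suc i)" if "i < n" for i
        using that assms(2,3)[of "Suc i"] by (simp_all del: upt_Suc)
      have iff: "(i, j) \<in> ?A \<longleftrightarrow> (Suc i, Suc j) \<in> ?B" for i j
        using *[of i] *[of j] assms(4) by (auto simp del: upt_Suc)
      show "map_prod Suc Suc ` ?A = ?B"
      proof (intro set_eqI iffI)
        fix z assume z: "z \<in> ?B"
        obtain i' j' where ij': "z = (i', j')" by (rule prod.exhaust)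
        with z have "0 < i'" "0 < j'" by auto
        then have "i' = Suc (i' - 1)" "j' = Suc (j' - 1)" by simp_all
        then obtain i j where ij: "z = (Suc i, Suc j)" using ij' by metis
        then have "(i, j) \<in> ?A" using iff[of i j] z by (simp only:)
        then show "z \<in> map_prod Suc Suc ` ?A" unfolding ij by (rule rev_image_eqI) (simp only: map_prod_simp)
      next
        fix z assume "z \<in> map_prod Suc Suc ` ?A"
        then obtain a where a: "a \<in> ?A" "z = map_prod Suc Suc a" by (rule imageE)
        obtain i j where ij: "a = (i, j)" by (rule prod.exhaust)
        show "z \<in> ?B" using iff[of i j] a unfolding ij by (simp only: map_prod_simp)
      qed
    qed
    then show ?thesis
      unfolding lsgn_card[OF d] perm_sign_def by (simp only: bij_betw_same_card)
  qed
  finally have "lsgn e' (map s w) * (lsgn e w * lsgn e w) = perm_sign s ps * (lsgn e w :: 'k)"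
    by (metis mult.assoc mult.right_neutral)
  then show ?thesis by (simp add: lsgn_sq[OF dw])
qed

section \<open>Signs of products of monomials\<close>

definition dsgn :: "('i::linorder \<Rightarrow> bool) \<Rightarrow> 'i dvar \<Rightarrow> 'i dvar \<Rightarrow> 'k::field" where
  "dsgn p u v = (if dvar_parity p u \<and> dvar_parity p v then
     (if u = v then 0 else if dvar_less v u then -1 else 1) else 1)"

text \<open>In contrast to \<open>mon_sign\<close>, this is multiplicative in both arguments even if odd variables are
  repeated; the two agree on monomials without repeated odd variables.\<close>

definition bisgn :: "('i::linorder \<Rightarrow> bool) \<Rightarrow> 'i dvar multiset \<Rightarrow> 'i dvar multiset \<Rightarrow> 'k::field" where
  "bisgn p M N = (\<Prod>u\<in>#M. \<Prod>v\<in>#N. dsgn p u v)"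

definition good :: "('i \<Rightarrow> bool) \<Rightarrow> 'i dvar multiset \<Rightarrow> bool" where
  "good p M \<longleftrightarrow> (\<forall>v. dvar_parity p v \<longrightarrow> count M v \<le> 1)"

lemma dvar_less_total: "u = v \<or> dvar_less u v \<or> dvar_less v u"
  by (cases u; cases v) auto

lemma dvar_less_asym: "dvar_less u v \<Longrightarrow> dvar_less v u \<Longrightarrow> False"
  by (cases u; cases v) auto

lemma dsgn_swap: "dsgn p u v = sg (dvar_parity p u) (dvar_parity p v) * dsgn p v u"
  using dvar_less_total[of u v] dvar_less_asym[of u v] by (auto simp: dsgn_def sg_def)

lemma bisgn_simps [simp]:
  "bisgn p {#} N = 1" "bisgn p M {#} = 1"
  "bisgn p (M + M') N = bisgn p M N * bisgn p M' N"
  "bisgn p M (N + N') = bisgn p M N * bisgn p M N'"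
  by (simp_all add: bisgn_def prod_mset.distrib)

lemma bisgn_add_mset:
  "bisgn p (add_mset u M) N = bisgn p {#u#} N * bisgn p M N"
  "bisgn p M (add_mset u N) = bisgn p M {#u#} * bisgn p M N"
  by (simp_all add: bisgn_def prod_mset.distrib)

lemma bisgn_single [simp]: "bisgn p {#u#} {#v#} = dsgn p u v"
  by (simp add: bisgn_def)

lemma mon_parity_simps [simp]: "mon_parity p {#} = False"
  "mon_parity p (M + N) = (mon_parity p M \<noteq> mon_parity p N)"
  "mon_parity p (add_mset v M) = (dvar_parity p v \<noteq> mon_parity p M)"
  by (auto simp: mon_parity_def)

text \<open>Supercommutativity of monomials: multiplicativity in both arguments reduces it to two
  variables, of which exactly one order is the normal one.\<close>

lemma bisgn_swap: "bisgn p M N = sg (mon_parity p M) (mon_parity p N) * (bisgn p N M :: 'k::field)"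
proof -
  have 1: "bisgn p {#u#} N = sg (dvar_parity p u) (mon_parity p N) * (bisgn p N {#u#} :: 'k)" for u
  proof (induction N)
    case (add v N)
    have "bisgn p {#u#} (add_mset v N) = (dsgn p u v * bisgn p {#u#} N :: 'k)"
      by (simp add: bisgn_def)
    then show ?case
      using add by (simp add: bisgn_def sg_xor dsgn_swap[of p u v] ac_simps)
  qed (simp add: bisgn_def)
  show ?thesis
  proof (induction M)
    case (add u M)
    have "bisgn p N (add_mset u M) = (bisgn p N {#u#} * bisgn p N M :: 'k)"
      by (simp add: bisgn_def prod_mset.distrib)
    moreover have "bisgn p (add_mset u M) N = (bisgn p {#u#} N * bisgn p M N :: 'k)"
      by (simp add: bisgn_def)
    ultimately show ?case
      using add 1[of u] by (simp only: mon_parity_simps) (simp add: sg_xor ac_simps)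
  qed (simp add: bisgn_def)
qed

lemma good_mono: "good p M \<Longrightarrow> N \<subseteq># M \<Longrightarrow> good p N"
  unfolding good_def by (meson le_trans mset_subset_eq_count)

lemma good_empty [simp]: "good p {#}" by (simp add: good_def)

text \<open>\<open>mon_sign\<close> sees only the sets of variables, \<open>bisgn\<close> also the
  multiplicities. Multiplicities above 1 occur only for even variables, whose factors are 1, so both
  are the same product over pairs of variables.\<close>

lemma mon_sign_eq:
  assumes "good p M" "good p N"
  shows "mon_sign p M N = (bisgn p M N :: 'k::field)"
proof -
  have out: "prod_mset (image_mset f K) = prod f (set_mset K)"
    if "good p K" "\<And>u. \<not> dvar_parity p u \<Longrightarrow> f u = 1" for f :: "_ \<Rightarrow> 'k" and K
    unfolding image_prod_mset_multiplicity
  proof (rule prod.cong)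
    fix x assume "x \<in> set_mset K"
    then have "count K x > 0" by simp
    then have "count K x = 1 \<or> \<not> dvar_parity p x"
      using that(1) unfolding good_def by (cases "dvar_parity p x") (auto intro: le_antisym)
    then show "f x ^ count K x = f x" using that(2) by auto
  qed simp
  have "prod_mset (image_mset (dsgn p u) N) = (prod (dsgn p u) (set_mset N) :: 'k)" for u
    by (rule out[OF assms(2)]) (simp add: dsgn_def)
  then have "bisgn p M N = prod (\<lambda>u. prod (dsgn p u :: _ \<Rightarrow> 'k) (set_mset N)) (set_mset M)"
    unfolding bisgn_def by (simp only:) (rule out[OF assms(1)], simp add: dsgn_def)
  also have "\<dots> = (\<Prod>(u, v)\<in>set_mset M \<times> set_mset N. dsgn p u v)"
    by (rule prod.cartesian_product)
  also have "\<dots> = mon_sign p M N"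
  proof (cases "\<exists>v. dvar_parity p v \<and> v \<in># M \<and> v \<in># N")
    case True
    then obtain v where "dvar_parity p v \<and> v \<in># M \<and> v \<in># N" by blast
    then have "\<exists>a\<in>set_mset M \<times> set_mset N. (case a of (u, v) \<Rightarrow> dsgn p u v) = (0::'k)"
      by (intro bexI[of _ "(v, v)"]) (auto simp: dsgn_def)
    then have "(\<Prod>(u, v)\<in>set_mset M \<times> set_mset N. dsgn p u v) = (0::'k)"
      by (subst prod_zero_iff) auto
    then show ?thesis using True by (simp add: mon_sign_def)
  next
    case False
    have "(\<Prod>(u, v)\<in>set_mset M \<times> set_mset N. dsgn p u v)
       = (\<Prod>z\<in>set_mset M \<times> set_mset N. if z \<in> {(u, v). u \<in># M \<and> v \<in># N \<and> dvar_parity p u \<and> dvar_parity p v \<and> dvar_less v u} then -1 else (1::'k))"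
      using False by (intro prod.cong refl) (auto simp: dsgn_def split: if_splits)
    also have "\<dots> = (-1) ^ card {(u, v). u \<in># M \<and> v \<in># N \<and> dvar_parity p u \<and> dvar_parity p v \<and> dvar_less v u}"
      by (subst prod.inter_restrict[symmetric], simp)
         (auto intro!: arg_cong[where f = "\<lambda>A. (-1) ^ card A"])
    finally show ?thesis using False by (simp add: mon_sign_def)
  qed
  finally show ?thesis by simp
qed

text \<open>If the product is again a monomial, no odd variable is shared and no factor is 0; the
  sign can then be cancelled.\<close>

lemma bisgn_sq:
  assumes "good p (M + N)"
  shows "bisgn p M N * bisgn p M N = (1::'k::field)"
proof -
  have "\<not> (\<exists>v. dvar_parity p v \<and> v \<in># M \<and> v \<in># N)"
    using assms unfolding good_def
  proof clarify
    fix v assume v: "dvar_parity p v" "v \<in># M" "v \<in># N"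
    then have "count (M + N) v \<le> 1" using assms by (simp add: good_def)
    moreover have "count M v > 0" "count N v > 0" using v by simp_all
    ultimately show False by simp
  qed
  then have "mon_sign p M N * mon_sign p M N = (1::'k)" by (simp add: mon_sign_def power_mult_distrib[symmetric])
  then show ?thesis using assms by (metis mon_sign_eq good_mono mset_subset_eq_add_left mset_subset_eq_add_right)
qed

section \<open>Formal sections and their Weyl algebra\<close>

lemma finite_submultisets: "finite {N. N \<subseteq># M}"
proof (induction M)
  case (add x M)
  have "{N. N \<subseteq># add_mset x M} \<subseteq> {N. N \<subseteq># M} \<union> add_mset x ` {N. N \<subseteq># M}"
  proof
    fix N assume N: "N \<in> {N. N \<subseteq># add_mset x M}"
    show "N \<in> {N. N \<subseteq># M} \<union> add_mset x ` {N. N \<subseteq># M}"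
    proof (cases "x \<in># N")
      case True
      then obtain N' where "N = add_mset x N'" by (meson mset_add)
      then show ?thesis using N by auto
    next
      case False
      then have "N \<subseteq># M"
        using N by (metis (no_types, lifting) Diff_eq_empty_iff_mset add_mset_remove_trivial diff_subset_eq_self mem_Collect_eq minus_add_mset_if_not_in_lhs)
      then show ?thesis by simp
    qed
  qed
  then show ?case using add by (simp add: finite_subset)
qed simp

lemma bisgn_even: "\<not> dvar_parity p v \<Longrightarrow> bisgn p {#v#} N = 1"
  by (simp add: bisgn_def dsgn_def)

lemma bisgn_odd_mem: "dvar_parity p v \<Longrightarrow> v \<in># N \<Longrightarrow> bisgn p {#v#} N = 0"
  by (auto dest!: multi_member_split simp: bisgn_def dsgn_def)

lemma dsgn_X: "dsgn p (X a) (X b) = pair_sg p a b"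
  by (auto simp: dsgn_def pair_sg_def)

lemma monomials_good: "M \<in> monomials I p r \<Longrightarrow> good p M"
  by (auto simp: monomials_def good_def)

lemma sum_fun_apply: "sum f A x = (\<Sum>a\<in>A. f a x)"
  by (induction A rule: infinite_finite_induct) auto

text \<open>The forms, of any degree, on which \<open>mon_sign\<close> may be replaced by the
  multiplicative \<open>bisgn\<close>.\<close>

definition supp_good :: "('i \<Rightarrow> bool) \<Rightarrow> ('i, 'v::zero) form \<Rightarrow> bool" where
  "supp_good p \<omega> \<longleftrightarrow> (\<forall>M. \<omega> M \<noteq> 0 \<longrightarrow> good p M)"

lemma forms_supp_good: "\<omega> \<in> forms I p r V \<Longrightarrow> supp_good p \<omega>"
  using monomials_good by (fastforce simp: forms_def supp_good_def)

definition cst :: "'f \<Rightarrow> ('i, 'f::zero) form" where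
  "cst v = (\<lambda>M. if M = {#} then v else 0)"

text \<open>The Koszul sign of bringing the letters in \<open>T\<close> to the left of an operator
  of parity \<open>q\<close> and the others to its right: each letter outside \<open>T\<close>
  passes the operator and the later letters in \<open>T\<close>.\<close>

primrec subword_sign :: "('n \<Rightarrow> bool) \<Rightarrow> bool \<Rightarrow> 'n set \<Rightarrow> 'n list \<Rightarrow> 'k::field" where
  "subword_sign e q T [] = 1"
| "subword_sign e q T (x # u) =
    (if x \<in> T then 1 else sg (e x) (q \<noteq> lpar e (filter (\<lambda>y. y \<in> T) u))) * subword_sign e q T u"

lemma subword_sign_cong: "(\<And>x. x \<in> set u \<Longrightarrow> x \<in> T \<longleftrightarrow> x \<in> T') \<Longrightarrow> subword_sign e q T u = subword_sign e q T' u"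
proof (induction u)
  case (Cons x u)
  then have "filter (\<lambda>y. y \<in> T) u = filter (\<lambda>y. y \<in> T') u" by (auto intro: filter_cong)
  then show ?case using Cons by simp
qed simp

lemma prod_list_mset_cong: "mset u = mset v \<Longrightarrow> prod_list (map f u) = (prod_list (map f v) :: 'k::comm_monoid_mult)"
  by (metis mset_map prod_mset_prod_list)

text \<open>Here \<open>i\<close> stands in for the operator: the sign in the Leibniz rule becomes
  the sign of rearranging the word \<open>u\<close>, \<open>i\<close>, \<open>j\<close> into two
  blocks that end in \<open>i\<close> and \<open>j\<close>.\<close>

lemma lsgn_subword:
  "lsgn e (filter (\<lambda>y. y \<in> T) u @ i # filter (\<lambda>y. y \<notin> T) u @ [j]) = subword_sign e (e i) T u * (lsgn e (u @ [i, j]) :: 'k::field)"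
proof (induction u)
  case (Cons x u)
  let ?w = "filter (\<lambda>y. y \<in> T) u @ i # filter (\<lambda>y. y \<notin> T) u @ [j]"
  have "mset ?w = mset (u @ [i, j])" by (simp add: ac_simps)
  then have *: "lsgn e (x # ?w) = subword_sign e (e i) T u * (lsgn e (x # u @ [i, j]) :: 'k)"
    by (simp only: lsgn.simps prod_list_mset_cong[of ?w "u @ [i, j]" "pair_sg e x"] Cons append_Cons mult.left_commute)
  show ?case
  proof (cases "x \<in> T")
    case False
    have "lsgn e ((filter (\<lambda>y. y \<in> T) u @ [i]) @ x # filter (\<lambda>y. y \<notin> T) u @ [j])
      = sg (e x) (e i \<noteq> lpar e (filter (\<lambda>y. y \<in> T) u)) * (lsgn e (x # ?w) :: 'k)"
      by (subst lsgn_move) (auto simp: eq_commute)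
    then show ?thesis using False * by simp
  qed (use * in simp)
qed simp

section \<open>Derivatives and coordinate multiplications on formal sections\<close>

locale sections = superspace sF F
  for sF :: "'k::field_char_0 \<Rightarrow> 'f::ab_group_add \<Rightarrow> 'f" and F :: "bool \<Rightarrow> 'f set" +
  fixes I :: "'i::linorder set" and p :: "'i \<Rightarrow> bool"
  assumes finite_I: "finite I"
begin

definition scl :: "'k \<Rightarrow> ('i, 'f) form \<Rightarrow> ('i, 'f) form" where
  "scl c s = (\<lambda>M. sF c (s M))"

sublocale V: vector_space scl
  by unfold_locales (auto simp: scl_def fun_eq_iff scale_right_distrib scale_left_distrib)

abbreviation S :: "('i, 'f) form set" where "S \<equiv> forms I p 0 UNIV"

abbreviation pd :: "'i \<Rightarrow> ('i, 'f) form \<Rightarrow> ('i, 'f) form" where "pd \<equiv> form_partial p sF"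

definition vm :: "'i dvar \<Rightarrow> ('i, 'f) form \<Rightarrow> ('i, 'f) form" where
  "vm v s = form_mult p sF (mon_form {#v#}) s"

abbreviation xm :: "'i \<Rightarrow> ('i, 'f) form \<Rightarrow> ('i, 'f) form" where "xm a \<equiv> vm (X a)"

lemma vm_apply: "vm v s M = (if v \<in># M then sF (mon_sign p {#v#} (M - {#v#})) (s (M - {#v#})) else 0)"
proof -
  have "vm v s M = (\<Sum>N | N \<subseteq># M. if N = {#v#} then sF (mon_sign p {#v#} (M - {#v#})) (s (M - {#v#})) else 0)"
    unfolding vm_def form_mult_def mon_form_def by (intro sum.cong) auto
  then show ?thesis by (simp add: sum.delta[OF finite_submultisets])
qed

lemma vm_apply_bisgn:
  assumes "supp_good p s"
  shows "vm v s M = (if v \<in># M then sF (bisgn p {#v#} (M - {#v#})) (s (M - {#v#})) else 0)"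
proof (cases "s (M - {#v#}) = 0")
  case False
  then have "good p (M - {#v#})" using assms by (simp add: supp_good_def)
  moreover have "good p {#v#}" by (simp add: good_def)
  ultimately show ?thesis by (simp add: vm_apply mon_sign_eq)
qed (simp add: vm_apply)

lemma pd_apply:
  assumes "supp_good p s"
  shows "pd a s N = sF (of_nat (Suc (count N (X a))) * bisgn p {#X a#} N) (s (add_mset (X a) N))"
proof (cases "s (add_mset (X a) N) = 0")
  case False
  then have g: "good p (add_mset (X a) N)" using assms by (simp add: supp_good_def)
  have "good p {#X a#}" by (simp add: good_def)
  then show ?thesis using g by (simp add: form_partial_def mon_sign_eq good_mono)
qed (simp add: form_partial_def)

lemma linear_pd: "Vector_Spaces.linear scl scl (pd a)"
  by unfold_locales (auto simp: form_partial_def scl_def fun_eq_iff scale_right_distrib mult.commute)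

lemma linear_vm: "Vector_Spaces.linear scl scl (vm v)"
  by unfold_locales (auto simp: vm_apply scl_def fun_eq_iff scale_right_distrib mult.commute)

sublocale pd: Vector_Spaces.linear scl scl "pd a" for a by (rule linear_pd)
sublocale vm: Vector_Spaces.linear scl scl "vm v" for v by (rule linear_vm)

lemma S_iff: "s \<in> S \<longleftrightarrow> (\<forall>M. s M \<noteq> 0 \<longrightarrow> M \<in> monomials I p 0)"
  by (simp add: forms_def)

lemma S_supp_good: "s \<in> S \<Longrightarrow> supp_good p s"
  by (rule forms_supp_good)

lemma mono_add_mset: "add_mset (X a) N \<in> monomials I p r \<longleftrightarrow> a \<in> I \<and> N \<in> monomials I p r \<and> (p a \<longrightarrow> X a \<notin># N)"
proof -
  have "(\<forall>v. dvar_parity p v \<longrightarrow> count (add_mset (X a) N) v \<le> 1)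
    \<longleftrightarrow> (\<forall>v. dvar_parity p v \<longrightarrow> count N v \<le> 1) \<and> (p a \<longrightarrow> X a \<notin># N)" (is "?L \<longleftrightarrow> ?R")
  proof
    assume L: ?L
    have "count N v \<le> 1" if "dvar_parity p v" for v
      using L[rule_format, OF that] by (auto split: if_splits)
    moreover have "X a \<notin># N" if "p a"
      using L[rule_format, of "X a"] that by (simp add: not_in_iff)
    ultimately show ?R by blast
  next
    assume R: ?R
    show ?L
    proof (intro allI impI)
      fix v assume v: "dvar_parity p v"
      show "count (add_mset (X a) N) v \<le> 1"
        using R[THEN conjunct1, rule_format, OF v] R[THEN conjunct2] v by (auto simp: not_in_iff)
    qed
  qed
  then show ?thesis by (auto simp: monomials_def)
qed

lemma mono_cases:
  assumes "M \<in> monomials I p 0"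
  obtains "M = {#}" | a N where "M = add_mset (X a) N" "a \<in> I" "N \<in> monomials I p 0"
proof (cases M)
  case (add v N)
  show ?thesis
  proof (cases v)
    case (X a) then show ?thesis using assms add that(2) by (simp add: mono_add_mset)
  next
    case (D a) then show ?thesis using assms add by (simp add: monomials_def)
  qed
qed (use that in simp)

lemma empty_mono [simp]: "{#} \<in> monomials I p 0"
  by (simp add: monomials_def)


lemma subspace_S: "V.subspace S"
proof (rule V.subspaceI)
  show "0 \<in> S" by (simp add: S_iff)
  show "s + t \<in> S" if "s \<in> S" "t \<in> S" for s t
    unfolding S_iff
  proof (intro allI impI)
    fix M assume "(s + t) M \<noteq> 0"
    then have "s M \<noteq> 0 \<or> t M \<noteq> 0" by auto
    then show "M \<in> monomials I p 0" using that by (auto simp: S_iff)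
  qed
  show "scl c s \<in> S" if "s \<in> S" for c s
    using that by (auto simp: S_iff scl_def)
qed

lemma zero_S [simp]: "0 \<in> S" using subspace_S by (rule V.subspace_0)

lemma scl_S [simp]: "s \<in> S \<Longrightarrow> scl c s \<in> S" using subspace_S by (rule V.subspace_scale)

lemma add_S [simp]: "s \<in> S \<Longrightarrow> t \<in> S \<Longrightarrow> s + t \<in> S" using subspace_S by (rule V.subspace_add)

lemma diff_S [simp]: "s \<in> S \<Longrightarrow> t \<in> S \<Longrightarrow> s - t \<in> S" using subspace_S by (rule V.subspace_diff)

lemma sum_S [simp]: "(\<And>a. a \<in> A \<Longrightarrow> f a \<in> S) \<Longrightarrow> sum f A \<in> S"
  using subspace_S by (rule V.subspace_sum)

lemma cst_S [simp]: "cst v \<in> S"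
  by (auto simp: S_iff cst_def)

lemma pd_S [simp]: assumes "s \<in> S" shows "pd a s \<in> S"
  unfolding S_iff
proof (intro allI impI)
  fix N assume "pd a s N \<noteq> 0"
  then have "s (add_mset (X a) N) \<noteq> 0" by (auto simp: form_partial_def)
  then show "N \<in> monomials I p 0" using assms by (auto simp: S_iff mono_add_mset)
qed

lemma xm_S [simp]: assumes "s \<in> S" "a \<in> I" shows "xm a s \<in> S"
  unfolding S_iff
proof (intro allI impI)
  fix M assume *: "xm a s M \<noteq> 0"
  then have m: "X a \<in># M" by (auto simp: vm_apply split: if_splits)
  then obtain N where M: "M = add_mset (X a) N" by (meson mset_add)
  have **: "sF (bisgn p {#X a#} N) (s N) \<noteq> 0"
    using * unfolding vm_apply_bisgn[OF S_supp_good[OF assms(1)]] M by simp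
  then have "s N \<noteq> 0" by auto
  moreover have "p a \<longrightarrow> X a \<notin># N" using ** bisgn_odd_mem[of p "X a" N] by auto
  ultimately show "M \<in> monomials I p 0"
    using assms by (auto simp: S_iff mono_add_mset M)
qed

lemma pd_cst [simp]: "pd a (cst v) = 0"
  by (auto simp: form_partial_def cst_def fun_eq_iff)

lemma scale_2: "sF 2 x = x + x"
  using scale_left_distrib[of 1 1 x] by simp

text \<open>The commutation relation of the super Weyl algebra, read off coefficientwise. For an
  even variable the extra term comes from raising the multiplicity by one, for an odd one from the
  sign 0 of a square.\<close>

lemma weyl:
  assumes "s \<in> S" "a \<in> I"
  shows "pd b (xm a s) = (if a = b then s else 0) + scl (sg (p a) (p b)) (xm a (pd b s))"
proof (rule ext)
  fix N
  note g = S_supp_good[OF assms(1)] S_supp_good[OF pd_S[OF assms(1)]] S_supp_good[OF xm_S[OF assms]]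
  have L: "pd b (xm a s) N = (if a = b \<or> X a \<in># N then sF (of_nat (Suc (count N (X b))) * bisgn p {#X b#} N
      * bisgn p {#X a#} (add_mset (X b) N - {#X a#})) (s (add_mset (X b) N - {#X a#})) else 0)"
    by (auto simp: pd_apply[OF g(3)] vm_apply_bisgn[OF g(1)])
  show "pd b (xm a s) N = ((if a = b then s else 0) + scl (sg (p a) (p b)) (xm a (pd b s))) N"
  proof (cases "X a \<in># N")
    case True
    then obtain P where N: "N = add_mset (X a) P" by (meson mset_add)
    have R: "xm a (pd b s) N = sF (bisgn p {#X a#} P * (of_nat (Suc (count P (X b))) * bisgn p {#X b#} P)) (s (add_mset (X b) P))"
      by (simp add: vm_apply_bisgn[OF g(2)] N pd_apply[OF g(1)])
    show ?thesis
    proof (cases "a = b")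
      case False
      have "pair_sg p b a * bisgn p {#X b#} P * (pair_sg p a b * bisgn p {#X a#} P)
        = sg (p a) (p b) * (bisgn p {#X a#} P * bisgn p {#X b#} P :: 'k)"
        using False by (auto simp: pair_sg_def sg_def)
      then show ?thesis unfolding L plus_fun_apply scl_def R using False
        by (simp add: N bisgn_add_mset(2)[of p _ _ P] dsgn_X ac_simps)
    next
      case eq: True
      show ?thesis
      proof (cases "p a")
        case True
        \<comment> \<open>The variable is odd and occurs in \<open>N\<close>: the left side vanishes
          because of the square, and the two terms on the right cancel.\<close>
        have "s N = sF (bisgn p {#X a#} P * bisgn p {#X a#} P) (s N)"
        proof (cases "s N = 0")
          case False
          then have "good p N" using g(1) by (simp add: supp_good_def)
          then have "bisgn p {#X a#} P * bisgn p {#X a#} P = (1::'k)"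
            using bisgn_sq[of p "{#X a#}" P] by (simp add: N)
          then show ?thesis by simp
        qed simp
        moreover have "count P (X a) = 0" if "s N \<noteq> 0"
        proof -
          have "good p N" using g(1) that by (simp add: supp_good_def)
          then show ?thesis using True unfolding good_def N by (metis Suc_eq_plus1 add_cancel_left_left count_add_mset dvar_parity.simps(1) le_antisym le_zero_eq not_less_eq_eq plus_1_eq_Suc)
        qed
        ultimately show ?thesis unfolding L plus_fun_apply scl_def R using True eq
          by (cases "s N = 0") (simp_all add: N bisgn_odd_mem ac_simps)
      next
        case False
        then show ?thesis unfolding L plus_fun_apply scl_def R using eq
          by (simp add: N bisgn_even scale_left_distrib scale_2)
      qed
    qed
  next
    case False
    show ?thesis
    proof (cases "a = b")
      case True
      have "s N = sF (bisgn p {#X a#} N * bisgn p {#X a#} N) (s N)"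
      proof (cases "s N = 0")
        case nz: False
        then have "N \<in> monomials I p 0" using assms(1) by (auto simp: S_iff)
        then have "good p (add_mset (X a) N)"
          using mono_add_mset[of a N 0] False assms(2) monomials_good by blast
        then have "bisgn p {#X a#} N * bisgn p {#X a#} N = (1::'k)"
          using bisgn_sq[of p "{#X a#}" N] by simp
        then show ?thesis by simp
      qed simp
      moreover have "count N (X a) = 0" using False by (simp add: not_in_iff)
      ultimately show ?thesis unfolding L plus_fun_apply scl_def using True False
        by (simp add: vm_apply)
    qed (use False in \<open>simp add: L vm_apply scl_def\<close>)
  qed
qed

text \<open>For distinct variables the order affects only the factor that compares the two with each
  other; an odd derivative squares to 0.\<close>

lemma pd_commute:
  assumes "s \<in> S"
  shows "pd a (pd b s) = scl (sg (p a) (p b)) (pd b (pd a s))"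
proof (rule ext)
  fix N
  note g = S_supp_good[OF assms(1)]
  note g' = S_supp_good[OF pd_S[OF assms(1)]]
  show "pd a (pd b s) N = scl (sg (p a) (p b)) (pd b (pd a s)) N"
  proof (cases "a = b")
    case False
    have "bisgn p {#X a#} N * (pair_sg p b a * bisgn p {#X b#} N)
      = sg (p a) (p b) * (bisgn p {#X b#} N * (pair_sg p a b * bisgn p {#X a#} N) :: 'k)"
      using False by (auto simp: pair_sg_def sg_def)
    then show ?thesis unfolding scl_def pd_apply[OF g'] pd_apply[OF g] using False
      by (simp add: bisgn_add_mset(2)[of p _ _ N] dsgn_X ac_simps add_mset_commute)
  next
    case True
    then show ?thesis unfolding scl_def pd_apply[OF g'] pd_apply[OF g]
      by (cases "p b") (simp_all add: bisgn_add_mset(2)[of p _ _ N] dsgn_X pair_sg_def)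
  qed
qed

definition dec :: "'i \<Rightarrow> ('i, 'f) form \<Rightarrow> ('i, 'f) form" where
  "dec a s = (\<lambda>N. if \<forall>b. X b \<in># N \<longrightarrow> a \<le> b then sF (bisgn p {#X a#} N) (s (add_mset (X a) N)) else 0)"

lemma dec_S [simp]: assumes "s \<in> S" shows "dec a s \<in> S"
  unfolding S_iff
proof (intro allI impI)
  fix N assume "dec a s N \<noteq> 0"
  then have "s (add_mset (X a) N) \<noteq> 0" by (auto simp: dec_def split: if_splits)
  then show "N \<in> monomials I p 0" using assms by (auto simp: S_iff mono_add_mset)
qed

text \<open>Every monomial other than 1 is divided by its least variable.\<close>

lemma decomposition:
  assumes "s \<in> S"
  shows "s = cst (s {#}) + (\<Sum>a\<in>I. xm a (dec a s))"
proof (rule ext)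
  fix M
  note g = S_supp_good[OF dec_S[OF assms]]
  show "s M = (cst (s {#}) + (\<Sum>a\<in>I. xm a (dec a s))) M"
  proof (cases "M \<in> monomials I p 0 \<and> M \<noteq> {#}")
    case False
    have "xm a (dec a s) M = 0" if "a \<in> I" for a
    proof (cases "M = {#}")
      case neq: False
      then have "M \<notin> monomials I p 0" using False by blast
      then show ?thesis using xm_S[OF dec_S[OF assms] that, of a] by (auto simp: S_iff)
    qed (simp add: vm_apply)
    moreover have "s M = cst (s {#}) M" using False assms by (auto simp: cst_def S_iff)
    ultimately show ?thesis by (simp add: sum_fun_apply)
  next
    case True
    define B where "B = {b. X b \<in># M}"
    have XM: "\<exists>b. v = X b" if "v \<in># M" for v
      using True that by (cases v) (auto simp: monomials_def dest!: multi_member_split)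
    have B: "finite B" "B \<noteq> {}" "B \<subseteq> I"
    proof -
      have "B \<subseteq> dvar_index ` set_mset M" by (force simp: B_def)
      then show "finite B" "B \<subseteq> I" using True by (auto simp: monomials_def intro: finite_subset)
      show "B \<noteq> {}" using True XM by (auto simp: B_def) (metis multiset_nonemptyE)
    qed
    define m where "m = Min B"
    have m: "m \<in> B" "\<And>b. b \<in> B \<Longrightarrow> m \<le> b" using B by (auto simp: m_def)
    then obtain N where M: "M = add_mset (X m) N" by (auto simp: B_def dest!: multi_member_split)
    have "xm a (dec a s) M = (if a = m then s M else 0)" if "a \<in> I" for a
    proof (cases "a = m")
      case True
      have "good p M" using \<open>M \<in> _ \<and> _\<close> monomials_good by blast
      then have "bisgn p {#X m#} N * bisgn p {#X m#} N = (1::'k)" using bisgn_sq[of p "{#X m#}" N] by (simp add: M)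
      moreover have "\<forall>b. X b \<in># N \<longrightarrow> m \<le> b" using m(2) by (auto simp: B_def M)
      then have "dec m s N = sF (bisgn p {#X m#} N) (s M)" by (simp add: dec_def M)
      ultimately show ?thesis using True by (simp add: vm_apply_bisgn[OF g] M)
    next
      case False
      have "dec a s (M - {#X a#}) = 0" if "a \<in> B"
      proof -
        have "X m \<in># M - {#X a#}" using False M by (simp add: in_diff_count)
        moreover have "\<not> a \<le> m" using m(2)[OF that] False by simp
        ultimately show ?thesis by (auto simp: dec_def)
      qed
      then show ?thesis using False by (auto simp: vm_apply B_def)
    qed
    then have "(\<Sum>a\<in>I. xm a (dec a s) M) = (\<Sum>a\<in>I. if a = m then s M else 0)" by (intro sum.cong) auto
    also have "\<dots> = s M" using B m(1) finite_I by (auto simp: sum.delta)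
    finally show ?thesis using True by (simp add: sum_fun_apply cst_def)
  qed
qed

lemma additive_sum:
  fixes L :: "('i, 'f) form \<Rightarrow> 'b::ab_group_add"
  assumes "\<And>s t. s \<in> S \<Longrightarrow> t \<in> S \<Longrightarrow> L (s + t) = L s + L t" "\<And>a. a \<in> A \<Longrightarrow> f a \<in> S"
  shows "L (sum f A) = (\<Sum>a\<in>A. L (f a))"
proof -
  have 0: "0 \<in> S" using subspace_S by (rule V.subspace_0)
  have "L 0 = 0" using assms(1)[OF 0 0] by simp
  then show ?thesis using assms(2)
  proof (induction A rule: infinite_finite_induct)
    case (insert a A)
    have "sum f A \<in> S" using insert.prems by (intro V.subspace_sum[OF subspace_S]) simp
    then have "L (f a + sum f A) = L (f a) + L (sum f A)" using insert.prems by (intro assms(1)) simp_all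
    moreover have "sum f (insert a A) = f a + sum f A" using insert.hyps by (rule sum.insert)
    ultimately show ?case using insert by (simp only: sum.insert) simp
  qed auto
qed

text \<open>A section is determined modulo the powers of the maximal ideal, and as \<open>I\<close> is finite these are
  generated by monomials; so there is no need for \<open>F\<close> to be finite-dimensional.\<close>

lemma zero_operator:
  assumes add: "\<And>s t. s \<in> S \<Longrightarrow> t \<in> S \<Longrightarrow> L (s + t) = L s + L t"
    and xm: "\<And>b s. b \<in> I \<Longrightarrow> s \<in> S \<Longrightarrow> L (xm b s) = scl (\<epsilon> b) (xm b (L s))"
    and cst: "\<And>v. L (cst v) = 0" and s: "s \<in> S"
  shows "L s = 0"
proof -
  have "L s M = 0" if "s \<in> S" for s M
    using that
  proof (induction M arbitrary: s rule: measure_induct_rule[where f = size])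
    case (less M)
    have "L s = L (cst (s {#}) + (\<Sum>a\<in>I. xm a (dec a s)))"
      using decomposition[OF less.prems] by simp
    also have "\<dots> = L (cst (s {#})) + L (\<Sum>a\<in>I. xm a (dec a s))"
      using less.prems by (intro add V.subspace_sum[OF subspace_S]) (auto intro: dec_S)
    also have "\<dots> = (\<Sum>a\<in>I. L (xm a (dec a s)))"
      unfolding cst by (subst additive_sum[where L = L]) (simp_all add: add less.prems)
    also have "\<dots> = (\<Sum>a\<in>I. scl (\<epsilon> a) (xm a (L (dec a s))))"
      by (intro sum.cong refl xm dec_S less.prems)
    finally have "L s M = (\<Sum>a\<in>I. sF (\<epsilon> a) (xm a (L (dec a s)) M))"
      by (simp add: sum_fun_apply scl_def)
    also have "\<dots> = 0"
    proof (rule sum.neutral, rule ballI)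
      fix a
      have "L (dec a s) (M - {#X a#}) = 0" if "X a \<in># M"
        using that by (intro less.IH dec_S less.prems) (simp add: size_Diff1_less)
      then show "sF (\<epsilon> a) (xm a (L (dec a s)) M) = 0" by (simp add: vm_apply)
    qed
    finally show ?case .
  qed
  then show ?thesis using s by (simp add: fun_eq_iff)
qed

section \<open>Iterated derivatives and Taylor expansion at the origin\<close>

definition pdw :: "'i list \<Rightarrow> ('i, 'f) form \<Rightarrow> ('i, 'f) form" where
  "pdw u s = foldr pd u s"

lemma pdw_simps [simp]: "pdw [] s = s" "pdw (a # u) s = pd a (pdw u s)" "pdw (u @ w) s = pdw u (pdw w s)"
  by (simp_all add: pdw_def)

lemma pdw_S [simp]: "s \<in> S \<Longrightarrow> pdw u s \<in> S"
  by (induction u) simp_all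

lemma linear_pdw: "Vector_Spaces.linear scl scl (pdw u)"
  by (unfold_locales; induction u) (simp_all add: pd.add pd.scale)

sublocale pdw: Vector_Spaces.linear scl scl "pdw u" for u by (rule linear_pdw)

text \<open>A coefficient of positive degree is, up to a sign and a multiplicity, a coefficient of
  lower degree of some derivative. The multiplicity is invertible since the characteristic is
  zero.\<close>

lemma taylor:
  assumes "s \<in> S" "\<And>w. set w \<subseteq> I \<Longrightarrow> pdw w s {#} = 0"
  shows "s = 0"
proof -
  have "s M = 0" if "s \<in> S" "\<And>w. set w \<subseteq> I \<Longrightarrow> pdw w s {#} = 0" for s M
    using that
  proof (induction M arbitrary: s rule: measure_induct_rule[where f = size])
    case (less M)
    show ?case
    proof (rule ccontr)
      assume *: "s M \<noteq> 0"
      then have M: "M \<in> monomials I p 0" using less.prems(1) by (auto simp: S_iff)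
      then show False
      proof (cases rule: mono_cases)
        case 1
        then show False using * less.prems(2)[of "[]"] by simp
      next
        case (2 a N)
        have "pd a s N = 0"
        proof (rule less.IH)
          show "pdw w (pd a s) {#} = 0" if "set w \<subseteq> I" for w
            using less.prems(2)[of "w @ [a]"] that 2 by simp
        qed (use 2 less.prems in simp_all)
        moreover have "bisgn p {#X a#} N * bisgn p {#X a#} N = (1::'k)"
          using bisgn_sq[of p "{#X a#}" N] monomials_good[OF M] by (simp add: 2)
        then have "bisgn p {#X a#} N \<noteq> (0::'k)" by auto
        ultimately show False using * 2 by (auto simp: pd_apply[OF S_supp_good[OF less.prems(1)]] simp del: of_nat_Suc)
      qed
    qed
  qed
  then show ?thesis using assms by (simp add: fun_eq_iff)
qed

section \<open>Function-linear operators and the Leibniz rule\<close>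

text \<open>The parity \<open>q\<close> enters as the sign rule against coordinates. Commuting with
  scalars and coordinates is enough to control an operator, because \<open>decomposition\<close>
  reaches every section degree by degree.\<close>

definition super_linear :: "bool \<Rightarrow> (('i, 'f) form \<Rightarrow> ('i, 'f) form) \<Rightarrow> bool" where
  "super_linear q L \<longleftrightarrow> (\<forall>s\<in>S. L s \<in> S) \<and> (\<forall>s\<in>S. \<forall>t\<in>S. L (s + t) = L s + L t)
    \<and> (\<forall>c. \<forall>s\<in>S. L (scl c s) = scl c (L s))
    \<and> (\<forall>b\<in>I. \<forall>s\<in>S. L (xm b s) = scl (sg q (p b)) (xm b (L s)))"

lemma super_linearD:
  assumes "super_linear q L" "s \<in> S"
  shows "L s \<in> S" "t \<in> S \<Longrightarrow> L (s + t) = L s + L t" "L (scl c s) = scl c (L s)"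
    "b \<in> I \<Longrightarrow> L (xm b s) = scl (sg q (p b)) (xm b (L s))"
  using assms by (auto simp: super_linear_def)

lemma super_linear_0: "super_linear q L \<Longrightarrow> L 0 = 0"
  using super_linearD(3)[of q L 0 0] by simp

text \<open>The supercommutator of a derivative with an operator of parity \<open>q\<close>.\<close>

definition ad :: "'i \<Rightarrow> bool \<Rightarrow> (('i, 'f) form \<Rightarrow> ('i, 'f) form) \<Rightarrow> ('i, 'f) form \<Rightarrow> ('i, 'f) form" where
  "ad b q L s = pd b (L s) - scl (sg q (p b)) (L (pd b s))"

text \<open>When a coordinate is pulled out, both terms of the commutator produce the same extra
  term from \<open>weyl\<close>, and the two cancel; this is why the commutator is function-linear
  although the derivative is not.\<close>

lemma super_linear_ad:
  assumes L: "super_linear q L"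
  shows "super_linear (q \<noteq> p b) (ad b q L)"
  unfolding super_linear_def
proof (intro conjI ballI allI)
  fix s assume s: "s \<in> S"
  note d = super_linearD[OF L]
  show "ad b q L s \<in> S" using s d by (simp add: ad_def)
  show "ad b q L (s + t) = ad b q L s + ad b q L t" if "t \<in> S" for t
    using s that d by (simp add: ad_def pd.add V.scale_right_distrib)
  show "ad b q L (scl c s) = scl c (ad b q L s)" for c
    using s d by (simp add: ad_def pd.scale V.scale_right_diff_distrib mult.commute)
  fix a assume a: "a \<in> I"
  have 1: "pd b (L (xm a s)) = scl (sg q (p a)) ((if a = b then L s else 0) + scl (sg (p a) (p b)) (xm a (pd b (L s))))"
    using s a d by (simp add: pd.scale weyl)
  have 2: "L (pd b (xm a s)) = (if a = b then L s else 0) + scl (sg (p a) (p b) * sg q (p a)) (xm a (L (pd b s)))"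
    using s a d super_linear_0[OF L] by (simp add: weyl)
  show "ad b q L (xm a s) = scl (sg (q \<noteq> p b) (p a)) (xm a (ad b q L s))"
    unfolding ad_def 1 2 by (auto simp: vm.diff vm.scale V.scale_right_distrib V.scale_right_diff_distrib sg_xor sg_commute[of "p b" "p a"] mult.commute mult.left_commute)
qed

primrec adw :: "'i list \<Rightarrow> bool \<Rightarrow> (('i, 'f) form \<Rightarrow> ('i, 'f) form) \<Rightarrow> ('i, 'f) form \<Rightarrow> ('i, 'f) form" where
  "adw [] q L = L"
| "adw (a # u) q L = ad a (q \<noteq> lpar p u) (adw u q L)"

lemma super_linear_adw: "super_linear q L \<Longrightarrow> super_linear (q \<noteq> lpar p u) (adw u q L)"
proof (induction u)
  case (Cons a u)
  have "((q \<noteq> lpar p u) \<noteq> p a) = (q \<noteq> lpar p (a # u))" by auto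
  then show ?case using super_linear_ad[OF Cons.IH[OF Cons.prems], of a] by simp
qed simp

lemma pd_leibniz: "pd b (L t) = ad b q L t + scl (sg q (p b)) (L (pd b t))"
  by (simp add: ad_def)

text \<open>Each derivative either enters a commutator with \<open>L\<close> or passes it to act on
  \<open>t\<close>; \<open>T\<close> collects those of the first kind. The letters are positions
  labelled by \<open>A\<close>, since the same derivative may occur several times and its
  occurrences are chosen independently.\<close>

lemma leibniz:
  fixes A :: "'n \<Rightarrow> 'i"
  assumes L: "super_linear q L" and t: "t \<in> S"
  shows "distinct u \<Longrightarrow> pdw (map A u) (L t) = (\<Sum>T\<in>Pow (set u). scl (subword_sign (p \<circ> A) q T u)
    (adw (map A (filter (\<lambda>x. x \<in> T) u)) q L (pdw (map A (filter (\<lambda>x. x \<notin> T) u)) t)))"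
proof (induction u)
  case (Cons x u)
  define G where "G T u = scl (subword_sign (p \<circ> A) q T u)
    (adw (map A (filter (\<lambda>x. x \<in> T) u)) q L (pdw (map A (filter (\<lambda>x. x \<notin> T) u)) t))" for T u
  have x: "x \<notin> set u" using Cons.prems by simp
  have "pdw (map A u) (L t) = (\<Sum>T\<in>Pow (set u). G T u)"
    unfolding G_def by (rule Cons.IH) (use Cons.prems in simp)
  then have "pdw (map A (x # u)) (L t) = (\<Sum>T\<in>Pow (set u). pd (A x) (G T u))"
    by (simp add: pd.sum)
  \<comment> \<open>The new outermost derivative either joins \<open>T\<close> or passes the
    commutator; in the second case it picks up the factor by which \<open>subword_sign\<close>
    grows.\<close>
  also have "\<dots> = (\<Sum>T\<in>Pow (set u). G (insert x T) (x # u) + G T (x # u))"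
  proof (rule sum.cong[OF refl])
    fix T assume "T \<in> Pow (set u)"
    then have xT: "x \<notin> T" using x by blast
    have f: "filter (\<lambda>y. y \<in> insert x T) u = filter (\<lambda>y. y \<in> T) u"
      "filter (\<lambda>y. y \<notin> insert x T) u = filter (\<lambda>y. y \<notin> T) u"
      using x by (auto intro!: filter_cong)
    have r: "subword_sign (p \<circ> A) q (insert x T) u = (subword_sign (p \<circ> A) q T u :: 'k)"
      using x by (intro subword_sign_cong) auto
    have lp: "lpar p (map A w) = lpar (p \<circ> A) w" for w by (simp add: lpar_def filter_map)
    show "pd (A x) (G T u) = G (insert x T) (x # u) + G T (x # u)"
      unfolding G_def pd.scale
      by (subst pd_leibniz[where q = "q \<noteq> lpar p (map A (filter (\<lambda>y. y \<in> T) u))"])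
         (use xT f r in \<open>simp add: V.scale_right_distrib lp sg_commute[of "p (A x)"] mult.commute\<close>)
  qed
  also have "\<dots> = (\<Sum>T\<in>Pow (set (x # u)). G T (x # u))"
  proof -
    have "Pow (set (x # u)) = insert x ` Pow (set u) \<union> Pow (set u)" by (auto simp: Pow_insert)
    moreover have "inj_on (insert x) (Pow (set u))" using x by (auto simp: inj_on_def)
    moreover have "insert x ` Pow (set u) \<inter> Pow (set u) = {}" using x by blast
    ultimately show ?thesis by (simp add: sum.union_disjoint sum.reindex sum.distrib)
  qed
  finally show ?case by (simp only: G_def)
qed simp

text \<open>Up to its constant term a section is a sum of multiples of coordinates;
  function-linearity keeps them multiples of coordinates, and these vanish at the origin.\<close>

lemma super_linear_eval:
  assumes L: "super_linear q L" and s: "s \<in> S"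
  shows "L s {#} = L (cst (s {#})) {#}"
proof -
  note d = super_linearD[OF L]
  have "L s = L (cst (s {#}) + (\<Sum>a\<in>I. xm a (dec a s)))"
    using decomposition[OF s] by simp
  also have "\<dots> = L (cst (s {#})) + L (\<Sum>a\<in>I. xm a (dec a s))"
    using s by (intro d) auto
  also have "L (\<Sum>a\<in>I. xm a (dec a s)) = (\<Sum>a\<in>I. L (xm a (dec a s)))"
    by (rule additive_sum, rule super_linearD(2)[OF L]) (use s d in simp_all)
  also have "\<dots> = (\<Sum>a\<in>I. scl (sg q (p a)) (xm a (L (dec a s))))"
    by (intro sum.cong refl d dec_S s)
  finally show ?thesis by (simp add: sum_fun_apply scl_def vm_apply)
qed

text \<open>Derivatives kill constants, so of each commutator only the term that differentiates the
  result survives.\<close>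

lemma adw_cst: "super_linear q L \<Longrightarrow> adw u q L (cst v) = pdw u (L (cst v))"
proof (induction u)
  case (Cons a u)
  then show ?case using super_linear_0[OF super_linear_adw[OF Cons.prems]] by (simp add: ad_def)
qed simp

definition taylor_coeff :: "(('i, 'f) form \<Rightarrow> ('i, 'f) form) \<Rightarrow> 'i list \<Rightarrow> 'f \<Rightarrow> 'f" where
  "taylor_coeff L u v = pdw u (L (cst v)) {#}"

text \<open>At the origin the inner section may be replaced by its constant term, and on constants
  iterated commutators are iterated derivatives. A composite of operators thus turns into composites
  of Taylor coefficients.\<close>

lemma leibniz_eval:
  fixes A :: "'n \<Rightarrow> 'i"
  assumes L: "super_linear q L" and t: "t \<in> S" and u: "distinct u"
  shows "pdw (map A u) (L t) {#} = (\<Sum>T\<in>Pow (set u). sF (subword_sign (p \<circ> A) q T u)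
    (taylor_coeff L (map A (filter (\<lambda>x. x \<in> T) u)) (pdw (map A (filter (\<lambda>x. x \<notin> T) u)) t {#})))"
  unfolding leibniz[OF L t u] sum_fun_apply scl_def taylor_coeff_def adw_cst[OF L, symmetric]
  by (intro sum.cong refl arg_cong[where f = "sF _"] super_linear_eval[OF super_linear_adw[OF L]] pdw_S t)

section \<open>The quadratic sums over 2-partitions\<close>

text \<open>The sum over the 2-partitions that separate \<open>i\<close> from \<open>j\<close>,
  where \<open>T\<close> is the first part without \<open>i\<close>. Each part is listed with its
  distinguished letter last, because the last letter of a Taylor coefficient names the component and
  the others are derivatives.\<close>

definition qsum :: "('i list \<Rightarrow> 'f \<Rightarrow> 'f) \<Rightarrow> ('n::linorder \<Rightarrow> 'i) \<Rightarrow> 'n list \<Rightarrow> 'n \<Rightarrow> 'n \<Rightarrow> 'f \<Rightarrow> 'f" where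
  "qsum C A u i j v = (\<Sum>T\<in>Pow (set u).
     sF (lsgn (p \<circ> A) (filter (\<lambda>x. x \<in> T) u @ i # filter (\<lambda>x. x \<notin> T) u @ [j]))
       (C (map A (filter (\<lambda>x. x \<in> T) u @ [i])) (C (map A (filter (\<lambda>x. x \<notin> T) u @ [j])) v)))"

text \<open>The Leibniz rule for a product of two components. The outer one has the parity of its
  own index, so \<open>lsgn_subword\<close> matches the signs with \<open>i\<close> in the place of
  the operator.\<close>

lemma qsum_taylor:
  fixes A :: "'n::linorder \<Rightarrow> 'i"
  assumes L: "\<And>a. a \<in> I \<Longrightarrow> super_linear (p a) (L a)"
    and C: "\<And>as a. set as \<subseteq> I \<Longrightarrow> a \<in> I \<Longrightarrow> C (as @ [a]) = taylor_coeff (L a) as"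
    and u: "distinct u" "A ` set u \<subseteq> I" "A i \<in> I" "A j \<in> I"
  shows "qsum C A u i j v = sF (lsgn (p \<circ> A) (u @ [i, j])) (pdw (map A u) (L (A i) (L (A j) (cst v))) {#})"
proof -
  have *: "C (map A (filter P u @ [k])) = taylor_coeff (L (A k)) (map A (filter P u))" if "A k \<in> I" for P k
    using C[of "map A (filter P u)" "A k"] u that by auto
  have "L (A j) (cst v) \<in> S" using super_linearD(1)[OF L] u by simp
  note leibniz_eval[OF L[OF u(3)] this u(1)]
  then show ?thesis
    unfolding qsum_def *[OF u(3)] *[OF u(4)] lsgn_subword
    by (simp add: scale_sum_right taylor_coeff_def mult.commute)
qed

text \<open>Exchanging \<open>i\<close> and \<open>j\<close> changes the sign of the word by the
  factor that supercommutation asks for. On distinct positions this sign is invertible, even if the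
  labels are equal and odd, so the two conditions are equivalent.\<close>

lemma commute_iff_qsum:
  fixes A :: "'n::linorder \<Rightarrow> 'i"
  assumes L: "\<And>a. a \<in> I \<Longrightarrow> super_linear (p a) (L a)"
    and C: "\<And>as a. set as \<subseteq> I \<Longrightarrow> a \<in> I \<Longrightarrow> C (as @ [a]) = taylor_coeff (L a) as"
    and u: "distinct (u @ [i, j])" "A ` set u \<subseteq> I" "A i \<in> I" "A j \<in> I"
  shows "qsum C A u i j v = qsum C A u j i v \<longleftrightarrow>
    pdw (map A u) (L (A i) (L (A j) (cst v))) {#}
     = pdw (map A u) (scl (sg (p (A i)) (p (A j))) (L (A j) (L (A i) (cst v)))) {#}"
proof -
  have d: "distinct u" using u(1) by simp
  have nz: "lsgn (p \<circ> A) (u @ [i, j]) \<noteq> (0::'k)"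
    using lsgn_sq[OF u(1), of "p \<circ> A"] by (metis mult_zero_left zero_neq_one)
  have "lsgn (p \<circ> A) (u @ [j, i]) = sg (p (A i)) (p (A j)) * (lsgn (p \<circ> A) (u @ [i, j]) :: 'k)"
    by (simp add: lsgn_swap[of "p \<circ> A" u j i "[]"] sg_commute)
  then have "qsum C A u j i v = sF (lsgn (p \<circ> A) (u @ [i, j]))
      (pdw (map A u) (scl (sg (p (A i)) (p (A j))) (L (A j) (L (A i) (cst v)))) {#})"
    by (simp only: qsum_taylor[OF L C d u(2,4,3)] pdw.scale) (simp add: scl_def mult.commute)
  moreover have "qsum C A u i j v = sF (lsgn (p \<circ> A) (u @ [i, j])) (pdw (map A u) (L (A i) (L (A j) (cst v))) {#})"
    by (rule qsum_taylor[OF L C d u(2,3,4)])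
  ultimately show ?thesis using nz by simp
qed

end

section \<open>Components of connections\<close>

lemma mon_sign_empty [simp]: "mon_sign p {#} N = 1" "mon_sign p M {#} = 1"
  by (simp_all add: mon_sign_def)

text \<open>In the normal form every dx stands after every x, so dx^a forms an inversion with each
  odd variable of \<open>N\<close> if it is odd itself.\<close>

lemma bisgn_D:
  "(\<And>v. v \<in># N \<Longrightarrow> \<not> is_D v) \<Longrightarrow> bisgn p {#D a#} N = (sg (\<not> p a) (mon_parity p N) :: 'k::field)"
proof (induction N)
  case (add v N)
  have "\<not> is_D v" using add.prems by simp
  then obtain b where v: "v = X b" by (cases v) simp_all
  have "bisgn p {#D a#} N = (sg (\<not> p a) (mon_parity p N) :: 'k)" using add by simp
  moreover have "bisgn p {#D a#} (add_mset v N) = (dsgn p (D a) v * bisgn p {#D a#} N :: 'k)"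
    by (simp add: bisgn_def)
  ultimately show ?case by (auto simp: v dsgn_def sg_def)
qed simp

lemma good_add:
  assumes "good p M" "good p N" "mon_sign p M N \<noteq> (0::'k::field)"
  shows "good p (M + N)"
  unfolding good_def
proof (intro allI impI)
  fix v assume v: "dvar_parity p v"
  then have "v \<notin># M \<or> v \<notin># N" using assms(3) by (auto simp: mon_sign_def split: if_splits)
  then show "count (M + N) v \<le> 1" using assms(1,2) v by (auto simp: good_def not_in_iff)
qed

lemma monomials_iff: "M \<in> monomials I p r \<longleftrightarrow>
    dvar_index ` set_mset M \<subseteq> I \<and> good p M \<and> size (filter_mset is_D M) = r"
  by (simp add: monomials_def good_def)

lemma monomials_add:
  assumes "M \<in> monomials I p r" "N \<in> monomials I p r'" "mon_sign p M N \<noteq> (0::'k::field)"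
  shows "M + N \<in> monomials I p (r + r')"
  using assms good_add[of p M N] by (auto simp: monomials_iff)

lemma monomials_0: "M \<in> monomials I p 0 \<Longrightarrow> v \<in># M \<Longrightarrow> \<not> is_D v"
  by (auto simp: monomials_iff filter_mset_eq_conv)

lemma bisgn_D_monomial: "N \<in> monomials I p 0 \<Longrightarrow> bisgn p {#D a#} N = sg (\<not> p a) (mon_parity p N)"
  by (rule bisgn_D) (rule monomials_0)

lemma monomials_D:
  "add_mset (D a) N \<in> monomials I p (Suc r) \<Longrightarrow> a \<in> I \<and> N \<in> monomials I p r"
  using good_mono[of p "add_mset (D a) N" N] by (auto simp: monomials_iff)

lemma monomials_Suc_cases:
  assumes "M \<in> monomials I p (Suc r)"
  obtains a N where "M = add_mset (D a) N" "a \<in> I" "N \<in> monomials I p r"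
proof -
  have "size (filter_mset is_D M) = Suc r" using assms by (simp add: monomials_iff)
  then have "filter_mset is_D M \<noteq> {#}" by (metis nat.distinct(1) size_empty)
  then obtain v where "v \<in># filter_mset is_D M" by (rule multiset_nonemptyE)
  then have "v \<in># M" "is_D v" by simp_all
  moreover from this obtain a where "v = D a" by (cases v) auto
  ultimately obtain N where M: "M = add_mset (D a) N" by (meson mset_add)
  show thesis using that[OF M] monomials_D[of a N I p r] assms by (simp add: M)
qed

context sections
begin

abbreviation S1 :: "('i, 'f) form set" where "S1 \<equiv> forms I p (Suc 0) UNIV"

lemma S1_iff: "\<omega> \<in> S1 \<longleftrightarrow> (\<forall>M. \<omega> M \<noteq> 0 \<longrightarrow> M \<in> monomials I p (Suc 0))"
  by (simp add: forms_def)

lemma S1_supp_good: "s \<in> S1 \<Longrightarrow> supp_good p s"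
  by (rule forms_supp_good)

lemma subspace_S1: "V.subspace S1"
proof (rule V.subspaceI)
  show "0 \<in> S1" by (simp add: S1_iff)
  show "s + t \<in> S1" if "s \<in> S1" "t \<in> S1" for s t
    unfolding S1_iff
  proof (intro allI impI)
    fix M assume "(s + t) M \<noteq> 0"
    then have "s M \<noteq> 0 \<or> t M \<noteq> 0" by auto
    then show "M \<in> monomials I p (Suc 0)" using that by (auto simp: S1_iff)
  qed
  show "scl c s \<in> S1" if "s \<in> S1" for c s
    using that by (auto simp: S1_iff scl_def)
qed

lemma linear_D_coeff: "Vector_Spaces.linear scl scl (D_coeff p sF a)"
  by unfold_locales (auto simp: D_coeff_def scl_def fun_eq_iff scale_right_distrib mult.commute)

sublocale dc: Vector_Spaces.linear scl scl "D_coeff p sF a" for a by (rule linear_D_coeff)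

lemma D_coeff_apply:
  assumes "\<omega> \<in> S1" "N \<in> monomials I p 0"
  shows "D_coeff p sF a \<omega> N = sF (bisgn p {#D a#} N) (\<omega> (add_mset (D a) N))"
proof -
  have "good p {#D a#}" by (simp add: good_def)
  then have "mon_sign p {#D a#} N = (bisgn p {#D a#} N :: 'k)"
    using assms(2) by (intro mon_sign_eq) (auto simp: monomials_iff)
  then show ?thesis using monomials_0[OF assms(2)] by (auto simp: D_coeff_def)
qed

lemma D_coeff_S [simp]: assumes "\<omega> \<in> S1" shows "D_coeff p sF a \<omega> \<in> S"
  unfolding S_iff
proof (intro allI impI)
  fix N assume "D_coeff p sF a \<omega> N \<noteq> 0"
  then have "\<omega> (add_mset (D a) N) \<noteq> 0" by (auto simp: D_coeff_def split: if_splits)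
  then show "N \<in> monomials I p 0" using assms by (auto simp: S1_iff dest: monomials_D)
qed

lemma S1_apply:
  assumes "\<omega> \<in> S1" "N \<in> monomials I p 0"
  shows "\<omega> (add_mset (D a) N) = sF (bisgn p {#D a#} N) (D_coeff p sF a \<omega> N)"
  by (simp add: D_coeff_apply[OF assms] bisgn_D_monomial[OF assms(2)])

lemma S1_eqI:
  assumes "\<omega> \<in> S1" "\<omega>' \<in> S1" "\<And>a. a \<in> I \<Longrightarrow> D_coeff p sF a \<omega> = D_coeff p sF a \<omega>'"
  shows "\<omega> = \<omega>'"
proof (rule ext)
  fix M show "\<omega> M = \<omega>' M"
  proof (cases "M \<in> monomials I p (Suc 0)")
    case True
    then show ?thesis
      by (rule monomials_Suc_cases) (simp add: S1_apply[OF assms(1)] S1_apply[OF assms(2)] assms(3))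
  next
    case False
    then have "\<omega> M = 0" "\<omega>' M = 0" using assms(1,2) by (auto simp: S1_iff)
    then show ?thesis by simp
  qed
qed

lemma vm_supp_good: assumes "supp_good p s" shows "supp_good p (vm v s)"
  unfolding supp_good_def
proof (intro allI impI)
  fix M assume *: "vm v s M \<noteq> 0"
  then obtain N where M: "M = add_mset v N" by (auto simp: vm_apply dest!: multi_member_split split: if_splits)
  then have "s N \<noteq> 0" "mon_sign p {#v#} N \<noteq> (0::'k)" using * by (auto simp: vm_apply)
  moreover have "good p {#v#}" by (simp add: good_def)
  ultimately show "good p M" using good_add[of p "{#v#}" N] assms by (auto simp: supp_good_def M)
qed

lemma vm_X_S1: assumes "\<omega> \<in> S1" "b \<in> I" shows "xm b \<omega> \<in> S1"
  unfolding S1_iff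
proof (intro allI impI)
  fix M assume *: "xm b \<omega> M \<noteq> 0"
  then obtain N where M: "M = add_mset (X b) N" by (auto simp: vm_apply dest!: multi_member_split split: if_splits)
  then have "\<omega> N \<noteq> 0" using * by (auto simp: vm_apply)
  then have "N \<in> monomials I p (Suc 0)" using assms by (auto simp: S1_iff)
  moreover have "good p M" using vm_supp_good[OF S1_supp_good[OF assms(1)]] * by (auto simp: supp_good_def)
  ultimately show "M \<in> monomials I p (Suc 0)" using assms by (auto simp: monomials_iff M)
qed

lemma vm_D_S1: assumes "s \<in> S" "a \<in> I" shows "vm (D a) s \<in> S1"
  unfolding S1_iff
proof (intro allI impI)
  fix M assume *: "vm (D a) s M \<noteq> 0"
  then obtain N where M: "M = add_mset (D a) N" by (auto simp: vm_apply dest!: multi_member_split split: if_splits)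
  then have "s N \<noteq> 0" using * by (auto simp: vm_apply)
  then have "N \<in> monomials I p 0" using assms by (auto simp: S_iff)
  moreover have "good p M" using vm_supp_good[OF S_supp_good[OF assms(1)]] * by (auto simp: supp_good_def)
  ultimately show "M \<in> monomials I p (Suc 0)" using assms by (auto simp: monomials_iff M)
qed

lemma D_coeff_xm:
  assumes "\<omega> \<in> S1" "b \<in> I"
  shows "D_coeff p sF a (xm b \<omega>) = scl (sg (p b) (\<not> p a)) (xm b (D_coeff p sF a \<omega>))"
proof (rule ext)
  fix N
  show "D_coeff p sF a (xm b \<omega>) N = scl (sg (p b) (\<not> p a)) (xm b (D_coeff p sF a \<omega>)) N"
  proof (cases "N \<in> monomials I p 0")
    case True
    show ?thesis
    proof (cases "X b \<in># N")
      case b: True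
      then obtain P where N: "N = add_mset (X b) P" by (meson mset_add)
      have P: "P \<in> monomials I p 0" using True by (simp add: N mono_add_mset)
      have d: "dsgn p (D a) (X b) * dsgn p (X b) (D a) = (sg (p b) (\<not> p a) :: 'k)"
        by (auto simp: dsgn_def sg_def)
      have "D_coeff p sF a (xm b \<omega>) N = sF (bisgn p {#D a#} N * bisgn p {#X b#} (add_mset (D a) P)) (\<omega> (add_mset (D a) P))"
        unfolding D_coeff_apply[OF vm_X_S1[OF assms] True]
        by (simp add: vm_apply_bisgn[OF S1_supp_good[OF assms(1)]] N)
      also have "bisgn p {#D a#} N * bisgn p {#X b#} (add_mset (D a) P)
        = (dsgn p (D a) (X b) * dsgn p (X b) (D a)) * (bisgn p {#X b#} P * bisgn p {#D a#} P :: 'k)"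
        by (simp add: N bisgn_add_mset(2)[of p _ _ P])
      also have "sF ((dsgn p (D a) (X b) * dsgn p (X b) (D a)) * (bisgn p {#X b#} P * bisgn p {#D a#} P)) (\<omega> (add_mset (D a) P))
         = scl (sg (p b) (\<not> p a)) (xm b (D_coeff p sF a \<omega>)) N"
        unfolding d by (simp add: scl_def N vm_apply_bisgn[OF S_supp_good[OF D_coeff_S[OF assms(1)]]] D_coeff_apply[OF assms(1) P])
      finally show ?thesis .
    next
      case False
      then show ?thesis
        by (simp add: D_coeff_apply[OF vm_X_S1[OF assms] True] scl_def vm_apply)
    qed
  next
    case False
    then have "D_coeff p sF a (xm b \<omega>) N = 0" "xm b (D_coeff p sF a \<omega>) N = 0"
      using D_coeff_S[OF vm_X_S1[OF assms], of a] xm_S[OF D_coeff_S[OF assms(1)] assms(2), of a] by (auto simp: S_iff)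
    then show ?thesis by (simp add: scl_def)
  qed
qed

definition component :: "(('i, 'f) form \<Rightarrow> ('i, 'f) form) \<Rightarrow> 'i \<Rightarrow> ('i, 'f) form \<Rightarrow> ('i, 'f) form" where
  "component A a s = D_coeff p sF a (A s)"

lemma form_mult_const: "form_mult p sF (\<lambda>M. if M = {#} then c else 0) s = scl c s"
proof (rule ext)
  fix M
  have "form_mult p sF (\<lambda>M. if M = {#} then c else 0) s M = (\<Sum>N | N \<subseteq># M. if N = {#} then sF c (s M) else 0)"
    unfolding form_mult_def by (intro sum.cong) auto
  also have "\<dots> = sF c (s M)" by (simp add: sum.delta[OF finite_submultisets])
  finally show "form_mult p sF (\<lambda>M. if M = {#} then c else 0) s M = scl c s M" by (simp add: scl_def)
qed

text \<open>Function-linearity is applied to two families of homogeneous functions: the constants,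
  which are even, and the coordinates.\<close>

lemma odd_function_linearD:
  assumes "odd_function_linear I p sF F A" "s \<in> S"
  shows "A s \<in> S1" "t \<in> S \<Longrightarrow> A (s + t) = A s + A t" "A (scl c s) = scl c (A s)"
    "b \<in> I \<Longrightarrow> A (xm b s) = scl (sg True (p b)) (xm b (A s))"
    "s \<in> forms_part I p 0 F q \<Longrightarrow> A s \<in> forms_part I p 1 F (\<not> q)"
proof -
  show "A s \<in> S1" using assms by (auto simp: odd_function_linear_def)
  show "A (s + t) = A s + A t" if "t \<in> S" using assms that by (auto simp: odd_function_linear_def)
  show "A s \<in> forms_part I p 1 F (\<not> q)" if "s \<in> forms_part I p 0 F q"
    using assms that by (auto simp: odd_function_linear_def)
  have lin_ext: "A (form_mult p sF f s) M = sF (if q then -1 else 1) (form_mult p sF f (A s) M)"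
    if "f \<in> forms_part I p 0 scalar_part q" for f q M
    using assms that unfolding odd_function_linear_def by blast
  show "A (scl c s) = scl c (A s)"
  proof (rule ext)
    fix M
    have "(\<lambda>M. if M = {#} then c else 0) \<in> forms_part I p 0 scalar_part False"
      by (auto simp: forms_part_def forms_def scalar_part_def)
    from lin_ext[OF this, of M] show "A (scl c s) M = scl c (A s) M" by (simp add: form_mult_const)
  qed
  show "A (xm b s) = scl (sg True (p b)) (xm b (A s))" if "b \<in> I"
  proof (rule ext)
    fix M
    have "{#X b#} \<in> monomials I p 0" using that mono_add_mset[of b "{#}" 0] by simp
    then have "mon_form {#X b#} \<in> forms_part I p 0 scalar_part (p b)"
      by (auto simp: forms_part_def forms_def scalar_part_def mon_form_def)
    from lin_ext[OF this, of M] show "A (xm b s) M = scl (sg True (p b)) (xm b (A s)) M"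
      by (simp add: vm_def scl_def sg_def)
  qed
qed

text \<open>\<open>A\<close> is odd, and removing dx^a contributes the parity opposite to that of
  x^a; together this is the parity of x^a.\<close>

lemma super_linear_cp:
  assumes "odd_function_linear I p sF F A"
  shows "super_linear (p a) (component A a)"
proof -
  note d = odd_function_linearD[OF assms]
  have *: "sg True (p b) * sg (p b) (\<not> p a) = (sg (p a) (p b) :: 'k)" for b by (auto simp: sg_def)
  show ?thesis
    unfolding super_linear_def component_def
    by (auto simp: d dc.add dc.scale D_coeff_xm * mult.commute[of _ "sg True _"])
qed

lemma super_linear_comp:
  assumes "super_linear q L" "super_linear r L'"
  shows "super_linear (q \<noteq> r) (\<lambda>s. L (L' s))"
  using assms unfolding super_linear_def by (auto simp: sg_xor mult.commute)

lemma super_linear_scl: "super_linear q L \<Longrightarrow> super_linear q (\<lambda>s. scl c (L s))"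
  unfolding super_linear_def by (auto simp: V.scale_right_distrib vm.scale mult.commute)

lemma super_linear_eqI:
  assumes "super_linear q L" "super_linear q L'" "\<And>v. L (cst v) = L' (cst v)" "s \<in> S"
  shows "L s = L' s"
proof -
  have "(\<lambda>s. L s - L' s) s = 0"
    by (rule zero_operator[where L = "\<lambda>s. L s - L' s" and \<epsilon> = "\<lambda>b. sg q (p b)"])
       (use assms in \<open>simp_all add: super_linearD[OF assms(1)] super_linearD[OF assms(2)] V.scale_right_diff_distrib vm.diff\<close>)
  then show ?thesis by simp
qed

section \<open>Flatness\<close>

lemma extend_connection_eq:
  "extend_connection I p sF G \<omega> M = (\<Sum>a\<in>I. sF (sg True (\<not> p a)) (vm (D a) (G (D_coeff p sF a \<omega>)) M))"
  by (simp add: extend_connection_def vm_def sg_def)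

text \<open>Only the terms that take off dx^a or dx^c reach the monomial dx^a dx^c N, and their
  signs differ by exactly the factor that makes their cancellation a supercommutation.\<close>

lemma extend_zero_iff:
  assumes G: "\<And>s. s \<in> S \<Longrightarrow> G s \<in> S1" and s: "s \<in> S" and a: "a \<in> I" and c: "c \<in> I"
    and N: "N \<in> monomials I p 0"
  shows "extend_connection I p sF G (G s) (add_mset (D a) (add_mset (D c) N)) = 0
    \<longleftrightarrow> component G c (component G a s) N = sF (sg (p a) (p c)) (component G a (component G c s) N)"
proof -
  let ?M = "add_mset (D a) (add_mset (D c) N)"
  have S: "component G x s \<in> S" for x using G[OF s] by (simp add: component_def)
  have T: "vm (D x) (G (component G x s)) (add_mset (D x) (add_mset (D y) N))
      = sF (bisgn p {#D x#} N * dsgn p (D x) (D y) * bisgn p {#D y#} N) (component G y (component G x s) N)" for x y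
    using S1_apply[OF G[OF S[of x]] N, of y]
    by (simp add: vm_apply_bisgn[OF S1_supp_good[OF G[OF S]]] bisgn_add_mset(2)[of p _ _ N] component_def[of G y] ac_simps)
  have 0: "vm (D x) (G (component G x s)) ?M = 0" if "x \<noteq> a" "x \<noteq> c" for x
    using monomials_0[OF N, of "D x"] that by (auto simp: vm_apply)
  have E: "extend_connection I p sF G (G s) ?M = (\<Sum>x\<in>{a, c}. sF (sg True (\<not> p x)) (vm (D x) (G (component G x s)) ?M))"
    unfolding extend_connection_eq component_def[symmetric]
    by (rule sum.mono_neutral_right) (use finite_I a c 0 in auto)
  have b: "bisgn p {#D x#} N = sg (\<not> p x) (mon_parity p N)" for x by (rule bisgn_D_monomial[OF N])
  show ?thesis
  proof (cases "a = c")
    case True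
    \<comment> \<open>For \<open>a = c\<close> there is one term. If dx^a is odd, its square is 0
      and the right side is a tautology; if dx^a is even, then x^a is odd and the right side says
      that a vector equals its negative.\<close>
    have "sF 2 x = 0 \<longleftrightarrow> x = 0" for x by simp
    then have "x = - x \<longleftrightarrow> x = 0" for x :: 'f by (metis add.inverse_neutral add_eq_0_iff scale_2)
    then show ?thesis using E T[of a a] True by (cases "p a") (auto simp: dsgn_def b sg_def)
  next
    case False
    have "vm (D c) (G (component G c s)) ?M = vm (D c) (G (component G c s)) (add_mset (D c) (add_mset (D a) N))"
      by (simp add: add_mset_commute)
    then have E': "extend_connection I p sF G (G s) ?M =
       sF (sg True (\<not> p a) * (bisgn p {#D a#} N * dsgn p (D a) (D c) * bisgn p {#D c#} N)) (component G c (component G a s) N) +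
       sF (sg True (\<not> p c) * (bisgn p {#D c#} N * dsgn p (D c) (D a) * bisgn p {#D a#} N)) (component G a (component G c s) N)"
      using E False by (simp add: T)
    \<comment> \<open>\<open>k\<close> is the sign of the first term; the second carries the
      negative of \<open>k\<close> times the commutation sign.\<close>
    define k :: 'k where "k = sg True (\<not> p a) * (bisgn p {#D a#} N * dsgn p (D a) (D c) * bisgn p {#D c#} N)"
    have "sg True (\<not> p c) * (bisgn p {#D c#} N * dsgn p (D c) (D a) * bisgn p {#D a#} N) = - (k * sg (p a) (p c))"
      using False by (auto simp: k_def dsgn_def b sg_def)
    then have "extend_connection I p sF G (G s) ?M = sF k (component G c (component G a s) N - sF (sg (p a) (p c)) (component G a (component G c s) N))"
      unfolding E' k_def[symmetric] by (simp add: scale_right_diff_distrib)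
    moreover have "k \<noteq> 0" using False by (auto simp: k_def dsgn_def b sg_def)
    ultimately show ?thesis by simp
  qed
qed

lemma flat_iff:
  assumes G: "\<And>s. s \<in> S \<Longrightarrow> G s \<in> S1"
  shows "flat I p sF G \<longleftrightarrow> (\<forall>s\<in>S. \<forall>a\<in>I. \<forall>c\<in>I. component G c (component G a s) = scl (sg (p a) (p c)) (component G a (component G c s)))"
proof
  assume f: "flat I p sF G"
  show "\<forall>s\<in>S. \<forall>a\<in>I. \<forall>c\<in>I. component G c (component G a s) = scl (sg (p a) (p c)) (component G a (component G c s))"
  proof (intro ballI ext)
    fix s a c N assume *: "s \<in> S" "a \<in> I" "c \<in> I"
    have S: "component G x (component G y s) \<in> S" for x y using G[OF *(1)] G by (simp add: component_def)
    show "component G c (component G a s) N = scl (sg (p a) (p c)) (component G a (component G c s)) N"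
    proof (cases "N \<in> monomials I p 0")
      case True
      have "extend_connection I p sF G (G s) (add_mset (D a) (add_mset (D c) N)) = 0"
        using f *(1) by (simp add: flat_def)
      then show ?thesis by (simp only: extend_zero_iff[where G = G, OF G * True] scl_def)
    next
      case False
      then have "component G c (component G a s) N = 0" "component G a (component G c s) N = 0" using S by (auto simp: S_iff)
      then show ?thesis by (simp add: scl_def)
    qed
  qed
next
  assume *: "\<forall>s\<in>S. \<forall>a\<in>I. \<forall>c\<in>I. component G c (component G a s) = scl (sg (p a) (p c)) (component G a (component G c s))"
  show "flat I p sF G"
    unfolding flat_def
  proof (intro ballI allI)
    fix s M assume s: "s \<in> S"
    show "extend_connection I p sF G (G s) M = 0"
    proof (rule ccontr)
      assume nz: "extend_connection I p sF G (G s) M \<noteq> 0"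
      \<comment> \<open>A nonzero coefficient would sit at a monomial dx^a dx^c N, where the
        relation for \<open>a\<close> and \<open>c\<close> applies.\<close>
      then obtain a where a: "a \<in> I" "vm (D a) (G (component G a s)) M \<noteq> 0"
        unfolding extend_connection_eq component_def by (metis (no_types, lifting) scale_zero_right sum.neutral)
      then obtain M' where M: "M = add_mset (D a) M'"
        by (auto simp: vm_apply dest!: multi_member_split split: if_splits)
      then have "G (component G a s) M' \<noteq> 0" using a by (auto simp: vm_apply)
      moreover have "G (component G a s) \<in> S1" using G s by (simp add: component_def)
      ultimately have "M' \<in> monomials I p (Suc 0)" by (auto simp: S1_iff)
      then obtain c N where "M' = add_mset (D c) N" "c \<in> I" "N \<in> monomials I p 0" by (rule monomials_Suc_cases)
      then show False
        using nz extend_zero_iff[where G = G, OF G s a(1), of c N] *[rule_format, of s a c] s a(1)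
        by (simp add: M) (simp add: scl_def)
    qed
  qed
qed

lemma form_d_eq: "form_d I p sF s = (\<Sum>a\<in>I. vm (D a) (pd a s))"
  by (simp add: form_d_def vm_def fun_eq_iff sum_fun_apply)

lemma form_d_S1: "s \<in> S \<Longrightarrow> form_d I p sF s \<in> S1"
  unfolding form_d_eq by (intro V.subspace_sum[OF subspace_S1] vm_D_S1 pd_S)

lemma D_coeff_vm_D:
  assumes "s \<in> S" "c \<in> I"
  shows "D_coeff p sF a (vm (D c) s) = (if a = c then s else 0)"
proof (rule ext)
  fix N show "D_coeff p sF a (vm (D c) s) N = (if a = c then s else 0) N"
  proof (cases "N \<in> monomials I p 0")
    case True
    have "D c \<notin># N" using monomials_0[OF True, of "D c"] by auto
    then show ?thesis
      by (simp add: bisgn_D_monomial[OF True] D_coeff_apply[OF vm_D_S1[OF assms] True] vm_apply_bisgn[OF S_supp_good[OF assms(1)]])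
  next
    case False
    then have "D_coeff p sF a (vm (D c) s) N = 0" "s N = 0"
      using D_coeff_S[OF vm_D_S1[OF assms]] assms(1) unfolding S_iff by blast+
    then show ?thesis by simp
  qed
qed

lemma D_coeff_form_d:
  assumes "s \<in> S" "a \<in> I"
  shows "D_coeff p sF a (form_d I p sF s) = pd a s"
proof -
  have "D_coeff p sF a (form_d I p sF s) = (\<Sum>c\<in>I. if c = a then pd a s else 0)"
    unfolding form_d_eq dc.sum using assms by (intro sum.cong) (auto simp: D_coeff_vm_D)
  then show ?thesis using finite_I assms by (simp add: sum.delta)
qed

lemma S1_decomposition:
  assumes "\<omega> \<in> S1"
  shows "\<omega> = (\<Sum>a\<in>I. vm (D a) (D_coeff p sF a \<omega>))"
proof (rule S1_eqI[OF assms])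
  show "(\<Sum>a\<in>I. vm (D a) (D_coeff p sF a \<omega>)) \<in> S1"
    using assms by (intro V.subspace_sum[OF subspace_S1] vm_D_S1) auto
  fix a assume a: "a \<in> I"
  have "D_coeff p sF a (\<Sum>c\<in>I. vm (D c) (D_coeff p sF c \<omega>)) = (\<Sum>c\<in>I. if c = a then D_coeff p sF a \<omega> else 0)"
    unfolding dc.sum using assms by (intro sum.cong) (auto simp: D_coeff_vm_D)
  then show "D_coeff p sF a \<omega> = D_coeff p sF a (\<Sum>a\<in>I. vm (D a) (D_coeff p sF a \<omega>))"
    using finite_I a by (simp add: sum.delta)
qed

lemma pencil_eq: "s \<in> S \<Longrightarrow> pencil I p sF A l s = form_d I p sF s + scl l (A s)"
  by (simp add: pencil_def fun_eq_iff scl_def)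

text \<open>In components, flatness is an identity of polynomials of degree 2 in \<lambda>. The
  constant term holds because derivatives supercommute, and the other two coefficients give the
  conditions. Testing on constants removes the terms in which the section itself is
  differentiated.\<close>

lemma flat_pencil_iff:
  assumes A: "odd_function_linear I p sF F A"
  shows "(\<forall>l. flat I p sF (pencil I p sF A l)) \<longleftrightarrow>
    (\<forall>a\<in>I. \<forall>c\<in>I. \<forall>v. pd c (component A a (cst v)) = scl (sg (p a) (p c)) (pd a (component A c (cst v)))
      \<and> component A c (component A a (cst v)) = scl (sg (p a) (p c)) (component A a (component A c (cst v))))" (is "?L \<longleftrightarrow> ?R")
proof -
  note o = super_linear_cp[OF A]
  have G: "pencil I p sF A l s \<in> S1" if "s \<in> S" for s l
    using that unfolding pencil_eq[OF that]
    by (intro V.subspace_add[OF subspace_S1] V.subspace_scale[OF subspace_S1] form_d_S1 odd_function_linearD[OF A])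
  have na: "component (pencil I p sF A l) a s = pd a s + scl l (component A a s)" if "s \<in> S" "a \<in> I" for l a s
    using that by (simp add: component_def pencil_eq dc.add dc.scale D_coeff_form_d)
  have na2: "component (pencil I p sF A l) c (component (pencil I p sF A l) a s)
      = pd c (pd a s) + scl l (pd c (component A a s) + component A c (pd a s)) + scl (l * l) (component A c (component A a s))"
    if "s \<in> S" "a \<in> I" "c \<in> I" for l a c s
    using that super_linearD[OF o, OF that(1)]
    by (simp add: na pd.add pd.scale super_linearD[OF o] V.scale_right_distrib)
  have iff: "?L \<longleftrightarrow> (\<forall>l. \<forall>s\<in>S. \<forall>a\<in>I. \<forall>c\<in>I.
     pd c (pd a s) + scl l (pd c (component A a s) + component A c (pd a s)) + scl (l * l) (component A c (component A a s))
     = scl (sg (p a) (p c)) (pd a (pd c s) + scl l (pd a (component A c s) + component A a (pd c s)) + scl (l * l) (component A a (component A c s))))"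
    by (simp add: flat_iff[OF G] na2)
  show ?thesis
  proof
    assume L: ?L
    show ?R
    proof (intro ballI allI)
      fix a c v assume ac: "a \<in> I" "c \<in> I"
      let ?s = "sg (p a) (p c) :: 'k"
      define P where "P = pd c (component A a (cst v)) - scl ?s (pd a (component A c (cst v)))"
      define Q where "Q = component A c (component A a (cst v)) - scl ?s (component A a (component A c (cst v)))"
      have "scl l P + scl (l * l) Q = 0" for l
      proof -
        have "scl l (pd c (component A a (cst v))) + scl (l * l) (component A c (component A a (cst v)))
          = scl ?s (scl l (pd a (component A c (cst v))) + scl (l * l) (component A a (component A c (cst v))))"
          using L[unfolded iff, rule_format, of "cst v" a c l] ac super_linear_0[OF o] by simp
        then show ?thesis
          by (simp add: P_def Q_def V.scale_right_diff_distrib V.scale_right_distrib mult.commute algebra_simps)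
      qed
      \<comment> \<open>The values 1 and -1 of \<lambda> separate the two coefficients, since 2 is
        invertible.\<close>
      from this[of 1] this[of "-1"] have PQ: "P + Q = 0" "Q - P = 0" by (simp_all)
      then have "P = Q" by simp
      then have "scl 2 P = 0" using PQ(1) V.scale_left_distrib[of 1 1 P] by simp
      then have "P = 0" by simp
      with \<open>P = Q\<close> show "pd c (component A a (cst v)) = scl ?s (pd a (component A c (cst v)))
        \<and> component A c (component A a (cst v)) = scl ?s (component A a (component A c (cst v)))"
        by (simp add: P_def Q_def)
    qed
  next
    assume R: ?R
    show ?L
      unfolding iff
    proof (intro ballI allI)
      fix l s a c assume s: "s \<in> S" and ac: "a \<in> I" "c \<in> I"
      let ?s = "sg (p a) (p c) :: 'k"
      \<comment> \<open>The two sides of the linear condition are not function-linear, but after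
        regrouping they become commutators, which are; so both conditions extend from constants to
        all sections.\<close>
      have oa: "super_linear (p a \<noteq> p c) (ad c (p a) (component A a))" by (rule super_linear_ad[OF o])
      have "super_linear (p c \<noteq> p a) (ad a (p c) (component A c))" by (rule super_linear_ad[OF o])
      then have oc: "super_linear (p a \<noteq> p c) (\<lambda>s. scl ?s (ad a (p c) (component A c) s))"
        by (intro super_linear_scl) (simp add: eq_commute[of "p c"])
      have Rc: "pd c (component A a (cst v)) = scl ?s (pd a (component A c (cst v)))"
        "component A c (component A a (cst v)) = scl ?s (component A a (component A c (cst v)))" for v
        using R ac by blast+
      have "ad c (p a) (component A a) (cst v) = scl ?s (ad a (p c) (component A c) (cst v))" for v
        by (simp add: ad_def super_linear_0[OF o] Rc(1)[of v])
      note P = super_linear_eqI[OF oa oc this s]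
      have qa: "super_linear (p a \<noteq> p c) (\<lambda>s. scl ?s (component A a (component A c s)))" by (intro super_linear_scl super_linear_comp o)
      have "super_linear (p c \<noteq> p a) (\<lambda>s. component A c (component A a s))" by (intro super_linear_comp o)
      then have qc: "super_linear (p a \<noteq> p c) (\<lambda>s. component A c (component A a s))" by (simp add: eq_commute[of "p c"])
      have Q: "component A c (component A a s) = scl ?s (component A a (component A c s))"
        by (rule super_linear_eqI[OF qc qa Rc(2) s])
      have P': "pd c (component A a s) + component A c (pd a s) = scl ?s (pd a (component A c s) + component A a (pd c s))"
      proof -
        have *: "x - y = z - w \<Longrightarrow> x + w = z + y" for x y z w :: "('i, 'f) form"
          by (metis add.commute add_diff_eq diff_add_cancel)
        have "pd c (component A a s) - scl ?s (component A a (pd c s)) = scl ?s (pd a (component A c s)) - component A c (pd a s)"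
          using P unfolding ad_def V.scale_right_diff_distrib
          by (simp only: sg_commute[of "p c" "p a"] V.scale_scale sg_simps V.scale_one)
        from *[OF this] show ?thesis by (simp only: V.scale_right_distrib)
      qed
      show "pd c (pd a s) + scl l (pd c (component A a s) + component A c (pd a s)) + scl (l * l) (component A c (component A a s))
        = scl ?s (pd a (pd c s) + scl l (pd a (component A c s) + component A a (pd c s)) + scl (l * l) (component A a (component A c s)))"
        unfolding P' Q pd_commute[OF s, of c a]
        by (simp add: V.scale_right_distrib sg_commute[of "p c" "p a"] mult.commute mult.left_commute)
    qed
  qed
qed

text \<open>\<open>A\<close> without \<open>d\<close> is treated as if it were a connection: its
  square then involves no derivatives and is the wedge square of the 1-form.\<close>

lemma flat_of_commuting:
  assumes A: "odd_function_linear I p sF F A"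
    and R: "\<And>a c v. a \<in> I \<Longrightarrow> c \<in> I \<Longrightarrow> component A c (component A a (cst v)) = scl (sg (p a) (p c)) (component A a (component A c (cst v)))"
  shows "flat I p sF A"
proof (subst flat_iff)
  show "A s \<in> S1" if "s \<in> S" for s by (rule odd_function_linearD(1)[OF A that])
  note o = super_linear_cp[OF A]
  show "\<forall>s\<in>S. \<forall>a\<in>I. \<forall>c\<in>I. component A c (component A a s) = scl (sg (p a) (p c)) (component A a (component A c s))"
  proof (intro ballI)
    fix s a c assume s: "s \<in> S" and ac: "a \<in> I" "c \<in> I"
    let ?s = "sg (p a) (p c) :: 'k"
    have qa: "super_linear (p a \<noteq> p c) (\<lambda>s. scl ?s (component A a (component A c s)))" by (intro super_linear_scl super_linear_comp o)
    have "super_linear (p c \<noteq> p a) (\<lambda>s. component A c (component A a s))" by (intro super_linear_comp o)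
    then have qc: "super_linear (p a \<noteq> p c) (\<lambda>s. component A c (component A a s))" by (simp add: eq_commute[of "p c"])
    show "component A c (component A a s) = scl ?s (component A a (component A c s))"
      by (rule super_linear_eqI[OF qc qa R[OF ac] s])
  qed
qed

end

section \<open>Endomorphism-valued forms acting on sections\<close>

lemma endoD:
  assumes "vector_space sF" "\<phi> \<in> endo sF"
  shows "\<phi> (x + y) = \<phi> x + \<phi> y" "\<phi> (sF c x) = sF c (\<phi> x)" "\<phi> 0 = 0" "\<phi> (x - y) = \<phi> x - \<phi> y"
    "\<phi> (sum f A) = (\<Sum>a\<in>A. \<phi> (f a))"
proof -
  interpret l: Vector_Spaces.linear sF sF \<phi> using assms(2) by (simp add: endo_def)
  show "\<phi> (x + y) = \<phi> x + \<phi> y" "\<phi> (sF c x) = sF c (\<phi> x)" "\<phi> 0 = 0" "\<phi> (x - y) = \<phi> x - \<phi> y"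
    "\<phi> (sum f A) = (\<Sum>a\<in>A. \<phi> (f a))"
    by (rule l.add l.scale l.zero l.diff l.sum)+
qed

context superspace
begin

lemma endo_iff: "\<phi> \<in> endo scale \<longleftrightarrow> (\<forall>x y. \<phi> (x + y) = \<phi> x + \<phi> y) \<and> (\<forall>c x. \<phi> (scale c x) = scale c (\<phi> x))"
proof
  assume "\<phi> \<in> endo scale"
  from endoD(1,2)[OF vector_space_axioms this]
  show "(\<forall>x y. \<phi> (x + y) = \<phi> x + \<phi> y) \<and> (\<forall>c x. \<phi> (scale c x) = scale c (\<phi> x))" by blast
next
  assume *: "(\<forall>x y. \<phi> (x + y) = \<phi> x + \<phi> y) \<and> (\<forall>c x. \<phi> (scale c x) = scale c (\<phi> x))"
  show "\<phi> \<in> endo scale"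
    unfolding endo_def mem_Collect_eq by unfold_locales (use * in auto)
qed

lemma endo_part_iff: "\<phi> \<in> endo_part scale part q \<longleftrightarrow> \<phi> \<in> endo scale \<and> (\<forall>e. \<forall>v\<in>part e. \<phi> v \<in> part (e \<noteq> q))"
  by (auto simp: endo_part_def)

lemma endo_part_endo: "\<phi> \<in> endo_part scale part q \<Longrightarrow> \<phi> \<in> endo scale"
  by (simp add: endo_part_def)

lemma endo_part_scale: "\<phi> \<in> endo_part scale part q \<Longrightarrow> (\<lambda>v. scale c (\<phi> v)) \<in> endo_part scale part q"
  by (auto simp: endo_part_iff endo_iff scale_right_distrib mult.commute intro!: subspace_scale[OF subspace_part])

lemma endo_part_zero: "(\<lambda>v. 0) \<in> endo_part scale part q"
  by (auto simp: endo_part_iff endo_iff intro: subspace_0[OF subspace_part])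

lemma endo_part_add: "\<phi> \<in> endo_part scale part q \<Longrightarrow> \<psi> \<in> endo_part scale part q
    \<Longrightarrow> (\<lambda>v. \<phi> v + \<psi> v) \<in> endo_part scale part q"
  by (auto simp: endo_part_iff endo_iff scale_right_distrib intro!: subspace_add[OF subspace_part])

lemma endo_part_sum: "(\<And>a. a \<in> A \<Longrightarrow> \<phi> a \<in> endo_part scale part q)
    \<Longrightarrow> (\<lambda>v. \<Sum>a\<in>A. \<phi> a v) \<in> endo_part scale part q"
  by (induction A rule: infinite_finite_induct) (simp_all add: endo_part_zero endo_part_add)

lemma endo_part_comp: "\<phi> \<in> endo_part scale part q \<Longrightarrow> \<psi> \<in> endo_part scale part r
    \<Longrightarrow> \<phi> \<circ> \<psi> \<in> endo_part scale part (q \<noteq> r)"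
  unfolding endo_part_iff endo_iff
proof (intro conjI allI ballI; (elim conjE)?)
  fix e v assume *: "\<forall>e. \<forall>v\<in>part e. \<phi> v \<in> part (e \<noteq> q)" "\<forall>e. \<forall>v\<in>part e. \<psi> v \<in> part (e \<noteq> r)" "v \<in> part e"
  then have "\<phi> (\<psi> v) \<in> part ((e \<noteq> r) \<noteq> q)" by blast
  moreover have "((e \<noteq> r) \<noteq> q) = (e \<noteq> (q \<noteq> r))" by auto
  ultimately show "(\<phi> \<circ> \<psi>) v \<in> part (e \<noteq> (q \<noteq> r))" by simp
qed simp_all

lemma grading_involution_eq:
  assumes "u \<in> part False" "t \<in> part True"
  shows "grading_involution part (u + t) = u - t"
  unfolding grading_involution_def
proof (rule the_equality)
  show "\<exists>u'\<in>part False. \<exists>t'\<in>part True. u + t = u' + t' \<and> u - t = u' - t'" using assms by blast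
  fix w assume "\<exists>u'\<in>part False. \<exists>t'\<in>part True. u + t = u' + t' \<and> w = u' - t'"
  then obtain u' t' where *: "u' \<in> part False" "t' \<in> part True" "u + t = u' + t'" "w = u' - t'" by blast
  then have eq: "u - u' = t' - t" by (metis add_diff_cancel_left' diff_add_eq add.commute add_diff_cancel)
  have "u - u' \<in> part False" using assms * by (intro subspace_diff[OF subspace_part])
  moreover have "u - u' \<in> part True" unfolding eq using assms * by (intro subspace_diff[OF subspace_part])
  ultimately have "u - u' = 0" using part_Int by blast
  then show "w = u - t" using eq * by simp
qed

text \<open>The two grading involutions act on homogeneous vectors before and after \<phi>, whose
  parities differ by \<open>q\<close>; the product of the two signs depends on \<open>q\<close>
  alone.\<close>

lemma twist_homogeneous:
  assumes "\<phi> \<in> endo_part scale part q"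
  shows "twist part b \<phi> v = scale (sg b q) (\<phi> v)"
proof (cases b)
  case True
  obtain u t where v: "v = u + t" "u \<in> part False" "t \<in> part True" using part_sum by blast
  note e = endoD[OF vector_space_axioms endo_part_endo[OF assms]]
  have ut: "\<phi> u \<in> part q" "\<phi> t \<in> part (\<not> q)" "- \<phi> t \<in> part (\<not> q)"
    using assms v subspace_neg[OF subspace_part, of "\<phi> t" "\<not> q"] unfolding endo_part_iff by fastforce+
  have "grading_involution part (\<phi> u + - \<phi> t) = scale (sg True q) (\<phi> v)"
  proof (cases q)
    case True
    then show ?thesis using grading_involution_eq[of "- \<phi> t" "\<phi> u"] ut by (simp add: v e)
  next
    case False
    then show ?thesis using grading_involution_eq[of "\<phi> u" "- \<phi> t"] ut by (simp add: v e)
  qed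
  then show ?thesis using True by (simp add: twist_def v grading_involution_eq e)
qed (simp add: twist_def)

end

text \<open>Both sides run over the pairs whose sum \<open>N + P\<close> is contained in
  \<open>M\<close>.\<close>

lemma sum_submultisets_swap:
  "(\<Sum>N | N \<subseteq># M. \<Sum>P | P \<subseteq># M - N. g N P) = (\<Sum>P | P \<subseteq># M. \<Sum>N | N \<subseteq># M - P. g N P)"
proof -
  have sub: "P \<subseteq># M - N \<longleftrightarrow> P \<subseteq># M \<and> N + P \<subseteq># M" if NM: "N \<subseteq># M" for N P
  proof -
    obtain K where M: "M = N + K" using NM by (metis mset_subset_eq_exists_conv)
    have "P \<subseteq># N + K" if "P \<subseteq># K"
      using subset_mset.order_trans[OF that mset_subset_eq_add_right] .
    then show ?thesis by (auto simp: M)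
  qed
  have "(\<Sum>N | N \<subseteq># M. \<Sum>P | P \<subseteq># M - N. g N P) = (\<Sum>N\<in>{N. N \<subseteq># M}. \<Sum>P\<in>{P\<in>{P. P \<subseteq># M}. N + P \<subseteq># M}. g N P)"
    using sub by (intro sum.cong) auto
  also have "\<dots> = (\<Sum>P\<in>{P. P \<subseteq># M}. \<Sum>N\<in>{N\<in>{N. N \<subseteq># M}. N + P \<subseteq># M}. g N P)"
    by (rule sum.swap_restrict) (rule finite_submultisets)+
  also have "\<dots> = (\<Sum>P | P \<subseteq># M. \<Sum>N | N \<subseteq># M - P. g N P)"
    using sub by (intro sum.cong) (auto simp: add.commute)
  finally show ?thesis .
qed

lemma good_add_mset: "good p (add_mset v M) \<longleftrightarrow> good p M \<and> (dvar_parity p v \<longrightarrow> v \<notin># M)"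
proof
  assume g: "good p (add_mset v M)"
  then have "count M v = 0" if "dvar_parity p v" using that by (force simp: good_def)
  then show "good p M \<and> (dvar_parity p v \<longrightarrow> v \<notin># M)"
    using good_mono[OF g, of M] by (auto simp: not_in_iff)
next
  assume "good p M \<and> (dvar_parity p v \<longrightarrow> v \<notin># M)"
  then show "good p (add_mset v M)" by (auto simp: good_def not_in_iff)
qed

context sections
begin

lemma form_mult_eq:
  assumes "supp_good p f" "supp_good p \<omega>"
  shows "form_mult p sF f \<omega> M = (\<Sum>N | N \<subseteq># M. sF (bisgn p N (M - N) * f N) (\<omega> (M - N)))"
  unfolding form_mult_def
proof (rule sum.cong[OF refl])
  fix N
  show "sF (mon_sign p N (M - N) * f N) (\<omega> (M - N)) = sF (bisgn p N (M - N) * f N) (\<omega> (M - N))"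
    using assms mon_sign_eq[of p N "M - N"] by (cases "f N = 0 \<or> \<omega> (M - N) = 0") (auto simp: supp_good_def)
qed

lemma form_mult_supp_good:
  assumes "supp_good p f" "supp_good p \<omega>"
  shows "supp_good p (form_mult p sF f \<omega>)"
  unfolding supp_good_def
proof (intro allI impI)
  fix M assume "form_mult p sF f \<omega> M \<noteq> 0"
  then obtain N where N: "N \<subseteq># M" "sF (mon_sign p N (M - N) * f N) (\<omega> (M - N)) \<noteq> 0"
    unfolding form_mult_def by (auto elim: sum.not_neutral_contains_not_neutral)
  then have "mon_sign p N (M - N) \<noteq> (0::'k)" "f N \<noteq> 0" "\<omega> (M - N) \<noteq> 0" by auto
  then have "good p (N + (M - N))" using assms by (intro good_add) (auto simp: supp_good_def)
  then show "good p M" using N(1) by simp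
qed

definition odd_form :: "('i, 'f \<Rightarrow> 'f) form \<Rightarrow> bool" where
  "odd_form \<Phi> \<longleftrightarrow> (\<forall>M. \<Phi> M \<in> endo_part sF F (\<not> mon_parity p M))
     \<and> (\<forall>M v. \<Phi> M v \<noteq> 0 \<longrightarrow> M \<in> monomials I p (Suc 0))"

abbreviation app :: "('i, 'f \<Rightarrow> 'f) form \<Rightarrow> ('i, 'f) form \<Rightarrow> ('i, 'f) form" where
  "app \<equiv> endo_form_apply p sF F"

context
  fixes \<Phi> assumes \<Phi>: "odd_form \<Phi>"
begin

lemma odd_form_endo: "\<Phi> N \<in> endo sF"
  using \<Phi> by (auto simp: odd_form_def intro: endo_part_endo)

lemmas odd_formD = endoD[OF vector_space_axioms odd_form_endo]

lemma app_mon_sign: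
  "app \<Phi> \<omega> M = (\<Sum>N | N \<subseteq># M. sF (mon_sign p N (M - N) * sg (mon_parity p (M - N)) (\<not> mon_parity p N)) (\<Phi> N (\<omega> (M - N))))"
proof -
  have "twist F b (\<Phi> N) v = sF (sg b (\<not> mon_parity p N)) (\<Phi> N v)" for b N v
    using \<Phi> by (intro twist_homogeneous) (auto simp: odd_form_def)
  then show ?thesis by (simp add: endo_form_apply_def)
qed

lemma app_eq:
  assumes "supp_good p \<omega>"
  shows "app \<Phi> \<omega> M = (\<Sum>N | N \<subseteq># M. sF (bisgn p N (M - N) * sg (mon_parity p (M - N)) (\<not> mon_parity p N)) (\<Phi> N (\<omega> (M - N))))"
  unfolding app_mon_sign
proof (rule sum.cong[OF refl])
  fix N
  show "sF (mon_sign p N (M - N) * sg (mon_parity p (M - N)) (\<not> mon_parity p N)) (\<Phi> N (\<omega> (M - N)))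
    = sF (bisgn p N (M - N) * sg (mon_parity p (M - N)) (\<not> mon_parity p N)) (\<Phi> N (\<omega> (M - N)))"
  proof (cases "\<Phi> N (\<omega> (M - N)) = 0")
    case False
    then have "good p N" using \<Phi> by (auto simp: odd_form_def monomials_iff)
    moreover have "\<omega> (M - N) \<noteq> 0" using False odd_formD(3)[of N] by auto
    then have "good p (M - N)" using assms by (auto simp: supp_good_def)
    ultimately show ?thesis by (simp add: mon_sign_eq)
  qed simp
qed

lemma app_nonzero:
  assumes "app \<Phi> \<omega> M \<noteq> 0"
  obtains N R where "M = N + R" "mon_sign p N R \<noteq> (0::'k)" "N \<in> monomials I p (Suc 0)" "\<omega> R \<noteq> 0"
proof -
  from assms obtain N where N: "N \<subseteq># M"
    "sF (mon_sign p N (M - N) * sg (mon_parity p (M - N)) (\<not> mon_parity p N)) (\<Phi> N (\<omega> (M - N))) \<noteq> 0"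
    unfolding app_mon_sign by (auto elim: sum.not_neutral_contains_not_neutral)
  then have "mon_sign p N (M - N) \<noteq> (0::'k)" "\<Phi> N (\<omega> (M - N)) \<noteq> 0" by auto
  moreover from this have "\<omega> (M - N) \<noteq> 0" using odd_formD(3)[of N] by auto
  ultimately show thesis using \<Phi> N(1) by (intro that[of N "M - N"]) (auto simp: odd_form_def)
qed

lemma app_supp_good: "supp_good p \<omega> \<Longrightarrow> supp_good p (app \<Phi> \<omega>)"
  unfolding supp_good_def by (metis app_nonzero good_add monomials_good)

lemma app_S1: assumes "s \<in> S" shows "app \<Phi> s \<in> S1"
  unfolding S1_iff
proof (intro allI impI)
  fix M assume "app \<Phi> s M \<noteq> 0"
  then obtain N R where "M = N + R" "mon_sign p N R \<noteq> (0::'k)" "N \<in> monomials I p (Suc 0)" "s R \<noteq> 0"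
    by (rule app_nonzero)
  then show "M \<in> monomials I p (Suc 0)" using assms monomials_add[of N I p "Suc 0" R 0] by (auto simp: S_iff)
qed

lemma app_add: "app \<Phi> (s + t) = app \<Phi> s + app \<Phi> t"
  by (rule ext) (simp add: app_mon_sign odd_formD(1) scale_right_distrib sum.distrib)

lemma app_sum: "app \<Phi> (sum f A) = (\<Sum>a\<in>A. app \<Phi> (f a))"
proof (induction A rule: infinite_finite_induct)
  case (insert a A)
  have "app \<Phi> (f a + sum f A) = app \<Phi> (f a) + (\<Sum>a\<in>A. app \<Phi> (f a))" by (simp only: app_add insert.IH)
  moreover have "sum f (insert a A) = f a + sum f A" "(\<Sum>a\<in>insert a A. app \<Phi> (f a)) = app \<Phi> (f a) + (\<Sum>a\<in>A. app \<Phi> (f a))"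
    using insert.hyps by (rule sum.insert)+
  ultimately show ?case by (simp only:)
qed (simp_all add: app_mon_sign odd_formD(3) fun_eq_iff)

text \<open>Both sides sum over the ways to write \<open>M\<close> as a product of monomials of
  \<Phi>, f and \<omega>. Moving the monomial of f past the monomial of \<Phi> and past its
  coefficient costs the parity of f, because the parities of these two add up to odd.\<close>

lemma app_form_mult:
  assumes f: "supp_good p f" "\<And>N. f N \<noteq> 0 \<Longrightarrow> mon_parity p N = q" and \<omega>: "supp_good p \<omega>"
  shows "app \<Phi> (form_mult p sF f \<omega>) M = sF (sg True q) (form_mult p sF f (app \<Phi> \<omega>) M)"
proof -
  \<comment> \<open>The common summand, with the monomials in the order \<open>N\<close>,
    \<open>P\<close>, \<open>R\<close>, where \<open>R\<close> is the rest of
    \<open>M\<close>.\<close>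
  define G where "G N P = (let R = M - N - P in sF (bisgn p N P * bisgn p N R * bisgn p P R * f P
      * sg (mon_parity p P \<noteq> mon_parity p R) (\<not> mon_parity p N)) (\<Phi> N (\<omega> R)))" for N P
  have "app \<Phi> (form_mult p sF f \<omega>) M = (\<Sum>N | N \<subseteq># M. \<Sum>P | P \<subseteq># M - N. G N P)"
    unfolding app_eq[OF form_mult_supp_good[OF f(1) \<omega>]]
  proof (rule sum.cong[OF refl])
    fix N
    have "sF (bisgn p N (M - N) * sg (mon_parity p (M - N)) (\<not> mon_parity p N)) (\<Phi> N (form_mult p sF f \<omega> (M - N)))
      = (\<Sum>P | P \<subseteq># M - N. sF (bisgn p N (M - N) * sg (mon_parity p (M - N)) (\<not> mon_parity p N))
          (sF (bisgn p P (M - N - P) * f P) (\<Phi> N (\<omega> (M - N - P)))))"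
      by (simp add: form_mult_eq[OF f(1) \<omega>] odd_formD(5,2) scale_sum_right)
    also have "\<dots> = (\<Sum>P | P \<subseteq># M - N. G N P)"
    proof (rule sum.cong[OF refl])
      fix P assume "P \<in> {P. P \<subseteq># M - N}"
      then obtain R where R: "M - N = P + R" by (metis mem_Collect_eq subset_mset.add_diff_inverse)
      then have "M - N - P = R" by simp
      then show "sF (bisgn p N (M - N) * sg (mon_parity p (M - N)) (\<not> mon_parity p N))
          (sF (bisgn p P (M - N - P) * f P) (\<Phi> N (\<omega> (M - N - P)))) = G N P"
        by (simp add: G_def R mult.commute mult.left_commute)
    qed
    finally show "sF (bisgn p N (M - N) * sg (mon_parity p (M - N)) (\<not> mon_parity p N)) (\<Phi> N (form_mult p sF f \<omega> (M - N)))
      = (\<Sum>P | P \<subseteq># M - N. G N P)" .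
  qed
  also have "\<dots> = (\<Sum>P | P \<subseteq># M. \<Sum>N | N \<subseteq># M - P. G N P)" by (rule sum_submultisets_swap)
  also have "\<dots> = (\<Sum>P | P \<subseteq># M. sF (sg True q) (sF (bisgn p P (M - P) * f P) (app \<Phi> \<omega> (M - P))))"
  proof (rule sum.cong[OF refl])
    fix P
    have "G N P = sF (sg True q) (sF (bisgn p P (M - P) * f P)
        (sF (bisgn p N (M - P - N) * sg (mon_parity p (M - P - N)) (\<not> mon_parity p N)) (\<Phi> N (\<omega> (M - P - N)))))"
      if NP: "N \<subseteq># M - P" for N
    proof (cases "f P = 0")
      case False
      then have q: "mon_parity p P = q" by (rule f)
      obtain R where R: "M - P = N + R" using NP by (metis mset_subset_eq_exists_conv)
      have "M - N - P = M - P - N" by (rule multiset_eqI) simp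
      then have R': "M - P - N = R" "M - N - P = R" by (simp_all only: R add_diff_cancel_left')
      have "bisgn p N P * sg (q \<noteq> mon_parity p R) (\<not> mon_parity p N)
        = sg True q * (bisgn p P N * sg (mon_parity p R) (\<not> mon_parity p N) :: 'k)"
        unfolding bisgn_swap[of p N P] q by (auto simp: sg_def)
      then have "bisgn p N P * bisgn p N R * bisgn p P R * f P * sg (q \<noteq> mon_parity p R) (\<not> mon_parity p N)
        = sg True q * (bisgn p P N * bisgn p P R * f P * (bisgn p N R * sg (mon_parity p R) (\<not> mon_parity p N)))"
        by (simp add: mult.commute mult.left_commute)
      then show ?thesis unfolding G_def Let_def R' R q by simp
    qed (simp add: G_def)
    then show "(\<Sum>N | N \<subseteq># M - P. G N P) = sF (sg True q) (sF (bisgn p P (M - P) * f P) (app \<Phi> \<omega> (M - P)))"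
      unfolding app_eq[OF \<omega>] scale_sum_right by (intro sum.cong) auto
  qed
  also have "\<dots> = sF (sg True q) (form_mult p sF f (app \<Phi> \<omega>) M)"
    by (simp only: form_mult_eq[OF f(1) app_supp_good[OF \<omega>]] scale_sum_right)
  finally show ?thesis .
qed

text \<open>Only \<open>N = M\<close> leaves the empty monomial for the constant; so the operator
  determines the form.\<close>

lemma app_cst: "app \<Phi> (cst v) M = \<Phi> M v"
proof -
  have "app \<Phi> (cst v) M = (\<Sum>N | N \<subseteq># M. if N = M then \<Phi> M v else 0)"
    unfolding app_mon_sign
  proof (rule sum.cong[OF refl])
    fix N assume "N \<in> {N. N \<subseteq># M}"
    then have "M - N = {#} \<longleftrightarrow> N = M" by (auto simp: Diff_eq_empty_iff_mset)
    then show "sF (mon_sign p N (M - N) * sg (mon_parity p (M - N)) (\<not> mon_parity p N)) (\<Phi> N (cst v (M - N))) = (if N = M then \<Phi> M v else 0)"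
      by (simp add: cst_def odd_formD(3))
  qed
  then show ?thesis by (simp add: sum.delta[OF finite_submultisets])
qed

lemma odd_function_linear_app: "odd_function_linear I p sF F (app \<Phi>)"
  unfolding odd_function_linear_def
proof (intro conjI allI ballI)
  show "app \<Phi> \<in> S \<rightarrow> forms I p 1 UNIV" using app_S1 by auto
  show "app \<Phi> s \<in> forms_part I p 1 F (\<not> q)" if s: "s \<in> forms_part I p 0 F q" for q s
  proof -
    have "app \<Phi> s M \<in> F (\<not> q \<noteq> mon_parity p M)" for M
      unfolding app_mon_sign
    proof (intro subspace_sum[OF subspace_part] subspace_scale[OF subspace_part])
      fix N assume "N \<in> {N. N \<subseteq># M}"
      then have M: "M = N + (M - N)" by simp
      have "s (M - N) \<in> F (q \<noteq> mon_parity p (M - N))" using s by (simp add: forms_part_def)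
      then have "\<Phi> N (s (M - N)) \<in> F ((q \<noteq> mon_parity p (M - N)) \<noteq> (\<not> mon_parity p N))"
        using \<Phi> unfolding odd_form_def endo_part_iff by blast
      moreover have "((q \<noteq> mon_parity p (M - N)) \<noteq> (\<not> mon_parity p N)) = (\<not> q \<noteq> mon_parity p M)"
        using arg_cong[OF M, of "mon_parity p"] by auto
      ultimately show "\<Phi> N (s (M - N)) \<in> F (\<not> q \<noteq> mon_parity p M)" by simp
    qed
    then show ?thesis using s app_S1[of s] by (simp add: forms_part_def)
  qed
  show "app \<Phi> (s + t) = app \<Phi> s + app \<Phi> t" for s t by (rule app_add)
  show "app \<Phi> (form_mult p sF f s) M = sF (if q then - 1 else 1) (form_mult p sF f (app \<Phi> s) M)"
    if f: "f \<in> forms_part I p 0 scalar_part q" and s: "s \<in> S" for q f s M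
  proof -
    have "f \<in> forms I p 0 UNIV" using f by (simp add: forms_part_def)
    then have g: "supp_good p f" by (rule forms_supp_good)
    have "mon_parity p N = q" if "f N \<noteq> 0" for N
      using f that by (auto simp: forms_part_def scalar_part_def split: if_splits)
    from app_form_mult[OF g this S_supp_good[OF s]] show ?thesis by (simp add: sg_def)
  qed
qed

text \<open>On a vector the wedge square is \<open>app \<Phi>\<close> applied twice to a constant
  section. Expanding the inner 1-form into its components and moving each dx^a out turns the outer
  application into \<open>extend_connection\<close>.\<close>

lemma wedge_zero:
  assumes "flat I p sF (app \<Phi>)"
  shows "endo_form_wedge p sF F \<Phi> \<Phi> = (\<lambda>M v. 0)"
proof (intro ext)
  fix M v
  define \<omega> where "\<omega> = app \<Phi> (cst v)"
  have \<omega>: "\<omega> \<in> S1" unfolding \<omega>_def by (rule app_S1) simp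
  have mon: "supp_good p (mon_form {#D a#} :: ('i, 'k) form)"
    "\<And>N. (mon_form {#D a#} :: ('i, 'k) form) N \<noteq> 0 \<Longrightarrow> mon_parity p N = (\<not> p a)" for a
    by (auto simp: supp_good_def mon_form_def good_def split: if_splits)
  have "\<omega> N = \<Phi> N v" for N by (simp add: \<omega>_def app_cst)
  then have "endo_form_wedge p sF F \<Phi> \<Phi> M v = app \<Phi> \<omega> M"
    by (simp add: endo_form_wedge_def endo_form_apply_def)
  also have "\<dots> = app \<Phi> (\<Sum>a\<in>I. vm (D a) (D_coeff p sF a \<omega>)) M"
    by (subst S1_decomposition[OF \<omega>]) simp
  also have "\<dots> = (\<Sum>a\<in>I. sF (sg True (\<not> p a)) (vm (D a) (app \<Phi> (D_coeff p sF a \<omega>)) M))"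
    unfolding app_sum sum_fun_apply vm_def
    by (intro sum.cong refl app_form_mult mon S_supp_good D_coeff_S \<omega>)
  also have "\<dots> = extend_connection I p sF (app \<Phi>) \<omega> M" by (simp only: extend_connection_eq)
  also have "\<dots> = 0" using assms by (simp add: flat_def \<omega>_def)
  finally show "endo_form_wedge p sF F \<Phi> \<Phi> M v = 0" .
qed

end

section \<open>Potentials of supersymmetric systems of endomorphisms\<close>

definition supersymmetric :: "('i list \<Rightarrow> 'f \<Rightarrow> 'f) \<Rightarrow> bool" where
  "supersymmetric C \<longleftrightarrow> (\<forall>as. as \<noteq> [] \<longrightarrow> set as \<subseteq> I \<longrightarrow> C as \<in> endo_part sF F (lpar p as))
    \<and> (\<forall>u a b w x. set (u @ a # b # w) \<subseteq> I \<longrightarrow> C (u @ a # b # w) x = sF (sg (p a) (p b)) (C (u @ b # a # w) x))"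

text \<open>Two equal odd indices can be brought next to each other; exchanging them then changes
  the sign and nothing else.\<close>

lemma supersymmetric_zero:
  assumes "supersymmetric C" "set as \<subseteq> I" "lsgn p as = (0::'k)"
  shows "C as x = 0"
proof -
  obtain b u v where b: "p b" "mset as = mset (b # b # u @ v)" using assms(3) lsgn_zero_iff by blast
  have I: "set w \<subseteq> I" if "mset w = mset as" for w using that assms(2) by (metis set_mset_mset)
  have "(C as x = 0) = (C (b # b # u @ v) x = 0)"
  proof (rule swap_invariant[where M = "mset as" and f = "\<lambda>w. C w x = 0"])
    fix u a b v assume "mset (u @ a # b # v) = mset as"
    then have "C (u @ a # b # v) x = sF (sg (p a) (p b)) (C (u @ b # a # v) x)"
      using assms(1) I unfolding supersymmetric_def by blast
    then show "(C (u @ a # b # v) x = 0) = (C (u @ b # a # v) x = 0)" by (simp add: sg_def)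
  qed (use b in simp_all)
  moreover have "C ([] @ b # b # u @ v) x = sF (sg (p b) (p b)) (C ([] @ b # b # u @ v) x)"
    using assms(1) I[of "b # b # u @ v"] b(2) unfolding supersymmetric_def by (metis append_Nil)
  then have "C (b # b # u @ v) x = - C (b # b # u @ v) x" using b(1) by simp
  then have "C (b # b # u @ v) x + C (b # b # u @ v) x = 0" by (metis add.left_inverse)
  then have "sF 2 (C (b # b # u @ v) x) = 0" by (simp only: scale_2)
  then have "C (b # b # u @ v) x = 0" by simp
  ultimately show ?thesis by simp
qed

lemma lsgn_nonzero_good: "lsgn p w \<noteq> (0::'k) \<Longrightarrow> good p (mset (map X w))"
proof (induction w)
  case (Cons x w)
  have "x \<notin> set w" if "p x"
    using Cons.prems that by (auto simp: prod_list_zero_iff pair_sg_def)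
  then show ?case using Cons by (auto simp: good_add_mset)
qed simp

lemma bisgn_word: "bisgn p {#X a#} (mset (map X w)) = prod_list (map (pair_sg p a) w)"
  by (induction w) (simp_all add: bisgn_add_mset(2)[of p _ "X _"] dsgn_X)

lemma word_eq: "word p (map X w) M = (if M = mset (map X w) then lsgn p w else (0::'k))"
proof (induction w arbitrary: M)
  case (Cons a w)
  have "word p (map X (a # w)) M = form_mult p (*) (mon_form {#X a#}) (word p (map X w)) M"
    by (simp add: word_def)
  also have "\<dots> = (\<Sum>N | N \<subseteq># M. if N = {#X a#} then mon_sign p {#X a#} (M - {#X a#}) * word p (map X w) (M - {#X a#}) else (0::'k))"
    unfolding form_mult_def mon_form_def by (intro sum.cong) auto
  also have "\<dots> = (if X a \<in># M then mon_sign p {#X a#} (M - {#X a#}) * word p (map X w) (M - {#X a#}) else 0)"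
    by (simp add: sum.delta[OF finite_submultisets])
  also have "\<dots> = (if M = mset (map X (a # w)) then mon_sign p {#X a#} (mset (map X w)) * lsgn p w else 0)"
    using Cons.IH[of "M - {#X a#}"] by (auto dest!: multi_member_split)
  \<comment> \<open>If the tail has sign 0, its content repeats an odd variable and
    \<open>mon_sign\<close> may differ from \<open>bisgn\<close>; the product is 0 in any
    case.\<close>
  also have "mon_sign p {#X a#} (mset (map X w)) * lsgn p w = (lsgn p (a # w) :: 'k)"
  proof (cases "lsgn p w = (0::'k)")
    case False
    have "good p {#X a#}" by (simp add: good_def)
    then have "mon_sign p {#X a#} (mset (map X w)) = (bisgn p {#X a#} (mset (map X w)) :: 'k)"
      using lsgn_nonzero_good[OF False] by (rule mon_sign_eq)
    then show ?thesis by (simp only: bisgn_word lsgn.simps)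
  qed simp
  finally show ?case .
qed (simp add: word_def mon_form_def)

text \<open>The series of \<open>potential\<close> for an abstract system; \<open>C\<close> will be
  the correlators of a representation or the Taylor coefficients of a connection.\<close>

definition pot :: "('i list \<Rightarrow> 'f \<Rightarrow> 'f) \<Rightarrow> ('i, 'f \<Rightarrow> 'f) form" where
  "pot C = (\<lambda>M v. \<Sum>n\<in>{1..size M}. \<Sum>as | set as \<subseteq> I \<and> length as = n.
     sF (word p (map X (rev as)) M / fact n) (C as v))"

text \<open>The number of permutations of the positions that leave the word fixed; a word of length
  n has n! / \<open>mfac\<close> rearrangements.\<close>

definition mfac :: "'i list \<Rightarrow> 'k" where
  "mfac as = of_nat (\<Prod>x\<in>set_mset (mset as). fact (count (mset as) x))"

lemma mfac_nonzero: "mfac as \<noteq> 0"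
  by (simp add: mfac_def)

lemma mfac_append: "mfac (as @ [a]) = of_nat (Suc (count (mset as) a)) * mfac as"
proof -
  define A where "A = mset as"
  let ?B = "insert a (set_mset A)"
  have "(\<Prod>y\<in>set_mset A. fact (count A y)) = (\<Prod>y\<in>?B. fact (count A y) :: nat)"
    by (rule prod.mono_neutral_left) (auto simp: not_in_iff)
  also have "\<dots> = fact (count A a) * (\<Prod>y\<in>?B - {a}. fact (count A y))"
    by (rule prod.remove) auto
  finally have 1: "(\<Prod>y\<in>set_mset A. fact (count A y) :: nat) = fact (count A a) * (\<Prod>y\<in>?B - {a}. fact (count A y))" .
  have "(\<Prod>y\<in>?B. fact (count (add_mset a A) y) :: nat)
    = fact (count (add_mset a A) a) * (\<Prod>y\<in>?B - {a}. fact (count (add_mset a A) y))"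
    by (rule prod.remove) auto
  also have "(\<Prod>y\<in>?B - {a}. fact (count (add_mset a A) y)) = (\<Prod>y\<in>?B - {a}. fact (count A y) :: nat)"
    by (rule prod.cong) auto
  finally have "(\<Prod>y\<in>?B. fact (count (add_mset a A) y)) = Suc (count A a) * (\<Prod>y\<in>set_mset A. fact (count A y) :: nat)"
    unfolding 1 by (simp add: algebra_simps)
  then have "(of_nat (\<Prod>y\<in>?B. fact (count (add_mset a A) y)) :: 'k) = of_nat (Suc (count A a)) * of_nat (\<Prod>y\<in>set_mset A. fact (count A y))"
    by (simp only: of_nat_mult)
  then show ?thesis by (simp add: mfac_def A_def del: of_nat_Suc of_nat_prod)
qed

text \<open>All rearrangements of \<open>as\<close> contribute equally, since the sign of the
  monomial and the value of \<open>C\<close> change together. Their number n! /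
  \<open>mfac as\<close> cancels the n! in the series.\<close>

lemma pot_word:
  assumes C: "supersymmetric C" and as: "set as \<subseteq> I" "as \<noteq> []"
  shows "pot C (mset (map X as)) v = sF (lsgn p (rev as) / mfac as) (C as v)"
proof -
  define n where "n = length as"
  define A where "A = permutations_of_multiset (mset as)"
  have A: "xs \<in> A \<longleftrightarrow> mset xs = mset as" for xs by (simp add: A_def permutations_of_multiset_def)
  have fin: "finite {xs. set xs \<subseteq> I \<and> length xs = m}" for m
    using finite_I by (rule finite_lists_length_eq)
  have inj: "mset (map X as) = mset (map X xs) \<longleftrightarrow> mset xs = mset as" for xs :: "'i list"
  proof
    assume "mset (map X as) = mset (map X xs)"
    then have "image_mset X (mset as) = image_mset X (mset xs)" by simp
    then have "image_mset dvar_index (image_mset X (mset as)) = image_mset dvar_index (image_mset X (mset xs))" by simp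
    then show "mset xs = mset as" by (simp add: multiset.map_comp comp_def)
  qed (metis mset_map)
  have w: "word p (map X (rev xs)) (mset (map X as)) = (if xs \<in> A then lsgn p (rev xs) else (0::'k))" for xs
    unfolding word_eq A using inj[of "rev xs"] by auto
  have const: "sF (lsgn p (rev xs)) (C xs v) = sF (lsgn p (rev as)) (C as v)" if "xs \<in> A" for xs
  proof (rule swap_invariant[where M = "mset as" and f = "\<lambda>xs. sF (lsgn p (rev xs)) (C xs v)"])
    fix u a b w assume "mset (u @ a # b # w) = mset as"
    then have "set (u @ a # b # w) \<subseteq> I" using as(1) by (metis set_mset_mset)
    then have "C (u @ a # b # w) v = sF (sg (p a) (p b)) (C (u @ b # a # w) v)" using C unfolding supersymmetric_def by blast
    moreover have "lsgn p (rev (u @ a # b # w)) = sg (p a) (p b) * (lsgn p (rev (u @ b # a # w)) :: 'k)"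
      using lsgn_swap[of p "rev w" b a "rev u"] by (simp add: sg_commute)
    ultimately show "sF (lsgn p (rev (u @ a # b # w))) (C (u @ a # b # w) v)
       = sF (lsgn p (rev (u @ b # a # w))) (C (u @ b # a # w) v)" by (simp add: mult.commute)
  qed (use that A in auto)
  have sub: "A \<subseteq> {xs. set xs \<subseteq> I \<and> length xs = n}"
  proof
    fix xs assume "xs \<in> A"
    then have "mset xs = mset as" by (simp add: A)
    then show "xs \<in> {xs. set xs \<subseteq> I \<and> length xs = n}"
      using as(1) mset_eq_setD[of xs as] mset_eq_length[of xs as] by (simp add: n_def)
  qed
  have "pot C (mset (map X as)) v = (\<Sum>m\<in>{1..n}. \<Sum>xs | set xs \<subseteq> I \<and> length xs = m.
     if xs \<in> A then sF (1 / fact n) (sF (lsgn p (rev as)) (C as v)) else 0)"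
    unfolding pot_def
  proof (intro sum.cong refl)
    fix m xs assume "xs \<in> {xs. set xs \<subseteq> I \<and> length xs = m}"
    then have m: "m = n" if "xs \<in> A" using that sub by auto
    show "sF (word p (map X (rev xs)) (mset (map X as)) / fact m) (C xs v)
      = (if xs \<in> A then sF (1 / fact n) (sF (lsgn p (rev as)) (C as v)) else 0)"
      unfolding w by (cases "xs \<in> A") (simp_all add: m const[symmetric])
  qed (simp add: n_def)
  also have "\<dots> = (\<Sum>m\<in>{1..n}. if m = n then \<Sum>xs | set xs \<subseteq> I \<and> length xs = n.
     if xs \<in> A then sF (1 / fact n) (sF (lsgn p (rev as)) (C as v)) else 0 else 0)"
  proof (intro sum.cong refl)
    fix m
    have "xs \<notin> A" if "length xs = m" "m \<noteq> n" for xs using that sub by auto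
    then show "(\<Sum>xs | set xs \<subseteq> I \<and> length xs = m. if xs \<in> A then sF (1 / fact n) (sF (lsgn p (rev as)) (C as v)) else 0)
     = (if m = n then \<Sum>xs | set xs \<subseteq> I \<and> length xs = n. if xs \<in> A then sF (1 / fact n) (sF (lsgn p (rev as)) (C as v)) else 0 else 0)"
      by (auto intro: sum.neutral)
  qed
  also have "\<dots> = (\<Sum>xs | set xs \<subseteq> I \<and> length xs = n. if xs \<in> A then sF (1 / fact n) (sF (lsgn p (rev as)) (C as v)) else 0)"
    using as(2) by (simp add: sum.delta n_def Suc_leI)
  also have "\<dots> = (\<Sum>xs\<in>A. sF (1 / fact n) (sF (lsgn p (rev as)) (C as v)))"
    using sub by (simp add: sum.inter_restrict[OF fin, symmetric] Int_absorb1)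
  also have "\<dots> = sF (of_nat (card A) / fact n) (sF (lsgn p (rev as)) (C as v))"
  proof -
    have "(\<Sum>xs\<in>A. y) = sF (of_nat (card A)) y" for y
      by (induction A rule: infinite_finite_induct) (simp_all add: scale_left_distrib)
    then show ?thesis by (simp add: divide_inverse mult.commute mult.left_commute)
  qed
  also have "of_nat (card A) / fact n = 1 / mfac as"
  proof -
    have "card A * (\<Prod>x\<in>set_mset (mset as). fact (count (mset as) x)) = fact n"
      using card_permutations_of_multiset[of "mset as"] by (simp add: A_def n_def)
    then have "of_nat (card A) * mfac as = (fact n :: 'k)"
      unfolding mfac_def by (metis of_nat_fact of_nat_mult)
    then show ?thesis using mfac_nonzero[of as] by (simp add: field_simps)
  qed
  finally show ?thesis by simp
qed

lemma pot_nonzero: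
  assumes "pot C M v \<noteq> 0"
  obtains as where "set as \<subseteq> I" "as \<noteq> []" "M = mset (map X as)" "good p M"
proof -
  obtain n where n: "n \<in> {1..size M}" "(\<Sum>as | set as \<subseteq> I \<and> length as = n. sF (word p (map X (rev as)) M / fact n) (C as v)) \<noteq> 0"
    using assms unfolding pot_def by (auto elim: sum.not_neutral_contains_not_neutral)
  then obtain as where as: "set as \<subseteq> I" "length as = n" "sF (word p (map X (rev as)) M / fact n) (C as v) \<noteq> 0"
    by (auto elim: sum.not_neutral_contains_not_neutral)
  then have "word p (map X (rev as)) M \<noteq> (0::'k)" by auto
  then have "M = mset (map X (rev as))" "lsgn p (rev as) \<noteq> (0::'k)" by (auto simp: word_eq split: if_splits)
  then show thesis using lsgn_nonzero_good[of "rev as"] as n by (intro that[of "rev as"]) auto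
qed

lemma mon_parity_word: "mon_parity p (mset (map X as)) = lpar p as"
  by (induction as) simp_all

lemma pot_monomial: assumes "pot C M v \<noteq> 0" shows "M \<in> monomials I p 0"
proof -
  obtain as where as: "set as \<subseteq> I" "as \<noteq> []" "M = mset (map X as)" "good p M" using assms by (rule pot_nonzero)
  have "filter_mset is_D (mset (map X as)) = {#}" by (induction as) simp_all
  then show ?thesis using as by (auto simp: monomials_iff)
qed

lemma pot_S: "(\<lambda>M. pot C M v) \<in> S"
  using pot_monomial by (auto simp: S_iff)

lemma pot_endo_part:
  assumes C: "supersymmetric C"
  shows "pot C M \<in> endo_part sF F (mon_parity p M)"
proof (cases "\<exists>v. pot C M v \<noteq> 0")
  case True
  then obtain as where as: "set as \<subseteq> I" "as \<noteq> []" "M = mset (map X as)" by (metis pot_nonzero)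
  have "pot C M = (\<lambda>v. sF (lsgn p (rev as) / mfac as) (C as v))"
    using pot_word[OF C as(1,2)] as(3) by (simp add: fun_eq_iff)
  moreover have "C as \<in> endo_part sF F (lpar p as)" using C as by (simp add: supersymmetric_def)
  ultimately show ?thesis using as(3) mon_parity_word by (simp only: endo_part_scale)
next
  case False
  then have "pot C M = (\<lambda>v. 0)" by auto
  then show ?thesis by (simp add: endo_part_zero)
qed

lemma pot_forms: "supersymmetric C \<Longrightarrow> pot C \<in> forms I p 0 (endo sF)"
  using pot_endo_part endo_part_endo pot_monomial by (fastforce simp: forms_def fun_eq_iff)

text \<open>The monomials of the potential are reversed words so that left derivatives, the
  innermost one first, take the factors off in order and without sign. The coefficient of a general
  monomial is needed because the induction moves letters from \<open>w\<close> to \<open>as\<close>;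
  for empty \<open>as\<close> the derivatives at the origin are the values of
  \<open>C\<close>.\<close>

lemma pdw_pot:
  assumes C: "supersymmetric C"
  shows "set w \<subseteq> I \<Longrightarrow> set as \<subseteq> I \<Longrightarrow> as @ w \<noteq> [] \<Longrightarrow>
    pdw w (\<lambda>M. pot C M v) (mset (map X as)) = sF (lsgn p (rev as) / mfac as) (C (as @ w) v)"
proof (induction w arbitrary: as)
  case Nil
  then show ?case using pot_word[OF C] by simp
next
  case (Cons a w)
  let ?M = "mset (map X as)"
  have cnt: "count ?M (X a) = count (mset as) a" by (induction as) auto
  have "pdw (a # w) (\<lambda>M. pot C M v) ?M
    = sF (of_nat (Suc (count (mset as) a)) * bisgn p {#X a#} ?M) (pdw w (\<lambda>M. pot C M v) (mset (map X (as @ [a]))))"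
    by (simp add: pd_apply[OF S_supp_good[OF pdw_S[OF pot_S]]] cnt[simplified])
  also have "\<dots> = sF (of_nat (Suc (count (mset as) a)) * bisgn p {#X a#} ?M)
      (sF (lsgn p (a # rev as) / mfac (as @ [a])) (C (as @ a # w) v))"
    using Cons.IH[of "as @ [a]"] Cons.prems by simp
  also have "\<dots> = sF (bisgn p {#X a#} ?M * lsgn p (a # rev as) / mfac as) (C (as @ a # w) v)"
  proof -
    have "of_nat (Suc (count (mset as) a)) \<noteq> (0::'k)" by (simp del: of_nat_Suc)
    then show ?thesis using mfac_nonzero[of as]
      by (simp add: mfac_append field_simps del: of_nat_Suc lsgn.simps)
  qed
  also have "\<dots> = sF (lsgn p (rev as) / mfac as) (C (as @ a # w) v)"
  \<comment> \<open>A repeated odd index makes both sides 0, the left through the sign and the right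
    through \<open>supersymmetric_zero\<close>.\<close>
  proof (cases "lsgn p (a # rev as) = (0::'k)")
    case True
    then obtain b u t where b: "p b" "mset (a # rev as) = mset (b # b # u @ t)" using lsgn_zero_iff by blast
    then have "mset (as @ a # w) = mset (b # b # (u @ t) @ w)" by simp
    then have "lsgn p (as @ a # w) = (0::'k)" unfolding lsgn_zero_iff using b(1) by blast
    then have "C (as @ a # w) v = 0" using Cons.prems by (intro supersymmetric_zero[OF C]) auto
    then show ?thesis by simp
  next
    case False
    have "bisgn p {#X a#} (mset (map X (rev as))) = (prod_list (map (pair_sg p a) (rev as)) :: 'k)" by (rule bisgn_word)
    then have eq: "lsgn p (a # rev as) = bisgn p {#X a#} ?M * (lsgn p (rev as) :: 'k)" by simp
    have "bisgn p {#X a#} ?M * bisgn p {#X a#} ?M = (1::'k)"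
      using bisgn_sq[of p "{#X a#}" ?M] lsgn_nonzero_good[OF False] by simp
    then have "bisgn p {#X a#} ?M * lsgn p (a # rev as) = (lsgn p (rev as) :: 'k)"
      unfolding eq by (simp only: mult.assoc[symmetric] mult_1_left)
    then show ?thesis by simp
  qed
  finally show ?case .
qed

section \<open>The connection form of a potential\<close>

definition dpot :: "('i list \<Rightarrow> 'f \<Rightarrow> 'f) \<Rightarrow> ('i, 'f \<Rightarrow> 'f) form" where
  "dpot C = form_d I p (\<lambda>c \<phi> v. sF c (\<phi> v)) (pot C)"

lemma dpot_apply: "dpot C M v = form_d I p sF (\<lambda>M. pot C M v) M"
  by (simp add: dpot_def form_d_def form_mult_def form_partial_def sum_fun_apply)

text \<open>The coefficient has the parity of its monomial in the potential, and replacing x^a by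
  dx^a in the monomial reverses that parity.\<close>

lemma odd_form_dpot:
  assumes C: "supersymmetric C"
  shows "odd_form (dpot C)"
  unfolding odd_form_def
proof (intro conjI allI impI)
  fix M
  have "dpot C M = (\<lambda>v. \<Sum>a\<in>I. if D a \<in># M then sF (mon_sign p {#D a#} (M - {#D a#})) (sF (of_nat (Suc (count (M - {#D a#}) (X a)))
     * mon_sign p {#X a#} (M - {#D a#})) (pot C (add_mset (X a) (M - {#D a#})) v)) else 0)"
    by (simp add: fun_eq_iff dpot_apply form_d_eq sum_fun_apply vm_apply form_partial_def cong: if_cong)
  also have "\<dots> \<in> endo_part sF F (\<not> mon_parity p M)"
  proof (rule endo_part_sum)
    fix a
    show "(\<lambda>v. if D a \<in># M then sF (mon_sign p {#D a#} (M - {#D a#})) (sF (of_nat (Suc (count (M - {#D a#}) (X a)))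
     * mon_sign p {#X a#} (M - {#D a#})) (pot C (add_mset (X a) (M - {#D a#})) v)) else 0) \<in> endo_part sF F (\<not> mon_parity p M)"
    proof (cases "D a \<in># M")
      case True
      then obtain N where M: "M = add_mset (D a) N" by (meson mset_add)
      have "mon_parity p (add_mset (X a) N) = (\<not> mon_parity p M)" by (simp add: M)
      then have "pot C (add_mset (X a) N) \<in> endo_part sF F (\<not> mon_parity p M)"
        using pot_endo_part[OF C, of "add_mset (X a) N"] by simp
      then show ?thesis by (simp add: M endo_part_scale del: scale_scale)
    qed (simp add: endo_part_zero)
  qed
  finally show "dpot C M \<in> endo_part sF F (\<not> mon_parity p M)" .
  fix v assume "dpot C M v \<noteq> 0"
  then show "M \<in> monomials I p (Suc 0)" using form_d_S1[OF pot_S, of C v] by (auto simp: S1_iff dpot_apply)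
qed

lemma component_dpot_cst:
  assumes "supersymmetric C" "a \<in> I"
  shows "component (app (dpot C)) a (cst v) = pd a (\<lambda>M. pot C M v)"
proof -
  have "app (dpot C) (cst v) = form_d I p sF (\<lambda>M. pot C M v)"
    by (rule ext) (simp add: app_cst[OF odd_form_dpot[OF assms(1)]] dpot_apply)
  then show ?thesis by (simp add: component_def D_coeff_form_d[OF pot_S assms(2)])
qed

text \<open>The connection remembers the system from which it is built; injectivity and surjectivity
  of the correspondence both rest on this.\<close>

lemma taylor_coeff_dpot:
  assumes "supersymmetric C" "a \<in> I" "set u \<subseteq> I"
  shows "taylor_coeff (component (app (dpot C)) a) u = C (u @ [a])"
  using pdw_pot[OF assms(1), of "u @ [a]" "[]"] assms
  by (simp add: fun_eq_iff taylor_coeff_def component_dpot_cst mfac_def)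

text \<open>The linear condition holds because the components on constants are the derivatives of
  one potential. The quadratic one is tested on all Taylor coefficients, where it becomes
  \<open>Q\<close>; the standard positions are enough, as the labelling is arbitrary.\<close>

lemma flat_dpot:
  assumes C: "supersymmetric C"
    and Q: "\<And>n A v. A ` {1..n + 2} \<subseteq> I \<Longrightarrow> qsum C A [1..<Suc n] (n + 1) (n + 2) v = qsum C A [1..<Suc n] (n + 2) (n + 1) v"
  shows "flat I p sF (app (dpot C))" "flat I p sF (pencil I p sF (app (dpot C)) l)"
proof -
  note A = odd_function_linear_app[OF odd_form_dpot[OF C]]
  note o = super_linear_cp[OF A]
  let ?L = "component (app (dpot C))"
  have R: "?L c (?L a (cst v)) = scl (sg (p a) (p c)) (?L a (?L c (cst v)))" if ac: "a \<in> I" "c \<in> I" for a c v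
  proof -
    have "pdw w (?L c (?L a (cst v)) - scl (sg (p a) (p c)) (?L a (?L c (cst v)))) {#} = 0" if w: "set w \<subseteq> I" for w
    proof -
      define n where "n = length w"
      \<comment> \<open>The labelling spells \<open>w\<close> on the first \<open>n\<close>
        positions and puts the two components on the last two; the shift is needed because lists are
        indexed from 0.\<close>
      define A where "A i = (if i = n + 1 then c else if i = n + 2 then a else w ! (i - 1))" for i
      have mapA: "map A [1..<Suc n] = w" by (rule nth_equalityI) (auto simp: n_def A_def simp del: upt_Suc)
      have A: "A (n + 1) = c" "A (n + 2) = a" by (simp_all add: A_def)
      have sub: "A ` set [1..<Suc n] \<subseteq> I" using w mapA by (metis set_map)
      have "{1..n + 2} = set [1..<Suc n] \<union> {n + 1, n + 2}" by auto
      then have sub': "A ` {1..n + 2} \<subseteq> I" using sub A ac by auto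
      have "pdw (map A [1..<Suc n]) (?L (A (n + 1)) (?L (A (n + 2)) (cst v))) {#}
        = pdw (map A [1..<Suc n]) (scl (sg (p (A (n + 1))) (p (A (n + 2)))) (?L (A (n + 2)) (?L (A (n + 1)) (cst v)))) {#}"
      proof (rule commute_iff_qsum[THEN iffD1])
        show "super_linear (p a) (?L a)" for a by (rule o)
        show "C (as @ [a]) = taylor_coeff (?L a) as" if "set as \<subseteq> I" "a \<in> I" for as a
          using taylor_coeff_dpot[OF C that(2,1)] by simp
        show "qsum C A [1..<Suc n] (n + 1) (n + 2) v = qsum C A [1..<Suc n] (n + 2) (n + 1) v"
          by (rule Q[OF sub'])
      qed (use sub A ac in simp_all)
      then show ?thesis unfolding A mapA by (simp add: pdw.diff sg_commute)
    qed
    then have "?L c (?L a (cst v)) - scl (sg (p a) (p c)) (?L a (?L c (cst v))) = 0"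
      by (intro taylor diff_S scl_S super_linearD(1)[OF o] cst_S)
    then show ?thesis by simp
  qed
  show "flat I p sF (app (dpot C))" by (rule flat_of_commuting[OF A R])
  have "pd c (?L a (cst v)) = scl (sg (p a) (p c)) (pd a (?L c (cst v)))" if "a \<in> I" "c \<in> I" for a c v
    using that C by (simp add: component_dpot_cst pd_commute[OF pot_S, of c a] sg_commute)
  then show "flat I p sF (pencil I p sF (app (dpot C)) l)"
    using flat_pencil_iff[OF A] R by blast
qed

section \<open>The Taylor system of a flat pencil\<close>

lemma forms_part_cst: "v \<in> F q \<Longrightarrow> cst v \<in> forms_part I p 0 F q"
  using cst_S[of v] subspace_0[OF subspace_part] by (auto simp: forms_part_def cst_def)

lemma forms_part_pd: "s \<in> forms_part I p 0 F q \<Longrightarrow> pd a s \<in> forms_part I p 0 F (q \<noteq> p a)"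
proof -
  assume s: "s \<in> forms_part I p 0 F q"
  have "pd a s N \<in> F ((q \<noteq> p a) \<noteq> mon_parity p N)" for N
  proof -
    have "s (add_mset (X a) N) \<in> F (q \<noteq> mon_parity p (add_mset (X a) N))" using s unfolding forms_part_def by blast
    moreover have "(q \<noteq> mon_parity p (add_mset (X a) N)) = ((q \<noteq> p a) \<noteq> mon_parity p N)" by auto
    ultimately show ?thesis unfolding form_partial_def using subspace_scale[OF subspace_part] by simp
  qed
  then show ?thesis using s pd_S[of s a] by (simp add: forms_part_def)
qed

lemma forms_part_D_coeff: "s \<in> forms_part I p 1 F (\<not> q) \<Longrightarrow> D_coeff p sF a s \<in> forms_part I p 0 F (q \<noteq> p a)"
proof -
  assume s: "s \<in> forms_part I p 1 F (\<not> q)"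
  have "D_coeff p sF a s N \<in> F ((q \<noteq> p a) \<noteq> mon_parity p N)" for N
  proof -
    have "s (add_mset (D a) N) \<in> F ((\<not> q) \<noteq> mon_parity p (add_mset (D a) N))" using s unfolding forms_part_def by blast
    moreover have "((\<not> q) \<noteq> mon_parity p (add_mset (D a) N)) = ((q \<noteq> p a) \<noteq> mon_parity p N)" by auto
    ultimately show ?thesis unfolding D_coeff_def
      using subspace_scale[OF subspace_part] subspace_0[OF subspace_part] by simp
  qed
  then show ?thesis using s D_coeff_S[of s a] by (simp add: forms_part_def)
qed

lemma forms_part_pdw: "s \<in> forms_part I p 0 F q \<Longrightarrow> pdw u s \<in> forms_part I p 0 F (q \<noteq> lpar p u)"
proof (induction u)
  case (Cons a u)
  have "((q \<noteq> lpar p u) \<noteq> p a) = (q \<noteq> lpar p (a # u))" by auto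
  then show ?case using forms_part_pd[OF Cons.IH[OF Cons.prems], of a] by simp
qed simp

context
  fixes A assumes A: "odd_function_linear I p sF F A"
    and flat: "\<And>l. flat I p sF (pencil I p sF A l)"
begin

text \<open>The last letter names the component and the others the derivatives, so the values are
  meaningful on nonempty words.\<close>

definition taylor_sys :: "'i list \<Rightarrow> 'f \<Rightarrow> 'f" where
  "taylor_sys as = taylor_coeff (component A (last as)) (butlast as)"

lemma taylor_sys_snoc: "taylor_sys (u @ [a]) = taylor_coeff (component A a) u"
  by (simp add: taylor_sys_def)

lemma flat_components:
  assumes "a \<in> I" "c \<in> I"
  shows "pd c (component A a (cst v)) = scl (sg (p c) (p a)) (pd a (component A c (cst v)))"
    "component A c (component A a (cst v)) = scl (sg (p c) (p a)) (component A a (component A c (cst v)))"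
  unfolding sg_commute[of "p c" "p a"]
  using flat_pencil_iff[OF A, THEN iffD1, OF allI[OF flat]] assms by blast+

text \<open>The exchange of the last two letters is the linear condition of flatness; an exchange
  further left concerns derivatives only, and these supercommute.\<close>

lemma supersymmetric_sys: "supersymmetric taylor_sys"
  unfolding supersymmetric_def
proof (intro conjI allI impI)
  note o = super_linear_cp[OF A]
  have cst_add: "cst (x + y) = cst x + cst y" and cst_scl: "cst (sF c x) = scl c (cst x)" for x y c
    by (auto simp: cst_def scl_def fun_eq_iff)
  fix as assume as: "as \<noteq> []" "set as \<subseteq> I"
  obtain u a where ua: "as = u @ [a]" using as(1) by (metis append_butlast_last_id)
  have "taylor_coeff (component A a) u \<in> endo_part sF F (lpar p as)"
    unfolding endo_part_iff endo_iff
  proof (intro conjI allI ballI)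
    fix x y c
    show "taylor_coeff (component A a) u (x + y) = taylor_coeff (component A a) u x + taylor_coeff (component A a) u y"
      by (simp add: taylor_coeff_def cst_add super_linearD[OF o] pdw.add)
    have "taylor_coeff (component A a) u (sF c x) = scl c (pdw u (component A a (cst x))) {#}"
      by (simp add: taylor_coeff_def cst_scl super_linearD[OF o] pdw.scale)
    then show "taylor_coeff (component A a) u (sF c x) = sF c (taylor_coeff (component A a) u x)"
      by (simp add: taylor_coeff_def scl_def)
  next
    fix e v assume v: "v \<in> F e"
    have "pdw u (component A a (cst v)) \<in> forms_part I p 0 F ((e \<noteq> p a) \<noteq> lpar p u)"
      unfolding component_def
      by (intro forms_part_pdw forms_part_D_coeff odd_function_linearD(5)[OF A] cst_S forms_part_cst v)
    then have "pdw u (component A a (cst v)) {#} \<in> F ((e \<noteq> p a) \<noteq> lpar p u)"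
      unfolding forms_part_def by (auto dest!: spec[of _ "{#}"])
    moreover have "((e \<noteq> p a) \<noteq> lpar p u) = (e \<noteq> lpar p as)" by (auto simp: ua)
    ultimately show "taylor_coeff (component A a) u v \<in> F (e \<noteq> lpar p as)" by (simp add: taylor_coeff_def)
  qed
  then show "taylor_sys as \<in> endo_part sF F (lpar p as)" by (simp add: ua taylor_sys_snoc)
next
  note o = super_linear_cp[OF A]
  fix u a b w x assume I: "set (u @ a # b # w) \<subseteq> I"
  show "taylor_sys (u @ a # b # w) x = sF (sg (p a) (p b)) (taylor_sys (u @ b # a # w) x)"
  proof (cases w rule: rev_cases)
    case Nil
    have "pd a (component A b (cst x)) = scl (sg (p a) (p b)) (pd b (component A a (cst x)))"
      using I by (intro flat_components) auto
    then show ?thesis using Nil taylor_sys_snoc[of "u @ [a]" b] taylor_sys_snoc[of "u @ [b]" a]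
      by (simp add: taylor_coeff_def pdw.scale) (simp add: scl_def)
  next
    case (snoc w' c)
    have "component A c (cst x) \<in> S" by (rule super_linearD(1)[OF o cst_S])
    then show ?thesis using snoc taylor_sys_snoc[of "u @ a # b # w'" c] taylor_sys_snoc[of "u @ b # a # w'" c]
      by (simp add: taylor_coeff_def pdw.scale pd_commute[of _ a b]) (simp add: scl_def)
  qed
qed

lemma qsum_sys:
  fixes J :: "'n::linorder \<Rightarrow> 'i"
  assumes "distinct (u @ [i, j])" "J ` set u \<subseteq> I" "J i \<in> I" "J j \<in> I"
  shows "qsum taylor_sys J u i j v = qsum taylor_sys J u j i v"
proof (rule commute_iff_qsum[THEN iffD2, OF _ _ assms])
  show "super_linear (p a) (component A a)" for a by (rule super_linear_cp[OF A])
  have "component A (J i) (component A (J j) (cst v)) = scl (sg (p (J i)) (p (J j))) (component A (J j) (component A (J i) (cst v)))"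
    by (rule flat_components(2)[OF assms(4,3)])
  then show "pdw (map J u) (component A (J i) (component A (J j) (cst v))) {#}
     = pdw (map J u) (scl (sg (p (J i)) (p (J j))) (component A (J j) (component A (J i) (cst v)))) {#}" by simp
qed (simp add: taylor_sys_snoc)

text \<open>On constants the components of both operators have the same Taylor coefficients;
  function-linearity carries the equality to all sections.\<close>

lemma app_dpot_sys: "s \<in> S \<Longrightarrow> app (dpot taylor_sys) s = A s"
proof -
  note o = super_linear_cp[OF A]
  note A' = odd_function_linear_app[OF odd_form_dpot[OF supersymmetric_sys]]
  note o' = super_linear_cp[OF A']
  assume s: "s \<in> S"
  show ?thesis
  proof (rule S1_eqI)
    show "app (dpot taylor_sys) s \<in> S1" "A s \<in> S1" using odd_function_linearD(1)[OF A' s] odd_function_linearD(1)[OF A s] .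
    fix a assume a: "a \<in> I"
    have "component (app (dpot taylor_sys)) a (cst v) - component A a (cst v) = 0" for v
    proof (rule taylor)
      show "component (app (dpot taylor_sys)) a (cst v) - component A a (cst v) \<in> S"
        by (intro diff_S super_linearD(1)[OF o] super_linearD(1)[OF o'] cst_S)
      fix w assume "set w \<subseteq> I"
      from taylor_coeff_dpot[OF supersymmetric_sys a this]
      show "pdw w (component (app (dpot taylor_sys)) a (cst v) - component A a (cst v)) {#} = 0"
        by (simp add: taylor_sys_snoc taylor_coeff_def pdw.diff fun_eq_iff)
    qed
    then have "component (app (dpot taylor_sys)) a s = component A a s" by (intro super_linear_eqI[OF o' o _ s]) simp
    then show "D_coeff p sF a (app (dpot taylor_sys) s) = D_coeff p sF a (A s)" by (simp add: component_def)
  qed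
qed

end

lemma pot_cong:
  assumes "\<And>as. as \<noteq> [] \<Longrightarrow> set as \<subseteq> I \<Longrightarrow> C as = C' as"
  shows "pot C = pot C'"
  unfolding pot_def by (intro ext sum.cong refl) (subst assms, auto)

end

section \<open>Linear extension\<close>

definition pm_lift :: "('k::field \<Rightarrow> 'v::ab_group_add \<Rightarrow> 'v) \<Rightarrow> ('a \<Rightarrow> 'v) \<Rightarrow> ('a \<Rightarrow>\<^sub>0 'k) \<Rightarrow> 'v" where
  "pm_lift sc g x = (\<Sum>a\<in>Poly_Mapping.keys x. sc (Poly_Mapping.lookup x a) (g a))"

lemma pm_lift_superset:
  assumes "vector_space sc" "finite A" "Poly_Mapping.keys x \<subseteq> A"
  shows "pm_lift sc g x = (\<Sum>a\<in>A. sc (Poly_Mapping.lookup x a) (g a))"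
proof -
  interpret vector_space sc by fact
  show ?thesis unfolding pm_lift_def using assms(2,3)
    by (intro sum.mono_neutral_left) (auto simp: in_keys_iff)
qed

lemma linear_pm_lift:
  assumes "vector_space sc"
  shows "Vector_Spaces.linear pm_scale sc (pm_lift sc (g :: 'a \<Rightarrow> 'v::ab_group_add) :: ('a \<Rightarrow>\<^sub>0 'k::field) \<Rightarrow> 'v)"
proof -
  interpret vector_space sc by fact
  show ?thesis
  proof (unfold_locales)
    fix x y :: "'a \<Rightarrow>\<^sub>0 'k"
    let ?A = "Poly_Mapping.keys x \<union> Poly_Mapping.keys y"
    have "finite ?A" "Poly_Mapping.keys (x + y) \<subseteq> ?A" by (auto simp: Poly_Mapping.keys_add)
    then show "pm_lift sc g (x + y) = pm_lift sc g x + pm_lift sc g y"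
      by (simp add: pm_lift_superset[OF assms, of ?A] lookup_add scale_left_distrib sum.distrib)
  next
    fix c and x :: "'a \<Rightarrow>\<^sub>0 'k"
    have "Poly_Mapping.keys (pm_scale c x) \<subseteq> Poly_Mapping.keys x" by (auto simp: in_keys_iff)
    then show "pm_lift sc g (pm_scale c x) = sc c (pm_lift sc g x)"
      by (simp add: pm_lift_superset[OF assms, of "Poly_Mapping.keys x"] scale_sum_right)
  qed
qed

lemma pm_lift_single: "vector_space sc \<Longrightarrow> pm_lift sc g (Poly_Mapping.single a c) = sc c (g a)"
  by (subst pm_lift_superset[of _ "{a}"]) auto

lemma pm_lift_push:
  assumes "vector_space sc"
  shows "pm_lift sc g (pm_push f x) = pm_lift sc (\<lambda>a. g (f a)) x"
proof -
  interpret l: Vector_Spaces.linear pm_scale sc "pm_lift sc g" by (rule linear_pm_lift[OF assms])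
  show ?thesis
    unfolding pm_push_def l.sum by (subst pm_lift_single[OF assms]) (simp add: pm_lift_def)
qed

lemma abs_rep_hstar: "abs_hstar (rep_hstar h) = h"
  using Quotient3_hstar by (rule Quotient3_abs_rep)

global_interpretation hs: vector_space "hscale :: 'k::field \<Rightarrow> 'k hstar \<Rightarrow> _"
proof unfold_locales
  fix a b :: 'k and x y :: "'k hstar"
  obtain x' y' where xy: "x = abs_hstar x'" "y = abs_hstar y'" by (metis abs_rep_hstar)
  show "hscale a (x + y) = hscale a x + hscale a y"
    by (simp add: xy plus_hstar.abs_eq hscale.abs_eq pm.scale_right_distrib)
  show "hscale (a + b) x = hscale a x + hscale b x"
    by (simp add: xy plus_hstar.abs_eq hscale.abs_eq pm.scale_left_distrib)
  show "hscale a (hscale b x) = hscale (a * b) x" "hscale 1 x = x"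
    by (simp_all add: xy hscale.abs_eq)
qed

lemma hmult_add_left: "hmult (h + h') g = hmult h g + hmult h' g"
  and hmult_add_right: "hmult g (h + h') = hmult g h + hmult g h'"
  and hmult_scale_left: "hmult (hscale c h) g = hscale c (hmult h g)"
  and hmult_scale_right: "hmult g (hscale c h) = hscale c (hmult g h)"
proof -
  interpret l: Vector_Spaces.linear pm_scale pm_scale "\<lambda>z. pm_bilin cup z u" for u :: "opart \<Rightarrow>\<^sub>0 'a"
    by (rule linear_pm_bilin_left)
  interpret r: Vector_Spaces.linear pm_scale pm_scale "pm_bilin cup u" for u :: "opart \<Rightarrow>\<^sub>0 'a"
    by (rule linear_pm_bilin_right)
  obtain a b d where "h = abs_hstar a" "h' = abs_hstar b" "g = abs_hstar d" by (metis abs_rep_hstar)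
  then show "hmult (h + h') g = hmult h g + hmult h' g" "hmult g (h + h') = hmult g h + hmult g h'"
    "hmult (hscale c h) g = hscale c (hmult h g)" "hmult g (hscale c h) = hscale c (hmult g h)"
    by (simp_all add: plus_hstar.abs_eq hscale.abs_eq hmult.abs_eq l.add r.add l.scale r.scale)
qed

lemma hperm_add: "hperm s (h + h') = hperm s h + hperm s h'"
  and hperm_scale: "hperm s (hscale c h) = hscale c (hperm s h)"
proof -
  obtain a b where "h = abs_hstar a" "h' = abs_hstar b" by (metis abs_rep_hstar)
  then show "hperm s (h + h') = hperm s h + hperm s h'" "hperm s (hscale c h) = hscale c (hperm s h)"
    by (simp_all add: plus_hstar.abs_eq hscale.abs_eq hperm.abs_eq pm_push_add pm_push_scale)
qed

text \<open>The choice of a representative is harmless as soon as all relators are sent to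
  0.\<close>

definition hs_lift :: "('k::field \<Rightarrow> 'v::ab_group_add \<Rightarrow> 'v) \<Rightarrow> (opart \<Rightarrow> 'v) \<Rightarrow> 'k hstar \<Rightarrow> 'v" where
  "hs_lift sc g h = pm_lift sc g (rep_hstar h)"

lemma hs_lift_abs:
  assumes "vector_space sc" "\<And>r. r \<in> relators \<Longrightarrow> pm_lift sc g r = 0"
  shows "hs_lift sc g (abs_hstar x) = pm_lift sc g x"
proof -
  interpret vector_space sc by fact
  interpret l: Vector_Spaces.linear pm_scale sc "pm_lift sc g" by (rule linear_pm_lift[OF assms(1)])
  have "rep_hstar (abs_hstar x) - x \<in> pm.span relators"
    using Quotient3_hstar by (rule rep_abs_rsp_left) (simp add: pm.span_zero)
  moreover have "pm_lift sc g y = 0" if "y \<in> pm.span relators" for y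
    using that by (rule l.eq_0_on_span[rotated]) (rule assms(2))
  ultimately have "pm_lift sc g (rep_hstar (abs_hstar x) - x) = 0" by blast
  then show ?thesis by (simp add: hs_lift_def l.diff)
qed

lemma
  assumes "vector_space sc" "\<And>r. r \<in> relators \<Longrightarrow> pm_lift sc g r = 0"
  shows hs_lift_add: "hs_lift sc g (h + h') = hs_lift sc g h + hs_lift sc g h'"
    and hs_lift_scale: "hs_lift sc g (hscale c h) = sc c (hs_lift sc g h)"
    and hs_lift_mu: "hs_lift sc g (mu \<tau>) = g (Abs_opart \<tau>)"
proof -
  interpret vector_space sc by fact
  interpret l: Vector_Spaces.linear pm_scale sc "pm_lift sc g" by (rule linear_pm_lift[OF assms(1)])
  note a = hs_lift_abs[OF assms]
  obtain x y where "h = abs_hstar x" "h' = abs_hstar y" by (metis abs_rep_hstar)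
  then show "hs_lift sc g (h + h') = hs_lift sc g h + hs_lift sc g h'" "hs_lift sc g (hscale c h) = sc c (hs_lift sc g h)"
    by (simp_all add: plus_hstar.abs_eq hscale.abs_eq a l.add l.scale)
  show "hs_lift sc g (mu \<tau>) = g (Abs_opart \<tau>)"
    by (simp add: mu_def a pm_lift_single[OF assms(1)])
qed

section \<open>Products over the parts of a partition\<close>

lemma ordered_partition_enum:
  assumes "ordered_partition B (map set us)" "list_all distinct us"
  shows "distinct (concat us)" "set (concat us) = B"
proof -
  show "set (concat us) = B" using assms(1) by (simp add: ordered_partition_def)
  have "sorted_wrt disjnt (map set us)" using assms(1) by (simp add: ordered_partition_def)
  then show "distinct (concat us)" using assms(2)
  proof (induction us)
    case (Cons u us)
    then have "set u \<inter> set (concat us) = {}" by (auto simp: disjnt_def)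
    then show ?case using Cons by simp
  qed simp
qed

lemma Rep_Abs_opart: "1 \<le> n \<Longrightarrow> ordered_partition {1..n} \<tau> \<Longrightarrow> Rep_opart (Abs_opart \<tau>) = \<tau>"
  by (rule Abs_opart_inverse) blast

lemma ordered_partition_finite:
  "ordered_partition {1..n} \<tau> \<Longrightarrow> B \<in> set \<tau> \<Longrightarrow> finite B \<and> B \<noteq> {} \<and> B \<subseteq> {1..n}"
  unfolding ordered_partition_def by (metis Sup_upper finite_atLeastAtMost finite_subset)

lemma map_set_sorted_list:
  assumes "ordered_partition {1..n} \<tau>"
  shows "map set (map sorted_list_of_set \<tau>) = \<tau>" "list_all distinct (map sorted_list_of_set \<tau>)"
proof -
  have "map set (map sorted_list_of_set \<tau>) = map id \<tau>"
    unfolding map_map by (rule map_cong) (use ordered_partition_finite[OF assms] in auto)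
  then show "map set (map sorted_list_of_set \<tau>) = \<tau>" by simp
qed (simp add: list_all_iff)

context sections
begin

definition scE :: "'k \<Rightarrow> ('f \<Rightarrow> 'f) \<Rightarrow> ('f \<Rightarrow> 'f)" where
  "scE c \<phi> = (\<lambda>v. sF c (\<phi> v))"

sublocale E: vector_space scE
  by unfold_locales (auto simp: scE_def fun_eq_iff scale_right_distrib scale_left_distrib)

text \<open>Parts are given as words of positions, because \<open>C\<close> takes words; the sign in
  \<open>sprod\<close> removes the dependence on the order within each word.\<close>

definition pprod :: "('i list \<Rightarrow> 'f \<Rightarrow> 'f) \<Rightarrow> (nat \<Rightarrow> 'i) \<Rightarrow> nat list list \<Rightarrow> 'f \<Rightarrow> 'f" where
  "pprod C A us = foldr (\<lambda>u f. C (map A u) \<circ> f) us id"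

lemma pprod_simps [simp]: "pprod C A [] = id" "pprod C A (u # us) = C (map A u) \<circ> pprod C A us"
  by (simp_all add: pprod_def)

lemma pprod_append: "pprod C A (us @ us') = pprod C A us \<circ> pprod C A us'"
  by (induction us) auto

definition sprod :: "('i list \<Rightarrow> 'f \<Rightarrow> 'f) \<Rightarrow> (nat \<Rightarrow> 'i) \<Rightarrow> nat list list \<Rightarrow> 'f \<Rightarrow> 'f" where
  "sprod C A us = scE (lsgn (p \<circ> A) (concat us)) (pprod C A us)"

definition valid :: "(nat \<Rightarrow> 'i) \<Rightarrow> nat list list \<Rightarrow> bool" where
  "valid A us \<longleftrightarrow> [] \<notin> set us \<and> A ` set (concat us) \<subseteq> I"

lemma valid_simps [simp]: "valid A []" "valid A (u # us) \<longleftrightarrow> u \<noteq> [] \<and> A ` set u \<subseteq> I \<and> valid A us"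
  "valid A (us @ us') \<longleftrightarrow> valid A us \<and> valid A us'"
  by (auto simp: valid_def simp del: set_concat)

lemma pprod_endo_part:
  assumes "supersymmetric C" "valid A us"
  shows "pprod C A us \<in> endo_part sF F (lpar (p \<circ> A) (concat us))"
  using assms(2)
proof (induction us)
  case Nil
  show ?case by (auto simp: endo_part_iff endo_iff)
next
  case (Cons u us)
  have "C (map A u) \<in> endo_part sF F (lpar p (map A u))" using assms(1) Cons.prems by (simp add: supersymmetric_def)
  moreover have "lpar p (map A u) = lpar (p \<circ> A) u" by (simp add: lpar_def filter_map)
  moreover have "pprod C A us \<in> endo_part sF F (lpar (p \<circ> A) (concat us))" using Cons.prems by (intro Cons.IH) simp
  ultimately have "C (map A u) \<circ> pprod C A us \<in> endo_part sF F (lpar (p \<circ> A) u \<noteq> lpar (p \<circ> A) (concat us))"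
    by (intro endo_part_comp) (simp_all only:)
  then show ?case by (simp only: pprod_simps concat.simps lpar_simps)
qed

lemma pprod_scale: "supersymmetric C \<Longrightarrow> valid A us \<Longrightarrow> pprod C A us (sF c v) = sF c (pprod C A us v)"
  using endoD(2)[OF vector_space_axioms endo_part_endo[OF pprod_endo_part]] by blast

text \<open>An exchange inside one block changes the sign of the concatenated word and the value of
  \<open>C\<close> by the same factor.\<close>

lemma sprod_cong_block:
  assumes C: "supersymmetric C" and us: "valid A (us @ u # us')" and u': "mset u = mset u'"
  shows "sprod C A (us @ u # us') = sprod C A (us @ u' # us')"
proof (rule ext)
  fix v
  show "sprod C A (us @ u # us') v = sprod C A (us @ u' # us') v"
  proof (rule swap_invariant[where M = "mset u" and f = "\<lambda>u. sprod C A (us @ u # us') v"])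
    fix x a b y assume m: "mset (x @ a # b # y) = mset u"
    have "A ` set u \<subseteq> I" using us by simp
    then have "set (map A x @ A a # A b # map A y) \<subseteq> I" using mset_eq_setD[OF m] by auto
    then have "C (map A x @ A a # A b # map A y) w = sF (sg (p (A a)) (p (A b))) (C (map A x @ A b # A a # map A y) w)" for w
      using C unfolding supersymmetric_def by blast
    then have 1: "C (map A (x @ a # b # y)) w = sF (sg (p (A a)) (p (A b))) (C (map A (x @ b # a # y)) w)" for w
      by simp
    have 2: "lsgn (p \<circ> A) (concat (us @ (x @ a # b # y) # us'))
      = sg (p (A a)) (p (A b)) * (lsgn (p \<circ> A) (concat (us @ (x @ b # a # y) # us')) :: 'k)"
      using lsgn_swap[of "p \<circ> A" "concat us @ x" a b "y @ concat us'"] by simp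
    have v: "valid A us" using us by simp
    show "sprod C A (us @ (x @ a # b # y) # us') v = sprod C A (us @ (x @ b # a # y) # us') v"
      unfolding sprod_def scE_def 2 pprod_append pprod_simps comp_apply 1 pprod_scale[OF C v]
      by (simp add: mult.commute)
  qed (use u' in simp_all)
qed

lemma sprod_cong:
  assumes "supersymmetric C" "list_all2 (\<lambda>u u'. mset u = mset u') us us'" "valid A us"
  shows "sprod C A us = sprod C A us'"
proof -
  have "sprod C A (ws @ us) = sprod C A (ws @ us')" if "valid A ws" for ws
    using assms(2,3) that
  proof (induction us us' arbitrary: ws rule: list_all2_induct)
    case (Cons u us u' us')
    have u': "u' \<noteq> []" "A ` set u' \<subseteq> I" using Cons mset_eq_setD[of u u'] by auto
    have "sprod C A (ws @ u # us) = sprod C A (ws @ u' # us)"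
      using Cons by (intro sprod_cong_block assms(1)) auto
    also have "\<dots> = sprod C A ((ws @ [u']) @ us)" by simp
    also have "\<dots> = sprod C A ((ws @ [u']) @ us')"
      by (rule Cons.IH) (use Cons.prems u' in auto)
    finally show ?case by simp
  qed simp
  from this[of "[]"] show ?thesis by simp
qed

text \<open>The value of a partition symbol on the basis tensor with indices \<open>as\<close>. The
  value 0 for partitions of another size lets relators of all sizes be treated at once.\<close>

definition part_val :: "('i list \<Rightarrow> 'f \<Rightarrow> 'f) \<Rightarrow> 'i list \<Rightarrow> opart \<Rightarrow> 'f \<Rightarrow> 'f" where
  "part_val C as \<sigma> = (if npoints (Rep_opart \<sigma>) = length as
     then sprod C (\<lambda>i. as ! (i - 1)) (map sorted_list_of_set (Rep_opart \<sigma>)) else 0)"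

lemma valid_enum:
  assumes "ordered_partition {1..length as} (map set us)" "set as \<subseteq> I"
  shows "valid (\<lambda>i. as ! (i - 1)) us"
proof -
  have "[] \<notin> set us" using assms(1) by (force simp: ordered_partition_def)
  moreover have "set (concat us) = {1..length as}" using assms(1) by (simp add: ordered_partition_def)
  then have "(\<lambda>i. as ! (i - 1)) ` set (concat us) \<subseteq> I"
    using assms(2) by (auto simp del: set_concat intro!: subsetD[OF assms(2)] nth_mem)
  ultimately show ?thesis by (simp add: valid_def)
qed

lemma part_val_enum:
  assumes C: "supersymmetric C" and us: "ordered_partition {1..length as} (map set us)" "list_all distinct us"
    and as: "as \<noteq> []" "set as \<subseteq> I"
  shows "part_val C as (Abs_opart (map set us)) = sprod C (\<lambda>i. as ! (i - 1)) us"
proof -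
  have n: "1 \<le> length as" using as(1) by (cases as) auto
  have "list_all2 (\<lambda>u u'. mset u = mset u') (map sorted_list_of_set (map set us)) us"
    unfolding list_all2_conv_all_nth
  proof (intro conjI allI impI)
    fix i assume "i < length (map sorted_list_of_set (map set us))"
    then have "distinct (us ! i)" using us(2) by (simp add: list_all_iff)
    then show "mset (map sorted_list_of_set (map set us) ! i) = mset (us ! i)"
      using \<open>i < _\<close> by (simp add: set_eq_iff_mset_eq_distinct[symmetric])
  qed simp
  moreover have "valid (\<lambda>i. as ! (i - 1)) (map sorted_list_of_set (map set us))"
    by (rule valid_enum[OF _ as(2)]) (simp only: map_set_sorted_list(1)[OF us(1)] us(1))
  ultimately have "sprod C (\<lambda>i. as ! (i - 1)) (map sorted_list_of_set (map set us)) = sprod C (\<lambda>i. as ! (i - 1)) us"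
    by (intro sprod_cong C)
  then show ?thesis using Rep_Abs_opart[OF n us(1)] npoints_eq[OF us(1)] by (simp add: part_val_def)
qed

lemma opart_enum:
  obtains us n where "\<sigma> = Abs_opart (map set us)" "1 \<le> n" "ordered_partition {1..n} (map set us)" "list_all distinct us"
    "npoints (Rep_opart \<sigma>) = n"
proof -
  obtain \<tau> n where \<tau>: "\<sigma> = Abs_opart \<tau>" "1 \<le> n" "ordered_partition {1..n} \<tau>" by (rule opartE)
  then show thesis using that[of "map sorted_list_of_set \<tau>" n] map_set_sorted_list[OF \<tau>(3)]
      Rep_Abs_opart[OF \<tau>(2,3)] npoints_eq[OF \<tau>(3)] by simp
qed

lemma part_val_mismatch: "npoints (Rep_opart \<sigma>) \<noteq> length as \<Longrightarrow> part_val C as \<sigma> = 0"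
  by (simp add: part_val_def)

lemma part_val_endo_part:
  assumes C: "supersymmetric C" and as: "as \<noteq> []" "set as \<subseteq> I"
  shows "part_val C as \<sigma> \<in> endo_part sF F (lpar p as)"
proof (cases "npoints (Rep_opart \<sigma>) = length as")
  case True
  obtain us n where us: "\<sigma> = Abs_opart (map set us)" "ordered_partition {1..n} (map set us)" "list_all distinct us"
    "npoints (Rep_opart \<sigma>) = n" using opart_enum by metis
  have n: "n = length as" using us(4) True by simp
  let ?A = "\<lambda>i. as ! (i - 1)"
  have "mset (concat us) = mset [1..<Suc (length as)]"
    using ordered_partition_enum[OF us(2,3)] by (intro set_eq_iff_mset_eq_distinct[THEN iffD1]) (auto simp: n)
  then have "mset (map ?A (concat us)) = mset (map ?A [1..<Suc (length as)])" by (simp only: mset_map)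
  also have "map ?A [1..<Suc (length as)] = as" by (rule nth_equalityI) (auto simp del: upt_Suc)
  finally have "lpar p (map ?A (concat us)) = lpar p as" by (metis lpar_def mset_filter size_mset)
  moreover have "lpar p (map ?A (concat us)) = lpar (p \<circ> ?A) (concat us)" unfolding lpar_def filter_map length_map ..
  ultimately show ?thesis
    using pprod_endo_part[OF C valid_enum[OF us(2)[unfolded n] as(2)]] part_val_enum[OF C us(2)[unfolded n] us(3) as]
    unfolding us(1) sprod_def scE_def by (simp only: endo_part_scale)
next
  case False
  then show ?thesis by (simp add: part_val_mismatch endo_part_zero zero_fun_def)
qed

text \<open>Relabelling the positions leaves the composed endomorphisms alone and changes only the
  sign of the concatenated enumeration, which \<open>lsgn_perm\<close> evaluates.\<close>

lemma part_val_perm: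
  assumes C: "supersymmetric C" and as: "as \<noteq> []" "set as \<subseteq> I" and s: "s permutes {1..length as}"
  shows "part_val C (perm_list s as) (perm s \<sigma>) = scE (perm_sign s (map p as)) (part_val C as \<sigma>)"
proof -
  obtain us n where us: "\<sigma> = Abs_opart (map set us)" "1 \<le> n" "ordered_partition {1..n} (map set us)" "list_all distinct us"
    "npoints (Rep_opart \<sigma>) = n" using opart_enum by metis
  have len: "length (perm_list s as) = length as" by (simp add: perm_list_def del: upt_Suc)
  have p: "perm s \<sigma> = Abs_opart (raw_perm s (map set us))" unfolding us(1) by (rule Abs_perm[OF us(3,2)])
  have op: "ordered_partition {1..n} (raw_perm s (map set us))" by (rule ordered_partition_raw_perm[OF us(3)])
  have np: "npoints (Rep_opart (perm s \<sigma>)) = n" unfolding p by (simp add: Rep_Abs_opart[OF us(2) op] npoints_eq[OF op])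
  show ?thesis
  proof (cases "n = length as")
    case False
    then show ?thesis using us(5) np len by (simp add: part_val_mismatch)
  next
    case n: True
    let ?A = "\<lambda>i. as ! (i - 1)"
    let ?A' = "\<lambda>i. perm_list s as ! (i - 1)"
    have inj: "inj s" using s by (rule permutes_inj)
    have A': "?A' (s i) = ?A i" if "i \<in> {1..n}" for i
    proof -
      have "s i \<in> {1..n}" using permutes_in_image[OF s, of i] that n by simp
      then have "s i - Suc 0 < length as" "Suc (s i - Suc 0) = s i" by (auto simp: n)
      then show ?thesis using permutes_inverses(2)[OF s, of i] by (simp add: perm_list_def del: upt_Suc)
    qed
    have cu: "set (concat us) = {1..n}" "distinct (concat us)" using ordered_partition_enum[OF us(3,4)] by auto
    have rp: "raw_perm s (map set us) = map set (map (map s) us)"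
      using s us(3) by (simp add: raw_perm_def n ordered_partition_def)
    have sub: "set (perm_list s as) \<subseteq> I"
    proof
      fix x assume "x \<in> set (perm_list s as)"
      moreover have "set (perm_list s as) = (\<lambda>j. as ! (inv s j - 1)) ` {1..length as}"
        by (simp add: perm_list_def atLeastLessThanSuc_atLeastAtMost del: upt_Suc)
      ultimately obtain j where j: "j \<in> {1..length as}" "x = as ! (inv s j - 1)" by blast
      have "inv s j \<in> {1..length as}" using permutes_in_image[OF permutes_inv[OF s]] j(1) by blast
      then show "x \<in> I" using j as(2) by (auto intro!: subsetD[OF as(2)] nth_mem)
    qed
    have d: "list_all distinct (map (map s) us)"
      using us(4) inj by (auto simp: list_all_iff distinct_map intro: inj_on_subset)
    have "part_val C (perm_list s as) (perm s \<sigma>) = sprod C ?A' (map (map s) us)"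
      unfolding p rp
    proof (rule part_val_enum[OF C _ d _ sub])
      show "ordered_partition {1..length (perm_list s as)} (map set (map (map s) us))"
        using op unfolding rp len n .
      show "perm_list s as \<noteq> []" using as(1) len by auto
    qed
    also have "\<dots> = scE (lsgn (p \<circ> ?A') (map s (concat us))) (pprod C ?A us)"
    proof -
      have "map ?A' (map s u) = map ?A u" if "u \<in> set us" for u
        unfolding map_map comp_def
      proof (rule map_cong[OF refl])
        fix x assume "x \<in> set u"
        then have "x \<in> set (concat us)" using that by auto
        then show "?A' (s x) = ?A x" unfolding cu by (rule A')
      qed
      then have "pprod C ?A' (map (map s) us) = pprod C ?A us"
        unfolding pprod_def foldr_map by (intro foldr_cong refl) (simp only: comp_apply)
      then show ?thesis by (simp add: sprod_def map_concat)
    qed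
    also have "lsgn (p \<circ> ?A') (map s (concat us)) = perm_sign s (map p as) * (lsgn (p \<circ> ?A) (concat us) :: 'k)"
    proof (rule lsgn_perm)
      show "s permutes {1..n}" using s n by simp
      show "(p \<circ> ?A') (s i) = (p \<circ> ?A) i" if "i \<in> {1..n}" for i using A'[OF that] by simp
      show "(p \<circ> ?A) i = map p as ! (i - 1)" if "i \<in> {1..n}" for i using that n by auto
      show "length (map p as) = n" using n by simp
      show "mset (concat us) = mset [1..<Suc n]"
        using cu by (intro set_eq_iff_mset_eq_distinct[THEN iffD1]) auto
    qed
    also have "scE (perm_sign s (map p as) * lsgn (p \<circ> ?A) (concat us)) (pprod C ?A us)
       = scE (perm_sign s (map p as)) (sprod C ?A us)" by (simp add: sprod_def)
    also have "sprod C ?A us = part_val C as \<sigma>"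
      unfolding us(1) using us(3,4) as by (intro part_val_enum[symmetric] C) (auto simp: n)
    finally show ?thesis .
  qed
qed

text \<open>All positions of the second factor come after those of the first, so no inversions arise
  between them and the sign is a product.\<close>

lemma part_val_cup:
  assumes C: "supersymmetric C" and as: "as \<noteq> []" "set as \<subseteq> I" and bs: "bs \<noteq> []" "set bs \<subseteq> I"
    and \<tau>: "ordered_partition {1..length as} \<tau>" and \<sigma>: "ordered_partition {1..length bs} \<sigma>"
  shows "part_val C (as @ bs) (Abs_opart (raw_cup \<tau> \<sigma>)) = part_val C as (Abs_opart \<tau>) \<circ> part_val C bs (Abs_opart \<sigma>)"
proof -
  define us ws where "us = map sorted_list_of_set \<tau>" and "ws = map sorted_list_of_set \<sigma>"
  have u: "map set us = \<tau>" "list_all distinct us" unfolding us_def by (rule map_set_sorted_list[OF \<tau>])+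
  have w: "map set ws = \<sigma>" "list_all distinct ws" unfolding ws_def by (rule map_set_sorted_list[OF \<sigma>])+
  let ?n = "length as"
  let ?A = "\<lambda>i. as ! (i - 1)" and ?B = "\<lambda>i. bs ! (i - 1)" and ?AB = "\<lambda>i. (as @ bs) ! (i - 1)"
  let ?ws = "map (map ((+) ?n)) ws"
  have cu: "set (concat us) = {1..?n}" using ordered_partition_enum[of "{1..?n}" us] u \<tau> by simp
  have cw: "set (concat ws) = {1..length bs}" using ordered_partition_enum[of "{1..length bs}" ws] w \<sigma> by simp
  have AB1: "?AB i = ?A i" if "i \<in> {1..?n}" for i using that by (auto simp: nth_append)
  have AB2: "?AB (?n + i) = ?B i" if "i \<in> {1..length bs}" for i using that by (auto simp: nth_append)
  have "map ((`) ((+) ?n)) \<sigma> = map set ?ws" unfolding w(1)[symmetric] by simp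
  then have rc: "raw_cup \<tau> \<sigma> = map set (us @ ?ws)"
    by (simp add: raw_cup_def npoints_eq[OF \<tau>] u(1))
  have "list_all distinct (us @ ?ws)" using u w by (auto simp: list_all_iff distinct_map)
  moreover have "ordered_partition {1..length (as @ bs)} (map set (us @ ?ws))"
    using ordered_partition_raw_cup[OF \<tau> \<sigma>] unfolding rc by (simp only: length_append)
  ultimately have "part_val C (as @ bs) (Abs_opart (raw_cup \<tau> \<sigma>)) = sprod C ?AB (us @ ?ws)"
    unfolding rc using as bs by (intro part_val_enum C) simp_all
  also have "\<dots> = sprod C ?A us \<circ> sprod C ?B ws"
  proof -
    have "lsgn (p \<circ> ?AB) (concat (us @ ?ws)) = lsgn (p \<circ> ?AB) (concat us) * (lsgn (p \<circ> ?AB) (map ((+) ?n) (concat ws)) :: 'k)"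
      unfolding concat_append map_concat[symmetric]
      by (rule lsgn_less_append) (use cu cw in \<open>auto simp del: set_concat\<close>)
    also have "lsgn (p \<circ> ?AB) (map ((+) ?n) (concat ws)) = (lsgn (p \<circ> ?B) (concat ws) :: 'k)"
      by (rule lsgn_map) (use AB2 cw in \<open>auto simp del: set_concat\<close>)
    also have "lsgn (p \<circ> ?AB) (concat us) = (lsgn (p \<circ> ?A) (concat us) :: 'k)"
      using lsgn_map[of "concat us" id "p \<circ> ?AB" "p \<circ> ?A"] AB1 cu by (simp del: set_concat)
    finally have l: "lsgn (p \<circ> ?AB) (concat (us @ ?ws)) = lsgn (p \<circ> ?A) (concat us) * (lsgn (p \<circ> ?B) (concat ws) :: 'k)" .
    have "map ?AB u = map ?A u" if "u \<in> set us" for u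
    proof (rule map_cong[OF refl])
      fix x assume "x \<in> set u"
      then have "x \<in> set (concat us)" using that by auto
      then show "?AB x = ?A x" unfolding cu by (rule AB1)
    qed
    then have p1: "pprod C ?AB us = pprod C ?A us"
      unfolding pprod_def by (intro foldr_cong refl) (simp only:)
    have "map ?AB (map ((+) ?n) u) = map ?B u" if "u \<in> set ws" for u
      unfolding map_map comp_def
    proof (rule map_cong[OF refl])
      fix x assume "x \<in> set u"
      then have "x \<in> set (concat ws)" using that by auto
      then show "?AB (?n + x) = ?B x" unfolding cw by (rule AB2)
    qed
    then have p2: "pprod C ?AB ?ws = pprod C ?B ws"
      unfolding pprod_def foldr_map by (intro foldr_cong refl) (simp only: comp_apply)
    have "valid ?A us" by (rule valid_enum) (use u \<tau> as in auto)
    then show ?thesis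
      unfolding sprod_def l pprod_append p1 p2 by (auto simp: scE_def fun_eq_iff pprod_scale[OF C])
  qed
  also have "sprod C ?A us = part_val C as (Abs_opart \<tau>)"
    using part_val_enum[OF C, of as us] u \<tau> as by simp
  also have "sprod C ?B ws = part_val C bs (Abs_opart \<sigma>)"
    using part_val_enum[OF C, of bs ws] w \<sigma> bs by simp
  finally show ?thesis .
qed

lemma splits_bij:
  assumes "i \<in> B" "j \<in> B" "i \<noteq> j"
  shows "bij_betw (\<lambda>T. (insert i T, B - insert i T)) (Pow (B - {i, j})) (splits B i j)"
proof (rule bij_betwI[where g = "\<lambda>\<alpha>. fst \<alpha> - {i}"])
  show "(\<lambda>T. (insert i T, B - insert i T)) \<in> Pow (B - {i, j}) \<rightarrow> splits B i j"
    using assms by (auto simp: splits_def ordered_partition_def disjnt_def)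
  show "(\<lambda>\<alpha>. fst \<alpha> - {i}) \<in> splits B i j \<rightarrow> Pow (B - {i, j})"
    by (auto simp: splits_def ordered_partition_def disjnt_def)
  show "fst (insert i T, B - insert i T) - {i} = T" if "T \<in> Pow (B - {i, j})" for T using that by auto
  show "(insert i (fst \<alpha> - {i}), B - insert i (fst \<alpha> - {i})) = \<alpha>" if "\<alpha> \<in> splits B i j" for \<alpha>
    using that by (auto simp: splits_def ordered_partition_def disjnt_def)
qed

text \<open>The parts before and after the split one are the same in all terms and become outer
  factors; \<open>lsgn_cong_context\<close> separates the sign of the split part from theirs. The
  reference order \<open>w\<close> is free, so that one choice can serve both sums of a relator and
  make their outer signs equal.\<close>

lemma sum_splits:
  assumes C: "supersymmetric C" and as: "as \<noteq> []" "set as \<subseteq> I" and \<tau>: "ordered_partition {1..length as} \<tau>" and a: "a < length \<tau>"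
    and ij: "i \<in> \<tau> ! a" "j \<in> \<tau> ! a" "i \<noteq> j"
    and u: "distinct u" "set u = \<tau> ! a - {i, j}" and w: "mset w = mset (u @ [i, j])"
  shows "(\<Sum>\<alpha>\<in>splits (\<tau> ! a) i j. part_val C as (Abs_opart (refine \<tau> a \<alpha>)) v)
    = sF (lsgn (p \<circ> (\<lambda>i. as ! (i - 1))) (concat (map sorted_list_of_set (take a \<tau>)) @ w @ concat (map sorted_list_of_set (drop (Suc a) \<tau>)))
         * lsgn (p \<circ> (\<lambda>i. as ! (i - 1))) w)
       (pprod C (\<lambda>i. as ! (i - 1)) (map sorted_list_of_set (take a \<tau>))
         (qsum C (\<lambda>i. as ! (i - 1)) u i j (pprod C (\<lambda>i. as ! (i - 1)) (map sorted_list_of_set (drop (Suc a) \<tau>)) v)))"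
proof -
  let ?A = "\<lambda>i. as ! (i - 1)" and ?B = "\<tau> ! a"
  let ?e = "p \<circ> ?A"
  define x y where "x = map sorted_list_of_set (take a \<tau>)" and "y = map sorted_list_of_set (drop (Suc a) \<tau>)"
  have m: "map set (map sorted_list_of_set \<tau>) = \<tau>" and md: "list_all distinct (map sorted_list_of_set \<tau>)"
    by (rule map_set_sorted_list[OF \<tau>])+
  have xs: "map set x = take a \<tau>" "map set y = drop (Suc a) \<tau>"
    unfolding x_def y_def using m by (metis take_map, metis drop_map)
  have xd: "list_all distinct x" "list_all distinct y"
    using md unfolding x_def y_def by (auto simp: list_all_iff)
  have \<tau>v: "valid ?A (map sorted_list_of_set \<tau>)" by (rule valid_enum) (use \<tau> m as in auto)
  moreover have "map sorted_list_of_set \<tau> = x @ sorted_list_of_set ?B # y"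
    unfolding x_def y_def using id_take_nth_drop[OF a] by (metis (no_types, lifting) list.simps(9) map_append)
  ultimately have xv: "valid ?A x" "valid ?A y" by simp_all
  have xe: "pprod C ?A x \<in> endo sF" using pprod_endo_part[OF C xv(1)] by (rule endo_part_endo)
  define t1 t2 where "t1 T = filter (\<lambda>z. z \<in> T) u @ [i]" and "t2 T = filter (\<lambda>z. z \<notin> T) u @ [j]" for T
  have "distinct (u @ [i, j])" using u ij(3) by auto
  then have dw: "distinct w" using mset_eq_imp_distinct_iff[OF w] by blast
  have "part_val C as (Abs_opart (refine \<tau> a (insert i T, ?B - insert i T))) v
    = sF (lsgn ?e (concat x @ w @ concat y) * lsgn ?e w) (pprod C ?A x
       (sF (lsgn ?e (t1 T @ t2 T)) (C (map ?A (t1 T)) (C (map ?A (t2 T)) (pprod C ?A y v)))))"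
    if T: "T \<in> Pow (set u)" for T
  proof -
    have sT: "set (t1 T) = insert i T" "set (t2 T) = ?B - insert i T"
      using T u ij by (auto simp: t1_def t2_def)
    have "(insert i T, ?B - insert i T) \<in> splits ?B i j"
      using bij_betw_apply[OF splits_bij[OF ij], of T] T u by simp
    then have op: "ordered_partition {1..length as} (refine \<tau> a (insert i T, ?B - insert i T))"
      by (rule Union_refine[OF \<tau> a])
    have rf: "refine \<tau> a (insert i T, ?B - insert i T) = map set (x @ [t1 T, t2 T] @ y)"
      by (simp add: refine_def xs sT)
    have "distinct (t1 T)" "distinct (t2 T)" using u by (auto simp: t1_def t2_def)
    then have "part_val C as (Abs_opart (refine \<tau> a (insert i T, ?B - insert i T))) = sprod C ?A (x @ [t1 T, t2 T] @ y)"
      unfolding rf using op[unfolded rf] as xd by (intro part_val_enum C) auto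
    moreover have "lsgn ?e (concat (x @ [t1 T, t2 T] @ y))
       = lsgn ?e (concat x @ w @ concat y) * lsgn ?e w * (lsgn ?e (t1 T @ t2 T) :: 'k)"
    proof -
      have "mset (t1 T @ t2 T) = mset w"
        unfolding w t1_def t2_def by (simp add: ac_simps)
      then have H: "lsgn ?e (concat x @ w @ concat y) * lsgn ?e (t1 T @ t2 T)
          = (lsgn ?e (concat x @ (t1 T @ t2 T) @ concat y) * lsgn ?e w :: 'k)"
        by (intro lsgn_cong_context[OF dw]) simp
      have "lsgn ?e (concat (x @ [t1 T, t2 T] @ y)) = lsgn ?e (concat x @ (t1 T @ t2 T) @ concat y) * (lsgn ?e w * lsgn ?e w :: 'k)"
        by (simp add: lsgn_sq[OF dw])
      also have "\<dots> = (lsgn ?e (concat x @ w @ concat y) * lsgn ?e (t1 T @ t2 T)) * lsgn ?e w"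
        unfolding H by (simp only: mult.assoc)
      finally show ?thesis by (simp only: ac_simps)
    qed
    ultimately show ?thesis
      by (simp add: sprod_def scE_def pprod_append endoD(2)[OF vector_space_axioms xe[unfolded One_nat_def]])
  qed
  then have "(\<Sum>T\<in>Pow (set u). part_val C as (Abs_opart (refine \<tau> a (insert i T, ?B - insert i T))) v)
    = sF (lsgn ?e (concat x @ w @ concat y) * lsgn ?e w) (pprod C ?A x (qsum C ?A u i j (pprod C ?A y v)))"
    unfolding qsum_def endoD(5)[OF vector_space_axioms xe] scale_sum_right
    by (intro sum.cong refl) (simp add: t1_def t2_def)
  then show ?thesis
    unfolding x_def[symmetric] y_def[symmetric] sum.reindex_bij_betw[OF splits_bij[OF ij], symmetric] u(2) by simp
qed

definition quadratic :: "('i list \<Rightarrow> 'f \<Rightarrow> 'f) \<Rightarrow> bool" where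
  "quadratic C \<longleftrightarrow> (\<forall>(u :: nat list) i j A v. distinct (u @ [i, j]) \<longrightarrow> A ` set u \<subseteq> I \<longrightarrow> A i \<in> I \<longrightarrow> A j \<in> I
     \<longrightarrow> qsum C A u i j v = qsum C A u j i v)"

text \<open>Both sums of a relator have the same outer factors, and between these stand the two
  sides of the quadratic relation.\<close>

lemma part_val_relators:
  assumes C: "supersymmetric C" and Q: "quadratic C" and as: "as \<noteq> []" "set as \<subseteq> I" and r: "r \<in> relators"
  shows "pm_lift scE (part_val C as) r = 0"
proof -
  interpret l: Vector_Spaces.linear pm_scale scE "pm_lift scE (part_val C as)"
    by (rule linear_pm_lift) (rule E.vector_space_axioms)
  obtain \<tau> a i j n where r: "r = relator \<tau> a i j" and n: "1 \<le> n" "ordered_partition {1..n} \<tau>"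
    and a: "a < length \<tau>" and ij: "i \<in> \<tau> ! a" "j \<in> \<tau> ! a" "i \<noteq> j"
    using r by (rule relatorsE)
  have eq: "pm_lift scE (part_val C as) r = (\<Sum>\<alpha>\<in>splits (\<tau> ! a) i j. part_val C as (Abs_opart (refine \<tau> a \<alpha>)))
     - (\<Sum>\<alpha>\<in>splits (\<tau> ! a) j i. part_val C as (Abs_opart (refine \<tau> a \<alpha>)))"
    by (simp add: r relator_def l.diff l.sum pm_lift_single[OF E.vector_space_axioms])
  show ?thesis
  proof (cases "n = length as")
    case False
    \<comment> \<open>All terms are partitions of \<open>n\<close> points, so for another length of
      \<open>as\<close> each of them has the default value 0.\<close>
    have "part_val C as (Abs_opart (refine \<tau> a \<alpha>)) = 0" if "\<alpha> \<in> splits (\<tau> ! a) i j" for \<alpha> i j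
      using Union_refine[OF n(2) a that] False n(1)
      by (intro part_val_mismatch) (simp add: Rep_Abs_opart npoints_eq)
    then show ?thesis unfolding eq by simp
  next
    case True
    note \<tau> = n(2)[unfolded True]
    define u where "u = sorted_list_of_set (\<tau> ! a - {i, j})"
    have fin: "finite (\<tau> ! a)" "\<tau> ! a \<subseteq> {1..length as}" using ordered_partition_finite[OF \<tau> nth_mem[OF a]] by auto
    then have u: "distinct u" "set u = \<tau> ! a - {i, j}" "set u = \<tau> ! a - {j, i}" by (auto simp: u_def)
    have A: "as ! (k - 1) \<in> I" if "k \<in> \<tau> ! a" for k
    proof -
      have "k \<in> {1..length as}" using that fin(2) by blast
      then show ?thesis by (auto intro!: subsetD[OF as(2)] nth_mem)
    qed
    have "qsum C (\<lambda>i. as ! (i - 1)) u i j v = qsum C (\<lambda>i. as ! (i - 1)) u j i v" for v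
      by (rule Q[unfolded quadratic_def, rule_format]) (use u(1,2) ij A in auto)
    \<comment> \<open>Both sums are referred to the same order of the split part, hence get the same
      outer sign.\<close>
    moreover have "mset (u @ [i, j]) = mset (u @ [j, i])" by simp
    ultimately show ?thesis unfolding eq fun_eq_iff
      using sum_splits[OF C as \<tau> a ij u(1,2) refl] sum_splits[OF C as \<tau> a ij(2,1) ij(3)[symmetric] u(1,3), of "u @ [i, j]"]
      by (simp add: sum_fun_apply)
  qed
qed

end

section \<open>The algebra \<open>H\<^sub>*T\<close> and its representations\<close>

lemma hgraded_mu: "ordered_partition {1..n} \<tau> \<Longrightarrow> mu \<tau> \<in> hgraded n"
  unfolding hgraded_def by (rule hs.span_base) blast

lemma hgraded_subspace: "hs.subspace (hgraded n)"
  unfolding hgraded_def by (rule hs.subspace_span)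

lemma hgraded_induct [consumes 1, case_names mu zero add scale]:
  assumes "h \<in> hgraded n" "\<And>\<tau>. ordered_partition {1..n} \<tau> \<Longrightarrow> P (mu \<tau>)" "P 0"
    "\<And>x y. x \<in> hgraded n \<Longrightarrow> y \<in> hgraded n \<Longrightarrow> P x \<Longrightarrow> P y \<Longrightarrow> P (x + y)"
    "\<And>c x. x \<in> hgraded n \<Longrightarrow> P x \<Longrightarrow> P (hscale c x)"
  shows "P h"
proof -
  have "hs.span (mu ` {\<tau>. ordered_partition {1..n} \<tau>}) \<subseteq> {x \<in> hgraded n. P x}"
  proof (rule hs.span_minimal)
    show "mu ` {\<tau>. ordered_partition {1..n} \<tau>} \<subseteq> {x \<in> hgraded n. P x}" using assms(2) hgraded_mu by auto
    show "hs.subspace {x \<in> hgraded n. P x}"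
      using assms(3-5) hs.subspace_0[OF hgraded_subspace] hs.subspace_add[OF hgraded_subspace] hs.subspace_scale[OF hgraded_subspace]
      by (intro hs.subspaceI) auto
  qed
  then show ?thesis using assms(1) unfolding hgraded_def by blast
qed

lemma hmult_zero [simp]: "hmult 0 g = 0" "hmult g 0 = 0"
  using hmult_scale_left[of 0 0 g] hmult_scale_right[of g 0 0] by simp_all

lemma hperm_zero [simp]: "hperm s 0 = 0"
  using hperm_scale[of s 0 0] by simp

lemma hgraded_mult:
  assumes "h \<in> hgraded m" "g \<in> hgraded n" "1 \<le> m" "1 \<le> n"
  shows "hmult h g \<in> hgraded (m + n)"
  using assms(1)
proof (induction h rule: hgraded_induct)
  case (mu \<tau>)
  show ?case
    using assms(2)
  proof (induction g rule: hgraded_induct)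
    case (mu \<sigma>)
    then show ?case using \<open>ordered_partition {1..m} \<tau>\<close> assms(3,4)
      by (simp only: hmult_mu) (rule hgraded_mu, rule ordered_partition_raw_cup)
  qed (auto simp: hmult_add_right hmult_scale_right hs.subspace_0 hs.subspace_add hs.subspace_scale hgraded_subspace)
qed (auto simp: hmult_add_left hmult_scale_left hs.subspace_0 hs.subspace_add hs.subspace_scale hgraded_subspace)

lemma hgraded_perm:
  assumes "h \<in> hgraded n" "1 \<le> n" "s permutes {1..n}"
  shows "hperm s h \<in> hgraded n"
  using assms(1)
proof (induction h rule: hgraded_induct)
  case (mu \<tau>)
  have "ordered_partition {1..n} (map ((`) s) \<tau>)"
    using ordered_partition_image[OF permutes_inj[OF assms(3)] mu] permutes_image[OF assms(3)] by simp
  then show ?case unfolding hperm_mu[OF mu assms(2,3)] by (rule hgraded_mu)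
qed (auto simp: hperm_add hperm_scale hs.subspace_0 hs.subspace_add hs.subspace_scale hgraded_subspace)

section \<open>Permutations acting on one factor of a product\<close>

lemma perm_list_length [simp]: "length (perm_list s vs) = length vs"
  by (simp add: perm_list_def del: upt_Suc)

lemma perm_list_nth: "k < length vs \<Longrightarrow> perm_list s vs ! k = vs ! (inv s (Suc k) - 1)"
  by (simp add: perm_list_def del: upt_Suc)

lemma permutes_le:
  assumes "s permutes {1..n}"
  shows "i \<in> {1..n} \<Longrightarrow> 1 \<le> s i \<and> s i \<le> n" "i \<notin> {1..n} \<Longrightarrow> s i = i"
  using permutes_in_image[OF assms, of i] permutes_not_in[OF assms, of i] by simp_all

lemma perm_list_right:
  assumes "s permutes {1..length vs}"
  shows "perm_list s (vs @ ws) = perm_list s vs @ ws"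
proof (rule nth_equalityI)
  fix k assume "k < length (perm_list s (vs @ ws))"
  then have k: "k < length (vs @ ws)" by simp
  note le = permutes_le[OF permutes_inv[OF assms], of "Suc k"]
  show "perm_list s (vs @ ws) ! k = (perm_list s vs @ ws) ! k"
  proof (cases "k < length vs")
    case True
    then have "1 \<le> inv s (Suc k) \<and> inv s (Suc k) \<le> length vs" using le by simp
    then have "inv s (Suc k) - 1 < length vs" by auto
    then show ?thesis using True k by (simp add: perm_list_nth nth_append)
  next
    case False
    then show ?thesis using k le by (simp add: perm_list_nth nth_append)
  qed
qed simp

text \<open>\<open>s\<close> fixes the points beyond \<open>ps\<close>, so the appended entries take
  part in no inversion.\<close>

lemma perm_sign_right:
  assumes "s permutes {1..length ps}"
  shows "perm_sign s (ps @ qs) = perm_sign s ps"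
proof -
  have "{(i, j). 1 \<le> i \<and> i < j \<and> j \<le> length (ps @ qs) \<and> s j < s i \<and> (ps @ qs) ! (i - 1) \<and> (ps @ qs) ! (j - 1)}
    = {(i, j). 1 \<le> i \<and> i < j \<and> j \<le> length ps \<and> s j < s i \<and> ps ! (i - 1) \<and> ps ! (j - 1)}"
  proof (intro set_eqI, clarify)
    fix i j :: nat
    note le = permutes_le[OF assms, of i] permutes_le[OF assms, of j]
    have *: "j \<le> length ps" if "1 \<le> i" "i < j" "s j < s i"
    proof (rule ccontr)
      assume "\<not> j \<le> length ps"
      then have "s j = j" using le(4) by simp
      moreover have "s i < j" using le(1,2) that \<open>\<not> j \<le> length ps\<close> by (cases "i \<in> {1..length ps}") auto
      ultimately show False using that by simp
    qed
    show "((i, j) \<in> {(i, j). 1 \<le> i \<and> i < j \<and> j \<le> length (ps @ qs) \<and> s j < s i \<and> (ps @ qs) ! (i - 1) \<and> (ps @ qs) ! (j - 1)})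
      = ((i, j) \<in> {(i, j). 1 \<le> i \<and> i < j \<and> j \<le> length ps \<and> s j < s i \<and> ps ! (i - 1) \<and> ps ! (j - 1)})"
      using * by (auto simp: nth_append)
  qed
  then show ?thesis by (simp only: perm_sign_def)
qed

lemma hperm_hmult_right:
  assumes "s permutes {1..m}" "h \<in> hgraded m" "g \<in> hgraded n" "1 \<le> m" "1 \<le> n"
  shows "hperm s (hmult h g) = hmult (hperm s h) g"
  using assms(2)
proof (induction h rule: hgraded_induct)
  case (mu \<tau>)
  note \<tau> = mu
  show ?case
    using assms(3)
  proof (induction g rule: hgraded_induct)
    case (mu \<sigma>)
    have s: "s permutes {1..m + n}" using assms(1) by (rule permutes_subset) auto
    have op: "ordered_partition {1..m} (map ((`) s) \<tau>)"
      using ordered_partition_image[OF permutes_inj[OF assms(1)] \<tau>] permutes_image[OF assms(1)] by simp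
    have "s ` (+) m ` C = (+) m ` C" if "C \<in> set \<sigma>" for C
    proof -
      have "s (m + i) = m + i" if "i \<in> C" for i
        using ordered_partition_finite[OF mu \<open>C \<in> set \<sigma>\<close>] that by (intro permutes_le(2)[OF assms(1)]) auto
      then show ?thesis by (force simp: image_iff)
    qed
    then have "map ((`) s) (raw_cup \<tau> \<sigma>) = raw_cup (map ((`) s) \<tau>) \<sigma>"
      by (simp add: raw_cup_def npoints_eq[OF op] npoints_eq[OF \<tau>])
    then show ?case using \<tau> mu op assms(1,4,5) s
      by (simp add: hmult_mu hperm_mu[OF ordered_partition_raw_cup[OF \<tau> mu]] hperm_mu)
  qed (simp_all add: hmult_add_right hmult_scale_right hperm_add hperm_scale)
qed (simp_all add: hmult_add_left hmult_scale_left hperm_add hperm_scale)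

text \<open>Lets \<open>s\<close> act on the second factor of a product whose first factor has
  \<open>m\<close> points.\<close>

definition shift_perm :: "nat \<Rightarrow> (nat \<Rightarrow> nat) \<Rightarrow> nat \<Rightarrow> nat" where
  "shift_perm m s i = (if i \<le> m then i else m + s (i - m))"

lemma shift_perm_permutes:
  assumes "s permutes {1..n}"
  shows "shift_perm m s permutes {1..m + n}" "inv (shift_perm m s) = shift_perm m (inv s)"
proof -
  have c: "shift_perm m t (shift_perm m t' i) = i" if "t' permutes {1..n}" "t \<circ> t' = id" for t t' i
  proof (cases "i \<le> m")
    case False
    have "0 < t' (i - m)"
      using False permutes_le[OF that(1), of "i - m"] by (cases "i - m \<in> {1..n}") auto
    moreover have "t (t' (i - m)) = i - m" using that(2) by (metis comp_apply id_apply)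
    ultimately show ?thesis using False by (simp add: shift_perm_def)
  qed (simp add: shift_perm_def)
  have 1: "shift_perm m s (shift_perm m (inv s) i) = i" "shift_perm m (inv s) (shift_perm m s i) = i" for i
    using c[OF permutes_inv[OF assms] permutes_inv_o(1)[OF assms]] c[OF assms permutes_inv_o(2)[OF assms]] by auto
  then show "inv (shift_perm m s) = shift_perm m (inv s)" by (intro inv_unique_comp) (auto simp: fun_eq_iff)
  have "shift_perm m s i = i" if "i \<notin> {1..m + n}" for i
  proof (cases "i \<le> m")
    case False
    then have "i - m \<notin> {1..n}" using that by auto
    then show ?thesis using False permutes_le(2)[OF assms] by (simp add: shift_perm_def)
  qed (simp add: shift_perm_def)
  moreover have "bij (shift_perm m s)" using 1 by (intro o_bij[of "shift_perm m (inv s)"]) (auto simp: fun_eq_iff)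
  ultimately show "shift_perm m s permutes {1..m + n}" unfolding permutes_def by (metis bij_pointE)
qed

lemma perm_list_left:
  assumes "s permutes {1..length vs}"
  shows "perm_list (shift_perm (length ws) s) (ws @ vs) = ws @ perm_list s vs"
proof (rule nth_equalityI)
  fix k assume "k < length (perm_list (shift_perm (length ws) s) (ws @ vs))"
  then have k: "k < length (ws @ vs)" by simp
  note inv = shift_perm_permutes(2)[OF assms]
  show "perm_list (shift_perm (length ws) s) (ws @ vs) ! k = (ws @ perm_list s vs) ! k"
  proof (cases "k < length ws")
    case True
    then show ?thesis using k by (simp add: perm_list_nth inv nth_append shift_perm_def)
  next
    case False
    have "Suc k - length ws \<in> {1..length vs}" using False k by auto
    then have "1 \<le> inv s (Suc k - length ws)"
      using permutes_le(1)[OF permutes_inv[OF assms]] by blast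
    then have "\<not> length ws + inv s (Suc k - length ws) - 1 < length ws"
      "length ws + inv s (Suc k - length ws) - 1 - length ws = inv s (Suc k - length ws) - 1" by simp_all
    moreover have "Suc (k - length ws) = Suc k - length ws" using False by simp
    ultimately show ?thesis using False k
      by (simp add: perm_list_nth inv nth_append shift_perm_def)
  qed
qed simp

lemma perm_sign_left:
  assumes "s permutes {1..length ps}"
  shows "perm_sign (shift_perm (length qs) s) (qs @ ps) = perm_sign s ps"
proof -
  let ?m = "length qs"
  let ?A = "{(i, j). 1 \<le> i \<and> i < j \<and> j \<le> length ps \<and> s j < s i \<and> ps ! (i - 1) \<and> ps ! (j - 1)}"
  let ?B = "{(i, j). 1 \<le> i \<and> i < j \<and> j \<le> length (qs @ ps) \<and> shift_perm ?m s j < shift_perm ?m s i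
     \<and> (qs @ ps) ! (i - 1) \<and> (qs @ ps) ! (j - 1)}"
  have "?B = map_prod ((+) ?m) ((+) ?m) ` ?A"
  proof (intro set_eqI iffI)
    fix z assume "z \<in> ?B"
    then obtain i j where z: "z = (i, j)" "1 \<le> i" "i < j" "j \<le> ?m + length ps" "shift_perm ?m s j < shift_perm ?m s i"
      "(qs @ ps) ! (i - 1)" "(qs @ ps) ! (j - 1)" by auto
    have i: "?m < i"
    proof (rule ccontr)
      assume "\<not> ?m < i"
      then show False using z(3,5) by (auto simp: shift_perm_def split: if_splits)
    qed
    then have "(i - ?m, j - ?m) \<in> ?A" using z by (auto simp: nth_append shift_perm_def split: if_splits)
    moreover have "z = map_prod ((+) ?m) ((+) ?m) (i - ?m, j - ?m)" using i z by simp
    ultimately show "z \<in> map_prod ((+) ?m) ((+) ?m) ` ?A" by (rule rev_image_eqI)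
  next
    fix z assume "z \<in> map_prod ((+) ?m) ((+) ?m) ` ?A"
    then show "z \<in> ?B" by (auto simp: nth_append shift_perm_def)
  qed
  moreover have "inj_on (map_prod ((+) ?m) ((+) ?m)) ?A" by (auto simp: inj_on_def)
  ultimately have "card ?B = card ?A" by (simp only: card_image)
  then show ?thesis by (simp only: perm_sign_def)
qed

lemma hperm_hmult_left:
  assumes "s permutes {1..n}" "h \<in> hgraded n" "g \<in> hgraded m" "1 \<le> n" "1 \<le> m"
  shows "hperm (shift_perm m s) (hmult g h) = hmult g (hperm s h)"
  using assms(2)
proof (induction h rule: hgraded_induct)
  case (mu \<tau>)
  note \<tau> = mu
  show ?case
    using assms(3)
  proof (induction g rule: hgraded_induct)
    case (mu \<sigma>)
    have s: "shift_perm m s permutes {1..m + n}" by (rule shift_perm_permutes[OF assms(1)])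
    have op: "ordered_partition {1..n} (map ((`) s) \<tau>)"
      using ordered_partition_image[OF permutes_inj[OF assms(1)] \<tau>] permutes_image[OF assms(1)] by simp
    have 1: "shift_perm m s ` (+) m ` C = (+) m ` s ` C" if "C \<in> set \<tau>" for C
    proof -
      have "shift_perm m s (m + i) = m + s i" if "i \<in> C" for i
      proof -
        have "1 \<le> i" using ordered_partition_finite[OF \<tau> \<open>C \<in> set \<tau>\<close>] that by auto
        then show ?thesis by (simp add: shift_perm_def)
      qed
      then show ?thesis unfolding image_image by (intro image_cong) simp_all
    qed
    have 2: "shift_perm m s ` C = C" if "C \<in> set \<sigma>" for C
    proof -
      have "shift_perm m s i = i" if "i \<in> C" for i
        using ordered_partition_finite[OF mu \<open>C \<in> set \<sigma>\<close>] that by (auto simp: shift_perm_def)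
      then show ?thesis by (force simp: image_iff)
    qed
    have "map ((`) (shift_perm m s)) (raw_cup \<sigma> \<tau>) = raw_cup \<sigma> (map ((`) s) \<tau>)"
      using 1 2 by (simp add: raw_cup_def npoints_eq[OF mu] map_idI)
    then show ?case using \<tau> mu op assms(1,4,5) s
      by (simp add: hmult_mu hperm_mu[OF ordered_partition_raw_cup[OF mu \<tau>]] hperm_mu)
  qed (simp_all add: hmult_add_left hmult_scale_left hperm_add hperm_scale)
qed (simp_all add: hmult_add_right hmult_scale_right hperm_add hperm_scale)

section \<open>The ideal of relations\<close>

locale ht = sections sF F I p + T: superspace sT T
  for sF :: "'k::field_char_0 \<Rightarrow> 'f::ab_group_add \<Rightarrow> 'f" and F :: "bool \<Rightarrow> 'f set"
    and I :: "'i::linorder set" and p :: "'i \<Rightarrow> bool"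
    and sT :: "'k \<Rightarrow> 't::ab_group_add \<Rightarrow> 't" and T :: "bool \<Rightarrow> 't set" +
  fixes \<Delta> :: "'i \<Rightarrow> 't"
  assumes basis: "homogeneous_basis sT T I p \<Delta>"
begin

abbreviation SG :: "(('k hstar \<times> 't list) \<Rightarrow>\<^sub>0 'k) set" where "SG \<equiv> pm.span tensor_gens"
abbreviation MR :: "(('k hstar \<times> 't list) \<Rightarrow>\<^sub>0 'k) set" where "MR \<equiv> multilinear_relators sT"
abbreviation CO :: "(('k hstar \<times> 't list) \<Rightarrow>\<^sub>0 'k) set" where "CO \<equiv> coinvariant_relators T"
abbreviation Rel :: "(('k hstar \<times> 't list) \<Rightarrow>\<^sub>0 'k) set" where "Rel \<equiv> pm.span (MR \<union> CO)"
abbreviation cls :: "(('k hstar \<times> 't list) \<Rightarrow>\<^sub>0 'k) \<Rightarrow> ('k, 't) HT_elem" where "cls \<equiv> HT_class sT T"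

definition tm :: "(('k hstar \<times> 't list) \<Rightarrow>\<^sub>0 'k) \<Rightarrow> (('k hstar \<times> 't list) \<Rightarrow>\<^sub>0 'k) \<Rightarrow> (('k hstar \<times> 't list) \<Rightarrow>\<^sub>0 'k)" where
  "tm = pm_bilin (\<lambda>(h, vs) (h', vs'). (hmult h h', vs @ vs'))"

lemma tm_tgen [simp]: "tm (tgen h vs) (tgen h' vs') = tgen (hmult h h') (vs @ vs')"
  by (simp add: tm_def tgen_def)

sublocale tl: Vector_Spaces.linear pm_scale pm_scale "\<lambda>x. tm x y" for y
  unfolding tm_def by (rule linear_pm_bilin_left)

sublocale tr: Vector_Spaces.linear pm_scale pm_scale "tm x" for x
  unfolding tm_def by (rule linear_pm_bilin_right)

lemma subspace_tl: "pm.subspace V \<Longrightarrow> pm.subspace {x. tm x y \<in> V}"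
  by (auto simp: pm.subspace_def tl.add tl.scale tl.zero)

lemma subspace_tr: "pm.subspace V \<Longrightarrow> pm.subspace {y. tm x y \<in> V}"
  by (auto simp: pm.subspace_def tr.add tr.scale tr.zero)

lemma tgen_SG: "vs \<noteq> [] \<Longrightarrow> h \<in> hgraded (length vs) \<Longrightarrow> tgen h vs \<in> SG"
  unfolding tensor_gens_def by (rule pm.span_base) blast

lemma MR_intros:
  "vs \<noteq> [] \<Longrightarrow> h \<in> hgraded (length vs) \<Longrightarrow> h' \<in> hgraded (length vs) \<Longrightarrow> tgen (h + h') vs - tgen h vs - tgen h' vs \<in> MR"
  "vs \<noteq> [] \<Longrightarrow> h \<in> hgraded (length vs) \<Longrightarrow> tgen (hscale c h) vs - pm_scale c (tgen h vs) \<in> MR"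
  "h \<in> hgraded (Suc (length us + length ws)) \<Longrightarrow> tgen h (us @ (v + w) # ws) - tgen h (us @ v # ws) - tgen h (us @ w # ws) \<in> MR"
  "h \<in> hgraded (Suc (length us + length ws)) \<Longrightarrow> tgen h (us @ sT c v # ws) - pm_scale c (tgen h (us @ v # ws)) \<in> MR"
  unfolding multilinear_relators_def by blast+

lemma MRE:
  assumes "r \<in> MR"
  obtains (1) h h' vs where "r = tgen (h + h') vs - tgen h vs - tgen h' vs" "vs \<noteq> []" "h \<in> hgraded (length vs)" "h' \<in> hgraded (length vs)"
  | (2) c h vs where "r = tgen (hscale c h) vs - pm_scale c (tgen h vs)" "vs \<noteq> []" "h \<in> hgraded (length vs)"
  | (3) h us v w ws where "r = tgen h (us @ (v + w) # ws) - tgen h (us @ v # ws) - tgen h (us @ w # ws)" "h \<in> hgraded (Suc (length us + length ws))"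
  | (4) h us c v ws where "r = tgen h (us @ sT c v # ws) - pm_scale c (tgen h (us @ v # ws))" "h \<in> hgraded (Suc (length us + length ws))"
  using assms unfolding multilinear_relators_def by blast

lemma COE:
  assumes "r \<in> CO"
  obtains h vs ps s where "r = tgen h vs - pm_scale (perm_sign s ps) (tgen (hperm s h) (perm_list s vs))"
    "vs \<noteq> []" "h \<in> hgraded (length vs)" "list_all2 (\<lambda>v q. v \<in> T q) vs ps" "s permutes {1..length vs}"
  using assms unfolding coinvariant_relators_def by blast

lemma CO_intro:
  "vs \<noteq> [] \<Longrightarrow> h \<in> hgraded (length vs) \<Longrightarrow> list_all2 (\<lambda>v q. v \<in> T q) vs ps \<Longrightarrow> s permutes {1..length vs}
    \<Longrightarrow> tgen h vs - pm_scale (perm_sign s ps) (tgen (hperm s h) (perm_list s vs)) \<in> CO"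
  unfolding coinvariant_relators_def by blast

lemma MR_SG: "r \<in> MR \<Longrightarrow> r \<in> SG"
  by (erule MRE) (auto intro!: pm.span_diff pm.span_scale tgen_SG hs.subspace_add[OF hgraded_subspace] hs.subspace_scale[OF hgraded_subspace])

lemma CO_SG: "r \<in> CO \<Longrightarrow> r \<in> SG"
proof (erule COE)
  fix h vs ps s
  assume r: "r = tgen h vs - pm_scale (perm_sign s ps) (tgen (hperm s h) (perm_list s vs))"
    and vs: "vs \<noteq> []" "h \<in> hgraded (length vs)" "s permutes {1..length vs}"
  have n: "1 \<le> length vs" using vs(1) by (cases vs) auto
  have "perm_list s vs \<noteq> []" using vs(1) by (metis length_0_conv perm_list_length)
  then show "r \<in> SG"
    unfolding r using vs hgraded_perm[OF vs(2) n vs(3)] by (intro pm.span_diff pm.span_scale tgen_SG) auto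
qed

lemma tensor_gensE:
  assumes "x \<in> tensor_gens"
  obtains h vs where "x = tgen h vs" "vs \<noteq> []" "h \<in> hgraded (length vs)" "1 \<le> length vs"
proof -
  obtain h vs where *: "x = tgen h vs" "vs \<noteq> []" "h \<in> hgraded (length vs)"
    using assms unfolding tensor_gens_def by blast
  moreover have "1 \<le> length vs" using *(2) by (cases vs) auto
  ultimately show thesis by (rule that)
qed

lemma tm_SG: assumes "x \<in> SG" "y \<in> SG" shows "tm x y \<in> SG"
  using assms(1)
proof (rule pm.span_induct)
  show "pm.subspace {x. tm x y \<in> SG}" by (intro subspace_tl pm.subspace_span)
  fix x :: "('k hstar \<times> 't list) \<Rightarrow>\<^sub>0 'k" assume x: "x \<in> tensor_gens"
  show "tm x y \<in> SG"
    using assms(2)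
  proof (rule pm.span_induct)
    show "pm.subspace {y. tm x y \<in> SG}" by (intro subspace_tr pm.subspace_span)
    fix y :: "('k hstar \<times> 't list) \<Rightarrow>\<^sub>0 'k" assume "y \<in> tensor_gens"
    then show "tm x y \<in> SG" using x
      by (elim tensor_gensE) (simp, intro tgen_SG, auto intro: hgraded_mult)
  qed
qed

lemma MR_ideal:
  assumes "r \<in> pm.span MR" "y \<in> SG"
  shows "tm r y \<in> pm.span MR" "tm y r \<in> pm.span MR"
proof -
  have gen: "tm r y \<in> MR \<and> tm y r \<in> MR" if r: "r \<in> MR" and y: "y \<in> tensor_gens" for r y
  proof -
    obtain g xs where y: "y = tgen g xs" "xs \<noteq> []" "g \<in> hgraded (length xs)" "1 \<le> length xs" using y by (rule tensor_gensE)
    have m: "hmult h g \<in> hgraded (n + length xs)" "hmult g h \<in> hgraded (length xs + n)" if "h \<in> hgraded n" "1 \<le> n" for h n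
      using that y(3,4) by (simp_all add: hgraded_mult)
    note s = tl.diff tr.diff tl.scale tr.scale y(1)
    from r show ?thesis
    proof (cases rule: MRE)
      case (1 h h' vs)
      have n: "1 \<le> length vs" using 1(2) by (cases vs) auto
      show ?thesis using MR_intros(1)[of "vs @ xs" "hmult h g" "hmult h' g"] MR_intros(1)[of "xs @ vs" "hmult g h" "hmult g h'"]
          m[OF 1(3) n] m[OF 1(4) n] y(2) by (simp add: s 1(1) hmult_add_left hmult_add_right)
    next
      case (2 c h vs)
      have n: "1 \<le> length vs" using 2(2) by (cases vs) auto
      show ?thesis using MR_intros(2)[of "vs @ xs" "hmult h g" c] MR_intros(2)[of "xs @ vs" "hmult g h" c]
          m[OF 2(3) n] y(2) by (simp add: s 2(1) hmult_scale_left hmult_scale_right)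
    next
      case (3 h us v w ws)
      show ?thesis using MR_intros(3)[of "hmult h g" us "ws @ xs" v w] MR_intros(3)[of "hmult g h" "xs @ us" ws v w]
          m[OF 3(2)] by (simp add: s 3(1) add.assoc)
    next
      case (4 h us c v ws)
      show ?thesis using MR_intros(4)[of "hmult h g" us "ws @ xs" c v] MR_intros(4)[of "hmult g h" "xs @ us" ws c v]
          m[OF 4(2)] by (simp add: s 4(1) add.assoc)
    qed
  qed
  have "tm r y \<in> pm.span MR \<and> tm y r \<in> pm.span MR" if r: "r \<in> MR" for r
  proof
    show "tm r y \<in> pm.span MR" using assms(2)
      by (rule pm.span_induct) (auto intro!: subspace_tr pm.subspace_span intro: pm.span_base gen[OF r, THEN conjunct1])
    show "tm y r \<in> pm.span MR" using assms(2)
      by (rule pm.span_induct) (auto intro!: subspace_tl pm.subspace_span intro: pm.span_base gen[OF r, THEN conjunct2])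
  qed
  note * = this
  show "tm r y \<in> pm.span MR" using assms(1)
    by (rule pm.span_induct) (auto intro!: subspace_tl pm.subspace_span intro: *[THEN conjunct1])
  show "tm y r \<in> pm.span MR" using assms(1)
    by (rule pm.span_induct) (auto intro!: subspace_tr pm.subspace_span intro: *[THEN conjunct2])
qed

text \<open>Unlike general generators these have homogeneous factors, so that a coinvariant relator
  multiplied by one of them is a coinvariant relator again.\<close>

definition BG :: "(('k hstar \<times> 't list) \<Rightarrow>\<^sub>0 'k) set" where
  "BG = {tgen (mu \<tau>) (map \<Delta> as) | \<tau> as. as \<noteq> [] \<and> set as \<subseteq> I \<and> ordered_partition {1..length as} \<tau>}"

lemma \<Delta>_T: "a \<in> I \<Longrightarrow> \<Delta> a \<in> T (p a)"
  using basis by (simp add: homogeneous_basis_def)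

lemma span_\<Delta>: "T.span (\<Delta> ` I) = UNIV" and indep: "\<not> T.dependent (\<Delta> ` I)" and inj: "inj_on \<Delta> I"
  using basis by (simp_all add: homogeneous_basis_def)

text \<open>The class in \<open>H\<close> is expanded in partition symbols, and the vectors in the
  basis one after another from the left, at the cost of multilinear relators.\<close>

lemma SG_basis: "SG \<subseteq> pm.span (BG \<union> MR)"
proof (rule pm.span_minimal[OF _ pm.subspace_span], rule subsetI)
  let ?Z = "pm.span (BG \<union> MR)"
  have rel: "x \<in> ?Z" if "x - y \<in> MR" "y \<in> ?Z" for x y
    using pm.span_add[OF pm.span_base[of "x - y" "BG \<union> MR"] that(2)] that(1) by simp
  have rel2: "x \<in> ?Z" if "x - y - z \<in> MR" "y \<in> ?Z" "z \<in> ?Z" for x y z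
    using pm.span_add[OF pm.span_add[OF pm.span_base[of "x - y - z" "BG \<union> MR"] that(2)] that(3)] that(1) by simp
  have zero_rel: "x \<in> ?Z" if "x - pm_scale 0 y \<in> MR" for x y
    using pm.span_base[of "x - pm_scale 0 y" "BG \<union> MR"] that by simp
  \<comment> \<open>\<open>map \<Delta> as\<close> is the part already expanded. \<open>vs'\<close>
    has the length of \<open>vs\<close> and records that the whole word is not empty.\<close>
  have basis_case: "tgen (mu \<tau>) (map \<Delta> as @ vs) \<in> ?Z"
    if "ordered_partition {1..length as + length vs} \<tau>" "set as \<subseteq> I" "as \<noteq> [] \<or> vs' \<noteq> []" "length vs' = length vs" for \<tau> as and vs vs' :: "'t list"
    using that
  proof (induction vs arbitrary: as vs')
    case Nil
    then show ?case by (intro pm.span_base) (auto simp: BG_def)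
  next
    case (Cons v vs)
    have h: "mu \<tau> \<in> hgraded (Suc (length (map \<Delta> as) + length vs))" using hgraded_mu[OF Cons.prems(1)] by simp
    have "v \<in> T.span (\<Delta> ` I)" by (simp add: span_\<Delta>)
    then show ?case
    proof (rule T.span_induct)
      show "T.subspace {v. tgen (mu \<tau>) (map \<Delta> as @ v # vs) \<in> ?Z}"
      proof (rule T.subspaceI; clarsimp)
        show "tgen (mu \<tau>) (map \<Delta> as @ 0 # vs) \<in> ?Z"
          using zero_rel[OF MR_intros(4)[OF h, of 0 0, simplified T.scale_zero_left]] by simp
        show "tgen (mu \<tau>) (map \<Delta> as @ (x + y) # vs) \<in> ?Z"
          if "tgen (mu \<tau>) (map \<Delta> as @ x # vs) \<in> ?Z" "tgen (mu \<tau>) (map \<Delta> as @ y # vs) \<in> ?Z" for x y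
          by (rule rel2[OF MR_intros(3)[OF h] that])
        show "tgen (mu \<tau>) (map \<Delta> as @ sT c x # vs) \<in> ?Z" if "tgen (mu \<tau>) (map \<Delta> as @ x # vs) \<in> ?Z" for c x
          by (rule rel[OF MR_intros(4)[OF h] pm.span_scale[OF that]])
      qed
      fix v assume "v \<in> \<Delta> ` I"
      then obtain a where a: "v = \<Delta> a" "a \<in> I" by blast
      show "tgen (mu \<tau>) (map \<Delta> as @ v # vs) \<in> ?Z"
        using Cons.IH[of "as @ [a]" vs] Cons.prems a by simp
    qed
  qed
  fix x :: "('k hstar \<times> 't list) \<Rightarrow>\<^sub>0 'k" assume "x \<in> tensor_gens"
  then obtain h vs where x: "x = tgen h vs" "vs \<noteq> []" "h \<in> hgraded (length vs)" by (rule tensor_gensE)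
  show "x \<in> ?Z" unfolding x(1) using x(3)
  proof (induction h rule: hgraded_induct)
    case (mu \<tau>)
    then show ?case using basis_case[of "[]" vs \<tau> vs] x(2) by simp
  next
    case zero
    show ?case
      using zero_rel[OF MR_intros(2)[OF x(2) hs.subspace_0[OF hgraded_subspace], of 0, simplified hs.scale_zero_left]] .
  next
    case (add g h)
    then show ?case by (intro rel2[OF MR_intros(1)[OF x(2)]])
  next
    case (scale c h)
    then show ?case by (intro rel[OF MR_intros(2)[OF x(2)]] pm.span_scale)
  qed
qed

text \<open>A coinvariant relator times a basis tensor is one for the permutation extended by fixed
  points. A generator with inhomogeneous factors is first rewritten by \<open>SG_basis\<close>; the
  multilinear relators this brings in are absorbed by \<open>MR_ideal\<close>.\<close>

lemma Rel_ideal: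
  assumes "r \<in> Rel" "y \<in> SG"
  shows "tm r y \<in> Rel" "tm y r \<in> Rel"
proof -
  have MRR: "pm.span MR \<subseteq> Rel" by (rule pm.span_mono) simp
  have homog: "list_all2 (\<lambda>v q. v \<in> T q) (map \<Delta> as) (map p as)" if "set as \<subseteq> I" for as
    using that \<Delta>_T by (induction as) auto
  have gen: "tm r y \<in> CO \<and> tm y r \<in> CO" if r: "r \<in> CO" and y: "y \<in> BG" for r y
  proof -
    obtain \<tau> as where y: "y = tgen (mu \<tau>) (map \<Delta> as)" and as: "as \<noteq> []" "set as \<subseteq> I" and \<tau>: "ordered_partition {1..length as} \<tau>"
      using y unfolding BG_def by blast
    let ?xs = "map \<Delta> as"
    have g: "mu \<tau> \<in> hgraded (length as)" by (rule hgraded_mu[OF \<tau>])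
    have m: "1 \<le> length as" using as(1) by (cases as) auto
    obtain h vs ps s where r: "r = tgen h vs - pm_scale (perm_sign s ps) (tgen (hperm s h) (perm_list s vs))"
      and vs: "vs \<noteq> []" "h \<in> hgraded (length vs)" "list_all2 (\<lambda>v q. v \<in> T q) vs ps" "s permutes {1..length vs}"
      using r by (rule COE)
    have n: "1 \<le> length vs" using vs(1) by (cases vs) auto
    have len: "length ps = length vs" using vs(3) by (simp add: list_all2_lengthD)
    have s: "s permutes {1..length (vs @ ?xs)}" using vs(4) by (rule permutes_subset) auto
    have s': "shift_perm (length ?xs) s permutes {1..length (?xs @ vs)}" using shift_perm_permutes(1)[OF vs(4)] by simp
    have "tgen (hmult h (mu \<tau>)) (vs @ ?xs) - pm_scale (perm_sign s (ps @ map p as))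
       (tgen (hperm s (hmult h (mu \<tau>))) (perm_list s (vs @ ?xs))) \<in> CO"
      using vs hgraded_mult[OF vs(2) g n m] s by (intro CO_intro list_all2_appendI homog as) simp_all
    then have 1: "tm r y \<in> CO"
      using vs(4) len
      by (simp add: perm_sign_right[of s ps "map p as"] r y tl.diff tl.scale hperm_hmult_right[OF vs(4,2) g n m] perm_list_right)
    have "tgen (hmult (mu \<tau>) h) (?xs @ vs) - pm_scale (perm_sign (shift_perm (length ?xs) s) (map p as @ ps))
       (tgen (hperm (shift_perm (length ?xs) s) (hmult (mu \<tau>) h)) (perm_list (shift_perm (length ?xs) s) (?xs @ vs))) \<in> CO"
      using vs hgraded_mult[OF g vs(2) m n] s' by (intro CO_intro list_all2_appendI homog as) simp_all
    then have "tm y r \<in> CO"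
      using vs(4) len perm_list_left[OF vs(4), of ?xs] hperm_hmult_left[OF vs(4,2) g n m]
      by (simp add: perm_sign_left[of s ps "map p as", simplified] r y tr.diff tr.scale)
    with 1 show ?thesis ..
  qed
  have coord: "tm r y \<in> Rel \<and> tm y r \<in> Rel" if r: "r \<in> CO" and y: "y \<in> SG" for r y
  proof -
    have "tm r y \<in> Rel \<and> tm y r \<in> Rel" if "y \<in> BG \<union> MR" for y
      using that
    proof
      assume "y \<in> BG"
      then show ?thesis using gen[OF r] by (auto intro: pm.span_base)
    next
      assume "y \<in> MR"
      then show ?thesis using MR_ideal[OF pm.span_base CO_SG[OF r]] MRR by blast
    qed
    note * = this
    have y': "y \<in> pm.span (BG \<union> MR)" using y SG_basis by blast
    show ?thesis
    proof
      show "tm r y \<in> Rel" using y'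
        by (rule pm.span_induct) (use * in \<open>auto intro!: subspace_tr pm.subspace_span\<close>)
      show "tm y r \<in> Rel" using y'
        by (rule pm.span_induct) (use * in \<open>auto intro!: subspace_tl pm.subspace_span\<close>)
    qed
  qed
  have "tm r y \<in> Rel \<and> tm y r \<in> Rel" if "r \<in> MR \<union> CO" for r
    using that
  proof
    assume "r \<in> MR"
    then show ?thesis using MR_ideal[OF pm.span_base assms(2)] MRR by blast
  qed (use coord assms(2) in blast)
  note * = this
  show "tm r y \<in> Rel" using assms(1)
    by (rule pm.span_induct) (use * in \<open>auto intro!: subspace_tl pm.subspace_span\<close>)
  show "tm y r \<in> Rel" using assms(1)
    by (rule pm.span_induct) (use * in \<open>auto intro!: subspace_tr pm.subspace_span\<close>)
qed

section \<open>Operations on classes\<close>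

lemma cls_iff: "y \<in> cls x \<longleftrightarrow> x \<in> SG \<and> y \<in> SG \<and> x - y \<in> Rel"
  by (auto simp: HT_class_def HT_rel_def)

lemma cls_self: "x \<in> SG \<Longrightarrow> x \<in> cls x"
  by (simp add: cls_iff pm.span_zero)

lemma cls_eqI: assumes "x \<in> SG" "y \<in> SG" "x - y \<in> Rel" shows "cls x = cls y"
proof (rule set_eqI)
  fix z
  have "x - z \<in> Rel \<longleftrightarrow> y - z \<in> Rel"
  proof
    assume "x - z \<in> Rel"
    from pm.span_diff[OF this assms(3)] show "y - z \<in> Rel" by simp
  next
    assume "y - z \<in> Rel"
    from pm.span_add[OF this assms(3)] show "x - z \<in> Rel" by simp
  qed
  then show "z \<in> cls x \<longleftrightarrow> z \<in> cls y" using assms by (simp add: cls_iff)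
qed

lemma HT_eq: "HT sT T = cls ` SG"
  by (auto simp: HT_def quotient_def HT_class_def)

text \<open>The defining union runs over representatives that all give the same class, and it is not
  empty because a class contains its own representative.\<close>

lemma HT_add_cls: assumes "x \<in> SG" "y \<in> SG" shows "HT_add sT T (cls x) (cls y) = cls (x + y)"
proof -
  have "cls (x' + y') = cls (x + y)" if "x' \<in> cls x" "y' \<in> cls y" for x' y'
  proof (rule cls_eqI)
    have "(x - x') + (y - y') \<in> Rel" using that by (intro pm.span_add) (auto simp: cls_iff)
    from pm.span_neg[OF this] show "x' + y' - (x + y) \<in> Rel" by (simp add: algebra_simps)
  qed (use that assms in \<open>auto simp: cls_iff intro: pm.span_add\<close>)
  then have "HT_add sT T (cls x) (cls y) = (\<Union>x'\<in>cls x. \<Union>y'\<in>cls y. cls (x + y))"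
    unfolding HT_add_def by (intro SUP_cong refl) simp
  then show ?thesis using cls_self[OF assms(1)] cls_self[OF assms(2)] by auto
qed

lemma HT_scale_cls: assumes "x \<in> SG" shows "HT_scale sT T c (cls x) = cls (pm_scale c x)"
proof -
  have "cls (pm_scale c x') = cls (pm_scale c x)" if "x' \<in> cls x" for x'
  proof (rule cls_eqI)
    have "pm_scale (-c) (x - x') \<in> Rel" using that by (intro pm.span_scale) (auto simp: cls_iff)
    then show "pm_scale c x' - pm_scale c x \<in> Rel" by (simp add: pm.scale_right_diff_distrib)
  qed (use that assms in \<open>auto simp: cls_iff intro: pm.span_scale\<close>)
  then have "HT_scale sT T c (cls x) = (\<Union>x'\<in>cls x. cls (pm_scale c x))"
    unfolding HT_scale_def by (intro SUP_cong refl) simp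
  then show ?thesis using cls_self[OF assms] by auto
qed

lemma HT_mult_cls: assumes "x \<in> SG" "y \<in> SG" shows "HT_mult sT T (cls x) (cls y) = cls (tm x y)"
proof -
  have "cls (tm x' y') = cls (tm x y)" if "x' \<in> cls x" "y' \<in> cls y" for x' y'
  proof (rule cls_eqI)
    have "tm (x - x') y' + tm x (y - y') \<in> Rel"
      using that assms by (intro pm.span_add Rel_ideal) (auto simp: cls_iff)
    from pm.span_neg[OF this] show "tm x' y' - tm x y \<in> Rel" by (simp add: tl.diff tr.diff)
  qed (use that assms in \<open>auto simp: cls_iff intro: tm_SG\<close>)
  then have "HT_mult sT T (cls x) (cls y) = (\<Union>x'\<in>cls x. \<Union>y'\<in>cls y. cls (tm x y))"
    unfolding HT_mult_def tm_def[symmetric] by (intro SUP_cong refl) simp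
  then show ?thesis using cls_self[OF assms(1)] cls_self[OF assms(2)] by auto
qed

end

section \<open>Partitions into consecutive intervals\<close>

lemma lsgn_cong:
  assumes "\<And>x. x \<in> set w \<Longrightarrow> e x = e' x"
  shows "lsgn e w = (lsgn e' w :: 'k::field)"
proof -
  have "lsgn e (map id w) = (lsgn e' w :: 'k)" by (rule lsgn_map) (use assms in auto)
  then show ?thesis by simp
qed

lemma image_plus_0: "(`) ((+) (0::nat)) = id"
  by (rule ext) simp

primrec intervals :: "nat list \<Rightarrow> nat set list" where
  "intervals [] = []"
| "intervals (l # ls) = {1..l} # map ((`) ((+) l)) (intervals ls)"

lemma ordered_partition_single: "1 \<le> n \<Longrightarrow> ordered_partition {1..n} [{1..n}]"
  by (auto simp: ordered_partition_def)

lemma intervals_Cons: "1 \<le> l \<Longrightarrow> intervals (l # ls) = raw_cup [{1..l}] (intervals ls)"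
  by (simp add: raw_cup_def npoints_def)

lemma intervals_partition: "(\<And>l. l \<in> set ls \<Longrightarrow> 1 \<le> l) \<Longrightarrow> ordered_partition {1..sum_list ls} (intervals ls)"
proof (induction ls)
  case Nil
  then show ?case by (simp add: ordered_partition_def)
next
  case (Cons l ls)
  have l: "1 \<le> l" using Cons.prems by simp
  show ?case unfolding intervals_Cons[OF l] sum_list.Cons
    using Cons by (intro ordered_partition_raw_cup ordered_partition_single l) simp
qed

text \<open>Each block starts where the previous one ends, so the induction needs an arbitrary
  offset \<open>m\<close>.\<close>

lemma set_intervals: "concat us = [Suc m..<k] \<Longrightarrow> map set us = map ((`) ((+) m)) (intervals (map length us))"
proof (induction us arbitrary: m)
  case (Cons u us)
  define l where "l = length u"
  have "length (u @ concat us) = k - Suc m" using Cons.prems by simp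
  then have l: "Suc m + l \<le> k \<or> l = 0" unfolding l_def length_append by arith
  have "u @ concat us = [Suc m..<k]" using Cons.prems by simp
  then have "u = take l [Suc m..<k]" "concat us = drop l [Suc m..<k]"
    unfolding append_eq_conv_conj l_def by blast+
  then have u: "u = [Suc m..<Suc m + l]" and us: "concat us = [Suc (m + l)..<k]"
    using l by (auto simp: take_upt drop_upt)
  have "set u = (+) m ` {1..l}" unfolding u by (auto simp: image_iff atLeastLessThanSuc_atLeastAtMost intro!: bexI[of _ "_ - m"])
  moreover have "map set us = map ((`) ((+) m)) (map ((`) ((+) l)) (intervals (map length us)))"
    using Cons.IH[OF us] by (simp add: image_image add.assoc comp_def)
  ultimately show ?case by (simp add: l_def)
qed simp

lemma map_nth_shift: "map (\<lambda>i. as ! (i - 1)) [1..<Suc (length as)] = as"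
  by (rule nth_equalityI) (auto simp del: upt_Suc)

context ht
begin

section \<open>Correlators of a representation\<close>

definition correlator :: "(('k, 't) HT_elem \<Rightarrow> 'f \<Rightarrow> 'f) \<Rightarrow> 'i list \<Rightarrow> 'f \<Rightarrow> 'f" where
  "correlator K as = K (cls (tgen (mu [{1..length as}]) (map \<Delta> as)))"

lemma MR_Rel: "r \<in> MR \<Longrightarrow> r \<in> Rel" and CO_Rel: "r \<in> CO \<Longrightarrow> r \<in> Rel"
  by (auto intro: pm.span_base)

lemma homogeneous_word: "set as \<subseteq> I \<Longrightarrow> list_all2 (\<lambda>v q. v \<in> T q) (map \<Delta> as) (map p as)"
  using \<Delta>_T by (induction as) auto

lemma lpar_map: "odd (length (filter id (map p as))) = lpar p as"
  by (simp add: lpar_def filter_map)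

context
  fixes K assumes K: "K \<in> HT_representations sT T sF F"
begin

lemma cls_HT: "x \<in> SG \<Longrightarrow> cls x \<in> HT sT T"
  by (simp add: HT_eq)

lemma K_add: assumes "x \<in> SG" "y \<in> SG" shows "K (cls (x + y)) v = K (cls x) v + K (cls y) v"
  using K cls_HT[OF assms(1)] cls_HT[OF assms(2)] unfolding HT_representations_def HT_add_cls[OF assms, symmetric] by blast

lemma K_scale: assumes "x \<in> SG" shows "K (cls (pm_scale c x)) v = sF c (K (cls x) v)"
  using K cls_HT[OF assms(1)] unfolding HT_representations_def HT_scale_cls[OF assms, symmetric] by blast

lemma K_mult: assumes "x \<in> SG" "y \<in> SG" shows "K (cls (tm x y)) = K (cls x) \<circ> K (cls y)"
  using K cls_HT[OF assms(1)] cls_HT[OF assms(2)] unfolding HT_representations_def HT_mult_cls[OF assms, symmetric] by blast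

lemma K_rel: "x \<in> SG \<Longrightarrow> y \<in> SG \<Longrightarrow> x - y \<in> Rel \<Longrightarrow> K (cls x) = K (cls y)"
  by (simp only: cls_eqI)

lemma K_zero: "K (cls 0) v = 0"
  using K_add[of 0 0 v] by (simp add: pm.span_zero)

lemma K_MR: assumes "r \<in> MR" shows "K (cls r) v = 0"
  using K_rel[of r 0] assms K_zero by (simp add: MR_SG MR_Rel pm.span_zero)

lemma K_tgen_add:
  assumes "vs \<noteq> []" "h \<in> hgraded (length vs)" "h' \<in> hgraded (length vs)"
  shows "K (cls (tgen (h + h') vs)) v = K (cls (tgen h vs)) v + K (cls (tgen h' vs)) v"
proof -
  have "h + h' \<in> hgraded (length vs)" using assms by (intro hs.subspace_add[OF hgraded_subspace])
  then have "K (cls (tgen (h + h') vs)) = K (cls (tgen h vs + tgen h' vs))"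
    using MR_Rel[OF MR_intros(1)[OF assms]] assms
    by (intro K_rel) (simp_all add: tgen_SG pm.span_add diff_diff_eq)
  then show ?thesis using assms by (simp add: K_add tgen_SG)
qed

lemma K_coinv:
  assumes "vs \<noteq> []" "h \<in> hgraded (length vs)" "list_all2 (\<lambda>v q. v \<in> T q) vs ps" "s permutes {1..length vs}"
  shows "K (cls (tgen h vs)) v = sF (perm_sign s ps) (K (cls (tgen (hperm s h) (perm_list s vs))) v)"
proof -
  have n: "1 \<le> length vs" using assms(1) by (cases vs) auto
  have "perm_list s vs \<noteq> []" using assms(1) by (metis length_0_conv perm_list_length)
  then have g: "tgen (hperm s h) (perm_list s vs) \<in> SG" using assms n by (intro tgen_SG) (simp_all add: hgraded_perm)
  have "K (cls (tgen h vs)) = K (cls (pm_scale (perm_sign s ps) (tgen (hperm s h) (perm_list s vs))))"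
    using CO_Rel[OF CO_intro[OF assms]] assms g by (intro K_rel) (simp_all add: tgen_SG pm.span_scale)
  then show ?thesis using g by (simp add: K_scale)
qed

lemma correlator_endo_part:
  assumes "as \<noteq> []" "set as \<subseteq> I"
  shows "correlator K as \<in> endo_part sF F (lpar p as)"
proof -
  have n: "1 \<le> length as" using assms(1) by (cases as) auto
  have "tgen (mu [{1..length as}]) (map \<Delta> as) \<in> pm.span {tgen h vs | h vs ps. vs \<noteq> [] \<and> h \<in> hgraded (length vs)
     \<and> list_all2 (\<lambda>v e. v \<in> T e) vs ps \<and> odd (length (filter id ps)) = lpar p as}"
    using assms(1) hgraded_mu[OF ordered_partition_single[OF n]] homogeneous_word[OF assms(2)] lpar_map[of as]
    by (intro pm.span_base CollectI exI[of _ "mu [{1..length as}]"] exI[of _ "map \<Delta> as"] exI[of _ "map p as"]) simp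
  then have "cls (tgen (mu [{1..length as}]) (map \<Delta> as)) \<in> HT_part sT T (lpar p as)"
    unfolding HT_part_def by blast
  then show ?thesis using K unfolding HT_representations_def correlator_def by blast
qed

text \<open>The symbol of a partition into consecutive intervals is a product of one-part symbols,
  and \<open>K\<close> is multiplicative.\<close>

lemma K_intervals:
  "ws \<noteq> [] \<Longrightarrow> (\<And>w. w \<in> set ws \<Longrightarrow> w \<noteq> []) \<Longrightarrow>
    K (cls (tgen (mu (intervals (map length ws))) (map \<Delta> (concat ws)))) = foldr (\<lambda>w f. correlator K w \<circ> f) ws id"
proof (induction ws)
  case (Cons w ws)
  have l: "1 \<le> length w" using Cons.prems(2)[of w] by (cases w) auto
  show ?case
  proof (cases "ws = []")
    case True
    then show ?thesis by (simp add: correlator_def)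
  next
    case False
    have ge: "1 \<le> l'" if l': "l' \<in> set (map length ws)" for l'
    proof -
      obtain w' where w': "w' \<in> set ws" "l' = length w'" using l' by auto
      then show ?thesis using Cons.prems(2)[of w'] by (simp add: Suc_le_eq)
    qed
    have "ordered_partition {1..sum_list (map length ws)} (intervals (map length ws))"
      by (rule intervals_partition) (rule ge)
    note op = this ordered_partition_single[OF l]
    have len: "sum_list (map length ws) = length (concat ws)" by (simp add: length_concat)
    have cne: "concat ws \<noteq> []" using False Cons.prems(2) by (cases ws) auto
    then have n: "1 \<le> length (concat ws)" by (cases "concat ws") auto
    have 1: "tgen (mu [{1..length w}]) (map \<Delta> w) \<in> SG"
    proof (rule tgen_SG)
      show "mu [{1..length w}] \<in> hgraded (length (map \<Delta> w))" unfolding length_map by (rule hgraded_mu[OF op(2)])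
    qed (use l in auto)
    have 2: "tgen (mu (intervals (map length ws))) (map \<Delta> (concat ws)) \<in> SG"
    proof (rule tgen_SG)
      show "mu (intervals (map length ws)) \<in> hgraded (length (map \<Delta> (concat ws)))"
        unfolding length_map len[symmetric] by (rule hgraded_mu[OF op(1)])
    qed (use cne in auto)
    have "mu (intervals (map length (w # ws))) = (hmult (mu [{1..length w}]) (mu (intervals (map length ws))) :: 'k hstar)"
      unfolding list.map intervals_Cons[OF l] by (rule hmult_mu[OF op(2) l op(1)[unfolded len] n, symmetric])
    then have "tgen (mu (intervals (map length (w # ws)))) (map \<Delta> (concat (w # ws)))
      = tm (tgen (mu [{1..length w}]) (map \<Delta> w)) (tgen (mu (intervals (map length ws))) (map \<Delta> (concat ws)))"
      by simp
    then have "K (cls (tgen (mu (intervals (map length (w # ws)))) (map \<Delta> (concat (w # ws)))))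
      = correlator K w \<circ> K (cls (tgen (mu (intervals (map length ws))) (map \<Delta> (concat ws))))"
      using K_mult[OF 1 2] by (simp only: correlator_def)
    also have "K (cls (tgen (mu (intervals (map length ws))) (map \<Delta> (concat ws)))) = foldr (\<lambda>w f. correlator K w \<circ> f) ws id"
      by (rule Cons.IH[OF False]) (rule Cons.prems(2), simp)
    also have "correlator K w \<circ> foldr (\<lambda>w f. correlator K w \<circ> f) ws id = foldr (\<lambda>w f. correlator K w \<circ> f) (w # ws) id"
      by (rule ext) simp
    finally show ?thesis .
  qed
qed simp

text \<open>By coinvariance the parts can be moved to consecutive intervals. The permutation used is
  the one that straightens the enumeration \<open>w\<close> of the parts to the increasing
  word.\<close>

lemma K_mu:
  assumes as: "as \<noteq> []" "set as \<subseteq> I" and \<tau>: "ordered_partition {1..length as} \<tau>"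
  shows "K (cls (tgen (mu \<tau>) (map \<Delta> as))) = part_val (correlator K) as (Abs_opart \<tau>)"
proof -
  let ?n = "length as" and ?A = "\<lambda>i. as ! (i - 1)"
  have n: "1 \<le> ?n" using as(1) by (cases as) auto
  define us where "us = map sorted_list_of_set \<tau>"
  define w where "w = concat us"
  have us: "map set us = \<tau>" "list_all distinct us" unfolding us_def by (rule map_set_sorted_list[OF \<tau>])+
  have w: "distinct w" "set w = {1..?n}" unfolding w_def using ordered_partition_enum[of _ us] us \<tau> by auto
  then have lw: "length w = ?n" by (metis card_atLeastAtMost diff_Suc_1 distinct_card)
  \<comment> \<open>\<open>q\<close> sends a place in the enumeration to the point listed there,
    with list indices starting at 0, and is extended by fixed points; its inverse straightens the
    word.\<close>
  define q where "q j = (if j \<in> {1..?n} then w ! (j - 1) else j)" for j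
  have "bij_betw q {1..?n} {1..?n}"
  proof -
    have "bij_betw ((!) w) {..<?n} {1..?n}" using w lw by (intro bij_betw_nth) simp_all
    moreover have "bij_betw (\<lambda>j. j - 1) {1..?n} {..<?n}" by (rule bij_betwI[where g = Suc]) auto
    ultimately have "bij_betw ((!) w \<circ> (\<lambda>j. j - 1)) {1..?n} {1..?n}" by (rule bij_betw_trans[rotated])
    then show ?thesis by (rule bij_betw_cong[THEN iffD1, rotated]) (simp add: q_def)
  qed
  then have q: "q permutes {1..?n}" by (rule bij_imp_permutes) (unfold q_def, rule if_not_P)
  define s where "s = inv q"
  have s: "s permutes {1..?n}" "inv s = q"
    unfolding s_def using q by (simp_all add: permutes_inv permutes_inv_inv)
  have mw: "map s w = [1..<Suc ?n]"
  proof (rule nth_equalityI)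
    fix k assume "k < length (map s w)"
    then have k: "k < ?n" by (simp add: lw)
    then have "w ! k = q (Suc k)" by (simp add: q_def)
    then show "map s w ! k = [1..<Suc ?n] ! k" using k lw permutes_inverses(2)[OF q, of "Suc k"]
      by (simp add: s_def del: upt_Suc)
  qed (simp add: lw del: upt_Suc)
  have "concat (map (map s) us) = [Suc 0..<Suc ?n]" using mw by (simp add: w_def map_concat)
  from set_intervals[OF this] have iv: "map ((`) s) \<tau> = intervals (map length us)"
    by (simp add: us(1)[symmetric] comp_def image_plus_0)
  have pl: "perm_list s (map \<Delta> as) = map \<Delta> (concat (map (map ?A) us))"
  proof -
    have "perm_list s (map \<Delta> as) = map (\<lambda>j. map \<Delta> as ! (q j - 1)) [1..<Suc ?n]" by (simp add: perm_list_def s(2) del: upt_Suc)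
    also have "\<dots> = map (\<lambda>j. map \<Delta> as ! (q j - 1)) (map s w)" by (simp only: mw)
    also have "\<dots> = map (\<lambda>i. \<Delta> (?A i)) w"
    proof (unfold map_map, rule map_cong[OF refl])
      fix i assume "i \<in> set w"
      then have i: "i \<in> {1..?n}" using w by blast
      have "q (s i) = i" unfolding s_def by (rule permutes_inverses(1)[OF q])
      moreover have "i - 1 < length as" using i by auto
      ultimately show "((\<lambda>j. map \<Delta> as ! (q j - 1)) \<circ> s) i = \<Delta> (?A i)" by simp
    qed
    finally show ?thesis by (simp add: w_def map_concat comp_def)
  qed
  have ne: "u \<noteq> []" if "u \<in> set us" for u
    using that us \<tau> unfolding ordered_partition_def by (metis (no_types, lifting) image_eqI list.set(1) list.set_map)
  have usne: "us \<noteq> []" using lw n by (auto simp: w_def)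
  have "K (cls (tgen (mu \<tau>) (map \<Delta> as))) v = sF (perm_sign s (map p as)) (pprod (correlator K) ?A us v)" for v
  proof -
    have "K (cls (tgen (mu \<tau>) (map \<Delta> as))) v
      = sF (perm_sign s (map p as)) (K (cls (tgen (hperm s (mu \<tau>)) (perm_list s (map \<Delta> as)))) v)"
      using as hgraded_mu[OF \<tau>] homogeneous_word[OF as(2)] s by (intro K_coinv) simp_all
    also have "hperm s (mu \<tau>) = mu (intervals (map length (map (map ?A) us)))"
      unfolding hperm_mu[OF \<tau> n s(1)] iv by (simp add: comp_def)
    also have "K (cls (tgen (mu (intervals (map length (map (map ?A) us)))) (perm_list s (map \<Delta> as))))
       = foldr (\<lambda>w f. correlator K w \<circ> f) (map (map ?A) us) id"
      unfolding pl by (rule K_intervals) (use usne ne in auto)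
    finally show ?thesis by (simp only: pprod_def foldr_map comp_def)
  qed
  \<comment> \<open>The straightened word is increasing and has sign 1, so the sign of
    \<open>s\<close> is inverse to that of \<open>w\<close>; for signs this means equal.\<close>
  moreover have "perm_sign s (map p as) = (lsgn (p \<circ> ?A) w :: 'k)"
  proof -
    have "lsgn (p \<circ> ?A \<circ> q) (map s w) = perm_sign s (map p as) * (lsgn (p \<circ> ?A) w :: 'k)"
    proof (rule lsgn_perm[OF s(1)])
      show "(p \<circ> ?A \<circ> q) (s i) = (p \<circ> ?A) i" for i
        by (simp only: comp_apply s_def permutes_inverses(1)[OF q])
      show "mset w = mset [1..<Suc ?n]"
        by (rule set_eq_iff_mset_eq_distinct[THEN iffD1])
          (simp_all only: w distinct_upt set_upt atLeastLessThanSuc_atLeastAtMost)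
      show "(p \<circ> ?A) i = map p as ! (i - 1)" if "i \<in> {1..?n}" for i using that by auto
    qed simp
    moreover have "lsgn (p \<circ> ?A \<circ> q) (map s w) = (1::'k)" unfolding mw by (rule lsgn_sorted) (rule sorted_wrt_upt)
    ultimately have "perm_sign s (map p as) * (lsgn (p \<circ> ?A) w * lsgn (p \<circ> ?A) w) = (lsgn (p \<circ> ?A) w :: 'k)"
      by (simp add: mult.assoc[symmetric])
    then show ?thesis by (simp add: lsgn_sq[OF w(1)])
  qed
  ultimately show ?thesis
    by (simp add: fun_eq_iff part_val_def Rep_Abs_opart[OF n \<tau>] npoints_eq[OF \<tau>] us_def[symmetric] sprod_def scE_def w_def)
qed

text \<open>Every permutation fixes the one-part partition, so coinvariance under a transposition of
  neighbours is the exchange rule for the indices.\<close>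

lemma supersymmetric_ck: "supersymmetric (correlator K)"
  unfolding supersymmetric_def
proof (intro conjI allI impI)
  show "correlator K as \<in> endo_part sF F (lpar p as)" if "as \<noteq> []" "set as \<subseteq> I" for as
    using that by (rule correlator_endo_part)
next
  fix u a b w x assume I: "set (u @ a # b # w) \<subseteq> I"
  define as where "as = u @ a # b # w"
  let ?n = "length as"
  define i where "i = Suc (length u)"
  define s where "s = Transposition.transpose i (Suc i)"
  have ii: "i \<in> {1..?n}" "Suc i \<in> {1..?n}" by (auto simp: i_def as_def)
  have s: "s permutes {1..?n}" unfolding s_def by (rule permutes_swap_id[OF ii])
  have invs: "inv s = s" unfolding s_def by simp
  have n: "1 \<le> ?n" by (simp add: as_def)
  have op: "ordered_partition {1..?n} [{1..?n}]" by (rule ordered_partition_single[OF n])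
  have split: "[1..<Suc ?n] = [1..<i] @ i # Suc i # [Suc (Suc i)..<Suc ?n]"
  proof -
    have "[1..<Suc ?n] = [1..<i] @ [i..<Suc ?n]" using ii upt_add_eq_append[of 1 i "Suc ?n - i"] by (simp del: upt_Suc)
    also have "[i..<Suc ?n] = i # Suc i # [Suc (Suc i)..<Suc ?n]" using ii by (simp add: upt_conv_Cons)
    finally show ?thesis .
  qed
  have sid: "s j = j" if "j \<noteq> i" "j \<noteq> Suc i" for j using that by (simp add: s_def transpose_def)
  have si: "s i = Suc i" "s (Suc i) = i" by (simp_all add: s_def)
  have ms: "map s [1..<Suc ?n] = [1..<i] @ Suc i # i # [Suc (Suc i)..<Suc ?n]"
    unfolding split by (auto simp: si intro!: map_idI sid)
  have pl: "perm_list s (map \<Delta> as) = map \<Delta> (u @ b # a # w)"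
  proof -
    have "perm_list s (map \<Delta> as) = map (\<lambda>j. map \<Delta> as ! (j - 1)) (map s [1..<Suc ?n])"
      by (simp add: perm_list_def invs comp_def del: upt_Suc)
    also have "\<dots> = map (\<lambda>j. map \<Delta> as ! (j - 1)) ([1..<i] @ Suc i # i # [Suc (Suc i)..<Suc ?n])" by (simp only: ms)
    also have "\<dots> = map \<Delta> (u @ b # a # w)"
    proof (rule nth_equalityI)
      show "length (map (\<lambda>j. map \<Delta> as ! (j - 1)) ([1..<i] @ Suc i # i # [Suc (Suc i)..<Suc ?n])) = length (map \<Delta> (u @ b # a # w))"
        by (simp add: i_def as_def del: upt_Suc)
      fix k assume "k < length (map (\<lambda>j. map \<Delta> as ! (j - 1)) ([1..<i] @ Suc i # i # [Suc (Suc i)..<Suc ?n]))"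
      then have k: "k < Suc (Suc (length u + length w))" by (simp add: i_def as_def del: upt_Suc)
      consider "k < length u" | "k = length u" | "k = Suc (length u)" | "k > Suc (length u)" by linarith
      then show "map (\<lambda>j. map \<Delta> as ! (j - 1)) ([1..<i] @ Suc i # i # [Suc (Suc i)..<Suc ?n]) ! k = map \<Delta> (u @ b # a # w) ! k"
        using k by cases (auto simp: nth_append nth_Cons i_def as_def simp del: upt_Suc split: nat.splits)
    qed
    finally show ?thesis .
  qed
  \<comment> \<open>Comparing the increasing word with its image reduces the count of inversions to
    a single use of \<open>lsgn_swap\<close>.\<close>
  have "perm_sign s (map p as) = (sg (p a) (p b) :: 'k)"
  proof -
    let ?e = "\<lambda>i. p (as ! (i - 1))"
    have "lsgn (?e \<circ> s) (map s [1..<Suc ?n]) = perm_sign s (map p as) * (lsgn ?e [1..<Suc ?n] :: 'k)"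
    proof (rule lsgn_perm[OF s])
      show "(?e \<circ> s) (s i) = ?e i" for i using permutes_inverses(1)[OF s, of i] invs by simp
      show "?e i = map p as ! (i - 1)" if "i \<in> {1..?n}" for i using that by auto
    qed simp_all
    moreover have "lsgn ?e [1..<Suc ?n] = (1::'k)" by (rule lsgn_sorted) (rule sorted_wrt_upt)
    moreover have "lsgn (?e \<circ> s) (map s [1..<Suc ?n]) = (sg (p a) (p b) :: 'k)"
    proof -
      have "lsgn (?e \<circ> s) (map s [1..<Suc ?n]) = sg ((?e \<circ> s) (Suc i)) ((?e \<circ> s) i) * (lsgn (?e \<circ> s) [1..<Suc ?n] :: 'k)"
        by (subst ms, subst split, rule lsgn_swap)
      moreover have "lsgn (?e \<circ> s) [1..<Suc ?n] = (1::'k)" by (rule lsgn_sorted) (rule sorted_wrt_upt)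
      moreover have "(?e \<circ> s) (Suc i) = p a" "(?e \<circ> s) i = p b"
        by (simp_all add: si) (simp_all add: i_def as_def nth_append)
      ultimately show ?thesis by (simp only: mult_1_right)
    qed
    ultimately show ?thesis by simp
  qed
  moreover have "hperm s (mu [{1..?n}]) = (mu [{1..?n}] :: 'k hstar)"
    unfolding hperm_mu[OF op n s] by (simp add: permutes_image[OF s] del: One_nat_def)
  moreover have "correlator K as x = sF (perm_sign s (map p as)) (K (cls (tgen (hperm s (mu [{1..?n}])) (perm_list s (map \<Delta> as)))) x)"
    unfolding correlator_def using I hgraded_mu[OF op] s homogeneous_word[of as]
    by (intro K_coinv) (simp_all add: as_def)
  moreover have "length (u @ b # a # w) = ?n" by (simp add: as_def)
  ultimately show "correlator K (u @ a # b # w) x = sF (sg (p a) (p b)) (correlator K (u @ b # a # w) x)"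
    unfolding pl by (simp only: correlator_def as_def[symmetric])
qed

lemma qsum_cong:
  assumes "\<And>x. x \<in> set u \<Longrightarrow> A x = B x" "A i = B i" "A j = B j"
  shows "qsum C A u i j v = qsum C B u i j v"
proof -
  have m: "map A (filter P u) = map B (filter P u)" for P using assms by (intro map_cong) auto
  have "lsgn (p \<circ> A) (filter P u @ i # filter Q u @ [j]) = (lsgn (p \<circ> B) (filter P u @ i # filter Q u @ [j]) :: 'k)" for P Q
    by (rule lsgn_cong) (use assms in auto)
  then show ?thesis unfolding qsum_def by (simp only: map_append m list.map assms)
qed

text \<open>This is the defining relation for the one-part partition of \<open>n + 2\<close> points
  and its last two points: \<open>K_mu\<close> evaluates each term and \<open>sum_splits\<close>
  collects them.\<close>

lemma qsum_ck:
  assumes A: "A ` {1..n + 2} \<subseteq> I"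
  shows "qsum (correlator K) A [1..<Suc n] (n + 1) (n + 2) v = qsum (correlator K) A [1..<Suc n] (n + 2) (n + 1) v"
proof -
  define as where "as = map A [1..<Suc (n + 2)]"
  let ?B = "\<lambda>i. as ! (i - 1)" and ?u = "[1..<Suc n]" and ?\<tau> = "[{1..n + 2}]"
  have B: "A i = ?B i" if "i \<in> {1..n + 2}" for i
    using that by (auto simp: as_def simp del: upt_Suc)
  have len: "length as = n + 2" by (simp add: as_def)
  have as: "as \<noteq> []" "set as \<subseteq> I" using len A by (auto simp: as_def atLeastLessThanSuc_atLeastAtMost simp del: upt_Suc)
  have op: "ordered_partition {1..length as} ?\<tau>" unfolding len by (rule ordered_partition_single) simp
  note C = supersymmetric_ck
  have split: "(\<Sum>\<alpha>\<in>splits (?\<tau> ! 0) i j. part_val (correlator K) as (Abs_opart (refine ?\<tau> 0 \<alpha>)) v) = qsum (correlator K) A ?u i j v"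
    if ij: "i = n + 1 \<and> j = n + 2 \<or> i = n + 2 \<and> j = n + 1" for i j v
  proof -
    define u where "u = ?u"
    have u: "set u = {1..n}" "distinct u" by (auto simp: u_def)
    have ij': "i \<notin> {1..n}" "j \<notin> {1..n}" "i \<noteq> j" using ij by auto
    then have d1: "distinct (u @ [i, j])" using u by simp
    have "{1..n + 2} = {1..n} \<union> {n + 1, n + 2}" by auto
    also have "{n + 1, n + 2} = {i, j}" using ij by blast
    finally have "set u = ?\<tau> ! 0 - {i, j}" using u ij' by auto
    note d = d1 this
    \<comment> \<open>No other parts surround the split one, so the outer sign is the square of a
      sign.\<close>
    have "(\<Sum>\<alpha>\<in>splits (?\<tau> ! 0) i j. part_val (correlator K) as (Abs_opart (refine ?\<tau> 0 \<alpha>)) v)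
      = sF (lsgn (p \<circ> ?B) (u @ [i, j]) * lsgn (p \<circ> ?B) (u @ [i, j])) (qsum (correlator K) ?B u i j v)"
      by (subst sum_splits[OF C as op _ _ _ _ u(2) d(2) refl]) (use ij in auto)
    also have "\<dots> = qsum (correlator K) ?B u i j v" by (simp only: lsgn_sq[OF d(1)] scale_one)
    also have "\<dots> = qsum (correlator K) A u i j v"
    proof (rule qsum_cong[symmetric])
      show "A x = ?B x" if "x \<in> set u" for x using that u by (intro B) auto
      show "A i = ?B i" "A j = ?B j" using ij by (intro B; auto)+
    qed
    finally show ?thesis unfolding u_def .
  qed
  have pv: "part_val (correlator K) as (Abs_opart (refine ?\<tau> 0 \<alpha>)) = K (cls (tgen (mu (refine ?\<tau> 0 \<alpha>)) (map \<Delta> as)))"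
    and hg: "mu (refine ?\<tau> 0 \<alpha>) \<in> hgraded (length (map \<Delta> as))" if "\<alpha> \<in> splits (?\<tau> ! 0) i j" for \<alpha> i j
    using Union_refine[OF op _ that] K_mu[OF as, of "refine ?\<tau> 0 \<alpha>"] hgraded_mu[of "length as"] by simp_all
  have sumK: "(\<Sum>\<alpha>\<in>B. K (cls (tgen (f \<alpha>) (map \<Delta> as))) v) = K (cls (tgen (\<Sum>\<alpha>\<in>B. f \<alpha>) (map \<Delta> as))) v"
    if "\<And>\<alpha>. \<alpha> \<in> B \<Longrightarrow> f \<alpha> \<in> hgraded (length (map \<Delta> as))" for f :: "nat set \<times> nat set \<Rightarrow> 'k hstar" and B
  proof -
    have ne: "map \<Delta> as \<noteq> []" using as by simp
    have z: "(0 :: 'k hstar) \<in> hgraded (length (map \<Delta> as))" by (rule hs.subspace_0[OF hgraded_subspace])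
    have 0: "K (cls (tgen 0 (map \<Delta> as))) v = 0"
      using K_tgen_add[OF ne z z, of v] by simp
    show ?thesis using that
    proof (induction B rule: infinite_finite_induct)
      case (insert x B)
      have "sum f B \<in> hgraded (length (map \<Delta> as))" using insert.prems by (intro hs.subspace_sum[OF hgraded_subspace]) simp
      then have "K (cls (tgen (f x + sum f B) (map \<Delta> as))) v = K (cls (tgen (f x) (map \<Delta> as))) v + K (cls (tgen (sum f B) (map \<Delta> as))) v"
        using insert.prems by (intro K_tgen_add ne) simp_all
      then show ?case using insert by simp
    qed (simp_all add: 0)
  qed
  have "(\<Sum>\<alpha>\<in>splits (?\<tau> ! 0) (n + 1) (n + 2). mu (refine ?\<tau> 0 \<alpha>)) = (\<Sum>\<alpha>\<in>splits (?\<tau> ! 0) (n + 2) (n + 1). (mu (refine ?\<tau> 0 \<alpha>) :: 'k hstar))"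
  proof -
    have abs_sum: "(\<Sum>\<alpha>\<in>B. mu (f \<alpha>)) = abs_hstar (\<Sum>\<alpha>\<in>B. Poly_Mapping.single (Abs_opart (f \<alpha>)) (1::'k))" for f and B :: "(nat set \<times> nat set) set"
      by (induction B rule: infinite_finite_induct) (simp_all add: zero_hstar.abs_eq plus_hstar.abs_eq zero_hstar_def mu_def)
    have "(relator ?\<tau> 0 (n + 1) (n + 2) :: opart \<Rightarrow>\<^sub>0 'k) \<in> relators"
      using op len by (intro relators_mem[of "n + 2"]) auto
    then have "relator ?\<tau> 0 (n + 1) (n + 2) \<in> pm.span (relators :: (opart \<Rightarrow>\<^sub>0 'k) set)" by (rule pm.span_base)
    then show ?thesis unfolding abs_sum by (simp only: hstar.abs_eq_iff relator_def)
  qed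
  moreover have sumK': "(\<Sum>\<alpha>\<in>splits (?\<tau> ! 0) i j. K (cls (tgen (mu (refine ?\<tau> 0 \<alpha>)) (map \<Delta> as))) v)
     = K (cls (tgen (\<Sum>\<alpha>\<in>splits (?\<tau> ! 0) i j. mu (refine ?\<tau> 0 \<alpha>)) (map \<Delta> as))) v" for i j
    by (rule sumK) (rule hg)
  ultimately have "(\<Sum>\<alpha>\<in>splits (?\<tau> ! 0) (n + 1) (n + 2). K (cls (tgen (mu (refine ?\<tau> 0 \<alpha>)) (map \<Delta> as))) v)
    = (\<Sum>\<alpha>\<in>splits (?\<tau> ! 0) (n + 2) (n + 1). K (cls (tgen (mu (refine ?\<tau> 0 \<alpha>)) (map \<Delta> as))) v)"
    by (simp only: sumK' )
  moreover have "(\<Sum>\<alpha>\<in>splits (?\<tau> ! 0) i j. K (cls (tgen (mu (refine ?\<tau> 0 \<alpha>)) (map \<Delta> as))) v) = qsum (correlator K) A ?u i j v"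
    if "i = n + 1 \<and> j = n + 2 \<or> i = n + 2 \<and> j = n + 1" for i j
    unfolding split[OF that, symmetric] by (intro sum.cong refl) (simp only: pv)
  ultimately show ?thesis by (simp only: simp_thms)
qed

end

text \<open>Modulo multilinearity the algebra is spanned by partition symbols with basis vectors,
  and \<open>K_mu\<close> computes the values there from the correlators alone.\<close>

lemma K_determined:
  assumes K: "K \<in> HT_representations sT T sF F" and K': "K' \<in> HT_representations sT T sF F"
    and eq: "\<And>as. as \<noteq> [] \<Longrightarrow> set as \<subseteq> I \<Longrightarrow> correlator K as = correlator K' as"
  shows "K = K'"
proof -
  have pv: "part_val (correlator K) as \<sigma> = part_val (correlator K') as \<sigma>" if as: "as \<noteq> []" "set as \<subseteq> I" for as \<sigma>
  proof (cases "npoints (Rep_opart \<sigma>) = length as")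
    case True
    obtain us n where us: "\<sigma> = Abs_opart (map set us)" "1 \<le> n" "ordered_partition {1..n} (map set us)" "npoints (Rep_opart \<sigma>) = n"
      using opart_enum by metis
    let ?us = "map sorted_list_of_set (Rep_opart \<sigma>)"
    have R: "Rep_opart \<sigma> = map set us" unfolding us(1) by (rule Rep_Abs_opart[OF us(2,3)])
    have "map set ?us = map set us" unfolding R by (rule map_set_sorted_list(1)[OF us(3)])
    then have "valid (\<lambda>i. as ! (i - 1)) ?us"
      using us(3,4) True by (intro valid_enum[OF _ as(2)]) (simp only:)
    moreover have "pprod (correlator K) A ws = pprod (correlator K') A ws" if "valid A ws" for A ws
      using that by (induction ws) (simp_all add: eq)
    ultimately show ?thesis by (simp add: part_val_def sprod_def)
  qed (simp add: part_val_def)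
  define E where "E = {x \<in> SG. K (cls x) = K' (cls x)}"
  have "pm.span (BG \<union> MR) \<subseteq> E"
  proof (rule pm.span_minimal)
    show "pm.subspace E"
      unfolding E_def by (rule pm.subspaceI)
        (auto simp: fun_eq_iff K_zero[OF K] K_zero[OF K'] K_add[OF K] K_add[OF K'] K_scale[OF K] K_scale[OF K']
          intro: pm.span_zero pm.span_add pm.span_scale)
    show "BG \<union> MR \<subseteq> E"
    proof
      fix x assume "x \<in> BG \<union> MR"
      then show "x \<in> E"
      proof
        assume "x \<in> BG"
        then obtain \<tau> as where x: "x = tgen (mu \<tau>) (map \<Delta> as)" "as \<noteq> []" "set as \<subseteq> I" "ordered_partition {1..length as} \<tau>"
          unfolding BG_def by blast
        then show ?thesis
          using pv K_mu[OF K x(2,3,4)] K_mu[OF K' x(2,3,4)] by (simp add: E_def tgen_SG hgraded_mu)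
      next
        assume "x \<in> MR"
        then show ?thesis using K_MR[OF K] K_MR[OF K'] by (simp add: E_def MR_SG fun_eq_iff)
      qed
    qed
  qed
  then have "K (cls x) = K' (cls x)" if "x \<in> SG" for x using that SG_basis unfolding E_def by blast
  then have "K A = K' A" if "A \<in> HT sT T" for A using that by (auto simp: HT_eq)
  \<comment> \<open>Off the carrier both functions are \<open>undefined\<close>.\<close>
  moreover have "K A = K' A" if "A \<notin> HT sT T" for A
    using that K K' unfolding HT_representations_def by (auto simp: PiE_def extensional_def)
  ultimately show ?thesis by blast
qed

end

context ht
begin

section \<open>Coordinates of tensors in the homogeneous basis\<close>

definition coord :: "'t \<Rightarrow> 'i \<Rightarrow> 'k" where
  "coord v a = T.representation (\<Delta> ` I) v (\<Delta> a)"

lemma coord_add: "coord (v + w) a = coord v a + coord w a"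
  unfolding coord_def by (subst T.representation_add) (simp_all add: indep span_\<Delta>)

lemma coord_scale: "coord (sT c v) a = c * coord v a"
  unfolding coord_def by (subst T.representation_scale) (simp_all add: indep span_\<Delta>)

lemma coord_basis: "a \<in> I \<Longrightarrow> b \<in> I \<Longrightarrow> coord (\<Delta> a) b = (if a = b then 1 else 0)"
  unfolding coord_def using inj by (subst T.representation_basis) (auto simp: indep dest: inj_onD)

lemma coord_sum: "coord (\<Sum>x\<in>A. f x) a = (\<Sum>x\<in>A. coord (f x) a)"
proof (induction A rule: infinite_finite_induct)
  case empty
  then show ?case using coord_scale[of 0 0 a] by simp
qed (use coord_scale[of 0 0 a] in \<open>simp_all add: coord_add\<close>)

lemma coord_expand: "v = (\<Sum>a\<in>I. sT (coord v a) (\<Delta> a))"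
proof -
  have "v = (\<Sum>b\<in>\<Delta> ` I. sT (T.representation (\<Delta> ` I) v b) b)"
    by (rule T.sum_representation_eq[symmetric]) (simp_all add: indep span_\<Delta> finite_I)
  also have "\<dots> = (\<Sum>a\<in>I. sT (coord v a) (\<Delta> a))" by (simp add: sum.reindex[OF inj] coord_def)
  finally show ?thesis .
qed

text \<open>The part \<open>w\<close> of \<open>v\<close> along basis vectors of the other parity
  lies in both \<open>T q\<close> and \<open>T (\<not> q)\<close>, so it is 0.\<close>

lemma coord_homogeneous:
  assumes v: "v \<in> T q" and a: "a \<in> I" and nz: "coord v a \<noteq> 0"
  shows "p a = q"
proof (rule ccontr)
  assume pa: "p a \<noteq> q"
  let ?J = "{b \<in> I. p b = q}" and ?J' = "{b \<in> I. p b \<noteq> q}"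
  define w where "w = (\<Sum>b\<in>?J'. sT (coord v b) (\<Delta> b))"
  have "v = (\<Sum>b\<in>?J. sT (coord v b) (\<Delta> b)) + w"
  proof -
    have "(\<Sum>a\<in>I. sT (coord v a) (\<Delta> a)) = (\<Sum>a\<in>?J \<union> ?J'. sT (coord v a) (\<Delta> a))"
      by (rule sum.cong) auto
    also have "\<dots> = (\<Sum>b\<in>?J. sT (coord v b) (\<Delta> b)) + (\<Sum>b\<in>?J'. sT (coord v b) (\<Delta> b))"
      by (rule sum.union_disjoint) (use finite_I in auto)
    finally have "(\<Sum>a\<in>I. sT (coord v a) (\<Delta> a)) = (\<Sum>b\<in>?J. sT (coord v b) (\<Delta> b)) + (\<Sum>b\<in>?J'. sT (coord v b) (\<Delta> b))" .
    then show ?thesis using coord_expand[of v] by (simp add: w_def)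
  qed
  moreover have "(\<Sum>b\<in>?J. sT (coord v b) (\<Delta> b)) \<in> T q"
    by (intro T.subspace_sum[OF T.subspace_part] T.subspace_scale[OF T.subspace_part]) (use \<Delta>_T in auto)
  ultimately have "w \<in> T q"
    using v T.subspace_diff[OF T.subspace_part, of v q "\<Sum>b\<in>?J. sT (coord v b) (\<Delta> b)"] by (metis add_diff_cancel_left')
  moreover have "w \<in> T (\<not> q)"
    unfolding w_def
  proof (intro T.subspace_sum[OF T.subspace_part] T.subspace_scale[OF T.subspace_part])
    fix b assume "b \<in> ?J'"
    then have "b \<in> I" "p b = (\<not> q)" by auto
    then show "\<Delta> b \<in> T (\<not> q)" using \<Delta>_T[of b] by simp
  qed
  ultimately have "w = 0" using T.part_Int by (cases q) auto
  then have "0 = coord w a" using coord_scale[of 0 0 a] by simp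
  also have "\<dots> = (\<Sum>b\<in>?J'. coord v b * coord (\<Delta> b) a)" by (simp add: w_def coord_sum coord_scale)
  also have "\<dots> = (\<Sum>b\<in>?J'. if b = a then coord v a else 0)" using a by (intro sum.cong) (auto simp: coord_basis)
  also have "\<dots> = coord v a" using a pa finite_I by (simp add: sum.delta)
  finally show False using nz by simp
qed

text \<open>The coefficient of the basis tensor of \<open>as\<close> in the tensor of
  \<open>vs\<close>. It is evaluated on words of equal length, where the second equation is the
  empty product.\<close>

fun coprod :: "'t list \<Rightarrow> 'i list \<Rightarrow> 'k" where
  "coprod (v # vs) (a # as) = coord v a * coprod vs as"
| "coprod _ _ = 1"

lemma coprod_append: "length us = length as \<Longrightarrow> coprod (us @ vs) (as @ bs) = coprod us as * coprod vs bs"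
  by (induction us as rule: list_induct2) simp_all

lemma coprod_conv: "length vs = length as \<Longrightarrow> coprod vs as = (\<Prod>i<length as. coord (vs ! i) (as ! i))"
  by (induction vs as rule: list_induct2) (simp_all add: prod.lessThan_Suc_shift del: prod.lessThan_Suc)

lemma coprod_basis: "length as = length bs \<Longrightarrow> set as \<subseteq> I \<Longrightarrow> set bs \<subseteq> I \<Longrightarrow> coprod (map \<Delta> as) bs = (if as = bs then 1 else 0)"
  by (induction as bs rule: list_induct2) (auto simp: coord_basis)

lemma coprod_perm:
  assumes "length vs = length as" "s permutes {1..length as}"
  shows "coprod (perm_list s vs) (perm_list s as) = coprod vs as"
proof -
  let ?n = "length as"
  have r: "inv s permutes {1..?n}" using assms(2) by (rule permutes_inv)
  have "coprod (perm_list s vs) (perm_list s as) = (\<Prod>k<?n. coord (vs ! (inv s (Suc k) - 1)) (as ! (inv s (Suc k) - 1)))"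
    using assms(1) by (subst coprod_conv) (auto simp: perm_list_nth)
  also have "\<dots> = (\<Prod>j\<in>{1..?n}. coord (vs ! (inv s j - 1)) (as ! (inv s j - 1)))"
    by (rule prod.reindex_bij_witness[where i = "\<lambda>j. j - 1" and j = Suc]) auto
  also have "\<dots> = (\<Prod>j\<in>{1..?n}. coord (vs ! (j - 1)) (as ! (j - 1)))"
    using prod.permute[OF r, of "\<lambda>j. coord (vs ! (j - 1)) (as ! (j - 1))"] by (simp add: comp_def)
  also have "\<dots> = (\<Prod>k<?n. coord (vs ! k) (as ! k))"
    by (rule prod.reindex_bij_witness[where i = Suc and j = "\<lambda>j. j - 1"]) auto
  finally show ?thesis using assms(1) by (simp add: coprod_conv)
qed

definition words :: "nat \<Rightarrow> 'i list set" where
  "words n = {as. set as \<subseteq> I \<and> length as = n}"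

lemma finite_words: "finite (words n)"
  unfolding words_def using finite_I by (rule finite_lists_length_eq)

lemma words_split:
  assumes "as \<in> words (Suc (m + n))"
  obtains bs b ds where "as = bs @ b # ds" "m = length bs"
proof -
  have len: "length as = Suc (m + n)" using assms by (simp add: words_def)
  then obtain b ds where "drop m as = b # ds" by (cases "drop m as") auto
  then have "as = take m as @ b # ds" by (metis append_take_drop_id)
  moreover have "m = length (take m as)" using len by simp
  ultimately show thesis by (rule that)
qed

lemma perm_list_words:
  assumes "s permutes {1..n}"
  shows "bij_betw (perm_list s) (words n) (words n)"
proof -
  have set_sub: "set (perm_list t as) \<subseteq> set as" if "t permutes {1..length as}" for t and as :: "'i list"
  proof
    fix x assume "x \<in> set (perm_list t as)"
    then obtain k where k: "k < length as" "x = as ! (inv t (Suc k) - 1)" by (metis in_set_conv_nth perm_list_length perm_list_nth)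
    then have "1 \<le> inv t (Suc k) \<and> inv t (Suc k) \<le> length as" using permutes_le(1)[OF permutes_inv[OF that], of "Suc k"] by simp
    then have "inv t (Suc k) - 1 < length as" by auto
    then show "x \<in> set as" using k by simp
  qed
  have inv: "perm_list (inv t) (perm_list t as) = as" if t: "t permutes {1..length as}" for t and as :: "'i list"
  proof (rule nth_equalityI)
    fix k assume "k < length (perm_list (inv t) (perm_list t as))"
    then have k: "k < length as" by simp
    have "1 \<le> t (Suc k) \<and> t (Suc k) \<le> length as" using permutes_le(1)[OF t, of "Suc k"] k by simp
    then have 1: "t (Suc k) - 1 < length as" "Suc (t (Suc k) - 1) = t (Suc k)" by auto
    then show "perm_list (inv t) (perm_list t as) ! k = as ! k"
      using k permutes_inverses(2)[OF t, of "Suc k"] by (simp add: perm_list_nth permutes_inv_inv[OF t])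
  qed simp
  note s' = permutes_inv[OF assms]
  show ?thesis
  proof (rule bij_betwI[where g = "perm_list (inv s)"])
    show "perm_list s \<in> words n \<rightarrow> words n" "perm_list (inv s) \<in> words n \<rightarrow> words n"
      using set_sub assms s' by (fastforce simp: words_def)+
    show "perm_list (inv s) (perm_list s as) = as" if "as \<in> words n" for as
      using inv[of s as] that assms by (simp add: words_def)
    show "perm_list s (perm_list (inv s) as) = as" if "as \<in> words n" for as
      using inv[of "inv s" as] that s' by (simp add: words_def permutes_inv_inv[OF assms])
  qed
qed

section \<open>The representation defined by a system of endomorphisms\<close>

context
  fixes C assumes C: "supersymmetric C" and Q: "quadratic C"
begin

definition hval :: "'i list \<Rightarrow> 'k hstar \<Rightarrow> 'f \<Rightarrow> 'f" where
  "hval as = hs_lift scE (part_val C as)"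

lemma
  assumes "as \<noteq> []" "set as \<subseteq> I"
  shows hval_add: "hval as (h + h') = hval as h + hval as h'"
    and hval_scale: "hval as (hscale c h) = scE c (hval as h)"
    and hval_mu: "hval as (mu \<tau>) = part_val C as (Abs_opart \<tau>)"
    and hval_abs: "hval as (abs_hstar x) = pm_lift scE (part_val C as) x"
  unfolding hval_def using part_val_relators[OF C Q assms] E.vector_space_axioms
  by (simp_all add: hs_lift_add hs_lift_scale hs_lift_mu hs_lift_abs)

lemma hval_zero: "as \<noteq> [] \<Longrightarrow> set as \<subseteq> I \<Longrightarrow> hval as 0 = 0"
  using hval_scale[of as 0 0] by simp

lemma hval_endo_part:
  assumes "as \<noteq> []" "set as \<subseteq> I"
  shows "hval as h \<in> endo_part sF F (lpar p as)"
proof -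
  have "hval as h = (\<lambda>v. \<Sum>\<sigma>\<in>Poly_Mapping.keys (rep_hstar h). sF (Poly_Mapping.lookup (rep_hstar h) \<sigma>) (part_val C as \<sigma> v))"
    by (simp add: fun_eq_iff hval_def hs_lift_def pm_lift_def sum_fun_apply scE_def)
  also have "\<dots> \<in> endo_part sF F (lpar p as)"
    by (intro endo_part_sum endo_part_scale part_val_endo_part[OF C assms])
  finally show ?thesis .
qed

lemma hval_perm:
  assumes "as \<noteq> []" "set as \<subseteq> I" "s permutes {1..length as}"
  shows "hval (perm_list s as) (hperm s h) = scE (perm_sign s (map p as)) (hval as h)"
proof -
  have "as \<in> words (length as)" using assms by (simp add: words_def)
  then have "perm_list s as \<in> words (length as)" using bij_betw_apply[OF perm_list_words[OF assms(3)]] by blast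
  moreover have "perm_list s as \<noteq> []" using assms(1) by (metis length_0_conv perm_list_length)
  ultimately have *: "perm_list s as \<noteq> []" "set (perm_list s as) \<subseteq> I" by (auto simp: words_def)
  obtain x where x: "h = abs_hstar x" by (metis abs_rep_hstar)
  have "hval (perm_list s as) (hperm s h) = pm_lift scE (\<lambda>\<sigma>. part_val C (perm_list s as) (perm s \<sigma>)) x"
    by (simp add: x hperm.abs_eq hval_abs[OF *] pm_lift_push[OF E.vector_space_axioms])
  also have "\<dots> = scE (perm_sign s (map p as)) (pm_lift scE (part_val C as) x)"
    by (simp add: part_val_perm[OF C assms] pm_lift_def E.scale_sum_right mult.commute)
  finally show ?thesis by (simp add: x hval_abs[OF assms(1,2)])
qed

lemma hval_mult:
  assumes as: "as \<noteq> []" "set as \<subseteq> I" and bs: "bs \<noteq> []" "set bs \<subseteq> I"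
    and h: "h \<in> hgraded (length as)" and g: "g \<in> hgraded (length bs)"
  shows "hval (as @ bs) (hmult h g) = hval as h \<circ> hval bs g"
proof -
  have ab: "as @ bs \<noteq> []" "set (as @ bs) \<subseteq> I" using as bs by auto
  have n: "1 \<le> length as" "1 \<le> length bs" using as bs by (auto simp: Suc_le_eq)
  note e = endoD[OF vector_space_axioms endo_part_endo[OF hval_endo_part[OF as]]]
  show ?thesis using h
  proof (induction h rule: hgraded_induct)
    case (mu \<tau>)
    note \<tau> = mu
    show ?case using g
    proof (induction g rule: hgraded_induct)
      case (mu \<sigma>)
      have "hval (as @ bs) (hmult (mu \<tau>) (mu \<sigma>)) = part_val C (as @ bs) (Abs_opart (raw_cup \<tau> \<sigma>))"
        unfolding hmult_mu[OF \<tau> n(1) mu n(2)] by (rule hval_mu[OF ab])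
      also have "\<dots> = part_val C as (Abs_opart \<tau>) \<circ> part_val C bs (Abs_opart \<sigma>)" by (rule part_val_cup[OF C as bs \<tau> mu])
      finally show ?case by (simp only: hval_mu[OF as] hval_mu[OF bs])
    qed (auto simp: hmult_add_right hmult_scale_right hval_add[OF ab] hval_add[OF bs] hval_scale[OF ab] hval_scale[OF bs]
        hval_zero[OF ab] hval_zero[OF bs] e fun_eq_iff scE_def)
  qed (auto simp: hmult_add_left hmult_scale_left hval_add[OF ab] hval_add[OF as] hval_scale[OF ab] hval_scale[OF as]
        hval_zero[OF ab] hval_zero[OF as] fun_eq_iff scE_def)
qed

text \<open>The multilinear extension from basis tensors, written on symbols that need not be
  multilinear yet; that \<open>lin_ext\<close> respects multilinearity is
  \<open>lin_ext_MR\<close>.\<close>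

definition gen :: "'k hstar \<times> 't list \<Rightarrow> 'f \<Rightarrow> 'f" where
  "gen = (\<lambda>(h, vs). \<Sum>as\<in>words (length vs). scE (coprod vs as) (hval as h))"

definition lin_ext :: "(('k hstar \<times> 't list) \<Rightarrow>\<^sub>0 'k) \<Rightarrow> 'f \<Rightarrow> 'f" where
  "lin_ext = pm_lift scE gen"

interpretation lin_ext: Vector_Spaces.linear pm_scale scE lin_ext
  unfolding lin_ext_def by (rule linear_pm_lift) (rule E.vector_space_axioms)

lemma lin_ext_tgen: "lin_ext (tgen h vs) = (\<Sum>as\<in>words (length vs). scE (coprod vs as) (hval as h))"
  by (simp add: lin_ext_def tgen_def pm_lift_single[OF E.vector_space_axioms] gen_def)

lemma wordsD: "as \<in> words (length vs) \<Longrightarrow> vs \<noteq> [] \<Longrightarrow> as \<noteq> [] \<and> set as \<subseteq> I \<and> length as = length vs"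
  by (auto simp: words_def)

lemma lin_ext_MR:
  assumes "r \<in> MR"
  shows "lin_ext r = 0"
  using assms
proof (cases rule: MRE)
  case (1 h h' vs)
  then show ?thesis
    by (simp add: lin_ext.diff lin_ext_tgen sum_subtractf[symmetric] del: sum_subtractf)
      (auto intro!: sum.neutral dest!: wordsD simp: hval_add E.scale_right_distrib)
next
  case (2 c h vs)
  then show ?thesis
    by (simp add: lin_ext.diff lin_ext.scale lin_ext_tgen E.scale_sum_right sum_subtractf[symmetric] del: sum_subtractf)
      (auto intro!: sum.neutral dest!: wordsD simp: hval_scale mult.commute)
next
  case (3 h us v w ws)
  have "coprod (us @ (v + w) # ws) as = coprod (us @ v # ws) as + coprod (us @ w # ws) as"
    if w: "as \<in> words (Suc (length us + length ws))" for as
  proof -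
    obtain bs b ds where as: "as = bs @ b # ds" "length us = length bs" using w by (rule words_split)
    show ?thesis unfolding as(1) coprod_append[OF as(2)] by (simp add: coord_add algebra_simps)
  qed
  then show ?thesis
    by (simp add: 3(1) lin_ext.diff lin_ext_tgen E.scale_left_distrib sum.distrib)
next
  case (4 h us c v ws)
  have "coprod (us @ sT c v # ws) as = c * coprod (us @ v # ws) as"
    if w: "as \<in> words (Suc (length us + length ws))" for as
  proof -
    obtain bs b ds where as: "as = bs @ b # ds" "length us = length bs" using w by (rule words_split)
    show ?thesis unfolding as(1) coprod_append[OF as(2)] by (simp add: coord_scale algebra_simps)
  qed
  then show ?thesis
    by (simp add: 4(1) lin_ext.diff lin_ext.scale lin_ext_tgen E.scale_sum_right)
qed

lemma coprod_parity:
  assumes "list_all2 (\<lambda>v q. v \<in> T q) vs ps" "length as = length vs" "set as \<subseteq> I" "coprod vs as \<noteq> 0"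
  shows "map p as = ps"
  using assms
proof (induction vs ps arbitrary: as rule: list_all2_induct)
  case (Cons v vs q ps)
  then obtain a as' where as: "as = a # as'" by (cases as) auto
  then show ?case using Cons coord_homogeneous[of v q a] by auto
qed simp

text \<open>\<open>perm_list s\<close> permutes the words, so the sum can be reindexed; each term
  then changes by the sign formed with the parities of \<open>as\<close>. Wherever the coefficient
  is not 0, these are the parities \<open>ps\<close> of the given vectors.\<close>

lemma lin_ext_CO:
  assumes "r \<in> CO"
  shows "lin_ext r = 0"
  using assms
proof (rule COE)
  fix h vs ps s
  assume r: "r = tgen h vs - pm_scale (perm_sign s ps) (tgen (hperm s h) (perm_list s vs))"
    and vs: "vs \<noteq> []" "h \<in> hgraded (length vs)" "list_all2 (\<lambda>v q. v \<in> T q) vs ps" "s permutes {1..length vs}"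
  have "lin_ext (tgen (hperm s h) (perm_list s vs)) = (\<Sum>as\<in>words (length vs). scE (coprod (perm_list s vs) (perm_list s as)) (hval (perm_list s as) (hperm s h)))"
    using sum.reindex_bij_betw[OF perm_list_words[OF vs(4)], of "\<lambda>as. scE (coprod (perm_list s vs) as) (hval as (hperm s h))"]
    by (simp add: lin_ext_tgen)
  also have "\<dots> = (\<Sum>as\<in>words (length vs). scE (perm_sign s ps) (scE (coprod vs as) (hval as h)))"
  proof (rule sum.cong[OF refl])
    fix as assume "as \<in> words (length vs)"
    then have as: "as \<noteq> []" "set as \<subseteq> I" "length as = length vs" using wordsD vs(1) by auto
    have s: "s permutes {1..length as}" using vs(4) as(3) by simp
    have "coprod (perm_list s vs) (perm_list s as) = coprod vs as" by (rule coprod_perm[OF as(3)[symmetric] s])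
    moreover have "map p as = ps" if "coprod vs as \<noteq> 0" by (rule coprod_parity[OF vs(3) as(3,2) that])
    ultimately show "scE (coprod (perm_list s vs) (perm_list s as)) (hval (perm_list s as) (hperm s h))
      = scE (perm_sign s ps) (scE (coprod vs as) (hval as h))"
      unfolding hval_perm[OF as(1,2) s] by (cases "coprod vs as = 0") (simp_all add: mult.commute)
  qed
  also have "\<dots> = scE (perm_sign s ps) (lin_ext (tgen h vs))" by (simp add: lin_ext_tgen E.scale_sum_right)
  finally have "lin_ext (tgen (hperm s h) (perm_list s vs)) = scE (perm_sign s ps) (lin_ext (tgen h vs))" .
  moreover have "perm_sign s ps * perm_sign s ps = (1::'k)" by (simp add: perm_sign_def power_mult_distrib[symmetric])
  ultimately show "lin_ext r = 0" by (simp add: r lin_ext.diff lin_ext.scale)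
qed

lemma lin_ext_Rel: "r \<in> Rel \<Longrightarrow> lin_ext r = 0"
  by (rule lin_ext.eq_0_on_span[where b = "MR \<union> CO"]) (auto simp: lin_ext_MR lin_ext_CO)

lemma lin_ext_endo_part_tgen:
  assumes "vs \<noteq> []" "list_all2 (\<lambda>v q. v \<in> T q) vs ps"
  shows "lin_ext (tgen h vs) \<in> endo_part sF F (odd (length (filter id ps)))"
proof -
  have "lin_ext (tgen h vs) = (\<lambda>v. \<Sum>as\<in>words (length vs). sF (coprod vs as) (hval as h v))"
    by (simp add: lin_ext_tgen fun_eq_iff sum_fun_apply scE_def)
  also have "\<dots> \<in> endo_part sF F (odd (length (filter id ps)))"
  proof (rule endo_part_sum)
    fix as assume "as \<in> words (length vs)"
    then have as: "as \<noteq> []" "set as \<subseteq> I" "length as = length vs" using wordsD assms(1) by auto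
    show "(\<lambda>v. sF (coprod vs as) (hval as h v)) \<in> endo_part sF F (odd (length (filter id ps)))"
    proof (cases "coprod vs as = 0")
      case False
      then have "odd (length (filter id ps)) = lpar p as" using coprod_parity[OF assms(2) as(3,2)] lpar_map[of as] by simp
      then show ?thesis using hval_endo_part[OF as(1,2)] by (simp only: endo_part_scale)
    qed (simp add: endo_part_zero)
  qed
  finally show ?thesis .
qed

lemma lin_ext_tgen_endo: "vs \<noteq> [] \<Longrightarrow> lin_ext (tgen h vs) \<in> endo sF"
proof -
  assume "vs \<noteq> []"
  then have "\<forall>as\<in>words (length vs). hval as h \<in> endo sF"
    using wordsD hval_endo_part endo_part_endo by blast
  then show ?thesis
    by (simp add: lin_ext_tgen endo_iff sum_fun_apply scE_def scale_right_distrib sum.distrib scale_sum_right mult.commute)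
qed

lemma endo_subspace: "pm.subspace {x. lin_ext x \<in> endo sF}"
  by (rule pm.subspaceI) (auto simp: lin_ext.zero lin_ext.add lin_ext.scale endo_iff scE_def scale_right_distrib mult.commute algebra_simps)

lemma lin_ext_endo: assumes "x \<in> SG" shows "lin_ext x \<in> endo sF"
  using assms
  by (rule pm.span_induct[OF _ endo_subspace]) (auto elim!: tensor_gensE simp: lin_ext_tgen_endo)

lemma sum_words_append:
  "(\<Sum>as\<in>words (m + n). f as) = (\<Sum>as\<in>words m. \<Sum>bs\<in>words n. f (as @ bs))"
proof -
  have "bij_betw (\<lambda>(as, bs). as @ bs) (words m \<times> words n) (words (m + n))"
    by (rule bij_betwI[where g = "\<lambda>as. (take m as, drop m as)"])
       (auto simp: words_def dest: in_set_takeD in_set_dropD)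
  from sum.reindex_bij_betw[OF this, of f] show ?thesis by (simp add: sum.cartesian_product case_prod_unfold)
qed

lemma lin_ext_mult:
  assumes "x \<in> SG" "y \<in> SG"
  shows "lin_ext (tm x y) = lin_ext x \<circ> lin_ext y"
proof -
  have gen: "lin_ext (tm (tgen h vs) (tgen g ws)) = lin_ext (tgen h vs) \<circ> lin_ext (tgen g ws)"
    if vs: "vs \<noteq> []" "h \<in> hgraded (length vs)" and ws: "ws \<noteq> []" "g \<in> hgraded (length ws)" for h vs g ws
  proof (rule ext)
    fix v
    have "lin_ext (tm (tgen h vs) (tgen g ws)) v
      = (\<Sum>as\<in>words (length vs). \<Sum>bs\<in>words (length ws). sF (coprod vs as) (sF (coprod ws bs) (hval as h (hval bs g v))))"
      unfolding tm_tgen lin_ext_tgen length_append sum_words_append sum_fun_apply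
    proof (intro sum.cong refl)
      fix as bs assume "as \<in> words (length vs)" "bs \<in> words (length ws)"
      then have as: "as \<noteq> []" "set as \<subseteq> I" "length as = length vs" and bs: "bs \<noteq> []" "set bs \<subseteq> I" "length bs = length ws"
        using wordsD vs ws by auto
      show "scE (coprod (vs @ ws) (as @ bs)) (hval (as @ bs) (hmult h g)) v = sF (coprod vs as) (sF (coprod ws bs) (hval as h (hval bs g v)))"
        using vs ws hval_mult[OF as(1,2) bs(1,2), of h g] as bs by (simp add: coprod_append scE_def)
    qed
    also have "\<dots> = (\<Sum>as\<in>words (length vs). sF (coprod vs as) (hval as h (lin_ext (tgen g ws) v)))"
    proof (rule sum.cong[OF refl])
      fix as assume "as \<in> words (length vs)"
      then have as: "as \<noteq> []" "set as \<subseteq> I" using wordsD vs by auto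
      note e = endoD[OF vector_space_axioms endo_part_endo[OF hval_endo_part[OF as, of h]]]
      show "(\<Sum>bs\<in>words (length ws). sF (coprod vs as) (sF (coprod ws bs) (hval as h (hval bs g v))))
        = sF (coprod vs as) (hval as h (lin_ext (tgen g ws) v))"
        by (simp only: lin_ext_tgen sum_fun_apply scE_def e scale_sum_right)
    qed
    also have "\<dots> = (lin_ext (tgen h vs) \<circ> lin_ext (tgen g ws)) v" by (simp add: lin_ext_tgen[of h vs] sum_fun_apply scE_def)
    finally show "lin_ext (tm (tgen h vs) (tgen g ws)) v = (lin_ext (tgen h vs) \<circ> lin_ext (tgen g ws)) v" .
  qed
  show ?thesis using assms(1)
  proof (rule pm.span_induct)
    show "pm.subspace {x. lin_ext (tm x y) = lin_ext x \<circ> lin_ext y}"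
      by (rule pm.subspaceI) (auto simp: tl.zero tl.add tl.scale lin_ext.zero lin_ext.add lin_ext.scale fun_eq_iff scE_def)
    fix x :: "('k hstar \<times> 't list) \<Rightarrow>\<^sub>0 'k" assume "x \<in> tensor_gens"
    then obtain h vs where x: "x = tgen h vs" "vs \<noteq> []" "h \<in> hgraded (length vs)" by (rule tensor_gensE)
    note e = endoD[OF vector_space_axioms lin_ext_tgen_endo[OF x(2), of h]]
    show "lin_ext (tm x y) = lin_ext x \<circ> lin_ext y" using assms(2) unfolding x(1)
    proof (rule pm.span_induct)
      show "pm.subspace {y. lin_ext (tm (tgen h vs) y) = lin_ext (tgen h vs) \<circ> lin_ext y}"
        by (rule pm.subspaceI) (auto simp: tr.zero tr.add tr.scale lin_ext.zero lin_ext.add lin_ext.scale fun_eq_iff scE_def e)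
      fix y :: "('k hstar \<times> 't list) \<Rightarrow>\<^sub>0 'k" assume "y \<in> tensor_gens"
      then show "lin_ext (tm (tgen h vs) y) = lin_ext (tgen h vs) \<circ> lin_ext y" using gen[OF x(2,3)] by (auto elim!: tensor_gensE)
    qed
  qed
qed

text \<open>Any representative gives the same value because \<open>lin_ext\<close> kills the
  relations; the value off the carrier is the one that representations are required to have.\<close>

definition rep_of :: "('k, 't) HT_elem \<Rightarrow> 'f \<Rightarrow> 'f" where
  "rep_of A = (if A \<in> HT sT T then lin_ext (SOME x. x \<in> A) else undefined)"

lemma rep_of_cls: assumes "x \<in> SG" shows "rep_of (cls x) = lin_ext x"
proof -
  define y where "y = (SOME y. y \<in> cls x)"
  have "y \<in> cls x" unfolding y_def using cls_self[OF assms] by (rule someI)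
  then have "lin_ext (x - y) = 0" by (intro lin_ext_Rel) (simp add: cls_iff)
  then have "lin_ext y = lin_ext x" by (simp add: lin_ext.diff)
  then show ?thesis using assms by (simp add: rep_of_def y_def[symmetric] HT_eq)
qed

lemma rep_of_representation: "rep_of \<in> HT_representations sT T sF F"
  unfolding HT_representations_def
proof (intro CollectI conjI PiE_I ballI allI)
  show "rep_of A \<in> endo sF" if "A \<in> HT sT T" for A using that lin_ext_endo by (auto simp: HT_eq rep_of_cls)
  show "rep_of A = undefined" if "A \<notin> HT sT T" for A using that by (simp add: rep_of_def)
next
  fix A B v assume "A \<in> HT sT T" "B \<in> HT sT T"
  then obtain x y where x: "x \<in> SG" "y \<in> SG" "A = cls x" "B = cls y" by (auto simp: HT_eq)
  then show "rep_of (HT_add sT T A B) v = rep_of A v + rep_of B v"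
    by (simp add: HT_add_cls rep_of_cls pm.span_add lin_ext.add)
next
  fix c A v assume "A \<in> HT sT T"
  then obtain x where x: "x \<in> SG" "A = cls x" by (auto simp: HT_eq)
  then show "rep_of (HT_scale sT T c A) v = sF c (rep_of A v)"
    by (simp add: HT_scale_cls rep_of_cls pm.span_scale lin_ext.scale scE_def)
next
  fix A B assume "A \<in> HT sT T" "B \<in> HT sT T"
  then obtain x y where x: "x \<in> SG" "y \<in> SG" "A = cls x" "B = cls y" by (auto simp: HT_eq)
  then show "rep_of (HT_mult sT T A B) = rep_of A \<circ> rep_of B"
    by (simp only: HT_mult_cls rep_of_cls tm_SG lin_ext_mult)
next
  fix q A assume "A \<in> HT_part sT T q"
  let ?H = "{tgen h vs | h vs ps. vs \<noteq> [] \<and> h \<in> hgraded (length vs)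
     \<and> list_all2 (\<lambda>v e. v \<in> T e) vs ps \<and> odd (length (filter id ps)) = q}"
  obtain x where x: "A = cls x" "x \<in> pm.span ?H" using \<open>A \<in> HT_part sT T q\<close> unfolding HT_part_def by blast
  have "?H \<subseteq> tensor_gens" unfolding tensor_gens_def by blast
  then have "x \<in> SG" using x(2) pm.span_mono by blast
  moreover have "lin_ext x \<in> endo_part sF F q"
    using x(2)
  proof (rule pm.span_induct)
    show "pm.subspace {x. lin_ext x \<in> endo_part sF F q}"
    proof (rule pm.subspaceI; clarsimp simp: lin_ext.zero lin_ext.add lin_ext.scale)
      show "0 \<in> endo_part sF F q" using endo_part_zero by (simp add: zero_fun_def)
      show "lin_ext x + lin_ext y \<in> endo_part sF F q" if "lin_ext x \<in> endo_part sF F q" "lin_ext y \<in> endo_part sF F q" for x y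
        using endo_part_add[OF that] by (simp add: plus_fun_def)
      show "scE c (lin_ext x) \<in> endo_part sF F q" if "lin_ext x \<in> endo_part sF F q" for c x
        using endo_part_scale[OF that] by (simp add: scE_def)
    qed
  qed (use lin_ext_endo_part_tgen in blast)
  ultimately show "rep_of A \<in> endo_part sF F q" by (simp add: x(1) rep_of_cls)
qed

text \<open>The single part can be enumerated in increasing order; then the sign is 1 and the
  product has only the factor \<open>C as\<close>.\<close>

lemma correlator_Kc:
  assumes as: "as \<noteq> []" "set as \<subseteq> I"
  shows "correlator rep_of as = C as"
proof -
  have n: "1 \<le> length as" using as(1) by (simp add: Suc_le_eq)
  have op: "ordered_partition {1..length as} [{1..length as}]" by (rule ordered_partition_single[OF n])
  have "tgen (mu [{1..length as}]) (map \<Delta> as) \<in> SG"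
    using as hgraded_mu[OF op] by (intro tgen_SG) simp_all
  then have "correlator rep_of as = lin_ext (tgen (mu [{1..length as}]) (map \<Delta> as))" by (simp add: correlator_def rep_of_cls)
  also have "\<dots> = (\<Sum>bs\<in>words (length as). if bs = as then hval as (mu [{1..length as}]) else 0)"
    unfolding lin_ext_tgen length_map using as by (intro sum.cong) (auto simp: words_def coprod_basis)
  also have "\<dots> = hval as (mu [{1..length as}])"
    using as finite_words[of "length as"] by (simp add: sum.delta words_def)
  also have "\<dots> = part_val C as (Abs_opart [{1..length as}])" by (rule hval_mu[OF as])
  also have "\<dots> = sprod C (\<lambda>i. as ! (i - 1)) [[1..<Suc (length as)]]"
  proof -
    have s: "map set [[1..<Suc (length as)]] = [{1..length as}]" by (simp add: atLeastLessThanSuc_atLeastAtMost del: upt_Suc)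
    have "part_val C as (Abs_opart (map set [[1..<Suc (length as)]])) = sprod C (\<lambda>i. as ! (i - 1)) [[1..<Suc (length as)]]"
      by (rule part_val_enum[OF C _ _ as]) (simp_all only: s op list.pred_inject distinct_upt simp_thms)
    then show ?thesis by (simp only: s)
  qed
  also have "\<dots> = C as"
  proof -
    have "lsgn (p \<circ> (\<lambda>i. as ! (i - 1))) [1..<Suc (length as)] = (1::'k)" by (rule lsgn_sorted) (rule sorted_wrt_upt)
    then show ?thesis
      by (simp only: sprod_def concat.simps append_Nil2 pprod_simps map_nth_shift E.scale_one comp_id)
  qed
  finally show ?thesis .
qed

end

section \<open>The correspondence\<close>

lemma potential_eq: "potential sT T I p \<Delta> sF K = pot (correlator K)"
  unfolding potential_def pot_def correlator_def by (intro ext sum.cong refl) auto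

lemma d_potential_eq: "d_potential sT T I p \<Delta> sF K = dpot (correlator K)"
  by (simp only: d_potential_def potential_eq dpot_def)

text \<open>The term \<open>d\<close> is common to both pencils, so the value 1 of \<lambda>
  suffices.\<close>

lemma pencil_inj:
  assumes "pencil I p sF A = pencil I p sF A'" "s \<in> S"
  shows "A s = A' s"
proof -
  have "form_d I p sF s + scl 1 (A s) = form_d I p sF s + scl 1 (A' s)"
    using assms pencil_eq[OF assms(2)] by metis
  then show ?thesis by simp
qed

lemma pencil_cong:
  assumes "\<And>s. s \<in> S \<Longrightarrow> A s = A' s"
  shows "pencil I p sF A = pencil I p sF A'"
  unfolding pencil_def using assms by (intro ext) (simp add: restrict_def)

lemma correspondence:
  "(\<forall>K\<in>HT_representations sT T sF F.
      potential sT T I p \<Delta> sF K \<in> forms I p 0 (endo sF)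
    \<and> endo_form_wedge p sF F (d_potential sT T I p \<Delta> sF K) (d_potential sT T I p \<Delta> sF K) = (\<lambda>M v. 0))
   \<and> bij_betw (\<lambda>K. pencil I p sF (endo_form_apply p sF F (d_potential sT T I p \<Delta> sF K)))
       (HT_representations sT T sF F) (flat_pencils I p sF F)"
proof (intro conjI ballI)
  fix K assume K: "K \<in> HT_representations sT T sF F"
  note C = supersymmetric_ck[OF K]
  show "potential sT T I p \<Delta> sF K \<in> forms I p 0 (endo sF)" unfolding potential_eq by (rule pot_forms[OF C])
  have "flat I p sF (app (dpot (correlator K)))" by (rule flat_dpot(1)[OF C]) (rule qsum_ck[OF K])
  then show "endo_form_wedge p sF F (d_potential sT T I p \<Delta> sF K) (d_potential sT T I p \<Delta> sF K) = (\<lambda>M v. 0)"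
    unfolding d_potential_eq by (rule wedge_zero[OF odd_form_dpot[OF C]])
next
  show "bij_betw (\<lambda>K. pencil I p sF (endo_form_apply p sF F (d_potential sT T I p \<Delta> sF K)))
       (HT_representations sT T sF F) (flat_pencils I p sF F)"
    unfolding d_potential_eq bij_betw_def
  proof (intro conjI inj_onI set_eqI iffI)
    fix K K' assume K: "K \<in> HT_representations sT T sF F" and K': "K' \<in> HT_representations sT T sF F"
      and eq: "pencil I p sF (app (dpot (correlator K))) = pencil I p sF (app (dpot (correlator K')))"
    show "K = K'"
    \<comment> \<open>Equal pencils have equal operators on constant sections, hence equal Taylor
      coefficients of the components, and these are the correlators.\<close>
    proof (rule K_determined[OF K K'])
      fix as assume as: "as \<noteq> []" "set as \<subseteq> I"
      obtain u a where ua: "as = u @ [a]" using as(1) by (metis append_butlast_last_id)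
      then have I: "a \<in> I" "set u \<subseteq> I" using as by auto
      have "taylor_coeff (component (app (dpot (correlator K))) a) u = taylor_coeff (component (app (dpot (correlator K'))) a) u"
        by (rule ext) (simp only: taylor_coeff_def component_def pencil_inj[OF eq cst_S])
      then show "correlator K as = correlator K' as"
        unfolding ua taylor_coeff_dpot[OF supersymmetric_ck[OF K] I] taylor_coeff_dpot[OF supersymmetric_ck[OF K'] I] .
    qed
  next
    fix P assume "P \<in> (\<lambda>K. pencil I p sF (app (dpot (correlator K)))) ` HT_representations sT T sF F"
    then obtain K where K: "K \<in> HT_representations sT T sF F" and P: "P = pencil I p sF (app (dpot (correlator K)))" by blast
    note C = supersymmetric_ck[OF K]
    have "flat I p sF (pencil I p sF (app (dpot (correlator K))) l)" for l
      by (rule flat_dpot(2)[OF C]) (rule qsum_ck[OF K])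
    then show "P \<in> flat_pencils I p sF F"
      unfolding flat_pencils_def P using odd_function_linear_app[OF odd_form_dpot[OF C]] by blast
  next
    fix P assume "P \<in> flat_pencils I p sF F"
    then obtain A where A: "odd_function_linear I p sF F A" and flat: "\<And>l. flat I p sF (pencil I p sF A l)"
      and P: "P = pencil I p sF A" unfolding flat_pencils_def by blast
    let ?C = "taylor_sys A"
    have C: "supersymmetric ?C" by (rule supersymmetric_sys[OF A flat])
    have Q: "quadratic ?C" unfolding quadratic_def by (intro allI impI qsum_sys[OF A flat])
    have K: "rep_of ?C \<in> HT_representations sT T sF F" by (rule rep_of_representation[OF C Q])
    \<comment> \<open>The correlators of the constructed representation agree with the Taylor system
      on nonempty words in \<open>I\<close>, which is all that the potential sees.\<close>
    have "pot (correlator (rep_of ?C)) = pot ?C" by (rule pot_cong) (rule correlator_Kc[OF C Q])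
    then have "dpot (correlator (rep_of ?C)) = dpot ?C" by (simp only: dpot_def)
    then have "pencil I p sF (app (dpot (correlator (rep_of ?C)))) = P"
      unfolding P by (intro pencil_cong) (simp only: app_dpot_sys[OF A flat])
    then show "P \<in> (\<lambda>K. pencil I p sF (app (dpot (correlator K)))) ` HT_representations sT T sF F" using K by blast
  qed
qed

end

theorem theorem3p3p1:
  fixes sT :: "'k::field_char_0 \<Rightarrow> 't::ab_group_add \<Rightarrow> 't" and T :: "bool \<Rightarrow> 't set"
    and sF :: "'k \<Rightarrow> 'f::ab_group_add \<Rightarrow> 'f" and F :: "bool \<Rightarrow> 'f set"
    and I :: "'i::linorder set" and p :: "'i \<Rightarrow> bool" and \<Delta> :: "'i \<Rightarrow> 't"
  assumes "superspace sT T" and "superspace sF F" and "homogeneous_basis sT T I p \<Delta>"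
  shows "(\<forall>K\<in>HT_representations sT T sF F.
            potential sT T I p \<Delta> sF K \<in> forms I p 0 (endo sF)
          \<and> endo_form_wedge p sF F (d_potential sT T I p \<Delta> sF K) (d_potential sT T I p \<Delta> sF K)
              = (\<lambda>M v. 0))
       \<and> bij_betw (\<lambda>K. pencil I p sF (endo_form_apply p sF F (d_potential sT T I p \<Delta> sF K)))
           (HT_representations sT T sF F) (flat_pencils I p sF F)"
proof -
  interpret F: superspace sF F by fact
  interpret T: superspace sT T by fact
  interpret ht sF F I p sT T \<Delta>
    by unfold_locales (use assms(3) in \<open>simp_all add: homogeneous_basis_def\<close>)
  show ?thesis by (rule correspondence)
qed

end
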